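(* Let $2<p<\infty$ and $3<q<\infty$ with $\frac{2}{p}+\frac{3}{q}=1$. Let $T>0$, and suppose that $u$ is a solution to the three dimensional Navier-Stokes equation (in the sense given in the context) satisfying $$\int_0^T \frac{\|u(t)\|_q^p}{1+\log^+\|u(t)\|_q}\,dt<\infty .$$ Then $u(t)$ is regular for $0<t\le T$.
   Context: The three dimensional Navier-Stokes equation is the equation for a time dependent vector field $u=u(t)=u(x,t)$ on $\mathbb R^3$ ($t\ge 0$, $x\in\mathbb R^3$): $$\frac{\partial u}{\partial t}=\Delta u-L\,\mathrm{div}(u\otimes u),\qquad u(0)=u_0,$$ where $L$ is the Leray projection (the projection onto divergence-free vector fields) and $\mathrm{div}(u\otimes u)$ has components $\sum_j \partial_{x_j}(u_j u_i)$. Solution: $u(t)$, $0\le t\le T$, is called a solution of the Navier-Stokes equation if, whenever $u(t_0)$ is sufficiently regular for a mild solution $$u(t)=e^{(t-t_0)\Delta}u(t_0)-\int_{t_0}^t e^{(t-s)\Delta}L\,\mathrm{div}(u(s)\otimes u(s))\,ds$$ to exist for $t\in[t_0,t_0+\tau)$ for some $\tau>0$, then $u(t)$ is equal to that mild solution in $[t_0,t_0+\tau)$. Regular: a vector field on $\mathbb R^3$ is called regular if, for some $2\le q'<\infty$, it lies in the Sobolev spaces $W^{n,q'}(\mathbb R^3)$ for all positive integers $n$. Notation: $\|\cdot\|_q$ is the $L_q(\mathbb R^3)$ norm in the space variable $x$ (with value $+\infty$ if the function is not in $L_q$, in which case the integrand is read as $+\infty$); $\log^+ s=\max\{\log s,0\}$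 for $s>0$, and $\log^+0=0$. *)

theory Defs
  imports "HOL-Analysis.Analysis"
begin

section \<open>Lebesgue norms of vector fields\<close>

definition in_Lq :: "real \<Rightarrow> (real^3 \<Rightarrow> real^3) \<Rightarrow> bool" where
  "in_Lq q f \<longleftrightarrow> f \<in> borel_measurable lebesgue \<and> integrable lebesgue (\<lambda>x. norm (f x) powr q)"

text \<open>Meaningful only when \<^term>\<open>in_Lq q f\<close> holds (the Bochner integral of a non-integrable
  function is \<open>0\<close>, not \<open>\<infinity>\<close>).\<close>

definition Lq_norm :: "real \<Rightarrow> (real^3 \<Rightarrow> real^3) \<Rightarrow> real" where
  "Lq_norm q f = (\<integral>x. norm (f x) powr q \<partial>lebesgue) powr (1 / q)"

definition Lq_continuous_on :: "real set \<Rightarrow> real \<Rightarrow> (real \<Rightarrow> real^3 \<Rightarrow> real^3) \<Rightarrow> bool" where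
  "Lq_continuous_on S q v \<longleftrightarrow>
     (\<forall>t\<in>S. in_Lq q (v t) \<and> ((\<lambda>s. Lq_norm q (\<lambda>x. v s x - v t x)) \<longlongrightarrow> 0) (at t within S))"

definition log_plus :: "real \<Rightarrow> real" where
  "log_plus s = (if s > 0 then max (ln s) 0 else 0)"

section \<open>Sobolev spaces and regular vector fields\<close>

definition partial_deriv :: "3 \<Rightarrow> (real^3 \<Rightarrow> 'b) \<Rightarrow> real^3 \<Rightarrow> 'b::real_normed_vector" where
  "partial_deriv j f x = frechet_derivative f (at x) (axis j 1)"

text \<open>A multi-index \<open>\<alpha>\<close> is represented by a list of coordinate directions, \<open>|\<alpha>|\<close> by its length.\<close>

primrec partial_derivs :: "3 list \<Rightarrow> (real^3 \<Rightarrow> 'b) \<Rightarrow> real^3 \<Rightarrow> 'b::real_normed_vector" where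
  "partial_derivs [] f = f"
| "partial_derivs (j # js) f = partial_deriv j (partial_derivs js f)"

text \<open>Test functions: infinitely differentiable with compact support.\<close>

definition test_function :: "(real^3 \<Rightarrow> real) \<Rightarrow> bool" where
  "test_function \<phi> \<longleftrightarrow>
     (\<forall>js x. partial_derivs js \<phi> differentiable (at x)) \<and> (\<exists>R. \<forall>x. norm x > R \<longrightarrow> \<phi> x = 0)"

definition weak_deriv :: "3 list \<Rightarrow> (real^3 \<Rightarrow> real^3) \<Rightarrow> (real^3 \<Rightarrow> real^3) \<Rightarrow> bool" where
  "weak_deriv js f g \<longleftrightarrow>
     (\<forall>\<phi>. test_function \<phi> \<longrightarrow>
        (\<integral>x. partial_derivs js \<phi> x *\<^sub>R f x \<partial>lebesgue)
          = (-1) ^ length js *\<^sub>R (\<integral>x. \<phi> x *\<^sub>R g x \<partial>lebesgue))"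

definition in_Sobolev :: "nat \<Rightarrow> real \<Rightarrow> (real^3 \<Rightarrow> real^3) \<Rightarrow> bool" where
  "in_Sobolev n q f \<longleftrightarrow>
     in_Lq q f \<and> (\<forall>js. length js \<le> n \<longrightarrow> (\<exists>g. in_Lq q g \<and> weak_deriv js f g))"

definition regular_field :: "(real^3 \<Rightarrow> real^3) \<Rightarrow> bool" where
  "regular_field f \<longleftrightarrow> (\<exists>q'\<ge>2. \<forall>n\<ge>1. in_Sobolev n q' f)"

section \<open>The heat semigroup and the Leray projection\<close>

definition heat_kernel :: "real \<Rightarrow> real^3 \<Rightarrow> real" where
  "heat_kernel \<sigma> x = (4 * pi * \<sigma>) powr (- 3 / 2) * exp (- (norm x)\<^sup>2 / (4 * \<sigma>))"

definition heat_semigroup :: "real \<Rightarrow> (real^3 \<Rightarrow> real^3) \<Rightarrow> real^3 \<Rightarrow> real^3" where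
  "heat_semigroup \<sigma> f x =
     (if \<sigma> = 0 then f x else (\<integral>y. heat_kernel \<sigma> (x - y) *\<^sub>R f y \<partial>lebesgue))"

definition fourier_transform :: "(real^3 \<Rightarrow> real) \<Rightarrow> real^3 \<Rightarrow> complex" where
  "fourier_transform f \<xi> = (\<integral>x. cis (- (x \<bullet> \<xi>)) * of_real (f x) \<partial>lebesgue)"

text \<open>The projection onto divergence-free fields: at each frequency \<open>\<xi>\<close> the transform of \<open>v\<close> is
  projected orthogonally onto the plane \<open>\<xi>\<^sup>\<bottom>\<close>. The formula is for fields that are integrable with
  integrable Fourier transform; below it is applied to heat kernels only.\<close>

definition leray :: "(real^3 \<Rightarrow> real^3) \<Rightarrow> real^3 \<Rightarrow> real^3" where
  "leray v x = (\<chi> i. Re ((\<integral>\<xi>. cis (x \<bullet> \<xi>) *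
       (fourier_transform (\<lambda>y. v y $ i) \<xi>
        - of_real (\<xi> $ i / (norm \<xi>)\<^sup>2) *
            (\<Sum>k\<in>UNIV. of_real (\<xi> $ k) * fourier_transform (\<lambda>y. v y $ k) \<xi>)) \<partial>lebesgue)
     / of_real ((2 * pi) ^ 3)))"

text \<open>\<open>e\<^bsup>\<sigma>\<Delta>\<^esup> L div F\<close> for a matrix field \<open>F\<close>, where \<open>(div F)\<^sub>k = \<Sum>\<^sub>j \<partial>\<^sub>j F\<^sub>j\<^sub>k\<close> and \<open>\<sigma> > 0\<close>. As
  \<open>e\<^bsup>\<sigma>\<Delta>\<^esup>\<close>, \<open>L\<close> and \<open>\<partial>\<^sub>j\<close> commute with translations and with each other, the composite is
  convolution with \<open>\<partial>\<^sub>j L (\<Gamma>\<^sub>\<sigma> e\<^sub>k)\<close>, \<open>\<Gamma>\<^sub>\<sigma>\<close> being the heat kernel. This smooth kernel lies in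
  every \<open>L\<^sub>r\<close>, \<open>1 \<le> r \<le> \<infinity>\<close>, so the operator makes sense on merely \<open>L\<^sub>r\<close> matrix fields.\<close>

definition heat_leray_div :: "real \<Rightarrow> (real^3 \<Rightarrow> real^3^3) \<Rightarrow> real^3 \<Rightarrow> real^3" where
  "heat_leray_div \<sigma> F x =
     (\<integral>y. (\<Sum>j\<in>UNIV. \<Sum>k\<in>UNIV.
         F y $ j $ k *\<^sub>R partial_deriv j (leray (\<lambda>z. heat_kernel \<sigma> z *\<^sub>R axis k 1)) (x - y)) \<partial>lebesgue)"

definition tensor_square :: "(real^3 \<Rightarrow> real^3) \<Rightarrow> real^3 \<Rightarrow> real^3^3" where
  "tensor_square v x = (\<chi> j k. v x $ j * v x $ k)"

section \<open>Mild solutions and solutions\<close>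

text \<open>Mild solutions on \<open>[t\<^sub>0, t\<^sub>0 + \<tau>)\<close> with datum \<open>a\<close> are taken in the classical well-posedness
  classes \<open>C([t\<^sub>0, t\<^sub>0 + \<tau>); L\<^sub>r)\<close>, \<open>3 \<le> r < \<infinity>\<close>. A class has to be fixed, since without one
  ``the'' mild solution is not unique. As usual, fields are identified when equal
  almost everywhere.\<close>

definition mild_solution ::
    "real \<Rightarrow> real \<Rightarrow> (real^3 \<Rightarrow> real^3) \<Rightarrow> (real \<Rightarrow> real^3 \<Rightarrow> real^3) \<Rightarrow> bool" where
  "mild_solution t0 \<tau> a v \<longleftrightarrow>
     (\<exists>r\<ge>3. Lq_continuous_on {t0..<t0 + \<tau>} r v) \<and>
     (\<forall>t\<in>{t0..<t0 + \<tau>}. AE x in lebesgue.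
        set_integrable lebesgue {t0..t} (\<lambda>s. heat_leray_div (t - s) (tensor_square (v s)) x) \<and>
        v t x = heat_semigroup (t - t0) a x
                - (LINT s:{t0..t}|lebesgue. heat_leray_div (t - s) (tensor_square (v s)) x))"

text \<open>A field \<open>u(t)\<close>, \<open>0 \<le> t \<le> T\<close>, that from every time \<open>t\<^sub>0\<close> on agrees with the mild solution
  started from \<open>u(t\<^sub>0)\<close> whenever and as long as one exists (within the time interval
  \<open>[0, T]\<close> on which \<open>u\<close> lives).\<close>

definition navier_stokes_solution :: "real \<Rightarrow> (real \<Rightarrow> real^3 \<Rightarrow> real^3) \<Rightarrow> bool" where
  "navier_stokes_solution T u \<longleftrightarrow>
     (\<forall>t0\<in>{0..T}. \<forall>\<tau>>0. \<forall>v. mild_solution t0 \<tau> (u t0) v \<longrightarrow>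
        (\<forall>t\<in>{t0..<t0 + \<tau>}. t \<le> T \<longrightarrow> (AE x in lebesgue. u t x = v t x)))"

end

theory Submission
  imports Defs "HOL-Probability.Probability" "HOL-Complex_Analysis.Complex_Analysis" "HOL-Real_Asymp.Real_Asymp"
begin

text \<open>For a datum \<open>a\<close> in \<open>L\<^sub>q\<close> a mild solution with \<open>\<parallel>v(t)\<parallel>\<^sub>q \<le> \<Lambda> \<parallel>a\<parallel>\<^sub>q\<close> exists on a time interval of
  length \<open>\<tau>\<close> as soon as \<open>\<tau> powr (1 / p) * \<parallel>a\<parallel>\<^sub>q \<le> c\<close>. It is the limit of a Picard iteration which is dominated
  pointwise by a scalar iteration with positive kernels, and the iteration converges wherever the
  scalar majorant is finite. Because the domination persists for small complex velocities and
  dilations, the solution is analytic in these parameters, hence regular and continuous in time.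
  A solution thus needs time at least \<open>(c / L) powr p\<close> to grow from norm \<open>L\<close> to \<open>\<Lambda> L\<close>, during
  which the integral with the logarithm grows by a multiple of \<open>1 / (1 + ln L)\<close>. Over geometrically growing
  levels \<open>L\<close> these increments form a divergent harmonic series, so the norm stays bounded away
  from \<open>t = 0\<close>, and restarting shortly before \<open>t\<close> gives regularity at \<open>t\<close>.\<close>

text \<open>Smoothness is to come from Cauchy estimates in a complex translation, but a datum that
  is merely in \<open>L_q\<close> has no complex translates. Hence the translation moves with time:
  in the frame \<open>x + t *\<^sub>R h\<close> the datum stays where it is, and the kernel linking
  times s < t sees only the displacement \<open>(t - s) *\<^sub>R h\<close>. For complex h this
  costs a Gaussian of age t - s a factor exp (const * (t - s)), which is harmless for times up to 1.
  The domination has to be pointwise rather than in norm, because the exceptional set, where the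
  majorant is infinite, is then the same null set for all parameters, and holomorphy makes sense at
  each point off it. By definition a solution agrees with every mild solution, so exhibiting one
  with the right bounds is enough. The lifetime exponent comes from the power of time gained by the
  nonlinear term, \<open>gain q\<close>, which is 1 / p by \<open>2 / p + 3 / q = 1\<close>. A
  lifetime of order \<open>L powr - p\<close> makes all powers of L cancel in the final count, and
  only the logarithm survives.\<close>

no_notation fps_nth (infixl "$" 75)

section \<open>Real powers of extended nonnegative reals\<close>

text \<open>Powers of extended reals make it possible to run the \<open>L\<^sub>q\<close> estimates for the majorants
  without knowing beforehand that they are finite.\<close>

definition epow :: "ennreal \<Rightarrow> real \<Rightarrow> ennreal" where
  "epow x q = (if x = \<infinity> then \<infinity> else ennreal (enn2real x powr q))"

lemma epow_ennreal: "x \<ge> 0 \<Longrightarrow> epow (ennreal x) q = ennreal (x powr q)"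
  by (simp add: epow_def)

lemma epow_top [simp]: "epow \<infinity> q = \<infinity>" "epow top q = top"
  by (simp_all add: epow_def)

lemma epow_zero [simp]: "epow 0 q = 0"
  by (simp add: epow_def)

lemma epow_one [simp]: "epow x 1 = x"
  by (cases x) (auto simp: epow_def)

lemma epow_eq_0_iff [simp]: "epow x q = 0 \<longleftrightarrow> x = 0"
  by (cases x) (auto simp: epow_def ennreal_eq_0_iff)

lemma epow_eq_top_iff [simp]: "epow x q = top \<longleftrightarrow> x = top"
  by (auto simp: epow_def)

lemma epow_mono: "x \<le> y \<Longrightarrow> q \<ge> 0 \<Longrightarrow> epow x q \<le> epow y q"
  by (cases x; cases y) (auto simp: epow_ennreal top_unique intro!: ennreal_leI powr_mono2)

lemma epow_mult: "epow (x * y) q = epow x q * epow y q"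
proof (cases x; cases y)
  fix r s :: real assume *: "x = ennreal r" "0 \<le> r" "y = ennreal s" "0 \<le> s"
  then show ?thesis
    using epow_ennreal[of "r * s" q] by (simp add: epow_ennreal powr_mult ennreal_mult)
next
  fix r assume *: "x = ennreal r" "0 \<le> r" "y = top"
  then show ?thesis
    by (cases "r = 0") (auto simp: ennreal_mult_top epow_ennreal)
next
  fix r assume *: "y = ennreal r" "0 \<le> r" "x = top"
  then show ?thesis
    by (cases "r = 0") (auto simp: ennreal_top_mult epow_ennreal)
qed (auto simp: ennreal_top_mult)

lemma epow_epow: "epow (epow x a) b = epow x (a * b)"
  by (cases x) (auto simp: epow_ennreal powr_powr)

lemma epow_add_exp: "epow x a * epow x b = epow x (a + b)"
  by (cases x) (simp_all add: epow_ennreal powr_add ennreal_top_mult flip: ennreal_mult)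

lemma epow_two: "epow x 2 = x * x"
  using epow_add_exp[of x 1 1] by simp

lemma epow_le_iff: "q > 0 \<Longrightarrow> epow x q \<le> epow y q \<longleftrightarrow> x \<le> y"
  using epow_mono[of x y q] epow_mono[of "epow x q" "epow y q" "1/q"] by (auto simp: epow_epow)

lemma epow_galois: "q > 0 \<Longrightarrow> epow x q \<le> y \<longleftrightarrow> x \<le> epow y (1/q)"
  using epow_le_iff[of q x "epow y (1/q)"] by (simp add: epow_epow)

lemma epow_SUP: "q > 0 \<Longrightarrow> epow (SUP i\<in>I. f i) q = (SUP i\<in>I. epow (f i) q)"
proof (rule order_antisym)
  assume q: "q > 0"
  show "epow (SUP i\<in>I. f i) q \<le> (SUP i\<in>I. epow (f i) q)"
    unfolding epow_galois[OF q] by (rule SUP_least) (auto simp flip: epow_galois[OF q] intro: SUP_upper)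
  show "(SUP i\<in>I. epow (f i) q) \<le> epow (SUP i\<in>I. f i) q"
    using q by (intro SUP_least epow_mono SUP_upper) auto
qed

lemma epow_add_le:
  assumes "q > 0" shows "epow (a + b) q \<le> ennreal (2 powr q) * (epow a q + epow b q)"
proof -
  have "a + b \<le> ennreal 2 * max a b"
    by (metis add_mono ennreal_numeral max.cobounded1 max.cobounded2 mult_2)
  then have "epow (a + b) q \<le> epow (ennreal 2 * max a b) q"
    using assms by (intro epow_mono) auto
  also have "\<dots> = ennreal (2 powr q) * epow (max a b) q"
    by (simp add: epow_mult epow_ennreal del: ennreal_numeral)
  also have "\<dots> \<le> ennreal (2 powr q) * (epow a q + epow b q)"
    by (intro mult_left_mono) (auto simp: max_def)
  finally show ?thesis .
qed

lemma epow_measurable [measurable]: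
  assumes [measurable]: "f \<in> borel_measurable M" shows "(\<lambda>x. epow (f x) q) \<in> borel_measurable M"
  unfolding epow_def by measurable

text \<open>Young's inequality for \<open>x / A powr (1/q)\<close> and
  \<open>y / B powr (1/r)\<close>, multiplied back. The weights are free so that Hoelder can insert
  the two integrals for A and B; the bracket then integrates to 1/q + 1/r = 1.\<close>

lemma Youngs_inequality_epow:
  assumes "q > 1" "r = q / (q - 1)" "A > 0" "B > 0"
  shows "x * y \<le> ennreal (A powr (1/q) * B powr (1/r)) *
                  (ennreal (1 / (q * A)) * epow x q + ennreal (1 / (r * B)) * epow y r)"
proof -
  have "r > 1" using assms by (simp add: less_divide_eq)
  moreover have "1/r = (q - 1) / q" using assms by simp
  then have "1/q + 1/r = 1" using assms by (simp add: diff_divide_distrib)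
  ultimately have r: "r > 1" "1/q + 1/r = 1" by auto
  have pos: "0 < A powr (1/q) * B powr (1/r)" "1 / (q * A) > 0" "1 / (r * B) > 0" using assms r by auto
  show ?thesis
  proof (cases "x = top \<or> y = top")
    case True
    have "ennreal (1 / (q * A)) * epow x q + ennreal (1 / (r * B)) * epow y r = top"
      using True pos(2,3) by (auto simp: ennreal_mult_top ennreal_eq_0_iff simp del: ennreal_eq_zero_iff)
    then show ?thesis using pos by (auto simp: ennreal_mult_top)
  next
    case False
    then obtain a b where ab: "x = ennreal a" "y = ennreal b" "a \<ge> 0" "b \<ge> 0"
      by (cases x; cases y) auto
    have "(a / A powr (1/q)) * (b / B powr (1/r)) \<le> (a / A powr (1/q)) powr q / q + (b / B powr (1/r)) powr r / r"
      using assms r ab by (intro Youngs_inequality) auto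
    also have "\<dots> = 1 / (q * A) * a powr q + 1 / (r * B) * b powr r"
      using assms r ab by (simp add: powr_divide powr_powr mult_ac)
    finally have "a * b / (A powr (1/q) * B powr (1/r)) \<le> 1 / (q * A) * a powr q + 1 / (r * B) * b powr r"
      by simp
    then have "a * b \<le> (A powr (1/q) * B powr (1/r)) * (1 / (q * A) * a powr q + 1 / (r * B) * b powr r)"
      using pos(1) by (simp only: pos_divide_le_eq mult.commute)
    then show ?thesis using ab pos assms r
      by (simp add: epow_ennreal flip: ennreal_mult ennreal_plus) 
  qed
qed

text \<open>Taking q-th powers turns the conjugate norm into the power q / r = q - 1 of its
  integral, r being the conjugate exponent. Infinite integrals are allowed, so 0 and \<infinity>
  have to be treated apart from the case in which both integrals can serve as weights.\<close>

lemma Hoelder_epow: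
  fixes F G :: "'a \<Rightarrow> ennreal"
  assumes q: "q > 1" and [measurable]: "F \<in> borel_measurable M" "G \<in> borel_measurable M"
  shows "epow (\<integral>\<^sup>+x. F x * G x \<partial>M) q
    \<le> (\<integral>\<^sup>+x. epow (F x) q \<partial>M) * epow (\<integral>\<^sup>+x. epow (G x) (q / (q - 1)) \<partial>M) (q - 1)"
proof -
  define r where "r = q / (q - 1)"
  have "r > 1" using assms by (simp add: r_def less_divide_eq)
  moreover have "1/r = (q - 1) / q" using assms by (simp add: r_def)
  then have "1/q + 1/r = 1" using assms by (simp add: diff_divide_distrib)
  ultimately have r: "r > 1" "1/q + 1/r = 1" by auto
  define A where "A = (\<integral>\<^sup>+x. epow (F x) q \<partial>M)"
  define B where "B = (\<integral>\<^sup>+x. epow (G x) r \<partial>M)"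
  have "epow (\<integral>\<^sup>+x. F x * G x \<partial>M) q \<le> A * epow B (q - 1)"
  proof (cases "A = 0 \<or> B = 0")
    case True
    then have "(AE x in M. epow (F x) q = 0) \<or> (AE x in M. epow (G x) r = 0)"
      unfolding A_def B_def by (subst (asm) (1 2) nn_integral_0_iff_AE) auto
    then have "AE x in M. F x * G x = 0"
      by (auto elim!: eventually_mono)
    then have "(\<integral>\<^sup>+x. F x * G x \<partial>M) = 0"
      by (subst nn_integral_0_iff_AE) auto
    then show ?thesis by simp
  next
    case ne: False
    show ?thesis
    proof (cases "A = top \<or> B = top")
      case True
      then have "A * epow B (q - 1) = top" using ne by (auto simp: ennreal_mult_top ennreal_top_mult)
      then show ?thesis by simp
    next
      case False
      then obtain a b where ab: "A = ennreal a" "B = ennreal b" "a > 0" "b > 0"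
        using ne by (cases A; cases B) (auto simp: ennreal_eq_0_iff not_le)
      have "(\<integral>\<^sup>+x. F x * G x \<partial>M) \<le> (\<integral>\<^sup>+x. ennreal (a powr (1/q) * b powr (1/r)) *
                  (ennreal (1 / (q * a)) * epow (F x) q + ennreal (1 / (r * b)) * epow (G x) r) \<partial>M)"
        using q ab r_def by (intro nn_integral_mono Youngs_inequality_epow)
      also have "\<dots> = ennreal (a powr (1/q) * b powr (1/r)) *
                  (ennreal (1 / (q * a)) * A + ennreal (1 / (r * b)) * B)"
        by (simp add: nn_integral_cmult nn_integral_add A_def B_def)
      also have "\<dots> = ennreal (a powr (1/q) * b powr (1/r))"
        using ab q r by (simp add: field_simps flip: ennreal_mult ennreal_plus)
      finally have "epow (\<integral>\<^sup>+x. F x * G x \<partial>M) q \<le> epow (ennreal (a powr (1/q) * b powr (1/r))) q"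
        using q by (intro epow_mono) auto
      also have "\<dots> = A * epow B (q - 1)"
        using ab q r r_def by (simp add: epow_ennreal powr_mult powr_powr flip: ennreal_mult)
      finally show ?thesis .
    qed
  qed
  then show ?thesis by (simp add: A_def B_def r_def)
qed

text \<open>Jensen's inequality for the measure with density P, not normalised: Hoelder for the
  splitting of P into the powers 1/q and 1 - 1/q.\<close>

lemma nn_integral_weighted_power:
  fixes F P :: "'a \<Rightarrow> ennreal"
  assumes q: "q > 1" and [measurable]: "F \<in> borel_measurable M" "P \<in> borel_measurable M"
  shows "epow (\<integral>\<^sup>+x. P x * F x \<partial>M) q
    \<le> epow (\<integral>\<^sup>+x. P x \<partial>M) (q - 1) * (\<integral>\<^sup>+x. P x * epow (F x) q \<partial>M)"
proof -
  have "(\<lambda>x. P x * F x) = (\<lambda>x. (epow (P x) (1/q) * F x) * epow (P x) (1 - 1/q))"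
    using epow_add_exp[of _ "1/q" "1-1/q"] by (auto simp: fun_eq_iff mult_ac)
  then have "epow (\<integral>\<^sup>+x. P x * F x \<partial>M) q = epow (\<integral>\<^sup>+x. (epow (P x) (1/q) * F x) * epow (P x) (1 - 1/q) \<partial>M) q"
    by simp
  also have "\<dots> \<le> (\<integral>\<^sup>+x. epow (epow (P x) (1/q) * F x) q \<partial>M) *
     epow (\<integral>\<^sup>+x. epow (epow (P x) (1 - 1/q)) (q / (q - 1)) \<partial>M) (q - 1)"
    by (rule Hoelder_epow[OF q]) measurable
  also have e: "(1 - 1/q) * (q / (q - 1)) = 1" using q by (simp add: field_simps)
  have "(\<integral>\<^sup>+x. epow (epow (P x) (1 - 1/q)) (q / (q - 1)) \<partial>M) = (\<integral>\<^sup>+x. P x \<partial>M)"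
    by (simp only: epow_epow e epow_one)
  also have "(\<integral>\<^sup>+x. epow (epow (P x) (1/q) * F x) q \<partial>M) = (\<integral>\<^sup>+x. P x * epow (F x) q \<partial>M)"
    using q by (simp add: epow_mult epow_epow)
  finally show ?thesis by (simp add: mult_ac)
qed

text \<open>The pointwise core of Young's inequality from L_s and L_(q/2) into L_q, where 1/s + 2/q
  = 1 + 1/q. It is Hoelder for the three factors \<open>K powr (s/q) * F\<close>, \<open>F\<close>
  and \<open>K powr (1 - s/q)\<close> with exponents q, q and q / (q - 2), done in two
  rounds.\<close>

lemma nn_integral_kernel_square_power:
  fixes F K :: "'a \<Rightarrow> ennreal"
  assumes q: "q > 2" and s: "s = q / (q - 1)" and [measurable]: "F \<in> borel_measurable M" "K \<in> borel_measurable M"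
  shows "epow (\<integral>\<^sup>+x. K x * (F x * F x) \<partial>M) q
    \<le> (\<integral>\<^sup>+x. epow (K x) s * epow (F x) q \<partial>M) * (\<integral>\<^sup>+x. epow (F x) q \<partial>M) * epow (\<integral>\<^sup>+x. epow (K x) s \<partial>M) (q - 2)"
proof -
  \<comment> \<open>After the second Hoelder inequality, with exponent q - 1, the kernel carries the
    power s again; \<open>e2\<close> says that F is back at the power q.\<close>
  have e1: "(1 - s/q) * s * ((q - 1) / (q - 1 - 1)) = s" 
  proof -
    have "s / q = 1 / (q - 1)" using q s by simp
    then have "(1 - s/q) = (q - 2)/(q - 1)" using q by (simp add: diff_divide_eq_iff)
    then show ?thesis using q by simp
  qed
  have e2: "s * (q - 1) = q" using q s by auto
  have "(\<lambda>x. K x * (F x * F x)) = (\<lambda>x. (epow (K x) (s/q) * F x) * (F x * epow (K x) (1 - s/q)))"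
    using epow_add_exp[of _ "s/q" "1-s/q"] by (auto simp: fun_eq_iff mult_ac)
  then have "epow (\<integral>\<^sup>+x. K x * (F x * F x) \<partial>M) q = epow (\<integral>\<^sup>+x. (epow (K x) (s/q) * F x) * (F x * epow (K x) (1 - s/q)) \<partial>M) q"
    by simp
  also have "\<dots> \<le> (\<integral>\<^sup>+x. epow (epow (K x) (s/q) * F x) q \<partial>M) *
     epow (\<integral>\<^sup>+x. epow (F x * epow (K x) (1 - s/q)) (q / (q - 1)) \<partial>M) (q - 1)"
    using q by (intro Hoelder_epow) auto
  also have "(\<integral>\<^sup>+x. epow (epow (K x) (s/q) * F x) q \<partial>M) = (\<integral>\<^sup>+x. epow (K x) s * epow (F x) q \<partial>M)"
    using q by (simp add: epow_mult epow_epow)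
  also have "(\<integral>\<^sup>+x. epow (F x * epow (K x) (1 - s/q)) (q / (q - 1)) \<partial>M) =
      (\<integral>\<^sup>+x. epow (F x) s * epow (K x) ((1 - s/q) * s) \<partial>M)"
    by (simp add: epow_mult epow_epow s)
  also have "epow (\<integral>\<^sup>+x. epow (F x) s * epow (K x) ((1 - s/q) * s) \<partial>M) (q - 1) \<le>
     (\<integral>\<^sup>+x. epow (epow (F x) s) (q - 1) \<partial>M) *
     epow (\<integral>\<^sup>+x. epow (epow (K x) ((1 - s/q) * s)) ((q - 1) / (q - 1 - 1)) \<partial>M) (q - 1 - 1)"
    using q by (intro Hoelder_epow) auto
  also have "\<dots> = (\<integral>\<^sup>+x. epow (F x) q \<partial>M) * epow (\<integral>\<^sup>+x. epow (K x) s \<partial>M) (q - 2)"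
    by (simp only: epow_epow e1 e2) simp
  finally show ?thesis by (simp add: mult.assoc mult_left_mono)
qed

section \<open>Picard iteration under a majorant\<close>

primrec majorant :: "'m measure \<Rightarrow> ('m \<Rightarrow> ennreal) \<Rightarrow> ('m \<Rightarrow> 'm \<Rightarrow> ennreal) \<Rightarrow> nat \<Rightarrow> 'm \<Rightarrow> ennreal" where
  "majorant M \<beta> \<kappa> 0 = (\<lambda>_. 0)"
| "majorant M \<beta> \<kappa> (Suc n) = (\<lambda>\<xi>. \<beta> \<xi> + (\<integral>\<^sup>+\<eta>. \<kappa> \<xi> \<eta> * (majorant M \<beta> \<kappa> n \<eta> * majorant M \<beta> \<kappa> n \<eta>) \<partial>M))"

definition majorant_limit :: "'m measure \<Rightarrow> ('m \<Rightarrow> ennreal) \<Rightarrow> ('m \<Rightarrow> 'm \<Rightarrow> ennreal) \<Rightarrow> 'm \<Rightarrow> ennreal" where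
  "majorant_limit M \<beta> \<kappa> \<xi> = (SUP n. majorant M \<beta> \<kappa> n \<xi>)"

text \<open>An integral that does not exist counts as 0, so the iterates are total functions. The
  bound by the majorant survives this convention.\<close>

primrec picard :: "'m measure \<Rightarrow> ('m \<Rightarrow> 'v) \<Rightarrow> ('m \<Rightarrow> 'm \<Rightarrow> 'v \<Rightarrow> 'v \<Rightarrow> 'v) \<Rightarrow> nat \<Rightarrow> 'm \<Rightarrow> 'v::euclidean_space" where
  "picard M b k 0 = (\<lambda>_. 0)"
| "picard M b k (Suc n) = (\<lambda>\<xi>. b \<xi> - (\<integral>\<eta>. k \<xi> \<eta> (picard M b k n \<eta>) (picard M b k n \<eta>) \<partial>M))"

lemmas [simp del] = picard.simps(2) majorant.simps(2)

text \<open>Meaningful where the majorant limit is finite. Elsewhere \<open>lim\<close> may return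
  anything, so every later claim about the limit is confined to such points or to a kernel that
  vanishes there.\<close>

definition picard_limit :: "'m measure \<Rightarrow> ('m \<Rightarrow> 'v) \<Rightarrow> ('m \<Rightarrow> 'm \<Rightarrow> 'v \<Rightarrow> 'v \<Rightarrow> 'v) \<Rightarrow> 'm \<Rightarrow> 'v::euclidean_space" where
  "picard_limit M b k \<xi> = lim (\<lambda>n. picard M b k n \<xi>)"

locale majorant_kernel = sigma_finite_measure M for M :: "'m measure" +
  fixes \<beta> :: "'m \<Rightarrow> ennreal" and \<kappa> :: "'m \<Rightarrow> 'm \<Rightarrow> ennreal"
  assumes beta_measurable [measurable]: "\<beta> \<in> borel_measurable M"
    and kappa_measurable [measurable]: "(\<lambda>(\<xi>, \<eta>). \<kappa> \<xi> \<eta>) \<in> borel_measurable (M \<Otimes>\<^sub>M M)"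
begin

abbreviation "w \<equiv> majorant M \<beta> \<kappa>"
abbreviation "W \<equiv> majorant_limit M \<beta> \<kappa>"

lemma majorant_measurable [measurable]: "w n \<in> borel_measurable M"
  by (induction n) (simp_all add: majorant.simps(2))

lemma majorant_limit_measurable [measurable]: "W \<in> borel_measurable M"
  unfolding majorant_limit_def by measurable

lemma majorant_Suc_ge: "w n \<xi> \<le> w (Suc n) \<xi>"
proof (induction n arbitrary: \<xi>)
  case (Suc n)
  have "w (Suc n) \<xi> = \<beta> \<xi> + (\<integral>\<^sup>+\<eta>. \<kappa> \<xi> \<eta> * (w n \<eta> * w n \<eta>) \<partial>M)"
    by (simp add: majorant.simps(2))
  also have "\<dots> \<le> \<beta> \<xi> + (\<integral>\<^sup>+\<eta>. \<kappa> \<xi> \<eta> * (w (Suc n) \<eta> * w (Suc n) \<eta>) \<partial>M)"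
    by (intro add_left_mono nn_integral_mono mult_mono mult_left_mono Suc.IH) simp_all
  also have "\<dots> = w (Suc (Suc n)) \<xi>"
    by (simp only: majorant.simps(2)[of _ _ _ "Suc n"])
  finally show ?case .
qed simp

lemma majorant_mono: "m \<le> n \<Longrightarrow> w m \<xi> \<le> w n \<xi>"
  by (rule lift_Suc_mono_le[of "\<lambda>n. w n \<xi>"]) (rule majorant_Suc_ge)

lemma majorant_le_limit: "w n \<xi> \<le> W \<xi>"
  unfolding majorant_limit_def by (rule SUP_upper) simp

lemma majorant_limit_real:
  assumes "W \<xi> < \<infinity>"
  shows "(\<lambda>n. enn2real (w n \<xi>)) \<longlonglongrightarrow> enn2real (W \<xi>)" "w n \<xi> < \<infinity>"
proof -
  have "incseq (\<lambda>n. w n \<xi>)" by (rule incseq_SucI) (rule majorant_Suc_ge)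
  then have "(\<lambda>n. w n \<xi>) \<longlonglongrightarrow> W \<xi>"
    unfolding majorant_limit_def by (rule LIMSEQ_SUP)
  then show "(\<lambda>n. enn2real (w n \<xi>)) \<longlonglongrightarrow> enn2real (W \<xi>)"
    using assms by (intro tendsto_enn2real) auto
  show "w n \<xi> < \<infinity>" using majorant_le_limit assms by (rule order.strict_trans1)
qed

text \<open>Monotone convergence. Its main use is to unfold finiteness: if W is finite at \<xi>,
  then so are \<beta> \<xi> and the integral of \<kappa> W W, and the latter integrand is the
  dominating function in all limit passages below.\<close>

lemma majorant_limit_fixed_point:
  assumes "\<xi> \<in> space M"
  shows "W \<xi> = \<beta> \<xi> + (\<integral>\<^sup>+\<eta>. \<kappa> \<xi> \<eta> * (W \<eta> * W \<eta>) \<partial>M)"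
proof -
  have [measurable]: "(\<lambda>\<eta>. \<kappa> \<xi> \<eta>) \<in> borel_measurable M"
    using assms by measurable
  have inc: "incseq (\<lambda>n. w n \<eta>)" for \<eta>
    by (rule incseq_SucI) (rule majorant_Suc_ge)
  have sq: "\<kappa> \<xi> \<eta> * (W \<eta> * W \<eta>) = (SUP n. \<kappa> \<xi> \<eta> * (w n \<eta> * w n \<eta>))" for \<eta>
  proof -
    have "(\<lambda>n. w n \<eta>) \<longlonglongrightarrow> W \<eta>"
      unfolding majorant_limit_def by (rule LIMSEQ_SUP[OF inc])
    \<comment> \<open>Written as a power so that \<open>epow_SUP\<close> moves the square inside the
      supremum.\<close>
    have "W \<eta> * W \<eta> = epow (SUP n. w n \<eta>) 2" by (simp add: epow_two majorant_limit_def)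
    also have "\<dots> = (SUP n. w n \<eta> * w n \<eta>)" by (subst epow_SUP) (simp_all add: epow_two)
    finally show ?thesis by (simp add: SUP_mult_left_ennreal)
  qed
  have "W \<xi> = (SUP n. w (Suc n) \<xi>)"
    unfolding majorant_limit_def
    by (intro antisym SUP_least) (rule order_trans[OF majorant_Suc_ge], auto intro: SUP_upper)
  also have "\<dots> = \<beta> \<xi> + (SUP n. (\<integral>\<^sup>+\<eta>. \<kappa> \<xi> \<eta> * (w n \<eta> * w n \<eta>) \<partial>M))"
    by (simp add: ennreal_SUP_add_right majorant.simps(2))
  also have "(SUP n. (\<integral>\<^sup>+\<eta>. \<kappa> \<xi> \<eta> * (w n \<eta> * w n \<eta>) \<partial>M)) = (\<integral>\<^sup>+\<eta>. (SUP n. \<kappa> \<xi> \<eta> * (w n \<eta> * w n \<eta>)) \<partial>M)"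
    by (rule nn_integral_monotone_convergence_SUP[symmetric])
       (auto simp: incseq_def le_fun_def intro!: mult_mono majorant_mono)
  finally show ?thesis by (simp add: sq)
qed

end

text \<open>The kernel bound is required only where \<beta> is finite: the bounds on the heat
  kernels hold for time differences up to 1, and \<beta> will be set to \<infinity> at all other
  times.\<close>

locale majorized_picard = majorant_kernel M \<beta> \<kappa> for M :: "'m measure" and \<beta> \<kappa> +
  fixes b :: "'m \<Rightarrow> 'v::euclidean_space" and k :: "'m \<Rightarrow> 'm \<Rightarrow> 'v \<Rightarrow> 'v \<Rightarrow> 'v"
  assumes b_measurable [measurable]: "b \<in> borel_measurable M"
    and k_measurable: "\<And>f g. f \<in> borel_measurable M \<Longrightarrow> g \<in> borel_measurable M \<Longrightarrow>
          (\<lambda>(\<xi>, \<eta>). k \<xi> \<eta> (f \<eta>) (g \<eta>)) \<in> borel_measurable (M \<Otimes>\<^sub>M M)"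
    and k_bilinear: "\<And>\<xi> \<eta>. bounded_bilinear (k \<xi> \<eta>)"
    and b_bound: "\<And>\<xi>. ennreal (norm (b \<xi>)) \<le> \<beta> \<xi>"
    and k_bound: "\<And>\<xi> \<eta> x y. \<beta> \<xi> < \<infinity> \<Longrightarrow> ennreal (norm (k \<xi> \<eta> x y)) \<le> \<kappa> \<xi> \<eta> * (ennreal (norm x) * ennreal (norm y))"
begin

abbreviation "v \<equiv> picard M b k"
abbreviation "V \<equiv> picard_limit M b k"

lemma picard_measurable [measurable]: "v n \<in> borel_measurable M"
proof (induction n)
  case (Suc n)
  have [measurable]: "(\<lambda>(\<xi>, \<eta>). k \<xi> \<eta> (v n \<eta>) (v n \<eta>)) \<in> borel_measurable (M \<Otimes>\<^sub>M M)"
    by (rule k_measurable[OF Suc Suc])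
  have "(\<lambda>\<xi>. (\<integral>\<eta>. k \<xi> \<eta> (v n \<eta>) (v n \<eta>) \<partial>M)) \<in> borel_measurable M"
    by (rule borel_measurable_lebesgue_integral) simp
  then show ?case by (simp add: picard.simps(2))
qed simp

lemma picard_limit_measurable [measurable]: "V \<in> borel_measurable M"
  unfolding picard_limit_def by (rule borel_measurable_lim_metric) simp

lemma k_section_measurable:
  assumes "\<xi> \<in> space M" "f \<in> borel_measurable M" "g \<in> borel_measurable M"
  shows "(\<lambda>\<eta>. k \<xi> \<eta> (f \<eta>) (g \<eta>)) \<in> borel_measurable M"
  using measurable_compose[OF measurable_Pair1'[OF assms(1)] k_measurable[OF assms(2,3)]] by simp

lemma kappa_section_measurable [measurable]: "\<xi> \<in> space M \<Longrightarrow> (\<lambda>\<eta>. \<kappa> \<xi> \<eta>) \<in> borel_measurable M"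
  by measurable

lemma picard_le_majorant: "\<xi> \<in> space M \<Longrightarrow> ennreal (norm (v n \<xi>)) \<le> w n \<xi>"
proof (induction n arbitrary: \<xi>)
  case (Suc n)
  show ?case
  proof (cases "w (Suc n) \<xi> < \<infinity>")
    case True
    then have fin: "\<beta> \<xi> < \<infinity>" by (auto simp: less_top majorant.simps(2))
    have "ennreal (norm (v (Suc n) \<xi>)) \<le> ennreal (norm (b \<xi>) + norm (\<integral>\<eta>. k \<xi> \<eta> (v n \<eta>) (v n \<eta>) \<partial>M))"
      using norm_triangle_ineq4[of "b \<xi>"] by (simp only: picard.simps(2) ennreal_leI)
    also have "\<dots> \<le> \<beta> \<xi> + ennreal (norm (\<integral>\<eta>. k \<xi> \<eta> (v n \<eta>) (v n \<eta>) \<partial>M))"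
      using b_bound by (simp add: add_mono)
    also have "ennreal (norm (\<integral>\<eta>. k \<xi> \<eta> (v n \<eta>) (v n \<eta>) \<partial>M)) \<le> (\<integral>\<^sup>+\<eta>. ennreal (norm (k \<xi> \<eta> (v n \<eta>) (v n \<eta>))) \<partial>M)"
    proof (cases "integrable M (\<lambda>\<eta>. k \<xi> \<eta> (v n \<eta>) (v n \<eta>))")
      case True then show ?thesis by (rule integral_norm_bound_ennreal)
    qed (simp add: not_integrable_integral_eq)
    also have "\<dots> \<le> (\<integral>\<^sup>+\<eta>. \<kappa> \<xi> \<eta> * (w n \<eta> * w n \<eta>) \<partial>M)"
      using Suc.IH by (intro nn_integral_mono order_trans[OF k_bound[OF fin]] mult_mono) auto
    finally show ?thesis by (simp add: add_left_mono majorant.simps(2))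
  qed (simp add: not_less top_unique)
qed simp

text \<open>The increments of the iterates are dominated by those of the majorant, written as a sum
  because subtraction misbehaves at \<infinity>. With d the previous increment, k(v',v') - k(v,v) =
  k(d,v') + k(v,d), and |d| + w \<le> w' implies |d| w' + w |d| + w w \<le> |d| w' + w w' \<le> w'
  w', which is the induction step.\<close>

lemma picard_diff_le_majorant:
  "\<xi> \<in> space M \<Longrightarrow> ennreal (norm (v (Suc n) \<xi> - v n \<xi>)) + w n \<xi> \<le> w (Suc n) \<xi>"
proof (induction n arbitrary: \<xi>)
  case 0
  have "k \<xi> \<eta> 0 0 = 0" for \<eta> using bounded_bilinear.zero_left[OF k_bilinear] by auto
  then show ?case using b_bound by (simp add: picard.simps(2) majorant.simps(2))
next
  case (Suc n)
  show ?case
  proof (cases "w (Suc (Suc n)) \<xi> < \<infinity>")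
    case True
    then have fin: "\<beta> \<xi> < \<infinity>" and fin2: "(\<integral>\<^sup>+\<eta>. \<kappa> \<xi> \<eta> * (w (Suc n) \<eta> * w (Suc n) \<eta>) \<partial>M) < \<infinity>"
      by (auto simp: less_top majorant.simps(2)[of _ _ _ "Suc n"])
    note [measurable] = k_section_measurable[OF Suc.prems]
    define d where "d \<eta> = v (Suc n) \<eta> - v n \<eta>" for \<eta>
    have [measurable]: "d \<in> borel_measurable M" unfolding d_def by measurable
    have le1: "ennreal (norm (v (Suc n) \<eta>)) \<le> w (Suc n) \<eta>" "ennreal (norm (v n \<eta>)) \<le> w n \<eta>" if "\<eta> \<in> space M" for \<eta>
      using picard_le_majorant[OF that] by blast+
    have "(\<integral>\<^sup>+\<eta>. \<kappa> \<xi> \<eta> * (w n \<eta> * w n \<eta>) \<partial>M) \<le> (\<integral>\<^sup>+\<eta>. \<kappa> \<xi> \<eta> * (w (Suc n) \<eta> * w (Suc n) \<eta>) \<partial>M)"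
      by (intro nn_integral_mono mult_mono majorant_Suc_ge) auto
    then have fin1: "(\<integral>\<^sup>+\<eta>. \<kappa> \<xi> \<eta> * (w n \<eta> * w n \<eta>) \<partial>M) < \<infinity>" using fin2 by (rule order.strict_trans1)
    have int: "integrable M (\<lambda>\<eta>. k \<xi> \<eta> (v m \<eta>) (v m \<eta>))" if "(\<integral>\<^sup>+\<eta>. \<kappa> \<xi> \<eta> * (w m \<eta> * w m \<eta>) \<partial>M) < \<infinity>" for m
    proof (rule integrableI_bounded)
      have "(\<integral>\<^sup>+\<eta>. ennreal (norm (k \<xi> \<eta> (v m \<eta>) (v m \<eta>))) \<partial>M) \<le> (\<integral>\<^sup>+\<eta>. \<kappa> \<xi> \<eta> * (w m \<eta> * w m \<eta>) \<partial>M)"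
        using picard_le_majorant by (intro nn_integral_mono order_trans[OF k_bound[OF fin]] mult_mono) auto
      then show "(\<integral>\<^sup>+\<eta>. ennreal (norm (k \<xi> \<eta> (v m \<eta>) (v m \<eta>))) \<partial>M) < \<infinity>" using that by (rule order.strict_trans1)
    qed measurable
    have i1: "integrable M (\<lambda>\<eta>. k \<xi> \<eta> (v n \<eta>) (v n \<eta>))" by (rule int[OF fin1])
    have i2: "integrable M (\<lambda>\<eta>. k \<xi> \<eta> (v (Suc n) \<eta>) (v (Suc n) \<eta>))" by (rule int[OF fin2])
    have deq: "k \<xi> \<eta> (v (Suc n) \<eta>) (v (Suc n) \<eta>) - k \<xi> \<eta> (v n \<eta>) (v n \<eta>) = k \<xi> \<eta> (d \<eta>) (v (Suc n) \<eta>) + k \<xi> \<eta> (v n \<eta>) (d \<eta>)" for \<eta>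
      unfolding d_def bounded_bilinear.diff_left[OF k_bilinear] bounded_bilinear.diff_right[OF k_bilinear] by simp
    have "v (Suc (Suc n)) \<xi> - v (Suc n) \<xi> =
        - (\<integral>\<eta>. k \<xi> \<eta> (v (Suc n) \<eta>) (v (Suc n) \<eta>) - k \<xi> \<eta> (v n \<eta>) (v n \<eta>) \<partial>M)"
      by (subst Bochner_Integration.integral_diff[OF i2 i1])
         (simp add: picard.simps(2)[of M b k "Suc n"], simp add: picard.simps(2)[of M b k n])
    then have "ennreal (norm (v (Suc (Suc n)) \<xi> - v (Suc n) \<xi>)) = 
        ennreal (norm (\<integral>\<eta>. k \<xi> \<eta> (v (Suc n) \<eta>) (v (Suc n) \<eta>) - k \<xi> \<eta> (v n \<eta>) (v n \<eta>) \<partial>M))" by (simp only: norm_minus_cancel)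
    also have "\<dots> \<le> (\<integral>\<^sup>+\<eta>. ennreal (norm (k \<xi> \<eta> (v (Suc n) \<eta>) (v (Suc n) \<eta>) - k \<xi> \<eta> (v n \<eta>) (v n \<eta>))) \<partial>M)"
      by (rule integral_norm_bound_ennreal) (rule Bochner_Integration.integrable_diff[OF i2 i1])
    also have "\<dots> \<le> (\<integral>\<^sup>+\<eta>. \<kappa> \<xi> \<eta> * (ennreal (norm (d \<eta>)) * w (Suc n) \<eta> + w n \<eta> * ennreal (norm (d \<eta>))) \<partial>M)"
    proof (rule nn_integral_mono)
      fix \<eta> assume \<eta>: "\<eta> \<in> space M"
      have "ennreal (norm (k \<xi> \<eta> (v (Suc n) \<eta>) (v (Suc n) \<eta>) - k \<xi> \<eta> (v n \<eta>) (v n \<eta>)))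
         \<le> ennreal (norm (k \<xi> \<eta> (d \<eta>) (v (Suc n) \<eta>))) + ennreal (norm (k \<xi> \<eta> (v n \<eta>) (d \<eta>)))"
        unfolding deq by (simp add: norm_triangle_ineq ennreal_leI flip: ennreal_plus)
      also have "\<dots> \<le> \<kappa> \<xi> \<eta> * (ennreal (norm (d \<eta>)) * w (Suc n) \<eta>) + \<kappa> \<xi> \<eta> * (w n \<eta> * ennreal (norm (d \<eta>)))"
        using le1[OF \<eta>] by (intro add_mono order_trans[OF k_bound[OF fin]] mult_mono) auto
      finally show "ennreal (norm (k \<xi> \<eta> (v (Suc n) \<eta>) (v (Suc n) \<eta>) - k \<xi> \<eta> (v n \<eta>) (v n \<eta>))) \<le> \<kappa> \<xi> \<eta> * (ennreal (norm (d \<eta>)) * w (Suc n) \<eta> + w n \<eta> * ennreal (norm (d \<eta>)))"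
        by (simp add: distrib_left)
    qed
    finally have "ennreal (norm (v (Suc (Suc n)) \<xi> - v (Suc n) \<xi>)) + w (Suc n) \<xi> \<le>
       \<beta> \<xi> + ((\<integral>\<^sup>+\<eta>. \<kappa> \<xi> \<eta> * (ennreal (norm (d \<eta>)) * w (Suc n) \<eta> + w n \<eta> * ennreal (norm (d \<eta>))) \<partial>M) + (\<integral>\<^sup>+\<eta>. \<kappa> \<xi> \<eta> * (w n \<eta> * w n \<eta>) \<partial>M))"
      by (subst majorant.simps(2)) (simp only: add.left_commute[of _ "\<beta> \<xi>"] add_left_mono add_right_mono)
    also have "(\<integral>\<^sup>+\<eta>. \<kappa> \<xi> \<eta> * (ennreal (norm (d \<eta>)) * w (Suc n) \<eta> + w n \<eta> * ennreal (norm (d \<eta>))) \<partial>M) + (\<integral>\<^sup>+\<eta>. \<kappa> \<xi> \<eta> * (w n \<eta> * w n \<eta>) \<partial>M)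
      = (\<integral>\<^sup>+\<eta>. \<kappa> \<xi> \<eta> * (ennreal (norm (d \<eta>)) * w (Suc n) \<eta> + w n \<eta> * ennreal (norm (d \<eta>))) + \<kappa> \<xi> \<eta> * (w n \<eta> * w n \<eta>) \<partial>M)"
      using Suc.prems by (subst nn_integral_add) (auto simp del: majorant.simps)
    also have "\<dots> \<le> (\<integral>\<^sup>+\<eta>. \<kappa> \<xi> \<eta> * (w (Suc n) \<eta> * w (Suc n) \<eta>) \<partial>M)"
    proof (rule nn_integral_mono)
      fix \<eta> assume \<eta>: "\<eta> \<in> space M"
      have IH: "ennreal (norm (d \<eta>)) + w n \<eta> \<le> w (Suc n) \<eta>"
        using Suc.IH[OF \<eta>] by (simp only: d_def)
      have "ennreal (norm (d \<eta>)) * w (Suc n) \<eta> + w n \<eta> * ennreal (norm (d \<eta>)) + w n \<eta> * w n \<eta>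
          = ennreal (norm (d \<eta>)) * w (Suc n) \<eta> + w n \<eta> * (ennreal (norm (d \<eta>)) + w n \<eta>)"
        by (simp only: distrib_left add.assoc)
      also have "\<dots> \<le> ennreal (norm (d \<eta>)) * w (Suc n) \<eta> + w n \<eta> * w (Suc n) \<eta>"
        by (intro add_left_mono mult_left_mono IH) simp
      also have "\<dots> = (ennreal (norm (d \<eta>)) + w n \<eta>) * w (Suc n) \<eta>" by (simp only: distrib_right)
      also have "\<dots> \<le> w (Suc n) \<eta> * w (Suc n) \<eta>" by (intro mult_right_mono IH) simp
      finally show "\<kappa> \<xi> \<eta> * (ennreal (norm (d \<eta>)) * w (Suc n) \<eta> + w n \<eta> * ennreal (norm (d \<eta>))) + \<kappa> \<xi> \<eta> * (w n \<eta> * w n \<eta>) \<le> \<kappa> \<xi> \<eta> * (w (Suc n) \<eta> * w (Suc n) \<eta>)"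
        unfolding distrib_left[symmetric] by (rule mult_left_mono) simp
    qed
    also have "\<beta> \<xi> + (\<integral>\<^sup>+\<eta>. \<kappa> \<xi> \<eta> * (w (Suc n) \<eta> * w (Suc n) \<eta>) \<partial>M) = w (Suc (Suc n)) \<xi>" by (simp add: majorant.simps(2)[of _ _ _ "Suc n"])
    finally show ?thesis by (simp add: add_left_mono)
  qed (simp add: not_less top_unique)
qed

lemma picard_increment_sum_le:
  assumes "\<xi> \<in> space M" "m \<le> n"
  shows "ennreal (norm (v n \<xi> - v m \<xi>)) + w m \<xi> \<le> w n \<xi>"
  using assms(2)
proof (induction n rule: dec_induct)
  case (step n)
  have "ennreal (norm (v (Suc n) \<xi> - v m \<xi>)) \<le> ennreal (norm (v (Suc n) \<xi> - v n \<xi>)) + ennreal (norm (v n \<xi> - v m \<xi>))"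
    using norm_triangle_ineq[of "v (Suc n) \<xi> - v n \<xi>" "v n \<xi> - v m \<xi>"] by (simp add: ennreal_leI flip: ennreal_plus)
  then have "ennreal (norm (v (Suc n) \<xi> - v m \<xi>)) + w m \<xi> \<le> ennreal (norm (v (Suc n) \<xi> - v n \<xi>)) + (ennreal (norm (v n \<xi> - v m \<xi>)) + w m \<xi>)"
    by (simp only: add.assoc[symmetric] add_right_mono)
  also have "\<dots> \<le> ennreal (norm (v (Suc n) \<xi> - v n \<xi>)) + w n \<xi>"
    by (rule add_left_mono) (rule step)
  also have "\<dots> \<le> w (Suc n) \<xi>" by (rule picard_diff_le_majorant[OF assms(1)])
  finally show ?case .
qed simp

lemma picard_increment_real:
  assumes "\<xi> \<in> space M" "W \<xi> < \<infinity>" "m \<le> n"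
  shows "norm (v n \<xi> - v m \<xi>) \<le> enn2real (w n \<xi>) - enn2real (w m \<xi>)"
proof -
  obtain x y where xy: "w n \<xi> = ennreal x" "w m \<xi> = ennreal y" "x \<ge> 0" "y \<ge> 0"
    using majorant_limit_real(2)[OF assms(2)] by (metis ennreal_cases infinity_ennreal_def top.not_eq_extremum)
  show ?thesis using picard_increment_sum_le[OF assms(1,3)] xy by (simp flip: ennreal_plus)
qed

lemma picard_tendsto:
  assumes "\<xi> \<in> space M" "W \<xi> < \<infinity>"
  shows "(\<lambda>n. v n \<xi>) \<longlonglongrightarrow> V \<xi>"
proof -
  have C: "Cauchy (\<lambda>n. enn2real (w n \<xi>))"
    using majorant_limit_real(1)[OF assms(2)] by (rule LIMSEQ_imp_Cauchy)
  have "Cauchy (\<lambda>n. v n \<xi>)"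
  proof (rule metric_CauchyI)
    fix e :: real assume "e > 0"
    then obtain N where N: "\<And>m n. m \<ge> N \<Longrightarrow> n \<ge> N \<Longrightarrow> dist (enn2real (w m \<xi>)) (enn2real (w n \<xi>)) < e"
      using C by (meson metric_CauchyD)
    have "dist (v m \<xi>) (v n \<xi>) < e" if "m \<ge> N" "n \<ge> N" for m n
    proof (cases "m \<le> n")
      case True then show ?thesis
        using picard_increment_real[OF assms, of m n] N[OF that] by (auto simp: dist_norm norm_minus_commute)
    next
      case False then show ?thesis
        using picard_increment_real[OF assms, of n m] N[OF that] by (auto simp: dist_norm norm_minus_commute)
    qed
    then show "\<exists>N. \<forall>m\<ge>N. \<forall>n\<ge>N. dist (v m \<xi>) (v n \<xi>) < e" by blast
  qed
  then show ?thesis unfolding picard_limit_def by (simp add: Cauchy_convergent convergent_LIMSEQ_iff[symmetric])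
qed

lemma picard_limit_diff:
  assumes "\<xi> \<in> space M" "W \<xi> < \<infinity>"
  shows "norm (V \<xi> - v m \<xi>) \<le> enn2real (W \<xi>) - enn2real (w m \<xi>)"
proof (rule tendsto_le[OF sequentially_bot])
  show "(\<lambda>n. enn2real (w n \<xi>) - enn2real (w m \<xi>)) \<longlonglongrightarrow> enn2real (W \<xi>) - enn2real (w m \<xi>)"
    by (intro tendsto_intros majorant_limit_real assms)
  show "(\<lambda>n. norm (v n \<xi> - v m \<xi>)) \<longlonglongrightarrow> norm (V \<xi> - v m \<xi>)"
    by (intro tendsto_intros picard_tendsto assms)
  show "eventually (\<lambda>n. norm (v n \<xi> - v m \<xi>) \<le> enn2real (w n \<xi>) - enn2real (w m \<xi>)) sequentially"
    using eventually_ge_at_top[of m] by eventually_elim (rule picard_increment_real[OF assms])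
qed

lemma picard_limit_le:
  assumes "\<xi> \<in> space M" "W \<xi> < \<infinity>"
  shows "norm (V \<xi>) \<le> enn2real (W \<xi>)" "ennreal (norm (V \<xi>)) \<le> W \<xi>"
proof -
  show "norm (V \<xi>) \<le> enn2real (W \<xi>)" using picard_limit_diff[OF assms, of 0] by simp
  then show "ennreal (norm (V \<xi>)) \<le> W \<xi>" using assms(2) 
    by (metis ennreal_enn2real ennreal_leI infinity_ennreal_def)
qed

text \<open>Dominated convergence at each single point with finite W, the dominating function being
  \<kappa> W W. The equation therefore holds at every such point and not just almost everywhere in
  space-time, which matters for statements at a fixed time.\<close>

lemma picard_limit_fixed_point:
  assumes sp: "\<xi> \<in> space M" and W: "W \<xi> < \<infinity>"
  shows "integrable M (\<lambda>\<eta>. k \<xi> \<eta> (V \<eta>) (V \<eta>))"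
    and "V \<xi> = b \<xi> - (\<integral>\<eta>. k \<xi> \<eta> (V \<eta>) (V \<eta>) \<partial>M)"
    and "ennreal (norm (\<integral>\<eta>. k \<xi> \<eta> (V \<eta>) (V \<eta>) \<partial>M)) \<le> (\<integral>\<^sup>+\<eta>. \<kappa> \<xi> \<eta> * (W \<eta> * W \<eta>) \<partial>M)"
proof -
  have fin: "\<beta> \<xi> < \<infinity>" and fin2: "(\<integral>\<^sup>+\<eta>. \<kappa> \<xi> \<eta> * (W \<eta> * W \<eta>) \<partial>M) < \<infinity>"
    using W majorant_limit_fixed_point[OF sp] by (auto simp: less_top)
  have [measurable]: "(\<lambda>\<eta>. \<kappa> \<xi> \<eta> * (W \<eta> * W \<eta>)) \<in> borel_measurable M"
    using sp by measurable
  define g where "g \<eta> = enn2real (\<kappa> \<xi> \<eta> * (W \<eta> * W \<eta>))" for \<eta>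
  have AEfin: "AE \<eta> in M. \<kappa> \<xi> \<eta> * (W \<eta> * W \<eta>) \<noteq> \<infinity>"
    using fin2 by (intro nn_integral_PInf_AE) auto
  have gint: "integrable M g"
  proof (rule integrableI_bounded)
    have "(\<integral>\<^sup>+\<eta>. ennreal (norm (g \<eta>)) \<partial>M) = (\<integral>\<^sup>+\<eta>. \<kappa> \<xi> \<eta> * (W \<eta> * W \<eta>) \<partial>M)"
      using AEfin by (intro nn_integral_cong_AE) (auto simp: g_def less_top)
    then show "(\<integral>\<^sup>+\<eta>. ennreal (norm (g \<eta>)) \<partial>M) < \<infinity>" using fin2 by simp
  next
    have "(\<lambda>\<eta>. enn2real (\<kappa> \<xi> \<eta> * (W \<eta> * W \<eta>))) \<in> borel_measurable M" by measurable
    then show "g \<in> borel_measurable M" by (simp add: g_def[abs_def])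
  qed
  \<comment> \<open>Where \<kappa> vanishes, W \<eta> may be infinite and the iterates at \<eta> may
    diverge; the integrand converges nevertheless, being 0.\<close>
  have k0: "k \<xi> \<eta> x y = 0" if "\<kappa> \<xi> \<eta> = 0" for \<eta> x y
    using k_bound[OF fin, of \<eta> x y] that by (simp add: ennreal_eq_0_iff)
  have conv: "(\<lambda>n. k \<xi> \<eta> (v n \<eta>) (v n \<eta>)) \<longlonglongrightarrow> k \<xi> \<eta> (V \<eta>) (V \<eta>)"
    if "\<kappa> \<xi> \<eta> * (W \<eta> * W \<eta>) \<noteq> \<infinity>" "\<eta> \<in> space M" for \<eta>
  proof (cases "\<kappa> \<xi> \<eta> = 0")
    case False
    then have "W \<eta> < \<infinity>" using that by (auto simp: ennreal_mult_eq_top_iff less_top)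
    from picard_tendsto[OF that(2) this] show ?thesis
      by (intro bounded_bilinear.tendsto[OF k_bilinear])
  qed (simp add: k0)
  have bnd: "norm (k \<xi> \<eta> (v n \<eta>) (v n \<eta>)) \<le> g \<eta>"
    if "\<kappa> \<xi> \<eta> * (W \<eta> * W \<eta>) \<noteq> \<infinity>" "\<eta> \<in> space M" for \<eta> n
  proof -
    have "ennreal (norm (k \<xi> \<eta> (v n \<eta>) (v n \<eta>))) \<le> \<kappa> \<xi> \<eta> * (W \<eta> * W \<eta>)"
      using picard_le_majorant[OF that(2)] majorant_le_limit
      by (intro order_trans[OF k_bound[OF fin]] mult_mono) (auto intro: order_trans)
    also have "\<dots> = ennreal (g \<eta>)" using that(1) by (simp add: g_def less_top)
    finally show ?thesis by (simp add: g_def)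
  qed
  have m1: "(\<lambda>\<eta>. k \<xi> \<eta> (V \<eta>) (V \<eta>)) \<in> borel_measurable M"
    and m2: "(\<lambda>\<eta>. k \<xi> \<eta> (v n \<eta>) (v n \<eta>)) \<in> borel_measurable M" for n
    using sp by (auto intro!: k_section_measurable)
  have c: "AE \<eta> in M. (\<lambda>n. k \<xi> \<eta> (v n \<eta>) (v n \<eta>)) \<longlonglongrightarrow> k \<xi> \<eta> (V \<eta>) (V \<eta>)"
    using AEfin AE_space by eventually_elim (rule conv)
  have d: "AE \<eta> in M. norm (k \<xi> \<eta> (v n \<eta>) (v n \<eta>)) \<le> g \<eta>" for n
    using AEfin AE_space by eventually_elim (rule bnd)
  show int: "integrable M (\<lambda>\<eta>. k \<xi> \<eta> (V \<eta>) (V \<eta>))"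
    by (rule integrable_dominated_convergence[OF m1 m2 gint c d])
  have "(\<lambda>n. \<integral>\<eta>. k \<xi> \<eta> (v n \<eta>) (v n \<eta>) \<partial>M) \<longlonglongrightarrow> (\<integral>\<eta>. k \<xi> \<eta> (V \<eta>) (V \<eta>) \<partial>M)"
    by (rule integral_dominated_convergence[OF m1 m2 gint c d])
  then have "(\<lambda>n. v (Suc n) \<xi>) \<longlonglongrightarrow> b \<xi> - (\<integral>\<eta>. k \<xi> \<eta> (V \<eta>) (V \<eta>) \<partial>M)"
    unfolding picard.simps(2) by (intro tendsto_intros)
  moreover have "(\<lambda>n. v (Suc n) \<xi>) \<longlonglongrightarrow> V \<xi>"
    using picard_tendsto[OF sp W] by (rule LIMSEQ_Suc)
  ultimately show "V \<xi> = b \<xi> - (\<integral>\<eta>. k \<xi> \<eta> (V \<eta>) (V \<eta>) \<partial>M)"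
    by (rule LIMSEQ_unique[symmetric])
  have "ennreal (norm (\<integral>\<eta>. k \<xi> \<eta> (V \<eta>) (V \<eta>) \<partial>M)) \<le> (\<integral>\<^sup>+\<eta>. ennreal (norm (k \<xi> \<eta> (V \<eta>) (V \<eta>))) \<partial>M)"
    by (rule integral_norm_bound_ennreal[OF int])
  also have "\<dots> \<le> (\<integral>\<^sup>+\<eta>. \<kappa> \<xi> \<eta> * (W \<eta> * W \<eta>) \<partial>M)"
  proof (rule nn_integral_mono)
    fix \<eta> assume \<eta>: "\<eta> \<in> space M"
    have "ennreal (norm (V \<eta>)) \<le> W \<eta>"
      using picard_limit_le(2)[OF \<eta>] by (cases "W \<eta> < \<infinity>") (auto simp: not_less top_unique)
    then show "ennreal (norm (k \<xi> \<eta> (V \<eta>) (V \<eta>))) \<le> \<kappa> \<xi> \<eta> * (W \<eta> * W \<eta>)"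
      by (intro order_trans[OF k_bound[OF fin]] mult_mono) auto
  qed
  finally show "ennreal (norm (\<integral>\<eta>. k \<xi> \<eta> (V \<eta>) (V \<eta>) \<partial>M)) \<le> (\<integral>\<^sup>+\<eta>. \<kappa> \<xi> \<eta> * (W \<eta> * W \<eta>) \<partial>M)" .
qed

end

section \<open>Holomorphic dependence on a parameter\<close>

lemma borel_measurable_vec_nth [measurable (raw)]:
  fixes f :: "'a \<Rightarrow> 'b::real_normed_vector^'n"
  assumes "f \<in> borel_measurable M"
  shows "(\<lambda>x. f x $ i) \<in> borel_measurable M"
  by (rule measurable_compose[OF assms borel_measurable_continuous_onI]) (intro continuous_intros)

lemma holomorphic_deriv_bound:
  assumes "f holomorphic_on ball z0 r" "\<And>z. z \<in> ball z0 r \<Longrightarrow> norm (f z) \<le> B" "dist z0 w < r / 2"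
  shows "norm (deriv f w) \<le> 2 * B / r"
proof -
  have r: "r > 0" using assms(3) by (smt (verit) zero_le_dist field_sum_of_halves)
  have sub: "cball w (r/2) \<subseteq> ball z0 r"
  proof
    fix x assume "x \<in> cball w (r/2)"
    then have "dist z0 x < r" using assms(3) dist_triangle[of z0 x w] by (auto simp: field_simps)
    then show "x \<in> ball z0 r" by simp
  qed
  have "norm ((deriv ^^ 1) f w) \<le> fact 1 * B / (r/2)^1"
  proof (rule Cauchy_inequality)
    show "f holomorphic_on ball w (r/2)" using assms(1) sub ball_subset_cball by (meson holomorphic_on_subset subset_trans)
    show "continuous_on (cball w (r/2)) f" using assms(1) sub by (meson holomorphic_on_imp_continuous_on holomorphic_on_subset)
    show "norm (f x) \<le> B" if "norm (w - x) = r/2" for x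
      using that sub by (intro assms(2)) (auto simp: dist_norm subset_iff)
  qed (use r in auto)
  then show ?thesis by (simp add: mult.commute)
qed

lemma holomorphic_Lipschitz:
  assumes "f holomorphic_on ball z0 r" "\<And>z. z \<in> ball z0 r \<Longrightarrow> norm (f z) \<le> B" "dist z0 z < r / 2"
  shows "norm (f z - f z0) \<le> 2 * B / r * norm (z - z0)"
proof (rule field_differentiable_bound[where S="ball z0 (r/2)"])
  have r: "r > 0" using assms(3) by (smt (verit) zero_le_dist field_sum_of_halves)
  show "(f has_field_derivative deriv f w) (at w within ball z0 (r/2))" if "w \<in> ball z0 (r/2)" for w
  proof -
    have "w \<in> ball z0 r" using that r by auto
    then have "(f has_field_derivative deriv f w) (at w)"
      using assms(1) by (intro holomorphic_derivI) auto
    then show ?thesis by (rule has_field_derivative_at_within)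
  qed
  show "norm (deriv f w) \<le> 2 * B / r" if "w \<in> ball z0 (r/2)" for w
    using that by (intro holomorphic_deriv_bound[OF assms(1)] assms(2)) auto
  show "z \<in> ball z0 (r/2)" "z0 \<in> ball z0 (r/2)" using assms(3) r by auto
qed auto

text \<open>The rate depends on f only through B, which later makes difference quotients converge
  uniformly in further parameters. The constant is \<open>holomorphic_Lipschitz\<close> applied to
  the derivative: that is bounded by 2 B / r on the ball of radius r / 2, and 2 (2 B / r) / (r / 2)
  = 8 B / r^2.\<close>

lemma holomorphic_difference_quotient:
  assumes hol: "f holomorphic_on ball z0 r" and B: "\<And>z. z \<in> ball z0 r \<Longrightarrow> norm (f z) \<le> B"
    and h: "norm h < r / 4" "h \<noteq> 0"
  shows "norm ((f (z0 + h) - f z0) / h - deriv f z0) \<le> 8 * B / r\<^sup>2 * norm h"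
proof -
  have r: "r > 0" using h by (smt (verit) norm_ge_zero divide_nonpos_pos)
  have B0: "0 \<le> B" using B[of z0] r by (smt (verit) centre_in_ball norm_ge_zero)
  have d: "norm (deriv f w - deriv f z0) \<le> 8 * B / r\<^sup>2 * norm h" if "dist z0 w \<le> norm h" for w
  proof -
    have "norm (deriv f w - deriv f z0) \<le> 2 * (2 * B / r) / (r/2) * norm (w - z0)"
    proof (rule holomorphic_Lipschitz)
      have "f holomorphic_on ball z0 (r/2)" using hol r by (rule_tac holomorphic_on_subset) auto
      then show "deriv f holomorphic_on ball z0 (r/2)" by (rule holomorphic_deriv) auto
      show "norm (deriv f z) \<le> 2 * B / r" if "z \<in> ball z0 (r/2)" for z
        using that by (intro holomorphic_deriv_bound[OF hol B]) auto
      show "dist z0 w < r / 2 / 2" using that h by simp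
    qed
    also have "\<dots> \<le> 2 * (2 * B / r) / (r/2) * norm h"
      using that B0 r by (intro mult_left_mono) (auto simp: dist_norm norm_minus_commute)
    finally show ?thesis by (simp add: power2_eq_square)
  qed
  have "norm ((f (z0 + h) - deriv f z0 * (z0 + h)) - (f z0 - deriv f z0 * z0)) \<le> 8 * B / r\<^sup>2 * norm h * norm ((z0 + h) - z0)"
  proof (rule field_differentiable_bound[where S="cball z0 (norm h)" and f'="\<lambda>w. deriv f w - deriv f z0"])
    show "((\<lambda>a. f a - deriv f z0 * a) has_field_derivative deriv f w - deriv f z0) (at w within cball z0 (norm h))"
      if "w \<in> cball z0 (norm h)" for w
    proof -
      have "w \<in> ball z0 r" using that h r by auto
      then have "(f has_field_derivative deriv f w) (at w within cball z0 (norm h))"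
        using hol by (intro has_field_derivative_at_within[OF holomorphic_derivI]) auto
      then show ?thesis by (auto intro!: derivative_eq_intros)
    qed
  qed (use d in \<open>auto simp: dist_norm\<close>)
  then have "norm (f (z0 + h) - f z0 - deriv f z0 * h) \<le> 8 * B / r\<^sup>2 * norm h * norm h"
    by (simp add: algebra_simps)
  moreover have "(f (z0 + h) - f z0) / h - deriv f z0 = (f (z0 + h) - f z0 - deriv f z0 * h) / h"
    using h by (simp add: field_simps)
  ultimately show ?thesis using h by (simp add: norm_divide divide_le_eq)
qed

text \<open>A bound on f alone controls its difference quotients, by Cauchy: near z0 they are at
  most \<open>2 / r * g y\<close>. So differentiation under the integral sign follows from dominated
  convergence.\<close>

lemma holomorphic_on_integral:
  fixes f :: "complex \<Rightarrow> 'a \<Rightarrow> complex"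
  assumes A: "open A" and meas: "\<And>z. z \<in> A \<Longrightarrow> f z \<in> borel_measurable M"
    and hol: "AE y in M. (\<lambda>z. f z y) holomorphic_on A"
    and bound: "AE y in M. \<forall>z\<in>A. norm (f z y) \<le> g y" and g: "integrable M g"
  shows "(\<lambda>z. \<integral>y. f z y \<partial>M) holomorphic_on A"
proof (rule holomorphic_onI, rule field_differentiable_at_within)
  fix z0 assume z0: "z0 \<in> A"
  then obtain r where r: "r > 0" "ball z0 r \<subseteq> A" using A open_contains_ball by blast
  have int: "integrable M (f z)" if "z \<in> A" for z
    using bound that by (intro Bochner_Integration.integrable_bound[OF g meas[OF that]])
      (auto elim!: eventually_mono intro: order_trans)
  define Q where "Q h y = (f (z0 + h) y - f z0 y) / h" for h y
  \<comment> \<open>The derivative in z, taken along one fixed sequence of steps so that it is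
    measurable in y. The shift by 2 keeps z0 plus the step inside the ball.\<close>
  define D where "D y = lim (\<lambda>n. Q (of_real (r / (real n + 2))) y)" for y
  have inA: "z0 + h \<in> A" if "norm h < r" for h
    using r that by (auto simp: subset_iff dist_norm)
  have Qm: "Q h \<in> borel_measurable M" if "norm h < r" for h
    using meas[OF inA[OF that]] meas[OF z0] unfolding Q_def[abs_def] by measurable
  have small: "norm (of_real (r / (real n + 2)) :: complex) < r" for n
    using r by (subst norm_of_real) (simp add: divide_less_eq)
  have Dm: "D \<in> borel_measurable M"
    unfolding D_def by (rule borel_measurable_lim_metric) (rule Qm[OF small])
  have lim: "AE y in M. ((\<lambda>h. Q h y) \<longlongrightarrow> D y) (at 0)"
    using hol
  proof eventually_elim
    case (elim y)
    then have "((\<lambda>z. f z y) has_field_derivative deriv (\<lambda>z. f z y) z0) (at z0)"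
      using A z0 by (intro holomorphic_derivI)
    then have *: "((\<lambda>h. Q h y) \<longlongrightarrow> deriv (\<lambda>z. f z y) z0) (at 0)"
      unfolding DERIV_def Q_def .
    have "(\<lambda>n. of_real (r / (real n + 2)) :: complex) \<longlonglongrightarrow> of_real 0"
      by (intro tendsto_of_real) real_asymp
    moreover have "of_real (r / (real n + 2)) \<noteq> (0::complex)" for n
      using r unfolding of_real_eq_0_iff by simp
    ultimately have "(\<lambda>n. Q (of_real (r / (real n + 2))) y) \<longlonglongrightarrow> deriv (\<lambda>z. f z y) z0"
      using * unfolding tendsto_at_iff_sequentially by (auto simp: o_def)
    then have "D y = deriv (\<lambda>z. f z y) z0" unfolding D_def by (rule limI)
    then show ?case using * by simp
  qed
  have bnd: "AE y in M. \<forall>h. norm h < r/2 \<longrightarrow> norm (Q h y) \<le> 2 / r * g y"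
    using hol bound
  proof eventually_elim
    case (elim y)
    have gy: "0 \<le> g y" using elim(2) z0 by (meson norm_ge_zero order_trans)
    show ?case
    proof (intro allI impI)
      fix h :: complex assume h: "norm h < r/2"
      have "norm (f (z0 + h) y - f z0 y) \<le> 2 * g y / r * norm ((z0 + h) - z0)"
        using elim r h by (intro holomorphic_Lipschitz) (auto intro: holomorphic_on_subset simp: dist_norm)
      then show "norm (Q h y) \<le> 2 / r * g y"
        using gy r by (cases "h = 0") (simp_all add: Q_def norm_divide divide_le_eq)
    qed
  qed
  have "((\<lambda>h. \<integral>y. Q h y \<partial>M) \<longlongrightarrow> (\<integral>y. D y \<partial>M)) (at 0)"
    unfolding tendsto_at_iff_sequentially
  proof (intro allI impI)
    fix X assume X: "\<forall>i. X i \<in> UNIV - {0::complex}" "X \<longlonglongrightarrow> 0"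
    then have "eventually (\<lambda>n. norm (X n) < r/2) sequentially"
      using r by (metis (no_types) tendsto_norm_zero order_tendstoD(2) half_gt_zero)
    then obtain N where N: "\<And>n. n \<ge> N \<Longrightarrow> norm (X n) < r/2" by (auto simp: eventually_sequentially)
    have "(\<lambda>n. \<integral>y. Q (X (n + N)) y \<partial>M) \<longlonglongrightarrow> (\<integral>y. D y \<partial>M)"
    proof (rule integral_dominated_convergence[where w="\<lambda>y. 2 / r * g y"])
      have "norm (X (n + N)) < r" for n using N[of "n+N"] r by linarith
      then show "(\<lambda>y. Q (X (n + N)) y) \<in> borel_measurable M" for n using Qm by simp
      show "AE y in M. (\<lambda>n. Q (X (n + N)) y) \<longlonglongrightarrow> D y"
        using lim
      proof eventually_elim
        case (elim y)
        have "(\<lambda>n. Q (X n) y) \<longlonglongrightarrow> D y" using elim X unfolding tendsto_at_iff_sequentially by (auto simp: o_def)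
        then show ?case by (rule LIMSEQ_ignore_initial_segment)
      qed
      show "AE y in M. norm (Q (X (n + N)) y) \<le> 2 / r * g y" for n
        using bnd by eventually_elim (use N in auto)
    qed (use Dm g in auto)
    then show "((\<lambda>h. \<integral>y. Q h y \<partial>M) \<circ> X) \<longlonglongrightarrow> (\<integral>y. D y \<partial>M)"
      unfolding o_def by (rule LIMSEQ_offset)
  qed
  then have "((\<lambda>h. ((\<integral>y. f (z0 + h) y \<partial>M) - (\<integral>y. f z0 y \<partial>M)) / h) \<longlongrightarrow> (\<integral>y. D y \<partial>M)) (at 0)"
  proof (rule Lim_transform_eventually)
    show "\<forall>\<^sub>F h in at 0. (\<integral>y. Q h y \<partial>M) = ((\<integral>y. f (z0 + h) y \<partial>M) - (\<integral>y. f z0 y \<partial>M)) / h"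
      unfolding eventually_at using r inA int z0
      by (auto intro!: exI[of _ r] simp: Q_def[abs_def] Bochner_Integration.integral_diff)
  qed
  then show "(\<lambda>z. \<integral>y. f z y \<partial>M) field_differentiable at z0"
    unfolding field_differentiable_def DERIV_def by blast
qed

locale holomorphic_picard = majorant_kernel M \<beta> \<kappa> for M :: "'m measure" and \<beta> \<kappa> +
  fixes A :: "complex set" and b :: "complex \<Rightarrow> 'm \<Rightarrow> complex^'n" and k :: "complex \<Rightarrow> 'm \<Rightarrow> 'm \<Rightarrow> complex^'n \<Rightarrow> complex^'n \<Rightarrow> complex^'n"
  assumes A_open: "open A"
    and picard_A: "\<And>z. z \<in> A \<Longrightarrow> majorized_picard M \<beta> \<kappa> (b z) (k z)"
    and b_holomorphic: "\<And>\<xi> i. \<xi> \<in> space M \<Longrightarrow> \<beta> \<xi> < \<infinity> \<Longrightarrow> (\<lambda>z. b z \<xi> $ i) holomorphic_on A"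
    and k_holomorphic: "\<And>\<xi> \<eta> f g i. \<xi> \<in> space M \<Longrightarrow> \<beta> \<xi> < \<infinity> \<Longrightarrow> \<eta> \<in> space M \<Longrightarrow> (\<And>j. (\<lambda>z. f z $ j) holomorphic_on A)
        \<Longrightarrow> (\<And>j. (\<lambda>z. g z $ j) holomorphic_on A) \<Longrightarrow> (\<lambda>z. k z \<xi> \<eta> (f z) (g z) $ i) holomorphic_on A"
begin

text \<open>The induction hypothesis is available at \<eta> only if W \<eta> is finite. Since the
  integral of \<kappa> W W is finite at \<xi>, almost every \<eta> satisfies this or has \<kappa>
  \<xi> \<eta> = 0, where the integrand is identically 0 in z.\<close>

lemma picard_holomorphic:
  assumes "\<xi> \<in> space M" "W \<xi> < \<infinity>"
  shows "(\<lambda>z. picard M (b z) (k z) n \<xi> $ i) holomorphic_on A"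
  using assms
proof (induction n arbitrary: \<xi> i)
  case (Suc n)
  note sp = Suc.prems(1)
  have fin: "\<beta> \<xi> < \<infinity>" and fin2: "(\<integral>\<^sup>+\<eta>. \<kappa> \<xi> \<eta> * (W \<eta> * W \<eta>) \<partial>M) < \<infinity>"
    using Suc.prems(2) majorant_limit_fixed_point[OF sp] by (auto simp: less_top)
  have [measurable]: "(\<lambda>\<eta>. \<kappa> \<xi> \<eta> * (W \<eta> * W \<eta>)) \<in> borel_measurable M"
    using sp by measurable
  define g where "g \<eta> = enn2real (\<kappa> \<xi> \<eta> * (W \<eta> * W \<eta>))" for \<eta>
  have gm: "g \<in> borel_measurable M" unfolding g_def[abs_def] by measurable
  have AEfin: "AE \<eta> in M. \<kappa> \<xi> \<eta> * (W \<eta> * W \<eta>) \<noteq> \<infinity>"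
    using fin2 by (intro nn_integral_PInf_AE) auto
  have gint: "integrable M g"
  proof (rule integrableI_bounded[OF gm])
    have "(\<integral>\<^sup>+\<eta>. ennreal (norm (g \<eta>)) \<partial>M) = (\<integral>\<^sup>+\<eta>. \<kappa> \<xi> \<eta> * (W \<eta> * W \<eta>) \<partial>M)"
      using AEfin by (intro nn_integral_cong_AE) (auto simp: g_def less_top)
    then show "(\<integral>\<^sup>+\<eta>. ennreal (norm (g \<eta>)) \<partial>M) < \<infinity>" using fin2 by simp
  qed
  have bnd: "norm (k z \<xi> \<eta> (picard M (b z) (k z) n \<eta>) (picard M (b z) (k z) n \<eta>)) \<le> g \<eta>"
    if "\<kappa> \<xi> \<eta> * (W \<eta> * W \<eta>) \<noteq> \<infinity>" "\<eta> \<in> space M" "z \<in> A" for \<eta> z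
  proof -
    interpret P: majorized_picard M \<beta> \<kappa> "b z" "k z" by (rule picard_A[OF that(3)])
    have "ennreal (norm (k z \<xi> \<eta> (P.v n \<eta>) (P.v n \<eta>))) \<le> \<kappa> \<xi> \<eta> * (W \<eta> * W \<eta>)"
      using P.picard_le_majorant[OF that(2)] majorant_le_limit
      by (intro order_trans[OF P.k_bound[OF fin]] mult_mono) (auto intro: order_trans)
    also have "\<dots> = ennreal (g \<eta>)" using that(1) by (simp add: g_def less_top)
    finally show ?thesis by (simp add: g_def)
  qed
  have hol: "(\<lambda>z. \<integral>\<eta>. k z \<xi> \<eta> (picard M (b z) (k z) n \<eta>) (picard M (b z) (k z) n \<eta>) $ i \<partial>M) holomorphic_on A"
  proof (rule holomorphic_on_integral[OF A_open _ _ _ gint])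
    fix z assume z: "z \<in> A"
    interpret P: majorized_picard M \<beta> \<kappa> "b z" "k z" by (rule picard_A[OF z])
    have "(\<lambda>\<eta>. k z \<xi> \<eta> (P.v n \<eta>) (P.v n \<eta>)) \<in> borel_measurable M"
      using sp by (intro P.k_section_measurable) auto
    then show "(\<lambda>\<eta>. k z \<xi> \<eta> (P.v n \<eta>) (P.v n \<eta>) $ i) \<in> borel_measurable M"
      by (rule borel_measurable_vec_nth)
  next
    show "AE \<eta> in M. (\<lambda>z. k z \<xi> \<eta> (picard M (b z) (k z) n \<eta>) (picard M (b z) (k z) n \<eta>) $ i) holomorphic_on A"
      using AEfin AE_space
    proof eventually_elim
      case (elim \<eta>)
      show ?case
      proof (cases "\<kappa> \<xi> \<eta> = 0")
        case True
        have "k z \<xi> \<eta> x y = 0" if "z \<in> A" for z x y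
        proof -
          interpret P: majorized_picard M \<beta> \<kappa> "b z" "k z" by (rule picard_A[OF that])
          show ?thesis using P.k_bound[OF fin, of \<eta> x y] True by (simp add: ennreal_eq_0_iff)
        qed
        then show ?thesis by (subst holomorphic_cong[OF refl, where g="\<lambda>_. 0"]) auto
      next
        case False
        then have "W \<eta> < \<infinity>" using elim(1) by (auto simp: ennreal_mult_eq_top_iff less_top)
        then show ?thesis using elim(2) Suc.IH by (intro k_holomorphic[OF sp fin]) auto
      qed
    qed
    show "AE \<eta> in M. \<forall>z\<in>A. norm (k z \<xi> \<eta> (picard M (b z) (k z) n \<eta>) (picard M (b z) (k z) n \<eta>) $ i) \<le> g \<eta>"
      using AEfin AE_space
    proof eventually_elim
      case (elim \<eta>)
      show ?case using bnd[OF elim] Finite_Cartesian_Product.norm_nth_le by (blast intro: order_trans)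
    qed
  qed
  have "(\<lambda>z. b z \<xi> $ i - (\<integral>\<eta>. k z \<xi> \<eta> (picard M (b z) (k z) n \<eta>) (picard M (b z) (k z) n \<eta>) $ i \<partial>M)) holomorphic_on A"
    by (intro holomorphic_on_diff b_holomorphic hol sp fin)
  moreover have "picard M (b z) (k z) (Suc n) \<xi> $ i = b z \<xi> $ i - (\<integral>\<eta>. k z \<xi> \<eta> (picard M (b z) (k z) n \<eta>) (picard M (b z) (k z) n \<eta>) $ i \<partial>M)"
    if "z \<in> A" for z
  proof -
    interpret P: majorized_picard M \<beta> \<kappa> "b z" "k z" by (rule picard_A[OF that])
    have "integrable M (\<lambda>\<eta>. k z \<xi> \<eta> (P.v n \<eta>) (P.v n \<eta>))"
    proof (rule Bochner_Integration.integrable_bound[OF gint])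
      show "AE \<eta> in M. norm (k z \<xi> \<eta> (P.v n \<eta>) (P.v n \<eta>)) \<le> norm (g \<eta>)"
        using AEfin AE_space by eventually_elim (use bnd that in \<open>fastforce simp: g_def\<close>)
    qed (use sp in \<open>auto intro!: P.k_section_measurable\<close>)
    then have "(\<integral>\<eta>. k z \<xi> \<eta> (P.v n \<eta>) (P.v n \<eta>) \<partial>M) $ i = (\<integral>\<eta>. k z \<xi> \<eta> (P.v n \<eta>) (P.v n \<eta>) $ i \<partial>M)"
      by (rule integral_bounded_linear[OF bounded_linear_vec_nth, symmetric])
    then show ?thesis by (simp add: picard.simps(2))
  qed
  ultimately show ?case by (subst holomorphic_cong[OF refl]) auto
qed simp

text \<open>The error after n iterations is at most W \<xi> - w n \<xi>, in which the parameter does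
  not occur. So the convergence is uniform in z and the limit inherits holomorphy.\<close>

lemma picard_limit_holomorphic:
  assumes "\<xi> \<in> space M" "W \<xi> < \<infinity>"
  shows "(\<lambda>z. picard_limit M (b z) (k z) \<xi> $ i) holomorphic_on A"
proof (rule holomorphic_uniform_sequence[OF A_open])
  show "(\<lambda>z. picard M (b z) (k z) n \<xi> $ i) holomorphic_on A" for n
    by (rule picard_holomorphic[OF assms])
  fix x assume "x \<in> A"
  then obtain d where d: "d > 0" "cball x d \<subseteq> A" using A_open open_contains_cball by blast
  have "uniform_limit (cball x d) (\<lambda>n z. picard M (b z) (k z) n \<xi> $ i) (\<lambda>z. picard_limit M (b z) (k z) \<xi> $ i) sequentially"
  proof (rule uniform_limitI)
    fix e :: real assume "e > 0"
    then have "eventually (\<lambda>n. dist (enn2real (w n \<xi>)) (enn2real (W \<xi>)) < e) sequentially"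
      using majorant_limit_real(1)[OF assms(2)] by (simp add: tendsto_iff)
    then show "\<forall>\<^sub>F n in sequentially. \<forall>z\<in>cball x d. dist (picard M (b z) (k z) n \<xi> $ i) (picard_limit M (b z) (k z) \<xi> $ i) < e"
    proof eventually_elim
      case (elim n)
      show ?case
      proof
        fix z assume "z \<in> cball x d"
        then have "z \<in> A" using d by auto
        then interpret P: majorized_picard M \<beta> \<kappa> "b z" "k z" by (rule picard_A)
        have "dist (P.v n \<xi> $ i) (P.V \<xi> $ i) \<le> norm (P.V \<xi> - P.v n \<xi>)"
          using Finite_Cartesian_Product.norm_nth_le[of "P.V \<xi> - P.v n \<xi>" i] by (simp add: dist_norm norm_minus_commute)
        also have "\<dots> \<le> enn2real (W \<xi>) - enn2real (w n \<xi>)"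
          by (rule P.picard_limit_diff[OF assms])
        finally show "dist (P.v n \<xi> $ i) (P.V \<xi> $ i) < e" using elim by (simp add: dist_real_def)
      qed
    qed
  qed
  then show "\<exists>d>0. cball x d \<subseteq> A \<and> uniform_limit (cball x d) (\<lambda>n z. picard M (b z) (k z) n \<xi> $ i) (\<lambda>z. picard_limit M (b z) (k z) \<xi> $ i) sequentially"
    using d by blast
qed

end

section \<open>Gaussian integrals\<close>

lemma
  fixes f :: "'n::finite \<Rightarrow> real \<Rightarrow> complex"
  assumes f: "\<And>i. integrable lborel (f i)"
  shows integrable_lborel_prod_vec: "integrable lborel (\<lambda>x::real^'n. \<Prod>i\<in>UNIV. f i (x $ i))"
    and integral_lborel_prod_vec: "(\<integral>x. (\<Prod>i\<in>UNIV. f i ((x::real^'n) $ i)) \<partial>lborel) = (\<Prod>i\<in>UNIV. \<integral>t. f i t \<partial>lborel)"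
proof -
  interpret product_sigma_finite "\<lambda>b::real^'n. lborel :: real measure"
    by standard
  have [measurable]: "f i \<in> borel_measurable borel" for i
    using f[of i] by (simp add: integrable_iff_bounded)
  \<comment> \<open>Lebesgue measure is a product over the basis vectors, while the factors are
    indexed by coordinates; \<open>g\<close> translates one index set into the other.\<close>
  define g where "g b = f (THE i. b = axis i 1)" for b :: "real^'n"
  have g: "g (axis i 1) = f i" for i
    by (simp add: g_def axis_eq_axis)
  have B: "Basis = (\<lambda>i. axis i 1 :: real^'n) ` UNIV"
    by (auto simp: Basis_vec_def)
  have inj: "inj (\<lambda>i. axis i 1 :: real^'n)"
    by (auto simp: inj_on_def axis_eq_axis)
  have ig: "integrable lborel (g b)" if "b \<in> Basis" for b
    using that f g by (auto simp: B)
  have nth: "(\<Sum>b\<in>Basis. h b *\<^sub>R b) $ i = h (axis i 1)" for h :: "real^'n \<Rightarrow> real" and i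
  proof -
    have "(\<Sum>b\<in>Basis. h b *\<^sub>R b) $ i = (\<Sum>b\<in>Basis. h b *\<^sub>R b) \<bullet> axis i 1" by (simp add: inner_axis)
    also have "\<dots> = h (axis i 1)" by (subst inner_sum_left_Basis) (auto simp: B)
    finally show ?thesis .
  qed
  have eq: "(\<Prod>i\<in>UNIV. f i ((\<Sum>b\<in>Basis. h b *\<^sub>R b) $ i)) = (\<Prod>b\<in>Basis. g b (h b))" for h :: "real^'n \<Rightarrow> real"
    unfolding nth by (subst B, subst prod.reindex[OF inj]) (simp add: g)
  have [measurable]: "(\<lambda>h. \<Sum>b\<in>Basis. h b *\<^sub>R b) \<in> (\<Pi>\<^sub>M b\<in>(Basis :: (real^'n) set). lborel) \<rightarrow>\<^sub>M borel"
    by measurable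
  have m[measurable]: "(\<lambda>x. \<Prod>i\<in>UNIV. f i ((x::real^'n) $ i)) \<in> borel_measurable borel"
    by measurable
  show "integrable lborel (\<lambda>x::real^'n. \<Prod>i\<in>UNIV. f i (x $ i))"
    unfolding lborel_eq[where 'a="real^'n"]
    by (subst integrable_distr_eq) (measurable, unfold eq, intro product_integrable_prod ig, auto)
  have "(\<integral>x. (\<Prod>i\<in>UNIV. f i ((x::real^'n) $ i)) \<partial>lborel) = (\<integral>h. (\<Prod>b\<in>Basis. g b (h b)) \<partial>(\<Pi>\<^sub>M b\<in>(Basis :: (real^'n) set). lborel))"
    unfolding lborel_eq[where 'a="real^'n"] by (subst integral_distr) (measurable, unfold eq, rule refl)
  also have "\<dots> = (\<Prod>b\<in>Basis. \<integral>t. g b t \<partial>lborel)"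
    by (intro product_integral_prod ig) auto
  also have "\<dots> = (\<Prod>i\<in>UNIV. \<integral>t. f i t \<partial>lborel)"
    unfolding B by (subst prod.reindex[OF inj]) (simp add: g)
  finally show "(\<integral>x. (\<Prod>i\<in>UNIV. f i ((x::real^'n) $ i)) \<partial>lborel) = (\<Prod>i\<in>UNIV. \<integral>t. f i t \<partial>lborel)" .
qed

lemma integral_derivative_zero:
  fixes F f :: "real \<Rightarrow> complex"
  assumes "\<And>x. (F has_vector_derivative f x) (at x)" "\<And>x. isCont f x" "integrable lborel f"
    and "(F \<longlongrightarrow> 0) at_top" "(F \<longlongrightarrow> 0) at_bot"
  shows "(\<integral>x. f x \<partial>lborel) = 0"
proof -
  have "(LBINT x=-\<infinity>..\<infinity>. f x) = 0 - 0"
    by (rule interval_integral_FTC_integrable[where F=F])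
       (use assms in \<open>auto simp: ereal_tendsto_simps set_integrable_def einterval_def\<close>)
  then show ?thesis
    by (simp add: interval_lebesgue_integral_def set_lebesgue_integral_def einterval_def)
qed

definition gauss_osc :: "real \<Rightarrow> real \<Rightarrow> real \<Rightarrow> complex" where
  "gauss_osc l x t = cis (x * t) * of_real (exp (- l * t\<^sup>2))"

lemma gauss_osc_exp: "gauss_osc l x t = exp (\<i> * of_real x * of_real t - of_real l * (of_real t)\<^sup>2)"
  by (simp add: gauss_osc_def cis_conv_exp exp_diff exp_minus field_simps flip: exp_of_real)

lemma isCont_gauss_osc [continuous_intros]: "isCont (gauss_osc l x) t"
  unfolding gauss_osc_exp[abs_def] by (intro continuous_intros)

lemma gauss_osc_measurable [measurable]: "gauss_osc l x \<in> borel_measurable borel"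
  by (intro borel_measurable_continuous_onI continuous_at_imp_continuous_on ballI isCont_gauss_osc)

lemma integrable_gauss_osc:
  assumes "l > 0" shows "integrable lborel (\<lambda>t. of_real t ^ m * gauss_osc l x t)"
proof (rule Bochner_Integration.integrable_bound)
  define s where "s = 1 / sqrt (2 * l)"
  have s: "s > 0" "2 * s\<^sup>2 = 1 / l" using assms by (auto simp: s_def power_divide)
  have "integrable lborel (\<lambda>t. sqrt (2 * pi * s\<^sup>2) * (normal_density 0 s t * \<bar>t - 0\<bar>^m))"
    by (intro integrable_mult_right integrable_normal_moment_abs s)
  moreover have "sqrt (2 * pi * s\<^sup>2) * (normal_density 0 s t * \<bar>t - 0\<bar>^m) = \<bar>t\<bar>^m * exp (- l * t\<^sup>2)" for t
    using s assms by (simp add: normal_density_def real_sqrt_mult)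
  ultimately show "integrable lborel (\<lambda>t. \<bar>t\<bar>^m * exp (- l * t\<^sup>2))" by (simp only:)
qed (simp, auto simp: gauss_osc_def norm_mult norm_power)

text \<open>The characteristic function of the standard normal distribution at x / sqrt (2 l), after
  the substitution of sqrt (2 l) t for the variable.\<close>

lemma integral_gauss_osc_0:
  assumes "l > 0" shows "(\<integral>t. gauss_osc l x t \<partial>lborel) = of_real (sqrt (pi / l) * exp (- x\<^sup>2 / (4 * l)))"
proof -
  define c where "c = sqrt (2 * l)"
  have c: "c > 0" "c\<^sup>2 = 2 * l" using assms by (auto simp: c_def)
  define t where "t = x / c"
  have "of_real (exp (- (t^2) / 2)) = char std_normal_distribution t"
    by (simp add: char_std_normal_distribution)
  also have "\<dots> = (\<integral>y. std_normal_density y *\<^sub>R iexp (t * y) \<partial>lborel)"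
    unfolding char_def by (subst integral_density) auto
  also have "\<dots> = \<bar>c\<bar> *\<^sub>R (\<integral>y. std_normal_density (0 + c * y) *\<^sub>R iexp (t * (0 + c * y)) \<partial>lborel)"
    using c by (intro lborel_integral_real_affine) auto
  also have "(\<lambda>y. std_normal_density (0 + c * y) *\<^sub>R iexp (t * (0 + c * y))) = (\<lambda>y. of_real (1 / sqrt (2 * pi)) * gauss_osc l x y)"
    using c by (auto simp: fun_eq_iff std_normal_density_def gauss_osc_def power_mult_distrib t_def cis_conv_exp scaleR_conv_of_real)
  finally have "of_real (exp (- (t^2) / 2)) = of_real (c / sqrt (2 * pi)) * (\<integral>y. gauss_osc l x y \<partial>lborel)"
    using c by (simp add: scaleR_conv_of_real)
  moreover have t: "- (t^2) / 2 = - x\<^sup>2 / (4 * l)" using c by (simp add: t_def power_divide)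
  ultimately have "of_real (sqrt (pi / l) * (c / sqrt (2 * pi))) * (\<integral>y. gauss_osc l x y \<partial>lborel) = of_real (sqrt (pi / l) * exp (- x\<^sup>2 / (4 * l)))"
    by (simp only: of_real_mult mult.assoc)
  moreover have "sqrt (pi / l) * (c / sqrt (2 * pi)) = 1"
    using assms by (simp add: c_def real_sqrt_mult real_sqrt_divide)
  ultimately show ?thesis by (simp only: of_real_1 mult_1_left)
qed

lemma gauss_osc_derivative:
  "((\<lambda>t. of_real t ^ n * gauss_osc l x t) has_vector_derivative
     (of_nat n * of_real t ^ (n - 1) + of_real t ^ n * (\<i> * of_real x - 2 * of_real l * of_real t)) * gauss_osc l x t) (at t)"
  unfolding gauss_osc_exp
  by (rule has_vector_derivative_real_field[where f="\<lambda>z. z ^ n * exp (\<i> * of_real x * z - of_real l * z\<^sup>2)"])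
     (auto intro!: derivative_eq_intros simp: algebra_simps)

lemma gauss_osc_tendsto:
  assumes "l > 0" "n \<le> 1"
  shows "((\<lambda>t. of_real t ^ n * gauss_osc l x t) \<longlongrightarrow> 0) at_top" "((\<lambda>t. of_real t ^ n * gauss_osc l x t) \<longlongrightarrow> 0) at_bot"
proof -
  consider "n = 0" | "n = 1" using assms by linarith
  then have "((\<lambda>t. \<bar>t\<bar> ^ n * exp (- l * t\<^sup>2)) \<longlongrightarrow> 0) at_top \<and> ((\<lambda>t. \<bar>t\<bar> ^ n * exp (- l * t\<^sup>2)) \<longlongrightarrow> 0) at_bot"
  proof cases
    case 1 then show ?thesis using assms(1) by (intro conjI; simp; real_asymp)
  next
    case 2 then show ?thesis using assms(1) by (intro conjI; simp; real_asymp)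
  qed
  then show "((\<lambda>t. of_real t ^ n * gauss_osc l x t) \<longlongrightarrow> 0) at_top" "((\<lambda>t. of_real t ^ n * gauss_osc l x t) \<longlongrightarrow> 0) at_bot"
    by (rule_tac [!] tendsto_norm_zero_cancel) (simp_all add: gauss_osc_def norm_mult norm_power)
qed

text \<open>The ratio of the m-th to the zeroth moment of \<open>gauss_osc l x\<close>. It is meant
  for m \<le> 2; the last branch does not distinguish larger m.\<close>

definition gauss_coeff :: "real \<Rightarrow> nat \<Rightarrow> real \<Rightarrow> complex" where
  "gauss_coeff l m x = (if m = 0 then 1 else if m = 1 then \<i> * of_real x / of_real (2 * l)
     else of_real (1 / (2 * l) - x\<^sup>2 / (4 * l\<^sup>2)))"

text \<open>The derivative of \<open>of_real t ^ n * gauss_osc l x t\<close> has integral 0. For n =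
  0 and n = 1 this gives two linear relations, which express the first and second moments through
  the zeroth.\<close>

lemma integral_gauss_osc:
  assumes l: "l > 0" and "m \<le> 2"
  shows "(\<integral>t. of_real t ^ m * gauss_osc l x t \<partial>lborel) = gauss_coeff l m x * of_real (sqrt (pi / l) * exp (- x\<^sup>2 / (4 * l)))"
proof -
  define I where "I m = (\<integral>t. of_real t ^ m * gauss_osc l x t \<partial>lborel)" for m
  have int: "integrable lborel (\<lambda>t. of_real t ^ m * gauss_osc l x t)" for m
    by (rule integrable_gauss_osc[OF l])
  have 0: "(\<integral>t. (of_nat n * of_real t ^ (n - 1) + of_real t ^ n * (\<i> * of_real x - 2 * of_real l * of_real t)) * gauss_osc l x t \<partial>lborel) = 0"
    if "n \<le> 1" for n
  proof (rule integral_derivative_zero)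
    have "integrable lborel (\<lambda>t. of_nat n * (of_real t ^ (n - 1) * gauss_osc l x t) + \<i> * of_real x * (of_real t ^ n * gauss_osc l x t)
       - 2 * of_real l * (of_real t ^ Suc n * gauss_osc l x t))"
      by (intro Bochner_Integration.integrable_add Bochner_Integration.integrable_diff integrable_mult_right int)
    then show "integrable lborel (\<lambda>t. (of_nat n * of_real t ^ (n - 1) + of_real t ^ n * (\<i> * of_real x - 2 * of_real l * of_real t)) * gauss_osc l x t)"
      by (rule back_subst[of "integrable lborel"]) (auto simp: fun_eq_iff algebra_simps)
    show "isCont (\<lambda>t. (of_nat n * of_real t ^ (n - 1) + of_real t ^ n * (\<i> * of_real x - 2 * of_real l * of_real t)) * gauss_osc l x t) t" for t
      unfolding gauss_osc_exp by (intro continuous_intros)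
  qed (use gauss_osc_derivative gauss_osc_tendsto[OF l that] in auto)
  have "(\<lambda>t. (of_nat 0 * of_real t ^ (0 - 1) + of_real t ^ 0 * (\<i> * of_real x - 2 * of_real l * of_real t)) * gauss_osc l x t)
     = (\<lambda>t. \<i> * of_real x * (of_real t ^ 0 * gauss_osc l x t) - 2 * of_real l * (of_real t ^ 1 * gauss_osc l x t))"
    by (auto simp: fun_eq_iff algebra_simps)
  then have "(\<integral>t. \<i> * of_real x * (of_real t ^ 0 * gauss_osc l x t) - 2 * of_real l * (of_real t ^ 1 * gauss_osc l x t) \<partial>lborel) = 0"
    using 0[of 0] by simp
  then have I1: "\<i> * of_real x * I 0 - 2 * of_real l * I 1 = 0"
    using Bochner_Integration.integral_diff[OF integrable_mult_right[OF int[of 0], of "\<i> * of_real x"] integrable_mult_right[OF int[of 1], of "2 * of_real l"]]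
    unfolding I_def by (simp only: integral_mult_right_zero)
  have "(\<lambda>t. (of_nat 1 * of_real t ^ (1 - 1) + of_real t ^ 1 * (\<i> * of_real x - 2 * of_real l * of_real t)) * gauss_osc l x t)
     = (\<lambda>t. (of_real t ^ 0 * gauss_osc l x t + \<i> * of_real x * (of_real t ^ 1 * gauss_osc l x t)) - 2 * of_real l * (of_real t ^ 2 * gauss_osc l x t))"
    by (auto simp: fun_eq_iff algebra_simps power2_eq_square)
  then have "(\<integral>t. (of_real t ^ 0 * gauss_osc l x t + \<i> * of_real x * (of_real t ^ 1 * gauss_osc l x t)) - 2 * of_real l * (of_real t ^ 2 * gauss_osc l x t) \<partial>lborel) = 0"
    using 0[of 1] by simp
  then have I2: "I 0 + \<i> * of_real x * I 1 - 2 * of_real l * I 2 = 0"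
    using Bochner_Integration.integral_diff[OF Bochner_Integration.integrable_add[OF int[of 0] integrable_mult_right[OF int[of 1], of "\<i> * of_real x"]] integrable_mult_right[OF int[of 2], of "2 * of_real l"]]
      Bochner_Integration.integral_add[OF int[of 0] integrable_mult_right[OF int[of 1], of "\<i> * of_real x"]]
    unfolding I_def by (simp only: integral_mult_right_zero)
  have I0: "I 0 = of_real (sqrt (pi / l) * exp (- x\<^sup>2 / (4 * l)))"
    using integral_gauss_osc_0[OF l, of x] by (simp add: I_def)
  have I1': "I 1 = (\<i> * of_real x / of_real (2 * l)) * I 0"
    using I1 l by (simp add: field_simps)
  have I2': "I 2 = of_real (1 / (2 * l) - x\<^sup>2 / (4 * l\<^sup>2)) * I 0"
    using I2 l unfolding I1' by (simp add: field_simps power2_eq_square)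
  consider "m = 0" | "m = 1" | "m = 2" using assms by linarith
  then show ?thesis
  proof cases
    case 1 then show ?thesis using I0 by (simp add: I_def gauss_coeff_def)
  next
    case 2 then show ?thesis using I1' unfolding I0 by (simp add: I_def gauss_coeff_def)
  next
    case 3 then show ?thesis using I2' unfolding I0 by (simp add: I_def gauss_coeff_def)
  qed
qed

text \<open>For even m = 2 n this is the Boys function F_n, an entire relative of the incomplete
  Gamma function. The type is left open so that one definition serves the real kernels and their
  complex continuations.\<close>

definition gauss_moment :: "nat \<Rightarrow> 'a \<Rightarrow> 'a::{banach, real_normed_field}" where
  "gauss_moment m u = integral (cbox 0 1) (\<lambda>t::real. of_real t ^ m * exp (- u * of_real (t\<^sup>2)))"

lemma gauss_moment_continuous_integrand:
  "continuous_on S (\<lambda>t::real. of_real t ^ m * exp (- (u::'a::{banach, real_normed_field}) * of_real (t\<^sup>2)))"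
  by (intro continuous_intros)

lemma gauss_moment_integrable:
  "(\<lambda>t::real. of_real t ^ m * exp (- (u::'a::{banach, real_normed_field}) * of_real (t\<^sup>2))) integrable_on cbox 0 1"
  by (intro integrable_continuous gauss_moment_continuous_integrand)

lemma gauss_moment_derivative:
  "(gauss_moment m has_field_derivative - gauss_moment (m + 2) u) (at (u::'a::{banach, real_normed_field}))"
proof -
  have "((\<lambda>u. integral (cbox 0 1) (\<lambda>t::real. of_real t ^ m * exp (- u * of_real (t\<^sup>2)))) has_field_derivative
     integral (cbox 0 1) (\<lambda>t. of_real t ^ m * (exp (- u * of_real (t\<^sup>2)) * (- of_real (t\<^sup>2))))) (at (u::'a) within UNIV)"
  proof (rule leibniz_rule_field_derivative)
    show "((\<lambda>u::'a. of_real t ^ m * exp (- u * of_real (t\<^sup>2))) has_field_derivative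
       of_real t ^ m * (exp (- u * of_real (t\<^sup>2)) * (- of_real (t\<^sup>2)))) (at u within UNIV)" for u and t :: real
      by (auto intro!: derivative_eq_intros)
    show "continuous_on (UNIV \<times> cbox (0::real) 1) (\<lambda>(x::'a, t). of_real t ^ m * (exp (- x * of_real (t\<^sup>2)) * (- of_real (t\<^sup>2))))"
      unfolding split_beta by (intro continuous_intros)
  qed (use gauss_moment_integrable in blast, auto)
  moreover have "(\<lambda>t::real. of_real t ^ m * (exp (- u * of_real (t\<^sup>2)) * (- of_real (t\<^sup>2)))) =
      (\<lambda>t. - (of_real t ^ (m + 2) * exp (- u * of_real (t\<^sup>2))))"
    by (auto simp: fun_eq_iff power_add power2_eq_square)
  ultimately show ?thesis
    unfolding gauss_moment_def[abs_def] by (simp only: integral_neg)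
qed

text \<open>Integrate the derivative of \<open>t ^ (m + 1) * exp (- u * t\<^sup>2)\<close> over
  [0, 1].\<close>

lemma gauss_moment_recurrence:
  "of_nat (m + 1) * gauss_moment m u - 2 * u * gauss_moment (m + 2) u = exp (- (u::'a::{banach, real_normed_field,euclidean_space}))"
proof -
  let ?F = "\<lambda>t::real. of_real t ^ (m + 1) * exp (- u * of_real (t\<^sup>2))"
  let ?f = "\<lambda>m. \<lambda>t::real. of_real t ^ m * exp (- u * of_real (t\<^sup>2))"
  have "((\<lambda>t. of_nat (m + 1) * ?f m t - 2 * u * ?f (m + 2) t) has_integral ?F 1 - ?F 0) {0..1}"
  proof (rule fundamental_theorem_of_calculus)
    fix t :: real
    have "((\<lambda>z. z ^ (m + 1) * exp (- u * z\<^sup>2)) has_field_derivative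
       of_nat (m + 1) * (z ^ m * exp (- u * z\<^sup>2)) - 2 * u * (z ^ (m + 2) * exp (- u * z\<^sup>2))) (at z)" for z
    proof -
      have 1: "((\<lambda>z. z ^ Suc m) has_field_derivative of_nat (Suc m) * z ^ m) (at z)"
        using DERIV_power[OF DERIV_ident[of "at z"], of "Suc m"] by simp
      have 2: "((\<lambda>z. exp (- u * z\<^sup>2)) has_field_derivative exp (- u * z\<^sup>2) * (- u * (2 * z))) (at z)"
        by (auto intro!: derivative_eq_intros)
      show ?thesis using DERIV_mult[OF 1 2]
        by (rule DERIV_cong_ev[THEN iffD1, rotated -1]) (auto simp: power2_eq_square algebra_simps)
    qed
    from has_vector_derivative_real_field[OF this]
    show "(?F has_vector_derivative of_nat (m + 1) * ?f m t - 2 * u * ?f (m + 2) t) (at t within {0..1})"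
      by simp
  qed simp
  then have "integral {0..1} (\<lambda>t. of_nat (m + 1) * ?f m t - 2 * u * ?f (m + 2) t) = exp (- u)"
    by (simp add: integral_unique)
  moreover have i: "(?f m) integrable_on {0..1}" for m
    using gauss_moment_integrable[of m u] by simp
  have "integral {0..1} (\<lambda>t. of_nat (m + 1) * ?f m t - 2 * u * ?f (m + 2) t) =
    integral {0..1} (\<lambda>t. of_nat (m + 1) * ?f m t) - integral {0..1} (\<lambda>t. 2 * u * ?f (m + 2) t)"
    by (intro Henstock_Kurzweil_Integration.integral_diff integrable_on_mult_right i)
  ultimately show ?thesis
    by (simp add: gauss_moment_def)
qed

lemma gauss_moment_of_real: "gauss_moment m (of_real u) = (of_real (gauss_moment m u) :: 'a::{banach, real_normed_field})"
proof -
  have "integral (cbox 0 1) ((of_real :: real \<Rightarrow> 'a) \<circ> (\<lambda>t. t ^ m * exp (- u * t\<^sup>2))) = of_real (integral (cbox 0 1) (\<lambda>t. t ^ m * exp (- u * t\<^sup>2)))"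
    using gauss_moment_integrable[of m u] by (intro integral_linear bounded_linear_of_real) simp
  moreover have "(of_real \<circ> (\<lambda>t. t ^ m * exp (- u * t\<^sup>2))) = (\<lambda>t::real. of_real t ^ m * exp (- of_real u * of_real (t\<^sup>2)) :: 'a)"
    by (auto simp: fun_eq_iff simp flip: exp_of_real)
  ultimately show ?thesis by (simp add: gauss_moment_def del: cbox_interval of_real_power)
qed

lemma gauss_moment_field_derivative [derivative_intros]:
  assumes "(f has_field_derivative f') (at x within S)"
  shows "((\<lambda>x. gauss_moment m (f x)) has_field_derivative - gauss_moment (m + 2) (f x) * f') (at x within S)"
  using DERIV_chain2[OF gauss_moment_derivative assms] .

lemma gauss_moment_has_derivative [derivative_intros]:
  fixes f :: "'b::real_normed_vector \<Rightarrow> real"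
  assumes "(f has_derivative f') (at x within S)"
  shows "((\<lambda>x. gauss_moment m (f x)) has_derivative (\<lambda>h. f' h * - gauss_moment (m + 2) (f x))) (at x within S)"
  using DERIV_compose_FDERIV[OF gauss_moment_derivative assms] .

lemma continuous_on_gauss_moment [continuous_intros]:
  fixes f :: "'b::topological_space \<Rightarrow> 'a::{banach, real_normed_field}"
  assumes "continuous_on S f"
  shows "continuous_on S (\<lambda>x. gauss_moment m (f x))"
proof -
  have "continuous_on UNIV (gauss_moment m :: 'a \<Rightarrow> 'a)"
    by (intro continuous_at_imp_continuous_on ballI DERIV_isCont[OF gauss_moment_derivative])
  from continuous_on_compose2[OF this assms] show ?thesis by simp
qed

lemma gauss_moment_holomorphic [holomorphic_intros]:
  assumes "f holomorphic_on A" shows "(\<lambda>z. gauss_moment m (f z)) holomorphic_on A"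
proof -
  have "gauss_moment m holomorphic_on UNIV"
    by (auto simp: holomorphic_on_open intro: gauss_moment_derivative)
  from holomorphic_on_compose_gen[OF assms this] show ?thesis by (simp add: o_def)
qed

lemma gauss_moment_measurable [measurable (raw)]:
  fixes f :: "'b \<Rightarrow> 'a::{banach, real_normed_field, second_countable_topology}"
  assumes "f \<in> borel_measurable M" shows "(\<lambda>x. gauss_moment m (f x)) \<in> borel_measurable M"
  by (rule measurable_compose[OF assms borel_measurable_continuous_onI]) (intro continuous_intros)

text \<open>As \<open>t\<^sup>2\<close> is at most 1 on the range of integration, losing c in the
  real part of u costs no more than the factor exp c.\<close>

lemma norm_gauss_moment_le:
  fixes u :: complex
  assumes "Re u \<ge> a - c" "c \<ge> 0"
  shows "norm (gauss_moment m u) \<le> exp c * gauss_moment m a"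
proof -
  have "norm (gauss_moment m u) \<le> integral (cbox 0 1) (\<lambda>t::real. exp c * (t ^ m * exp (- a * t\<^sup>2)))"
    unfolding gauss_moment_def
  proof (rule integral_norm_bound_integral[OF gauss_moment_integrable])
    show "(\<lambda>t::real. exp c * (t ^ m * exp (- a * t\<^sup>2))) integrable_on cbox 0 1"
      by (intro integrable_continuous continuous_intros)
    fix t :: real assume t: "t \<in> cbox 0 1"
    then have t2: "0 \<le> t\<^sup>2" "t\<^sup>2 \<le> 1" by (auto simp: power_le_one)
    have "(a - c) * t\<^sup>2 \<le> Re u * t\<^sup>2" using assms t2 by (intro mult_right_mono) auto
    moreover have "c * t\<^sup>2 \<le> c * 1" using assms t2 by (intro mult_left_mono) auto
    ultimately have "- (Re u * t\<^sup>2) \<le> c + - a * t\<^sup>2" by (simp add: algebra_simps)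
    then have "exp (- (Re u * t\<^sup>2)) \<le> exp c * exp (- a * t\<^sup>2)" by (simp flip: exp_add)
    then have "t ^ m * exp (- (Re u * t\<^sup>2)) \<le> t ^ m * (exp c * exp (- a * t\<^sup>2))"
      using t by (intro mult_left_mono) auto
    then show "norm (of_real t ^ m * exp (- u * of_real (t\<^sup>2))) \<le> exp c * (t ^ m * exp (- a * t\<^sup>2))"
      using t by (simp add: norm_mult norm_power algebra_simps)
  qed
  then show ?thesis by (simp add: gauss_moment_def)
qed

text \<open>From exp v \<ge> (1 + v / n)^n \<ge> ((1 + v) / n)^n.\<close>

lemma exp_minus_le_powr:
  fixes v :: real assumes "v \<ge> 0" "k \<ge> 0" "k \<le> real n" "n > 0"
  shows "exp (- v) \<le> real n ^ n * (1 + v) powr - k"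
proof -
  have "(1 + v) / real n \<le> 1 + v / real n" using assms by (simp add: add_divide_distrib)
  then have "((1 + v) / real n) ^ n \<le> (1 + v / real n) ^ n" using assms by (intro power_mono) auto
  also have "\<dots> \<le> exp v" using assms by (intro exp_ge_one_plus_x_over_n_power_n) auto
  finally have "(1 + v) powr real n \<le> real n ^ n * exp v" using assms
    by (simp add: power_divide divide_le_eq powr_realpow mult.commute)
  moreover have "(1 + v) powr k \<le> (1 + v) powr real n" using assms by (intro powr_mono) auto
  ultimately have "(1 + v) powr k \<le> real n ^ n * exp v" by linarith
  then show ?thesis using assms by (simp add: powr_minus exp_minus divide_simps)
qed

text \<open>The rate is the one given by the scaling t / sqrt a. The exponential is replaced by a
  multiple of \<open>(1 + a * t\<^sup>2) powr - ((real m + 3) / 2)\<close>, chosen because its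
  product with \<open>t ^ m\<close> has the explicit antiderivative \<open>?G\<close>.\<close>

lemma gauss_moment_decay:
  fixes a :: real assumes "a \<ge> 0"
  shows "gauss_moment m a \<le> real (m + 4) ^ (m + 4) * (1 + a) powr - ((real m + 1) / 2)"
proof -
  let ?C = "real (m + 4) ^ (m + 4)"
  let ?G = "\<lambda>t::real. t ^ (m + 1) * (1 + a * t\<^sup>2) powr - ((real m + 1) / 2) / (real m + 1)"
  have pos: "1 + a * t\<^sup>2 > 0" for t using assms by (smt (verit) mult_nonneg_nonneg zero_le_power2)
  have int: "((\<lambda>t. t ^ m * (1 + a * t\<^sup>2) powr - ((real m + 3) / 2)) has_integral ?G 1 - ?G 0) {0..1}"
  proof (rule fundamental_theorem_of_calculus)
    fix t :: real
    have e: "(1 + a * t\<^sup>2) powr - ((real m + 1) / 2) = (1 + a * t\<^sup>2) * (1 + a * t\<^sup>2) powr - ((real m + 3) / 2)"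
    proof -
      have "1 + - ((real m + 3) / 2) = - ((real m + 1) / 2)" by (simp add: field_simps)
      then show ?thesis using powr_mult_base[of "1 + a * t\<^sup>2" "- ((real m + 3) / 2)"] pos[of t] by simp
    qed
    have e2: "(1 + a * t\<^sup>2) powr (- ((real m + 1) / 2) - 1) = (1 + a * t\<^sup>2) powr - ((real m + 3) / 2)"
      by (rule arg_cong[where f="\<lambda>x. _ powr x"]) (simp add: field_simps)
    have "(?G has_real_derivative (((real m + 1) * t ^ m) * (1 + a * t\<^sup>2) powr - ((real m + 1) / 2)
        + t ^ (m + 1) * (- ((real m + 1) / 2) * (1 + a * t\<^sup>2) powr (- ((real m + 1) / 2) - 1) * (2 * a * t))) / (real m + 1)) (at t within {0..1})"
    proof -
      have 1: "((\<lambda>t. t ^ Suc m) has_real_derivative of_nat (Suc m) * t ^ m) (at t within {0..1})"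
        using DERIV_power[OF DERIV_ident[of "at t within {0..1}"], of "Suc m"] by simp
      have 2: "((\<lambda>t. (1 + a * t\<^sup>2) powr - ((real m + 1) / 2)) has_real_derivative
          - ((real m + 1) / 2) * (1 + a * t\<^sup>2) powr (- ((real m + 1) / 2) - 1) * (2 * a * t)) (at t within {0..1})"
        using pos[of t] by (auto intro!: derivative_eq_intros)
      show ?thesis using DERIV_cdivide[OF DERIV_mult[OF 1 2], of "real m + 1"] by (simp add: mult_ac add_ac)
    qed
    moreover have alg: "(((real m + 1) * t ^ m) * ((1 + a * t\<^sup>2) * P)
        + t ^ (m + 1) * (- ((real m + 1) / 2) * P * (2 * a * t))) / (real m + 1) = t ^ m * P" for P
    proof -
      have "((real m + 1) * t ^ m) * ((1 + a * t\<^sup>2) * P)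
        + t ^ (m + 1) * (- ((real m + 1) / 2) * P * (2 * a * t)) = (real m + 1) * (t ^ m * P)"
        by (simp add: algebra_simps power2_eq_square)
      then show ?thesis by simp
    qed
    have "(((real m + 1) * t ^ m) * (1 + a * t\<^sup>2) powr - ((real m + 1) / 2)
        + t ^ (m + 1) * (- ((real m + 1) / 2) * (1 + a * t\<^sup>2) powr (- ((real m + 1) / 2) - 1) * (2 * a * t))) / (real m + 1)
       = t ^ m * (1 + a * t\<^sup>2) powr - ((real m + 3) / 2)"
      unfolding e e2 by (rule alg)
    ultimately show "(?G has_vector_derivative t ^ m * (1 + a * t\<^sup>2) powr - ((real m + 3) / 2)) (at t within {0..1})"
      by (simp add: has_real_derivative_iff_has_vector_derivative)
  qed simp
  have "gauss_moment m a \<le> integral {0..1} (\<lambda>t. ?C * (t ^ m * (1 + a * t\<^sup>2) powr - ((real m + 3) / 2)))"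
    unfolding gauss_moment_def cbox_interval
  proof (rule integral_le)
    show "(\<lambda>t::real. of_real t ^ m * exp (- a * of_real (t\<^sup>2))) integrable_on {0..1}"
      using gauss_moment_integrable[of m a] by simp
    show "(\<lambda>t. ?C * (t ^ m * (1 + a * t\<^sup>2) powr - ((real m + 3) / 2))) integrable_on {0..1}"
      using int by (intro integrable_on_mult_right) blast
    fix t :: real assume t: "t \<in> {0..1}"
    have "exp (- (a * t\<^sup>2)) \<le> ?C * (1 + a * t\<^sup>2) powr - ((real m + 3) / 2)"
      using assms by (intro exp_minus_le_powr) auto
    then have "t ^ m * exp (- (a * t\<^sup>2)) \<le> t ^ m * (?C * (1 + a * t\<^sup>2) powr - ((real m + 3) / 2))"
      using t by (intro mult_left_mono) auto
    then show "of_real t ^ m * exp (- a * of_real (t\<^sup>2)) \<le> ?C * (t ^ m * (1 + a * t\<^sup>2) powr - ((real m + 3) / 2))"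
      by (simp add: mult_ac)
  qed
  also have "\<dots> = ?C * ((1 + a) powr - ((real m + 1) / 2) / (real m + 1))"
    using int by (simp add: integral_unique)
  also have "\<dots> \<le> ?C * (1 + a) powr - ((real m + 1) / 2)"
    by (intro mult_left_mono) (auto simp: divide_le_eq mult_le_cancel_left1)
  finally show ?thesis .
qed

section \<open>The kernel of the projected heat semigroup\<close>

lemma gauss_osc_prod:
  fixes x \<xi> :: "real^3"
  shows "(\<Prod>i\<in>UNIV. gauss_osc l (x $ i) (\<xi> $ i)) = cis (x \<bullet> \<xi>) * of_real (exp (- l * (norm \<xi>)\<^sup>2))"
  unfolding gauss_osc_exp power2_norm_eq_inner inner_vec_def UNIV_3
  by (simp add: cis_conv_exp power2_eq_square algebra_simps flip: exp_of_real exp_add)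

lemma norm_vec3: "(norm (x::real^3))\<^sup>2 = (\<Sum>i\<in>UNIV. (x $ i)\<^sup>2)"
  unfolding power2_norm_eq_inner inner_vec_def by (simp add: power2_eq_square)

lemma
  fixes x :: "real^3"
  assumes l: "l > 0" and m: "\<And>i. m i \<le> 2"
  shows integrable_gauss3: "integrable lborel (\<lambda>\<xi>::real^3. (\<Prod>i\<in>UNIV. of_real (\<xi> $ i) ^ m i) * (cis (x \<bullet> \<xi>) * of_real (exp (- l * (norm \<xi>)\<^sup>2))))"
    and integral_gauss3: "(\<integral>\<xi>. (\<Prod>i\<in>UNIV. of_real ((\<xi>::real^3) $ i) ^ m i) * (cis (x \<bullet> \<xi>) * of_real (exp (- l * (norm \<xi>)\<^sup>2))) \<partial>lborel)
      = (\<Prod>i\<in>UNIV. gauss_coeff l (m i) (x $ i)) * of_real (sqrt (pi / l) ^ 3 * exp (- (norm x)\<^sup>2 / (4 * l)))"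
proof -
  have eq: "(\<lambda>\<xi>::real^3. (\<Prod>i\<in>UNIV. of_real (\<xi> $ i) ^ m i) * (cis (x \<bullet> \<xi>) * of_real (exp (- l * (norm \<xi>)\<^sup>2)))) =
     (\<lambda>\<xi>. \<Prod>i\<in>UNIV. of_real (\<xi> $ i) ^ m i * gauss_osc l (x $ i) (\<xi> $ i))"
    by (simp add: prod.distrib gauss_osc_prod)
  show "integrable lborel (\<lambda>\<xi>::real^3. (\<Prod>i\<in>UNIV. of_real (\<xi> $ i) ^ m i) * (cis (x \<bullet> \<xi>) * of_real (exp (- l * (norm \<xi>)\<^sup>2))))"
    unfolding eq by (rule integrable_lborel_prod_vec) (rule integrable_gauss_osc[OF l])
  have "(\<integral>\<xi>. (\<Prod>i\<in>UNIV. of_real ((\<xi>::real^3) $ i) ^ m i) * (cis (x \<bullet> \<xi>) * of_real (exp (- l * (norm \<xi>)\<^sup>2))) \<partial>lborel)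
     = (\<Prod>i\<in>UNIV. gauss_coeff l (m i) (x $ i) * of_real (sqrt (pi / l) * exp (- (x $ i)\<^sup>2 / (4 * l))))"
    unfolding eq by (subst integral_lborel_prod_vec) (auto simp: integrable_gauss_osc l integral_gauss_osc m)
  also have "\<dots> = (\<Prod>i\<in>UNIV. gauss_coeff l (m i) (x $ i)) * of_real (sqrt (pi / l) ^ 3 * (\<Prod>i\<in>UNIV. exp (- (x $ i)\<^sup>2 / (4 * l))))"
    by (simp add: prod.distrib)
  also have "(\<Prod>i\<in>UNIV. exp (- (x $ i)\<^sup>2 / (4 * l))) = exp (- (norm x)\<^sup>2 / (4 * l))"
    by (simp add: norm_vec3 sum_negf sum_divide_distrib flip: exp_sum)
  finally show "(\<integral>\<xi>. (\<Prod>i\<in>UNIV. of_real ((\<xi>::real^3) $ i) ^ m i) * (cis (x \<bullet> \<xi>) * of_real (exp (- l * (norm \<xi>)\<^sup>2))) \<partial>lborel)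
      = (\<Prod>i\<in>UNIV. gauss_coeff l (m i) (x $ i)) * of_real (sqrt (pi / l) ^ 3 * exp (- (norm x)\<^sup>2 / (4 * l)))" .
qed

lemma
  fixes x :: "real^3"
  assumes l: "l > 0"
  shows integrable_gauss3_0: "integrable lborel (\<lambda>\<xi>::real^3. cis (x \<bullet> \<xi>) * of_real (exp (- l * (norm \<xi>)\<^sup>2)))"
    and integral_gauss3_0: "(\<integral>\<xi>. cis (x \<bullet> \<xi>) * of_real (exp (- l * (norm \<xi>)\<^sup>2)) \<partial>lborel)
      = of_real (sqrt (pi / l) ^ 3 * exp (- (norm x)\<^sup>2 / (4 * l)))"
  using integrable_gauss3[OF l, of "\<lambda>_. 0" x] integral_gauss3[OF l, of "\<lambda>_. 0" x]
  by (simp_all add: gauss_coeff_def)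

abbreviation delta :: "'i \<Rightarrow> 'i \<Rightarrow> 'b::zero_neq_one" where
  "delta i k \<equiv> (if i = k then 1 else 0)"

lemma
  fixes x :: "real^3"
  assumes l: "l > 0"
  shows integrable_gauss3_2: "integrable lborel (\<lambda>\<xi>::real^3. of_real (\<xi> $ i * \<xi> $ k) * (cis (x \<bullet> \<xi>) * of_real (exp (- l * (norm \<xi>)\<^sup>2))))"
    and integral_gauss3_2: "(\<integral>\<xi>. of_real (\<xi> $ i * \<xi> $ k) * (cis (x \<bullet> \<xi>) * of_real (exp (- l * (norm \<xi>)\<^sup>2))) \<partial>lborel)
      = of_real ((delta i k / (2 * l) - x $ i * x $ k / (4 * l\<^sup>2)) * (sqrt (pi / l) ^ 3 * exp (- (norm x)\<^sup>2 / (4 * l))))"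
proof -
  let ?m = "\<lambda>j. (if j = i then 1 else 0) + (if j = k then 1 else (0::nat))"
  have e1: "(\<Prod>j\<in>UNIV. of_real (\<xi> $ j) ^ ?m j) = (of_real (\<xi> $ i * \<xi> $ k) :: complex)" for \<xi> :: "real^3"
    by (simp add: power_add prod.distrib if_distrib[of "\<lambda>n. _ ^ n"] cong: if_cong)
  have e2: "(\<Prod>j\<in>UNIV. gauss_coeff l (?m j) (x $ j)) = of_real (delta i k / (2 * l) - x $ i * x $ k / (4 * l\<^sup>2))"
  proof (cases "i = k")
    case True
    have "(\<Prod>j\<in>UNIV. gauss_coeff l (?m j) (x $ j)) = (\<Prod>j\<in>UNIV. if j = i then gauss_coeff l 2 (x $ i) else 1)"
      using True by (intro prod.cong) (auto simp: gauss_coeff_def)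
    then show ?thesis using True by (simp add: gauss_coeff_def power2_eq_square)
  next
    case False
    have "(\<Prod>j\<in>UNIV. gauss_coeff l (?m j) (x $ j)) = (\<Prod>j\<in>UNIV. (if j = i then gauss_coeff l 1 (x $ i) else 1) * (if j = k then gauss_coeff l 1 (x $ k) else 1))"
      using False by (intro prod.cong) (auto simp: gauss_coeff_def)
    also have "\<dots> = gauss_coeff l 1 (x $ i) * gauss_coeff l 1 (x $ k)" by (simp add: prod.distrib)
    also have "\<dots> = - of_real (x $ i * x $ k / (4 * l\<^sup>2))"
      by (simp add: gauss_coeff_def complex_eq_iff power2_eq_square)
    finally show ?thesis using False by simp
  qed
  have m: "?m j \<le> 2" for j by auto
  show "integrable lborel (\<lambda>\<xi>::real^3. of_real (\<xi> $ i * \<xi> $ k) * (cis (x \<bullet> \<xi>) * of_real (exp (- l * (norm \<xi>)\<^sup>2))))"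
    using integrable_gauss3[OF l, of ?m x, OF m] unfolding e1 .
  show "(\<integral>\<xi>. of_real (\<xi> $ i * \<xi> $ k) * (cis (x \<bullet> \<xi>) * of_real (exp (- l * (norm \<xi>)\<^sup>2))) \<partial>lborel)
      = of_real ((delta i k / (2 * l) - x $ i * x $ k / (4 * l\<^sup>2)) * (sqrt (pi / l) ^ 3 * exp (- (norm x)\<^sup>2 / (4 * l))))"
    using integral_gauss3[OF l, of ?m x, OF m] unfolding e1 e2 by (simp only: of_real_mult mult.assoc)
qed

lemma cis_measurable [measurable]: "cis \<in> borel_measurable borel"
  unfolding cis_conv_exp[abs_def] by (intro borel_measurable_continuous_onI continuous_intros)

lemma heat_kernel_measurable [measurable]: "heat_kernel \<sigma> \<in> borel_measurable borel"
  unfolding heat_kernel_def[abs_def] by measurable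

lemma sqrt_cube_powr: "a > 0 \<Longrightarrow> sqrt a ^ 3 = a powr (3 / 2)"
  by (simp add: powr_half_sqrt[symmetric] powr_powr flip: powr_realpow)

lemma gauss_normalization:
  fixes s :: real assumes s: "s > 0"
  shows "sqrt (pi / s) ^ 3 = (2 * pi) ^ 3 * (4 * pi * s) powr (-3/2)"
proof -
  have "sqrt (4 * pi * s) * sqrt (pi / s) = sqrt ((2 * pi)\<^sup>2)"
    using s by (simp add: power2_eq_square flip: real_sqrt_mult)
  then have e: "sqrt (4 * pi * s) * sqrt (pi / s) = 2 * pi" by (simp only: real_sqrt_abs) simp
  have "(4 * pi * s) powr (-3/2) * sqrt (4 * pi * s) ^ 3 = 1"
    using s by (subst sqrt_cube_powr) (auto simp flip: powr_add)
  then have "sqrt (pi / s) ^ 3 = (4 * pi * s) powr (-3/2) * (sqrt (4 * pi * s) * sqrt (pi / s)) ^ 3"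
    by (simp only: power_mult_distrib mult.assoc[symmetric] mult_1_left)
  then show ?thesis unfolding e by (simp only: mult.commute)
qed

lemma fourier_transform_heat_kernel:
  assumes s: "\<sigma> > 0"
  shows "fourier_transform (heat_kernel \<sigma>) \<xi> = of_real (exp (- \<sigma> * (norm \<xi>)\<^sup>2))"
proof -
  have l: "1 / (4 * \<sigma>) > 0" using s by simp
  have "fourier_transform (heat_kernel \<sigma>) \<xi> = (\<integral>x. of_real ((4 * pi * \<sigma>) powr (-3/2)) * (cis ((- \<xi>) \<bullet> x) * of_real (exp (- (1 / (4 * \<sigma>)) * (norm x)\<^sup>2))) \<partial>lborel)"
    unfolding fourier_transform_def
    by (subst integral_completion) (simp, auto simp: heat_kernel_def inner_commute mult_ac intro!: Bochner_Integration.integral_cong)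
  also have "\<dots> = of_real ((4 * pi * \<sigma>) powr (-3/2) * sqrt (4 * pi * \<sigma>) ^ 3) * of_real (exp (- \<sigma> * (norm \<xi>)\<^sup>2))"
    unfolding integral_mult_right_zero integral_gauss3_0[OF l] using s by (simp add: mult_ac)
  also have "(4 * pi * \<sigma>) powr (-3/2) * sqrt (4 * pi * \<sigma>) ^ 3 = 1"
    using s by (subst sqrt_cube_powr) (auto simp flip: powr_add)
  finally show ?thesis by simp
qed

text \<open>Obtained from \<open>\<partial>\<^sub>i \<partial>\<^sub>k \<Delta>\<^sup>-\<^sup>1 \<Gamma>\<^sub>s = - \<integral>\<^sub>s\<^sup>\<infinity> \<partial>\<^sub>i \<partial>\<^sub>k \<Gamma>\<^sub>r dr\<close>, where \<open>\<Gamma>\<^sub>r\<close> is the heat kernel and the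
  integral over \<open>r\<close> is turned into Gaussian moments over \<open>[0, 1]\<close> by the substitution \<open>r = s / t\<^sup>2\<close>.\<close>

definition riesz_heat :: "3 \<Rightarrow> 3 \<Rightarrow> real^3 \<Rightarrow> real \<Rightarrow> real" where
  "riesz_heat i k x s = (4 * pi * s) powr (-3/2) *
     (delta i k * gauss_moment 2 ((norm x)\<^sup>2 / (4 * s)) - x $ i * x $ k / (2 * s) * gauss_moment 4 ((norm x)\<^sup>2 / (4 * s)))"

text \<open>The right side is \<open>\<partial>\<^sub>i \<partial>\<^sub>k \<Gamma>\<^sub>s\<close>,
  so this is the heat equation for \<open>\<partial>\<^sub>i \<partial>\<^sub>k
  \<Delta>\<^sup>-\<^sup>1 \<Gamma>\<^sub>s\<close>. The recurrence eliminates the moments of order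
  2, 4 and 6 in pairs and leaves only the exponential.\<close>

lemma riesz_heat_derivative:
  assumes s: "s > 0"
  shows "(riesz_heat i k x has_real_derivative
     - ((4 * pi * s) powr (-3/2) * exp (- (norm x)\<^sup>2 / (4 * s)) * (delta i k / (2 * s) - x $ i * x $ k / (4 * s\<^sup>2)))) (at s)"
proof -
  define r where "r = (norm x)\<^sup>2"
  define U where "U = r / (4 * s)"
  define P where "P = (4 * pi * s) powr (-3/2)"
  have dP: "((\<lambda>s. (4 * pi * s) powr (-3/2)) has_real_derivative - (3/2) * P / s) (at s)"
  proof -
    have "(4 * pi * s) powr (-3/2 - 1) = P / (4 * pi * s)"
      using s unfolding P_def powr_diff by simp
    then show ?thesis using s by (auto intro!: derivative_eq_intros)
  qed
  have dU: "((\<lambda>s. r / (4 * s)) has_real_derivative - U / s) (at s)"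
    using s by (auto intro!: derivative_eq_intros simp: U_def field_simps power2_eq_square)
  have dm: "((\<lambda>s. gauss_moment m (r / (4 * s))) has_real_derivative - gauss_moment (m + 2) U * (- U / s)) (at s)" for m
    using gauss_moment_field_derivative[OF dU] by (simp add: U_def)
  have dq: "((\<lambda>s. x $ i * x $ k / (2 * s)) has_real_derivative - (x $ i * x $ k / (2 * s\<^sup>2))) (at s)"
    using s by (auto intro!: derivative_eq_intros simp: field_simps power2_eq_square)
  have r2: "2 * U * gauss_moment 4 U = 3 * gauss_moment 2 U - exp (- U)"
    and r4: "2 * U * gauss_moment 6 U = 5 * gauss_moment 4 U - exp (- U)"
    using gauss_moment_recurrence[of 2 U] gauss_moment_recurrence[of 4 U] by simp_all
  have "(riesz_heat i k x has_real_derivative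
     (- (3/2) * P / s) * (delta i k * gauss_moment 2 U - x $ i * x $ k / (2 * s) * gauss_moment 4 U)
     + (delta i k * (- gauss_moment (2 + 2) U * (- U / s)) - (- (x $ i * x $ k / (2 * s\<^sup>2)) * gauss_moment 4 U + - gauss_moment (4 + 2) U * (- U / s) * (x $ i * x $ k / (2 * s)))) * P) (at s)"
    unfolding riesz_heat_def[abs_def] r_def[symmetric]
    using DERIV_mult[OF dP DERIV_diff[OF DERIV_cmult[OF dm[of 2], of "delta i k"] DERIV_mult[OF dq dm[of 4]]]]
    by (simp add: U_def P_def)
  moreover have "(- (3/2) * P / s) * (delta i k * gauss_moment 2 U - x $ i * x $ k / (2 * s) * gauss_moment 4 U)
     + (delta i k * (- gauss_moment (2 + 2) U * (- U / s)) - (- (x $ i * x $ k / (2 * s\<^sup>2)) * gauss_moment 4 U + - gauss_moment (4 + 2) U * (- U / s) * (x $ i * x $ k / (2 * s)))) * P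
     = P / (2 * s) * (delta i k * (2 * U * gauss_moment 4 U - 3 * gauss_moment 2 U) - x $ i * x $ k / (2 * s) * (2 * U * gauss_moment 6 U - 5 * gauss_moment 4 U))"
    using s by (simp add: field_simps power2_eq_square)
  also have "\<dots> = - (P * exp (- U) * (delta i k / (2 * s) - x $ i * x $ k / (4 * s\<^sup>2)))"
    unfolding r2 r4 using s by (simp add: field_simps power2_eq_square)
  finally show ?thesis by (simp add: P_def U_def r_def)
qed

lemma riesz_heat_tendsto: "((riesz_heat i k x) \<longlongrightarrow> 0) at_top"
proof -
  have U: "((\<lambda>s. (norm x)\<^sup>2 / (4 * s)) \<longlongrightarrow> 0) at_top" by real_asymp
  have m: "((\<lambda>s. gauss_moment m ((norm x)\<^sup>2 / (4 * s))) \<longlongrightarrow> gauss_moment m (0::real)) at_top" for m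
    using DERIV_isCont[OF gauss_moment_derivative[of m 0]] U by (rule isCont_tendsto_compose)
  have P: "((\<lambda>s. (4 * pi * s) powr (-3/2)) \<longlongrightarrow> 0) at_top"
    using pi_gt_zero by real_asymp
  have q: "((\<lambda>s. x $ i * x $ k / (2 * s)) \<longlongrightarrow> 0) at_top" by real_asymp
  have "(riesz_heat i k x \<longlongrightarrow> 0 * (delta i k * gauss_moment 2 0 - 0 * gauss_moment 4 0)) at_top"
    unfolding riesz_heat_def[abs_def] by (intro tendsto_intros m P q)
  then show ?thesis by simp
qed

lemma has_bochner_integral_exp_ray:
  fixes a s :: real
  assumes a: "a > 0"
  shows "has_bochner_integral lborel (\<lambda>l. indicator {s<..} l * exp (- l * a)) (exp (- s * a) / a)"
proof -
  have "(\<integral>\<^sup>+l. ennreal (exp (- l * a)) * indicator {s..} l \<partial>lborel) = ennreal (0 - (- exp (- s * a) / a))"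
  proof (rule nn_integral_FTC_atLeast)
    show "((\<lambda>l. - exp (- l * a) / a) has_real_derivative exp (- l * a)) (at l)" for l
      using a by (auto intro!: derivative_eq_intros)
    show "((\<lambda>l. - exp (- l * a) / a) \<longlongrightarrow> 0) at_top" using a by real_asymp
  qed auto
  moreover have "(\<integral>\<^sup>+l. ennreal (exp (- l * a)) * indicator {s..} l \<partial>lborel) = (\<integral>\<^sup>+l. ennreal (indicator {s<..} l * exp (- l * a)) \<partial>lborel)"
    by (intro nn_integral_cong_AE AE_I[of _ _ "{s}"]) (auto split: split_indicator_asm)
  ultimately show ?thesis
    using a by (intro has_bochner_integral_nn_integral) auto
qed

lemma abs_mult_le_norm_sq: "\<bar>(\<xi>::real^3) $ i * \<xi> $ k\<bar> \<le> (norm \<xi>)\<^sup>2"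
  using mult_mono[OF component_le_norm_cart[of \<xi> i] component_le_norm_cart[of \<xi> k]]
  by (simp add: abs_mult power2_eq_square)

lemma integrable_gauss3_real:
  assumes "l > 0" shows "integrable lborel (\<lambda>\<xi>::real^3. exp (- l * (norm \<xi>)\<^sup>2))"
proof -
  have "integrable lborel (\<lambda>\<xi>::real^3. Re (cis (0 \<bullet> \<xi>) * of_real (exp (- l * (norm \<xi>)\<^sup>2))))"
    by (intro integrable_Re integrable_gauss3_0 assms)
  then show ?thesis by simp
qed

text \<open>The singular symbol is removed by writing
  \<open>exp (- s * (norm \<xi>)\<^sup>2) / (norm \<xi>)\<^sup>2\<close> as the integral of
  \<open>exp (- l * (norm \<xi>)\<^sup>2)\<close> over l > s. After exchanging the integrals, the
  inner one is a Gaussian second moment, namely \<open>(2 * pi) ^ 3 * D l\<close>, and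
  \<open>riesz_heat\<close> is the antiderivative of \<open>- D\<close> that vanishes at
  infinity.\<close>

lemma integral_riesz_gauss3:
  fixes x :: "real^3"
  assumes s: "s > 0"
  shows "integrable lborel (\<lambda>\<xi>. of_real (\<xi> $ i * \<xi> $ k / (norm \<xi>)\<^sup>2) * (cis (x \<bullet> \<xi>) * of_real (exp (- s * (norm \<xi>)\<^sup>2))))" (is "integrable _ ?g")
    and "(\<integral>\<xi>. of_real (\<xi> $ i * \<xi> $ k / (norm \<xi>)\<^sup>2) * (cis (x \<bullet> \<xi>) * of_real (exp (- s * (norm \<xi>)\<^sup>2))) \<partial>lborel)
       = of_real ((2 * pi) ^ 3 * riesz_heat i k x s)"
proof -
  show "integrable lborel ?g"
  proof (rule Bochner_Integration.integrable_bound[OF integrable_gauss3_real[OF s]])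
    show "AE \<xi> in lborel. norm (?g \<xi>) \<le> norm (exp (- s * (norm \<xi>)\<^sup>2))"
      using abs_mult_le_norm_sq by (intro always_eventually allI) (auto simp: norm_mult divide_le_eq mult_le_cancel_right1 norm_divide abs_mult simp flip: of_real_mult of_real_divide)
  qed simp
  define f where "f = (\<lambda>(\<xi>::real^3, l). indicator {s<..} l *\<^sub>R (of_real (\<xi> $ i * \<xi> $ k) * (cis (x \<bullet> \<xi>) * of_real (exp (- l * (norm \<xi>)\<^sup>2)))) :: complex)"
  have fm: "f \<in> borel_measurable (lborel \<Otimes>\<^sub>M lborel)"
    unfolding f_def by measurable
  have inner: "has_bochner_integral lborel (\<lambda>l. f (\<xi>, l)) (?g \<xi>)" for \<xi>
  proof (cases "\<xi> = 0")
    case False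
    have "has_bochner_integral lborel (\<lambda>l. (indicator {s<..} l * exp (- l * (norm \<xi>)\<^sup>2)) *\<^sub>R (of_real (\<xi> $ i * \<xi> $ k) * cis (x \<bullet> \<xi>)))
       ((exp (- s * (norm \<xi>)\<^sup>2) / (norm \<xi>)\<^sup>2) *\<^sub>R (of_real (\<xi> $ i * \<xi> $ k) * cis (x \<bullet> \<xi>)))"
      using False by (intro has_bochner_integral_scaleR_left has_bochner_integral_exp_ray) auto
    then show ?thesis
      by (rule has_bochner_integral_cong[THEN iffD1, rotated -1]) (auto simp: f_def scaleR_conv_of_real)
  qed (simp add: f_def has_bochner_integral_zero)
  have inner_norm: "(\<integral>l. norm (f (\<xi>, l)) \<partial>lborel) \<le> exp (- s * (norm \<xi>)\<^sup>2)" for \<xi>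
  proof (cases "\<xi> = 0")
    case False
    have "has_bochner_integral lborel (\<lambda>l. \<bar>\<xi> $ i * \<xi> $ k\<bar> * (indicator {s<..} l * exp (- l * (norm \<xi>)\<^sup>2)))
       (\<bar>\<xi> $ i * \<xi> $ k\<bar> * (exp (- s * (norm \<xi>)\<^sup>2) / (norm \<xi>)\<^sup>2))"
      using False by (intro has_bochner_integral_mult_right has_bochner_integral_exp_ray) auto
    moreover have "norm (f (\<xi>, l)) = \<bar>\<xi> $ i * \<xi> $ k\<bar> * (indicator {s<..} l * exp (- l * (norm \<xi>)\<^sup>2))" for l
      by (simp add: f_def norm_mult split: split_indicator flip: of_real_mult)
    ultimately have "(\<integral>l. norm (f (\<xi>, l)) \<partial>lborel) = \<bar>\<xi> $ i * \<xi> $ k\<bar> * (exp (- s * (norm \<xi>)\<^sup>2) / (norm \<xi>)\<^sup>2)"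
      by (simp add: has_bochner_integral_iff)
    also have "\<dots> \<le> exp (- s * (norm \<xi>)\<^sup>2)"
      using False abs_mult_le_norm_sq[of \<xi> i k] by (simp add: divide_le_eq mult.commute)
    finally show ?thesis .
  qed (simp add: f_def)
  have fint: "integrable (lborel \<Otimes>\<^sub>M lborel) f"
  proof (rule lborel_pair.Fubini_integrable[OF fm])
    show "integrable lborel (\<lambda>\<xi>. \<integral>l. norm (f (\<xi>, l)) \<partial>lborel)"
    proof (rule Bochner_Integration.integrable_bound[OF integrable_gauss3_real[OF s]])
      show "(\<lambda>\<xi>. \<integral>l. norm (f (\<xi>, l)) \<partial>lborel) \<in> borel_measurable lborel"
        using fm by (intro lborel.borel_measurable_lebesgue_integral) simp
      show "AE \<xi> in lborel. norm (\<integral>l. norm (f (\<xi>, l)) \<partial>lborel) \<le> norm (exp (- s * (norm \<xi>)\<^sup>2))"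
        using inner_norm by (intro always_eventually allI) (simp add: integral_nonneg_AE)
    qed
    show "AE \<xi> in lborel. integrable lborel (\<lambda>l. f (\<xi>, l))"
      using inner by (auto simp: has_bochner_integral_iff)
  qed
  define D where "D l = (4 * pi * l) powr (-3/2) * exp (- (norm x)\<^sup>2 / (4 * l)) * (delta i k / (2 * l) - x $ i * x $ k / (4 * l\<^sup>2))" for l
  have outer: "(\<integral>\<xi>. f (\<xi>, l) \<partial>lborel) = of_real ((2 * pi) ^ 3 * (indicator {s<..} l * D l))" for l
  proof (cases "l > s")
    case True
    then have l: "l > 0" using s by simp
    have "(delta i k / (2 * l) - x $ i * x $ k / (4 * l\<^sup>2)) * (sqrt (pi / l) ^ 3 * exp (- (norm x)\<^sup>2 / (4 * l))) = (2 * pi) ^ 3 * D l"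
      unfolding gauss_normalization[OF l] D_def by (simp only: mult_ac)
    then show ?thesis using integral_gauss3_2[OF l, of i k x] True by (simp add: f_def)
  qed (simp add: f_def)
  have "(\<integral>l. (\<integral>\<xi>. f (\<xi>, l) \<partial>lborel) \<partial>lborel) = (\<integral>\<xi>. (\<integral>l. f (\<xi>, l) \<partial>lborel) \<partial>lborel)"
    using fint by (intro lborel_pair.Fubini_integral) simp
  also have "\<dots> = (\<integral>\<xi>. ?g \<xi> \<partial>lborel)"
    using inner by (simp add: has_bochner_integral_iff)
  finally have swap: "(\<integral>\<xi>. ?g \<xi> \<partial>lborel) = (\<integral>l. of_real ((2 * pi) ^ 3 * (indicator {s<..} l * D l)) \<partial>lborel)"
    by (simp only: outer)
  have "integrable lborel (\<lambda>l. \<integral>\<xi>. f (\<xi>, l) \<partial>lborel)"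
    using lborel_pair.integrable_snd[of "\<lambda>x y. f (x, y)"] fint by simp
  then have "integrable lborel (\<lambda>l. (2 * pi) ^ 3 * (indicator {s<..} l * D l))"
    unfolding outer by (simp only: complex_of_real_integrable_eq)
  then have Dint: "integrable lborel (\<lambda>l. indicator {s<..} l * D l)"
    by simp
  have ei: "einterval (ereal s) \<infinity> = {s<..}" by (auto simp: einterval_def)
  have "(LBINT l=ereal s..\<infinity>. - D l) = 0 - riesz_heat i k x s"
  proof (rule interval_integral_FTC_integrable)
    show "(riesz_heat i k x has_vector_derivative - D l) (at l)" if "ereal s < ereal l" for l
      using riesz_heat_derivative[of l i k x] that s by (simp add: D_def has_real_derivative_iff_has_vector_derivative)
    show "isCont (\<lambda>l. - D l) l" if "ereal s < ereal l" for l
      unfolding D_def using that s by (auto intro!: continuous_intros)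
    show "set_integrable lborel (einterval (ereal s) \<infinity>) (\<lambda>l. - D l)"
      using Dint by (simp add: ei set_integrable_def)
    have "(riesz_heat i k x \<longlongrightarrow> riesz_heat i k x s) (at_right s)"
      using DERIV_isCont[OF riesz_heat_derivative[OF s]] by (simp add: isCont_def filterlim_at_split)
    then show "((riesz_heat i k x \<circ> real_of_ereal) \<longlongrightarrow> riesz_heat i k x s) (at_right (ereal s))"
      by (simp add: ereal_tendsto_simps)
    show "((riesz_heat i k x \<circ> real_of_ereal) \<longlongrightarrow> 0) (at_left \<infinity>)"
      using riesz_heat_tendsto by (simp add: ereal_tendsto_simps)
  qed simp
  then have "(\<integral>l. indicator {s<..} l * D l \<partial>lborel) = riesz_heat i k x s"
    by (simp add: interval_lebesgue_integral_def ei set_lebesgue_integral_def)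
  then show "(\<integral>\<xi>. ?g \<xi> \<partial>lborel) = of_real ((2 * pi) ^ 3 * riesz_heat i k x s)"
    unfolding swap by (simp add: integral_of_real del: of_real_mult)
qed

text \<open>Turns the projection, defined on the frequency side, into a closed formula in x. All
  kernel bounds and the continuation to complex arguments start from here.\<close>

lemma leray_heat_kernel:
  assumes s: "\<sigma> > 0"
  shows "leray (\<lambda>z. heat_kernel \<sigma> z *\<^sub>R axis k 1) x $ i = delta i k * heat_kernel \<sigma> x - riesz_heat i k x \<sigma>"
proof -
  let ?E = "\<lambda>\<xi>::real^3. of_real (exp (- \<sigma> * (norm \<xi>)\<^sup>2)) :: complex"
  have ft: "fourier_transform (\<lambda>y. (heat_kernel \<sigma> y *\<^sub>R axis k 1) $ j) \<xi> = delta j k * ?E \<xi>" for j \<xi>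
  proof (cases "j = k")
    case True then show ?thesis using fourier_transform_heat_kernel[OF s, of \<xi>] by simp
  next
    case False then show ?thesis by (simp add: fourier_transform_def axis_def)
  qed
  have sum: "(\<Sum>j\<in>UNIV. of_real (\<xi> $ j) * (delta j k * ?E \<xi>)) = of_real (\<xi> $ k) * ?E \<xi>" for \<xi>
    by (simp add: if_distrib[of "\<lambda>z. _ * z"] if_distrib[of "\<lambda>z. z * _"] cong: if_cong)
  have "leray (\<lambda>z. heat_kernel \<sigma> z *\<^sub>R axis k 1) x $ i = Re ((\<integral>\<xi>. delta i k * (cis (x \<bullet> \<xi>) * ?E \<xi>)
       - of_real (\<xi> $ i * \<xi> $ k / (norm \<xi>)\<^sup>2) * (cis (x \<bullet> \<xi>) * ?E \<xi>) \<partial>lebesgue) / of_real ((2 * pi) ^ 3))"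
    unfolding leray_def ft sum by (simp add: algebra_simps)
  also have "(\<integral>\<xi>. delta i k * (cis (x \<bullet> \<xi>) * ?E \<xi>)
       - of_real (\<xi> $ i * \<xi> $ k / (norm \<xi>)\<^sup>2) * (cis (x \<bullet> \<xi>) * ?E \<xi>) \<partial>lebesgue) =
     (\<integral>\<xi>. delta i k * (cis (x \<bullet> \<xi>) * ?E \<xi>)
       - of_real (\<xi> $ i * \<xi> $ k / (norm \<xi>)\<^sup>2) * (cis (x \<bullet> \<xi>) * ?E \<xi>) \<partial>lborel)"
    by (rule integral_completion) simp
  also have "\<dots> = delta i k * of_real (sqrt (pi / \<sigma>) ^ 3 * exp (- (norm x)\<^sup>2 / (4 * \<sigma>))) - of_real ((2 * pi) ^ 3 * riesz_heat i k x \<sigma>)"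
    by (subst Bochner_Integration.integral_diff)
       (simp_all only: integral_riesz_gauss3[OF s] integral_mult_right_zero integral_gauss3_0[OF s] integrable_mult_right integrable_gauss3_0[OF s])
  also have "Re (\<dots> / of_real ((2 * pi) ^ 3)) = delta i k * (sqrt (pi / \<sigma>) ^ 3 / (2 * pi) ^ 3 * exp (- (norm x)\<^sup>2 / (4 * \<sigma>))) - riesz_heat i k x \<sigma>"
    by (simp add: diff_divide_distrib flip: of_real_mult of_real_divide of_real_power of_real_diff)
  also have "sqrt (pi / \<sigma>) ^ 3 / (2 * pi) ^ 3 = (4 * pi * \<sigma>) powr (-3/2)"
    unfolding gauss_normalization[OF s] by simp
  finally show ?thesis by (simp add: heat_kernel_def)
qed

text \<open>The derivative in the j-th direction of the (i, k) entry of the Oseen tensor, the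
  convolution kernel of the projected heat semigroup. It is written with
  \<open>x \<bullet> x\<close> because this polynomial, unlike the norm, continues to complex
  vectors.\<close>

definition oseen :: "real \<Rightarrow> 3 \<Rightarrow> 3 \<Rightarrow> 3 \<Rightarrow> real^3 \<Rightarrow> real" where
  "oseen s i j k x = (4 * pi * s) powr (-3/2) *
     (- delta i k * x $ j / (2 * s) * exp (- (x \<bullet> x) / (4 * s))
      + (delta i k * x $ j + delta i j * x $ k + delta j k * x $ i) / (2 * s) * gauss_moment 4 ((x \<bullet> x) / (4 * s))
      - x $ i * x $ j * x $ k / (4 * s\<^sup>2) * gauss_moment 6 ((x \<bullet> x) / (4 * s)))"

lemma oseen_algebra:
  fixes d E xi xj xk A4 A6 a c s :: real
  shows "d * (E * - (xj / (2 * s))) - (d * (xj / (2 * s) * - A4) - (xi * xk / (2 * s) * (xj / (2 * s) * - A6) + (xi * c + a * xk) / (2 * s) * A4))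
    = - d * xj / (2 * s) * E + (d * xj + a * xk + c * xi) / (2 * s) * A4 - xi * xj * xk / (4 * s\<^sup>2) * A6"
proof -
  define r where "r = 1 / (2 * s)"
  have r: "z / (2 * s) = z * r" "z / (4 * s\<^sup>2) = z * (r * r)" for z
    by (simp_all add: r_def power2_eq_square)
  show ?thesis unfolding r by (simp add: algebra_simps)
qed

lemma partial_deriv_leray_heat_kernel:
  assumes s: "s > 0"
  shows "partial_deriv j (leray (\<lambda>z. heat_kernel s z *\<^sub>R axis k 1)) x $ i = oseen s i j k x"
proof -
  define P where "P = (4 * pi * s) powr (-3/2)"
  define U where "U x = (x \<bullet> x) / (4 * s)" for x :: "real^3"
  define A where "A m x = gauss_moment m (U x)" for m x
  define f where "f i x = P * (delta i k * exp (- U x) - (delta i k * A 2 x - x $ i * x $ k / (2 * s) * A 4 x))" for i x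
  define f' where "f' i h = P * (delta i k * (exp (- U x) * - ((x \<bullet> h) / (2 * s)))
     - (delta i k * (((x \<bullet> h) / (2 * s)) * - A 4 x) - (x $ i * x $ k / (2 * s) * (((x \<bullet> h) / (2 * s)) * - A 6 x) + (x $ i * h $ k + h $ i * x $ k) / (2 * s) * A 4 x)))" for i h
  have eq: "leray (\<lambda>z. heat_kernel s z *\<^sub>R axis k 1) = (\<lambda>x. \<chi> i. f i x)"
  proof (intro ext, unfold vec_eq_iff leray_heat_kernel[OF s] vec_lambda_beta, intro allI)
    fix x i
    show "delta i k * heat_kernel s x - riesz_heat i k x s = f i x"
      unfolding f_def riesz_heat_def heat_kernel_def U_def A_def P_def dot_square_norm
      by (simp add: right_diff_distrib)
  qed
  have dU: "(U has_derivative (\<lambda>h. (x \<bullet> h) / (2 * s))) (at x)"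
  proof -
    have "((\<lambda>x. x \<bullet> x) has_derivative (\<lambda>h. x \<bullet> h + h \<bullet> x)) (at x)"
      by (intro has_derivative_inner has_derivative_ident)
    from bounded_linear.has_derivative[OF bounded_linear_divide this, of "4 * s"]
    show ?thesis unfolding U_def[abs_def] by (simp add: inner_commute)
  qed
  have dA: "((\<lambda>x. A m x) has_derivative (\<lambda>h. ((x \<bullet> h) / (2 * s)) * - A (m + 2) x)) (at x)" for m
    unfolding A_def by (rule gauss_moment_has_derivative[OF dU])
  have dA2: "((\<lambda>x. A 2 x) has_derivative (\<lambda>h. ((x \<bullet> h) / (2 * s)) * - A 4 x)) (at x)"
    and dA4: "((\<lambda>x. A 4 x) has_derivative (\<lambda>h. ((x \<bullet> h) / (2 * s)) * - A 6 x)) (at x)"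
    using dA[of 2] dA[of 4] by simp_all
  have dE: "((\<lambda>x. exp (- U x)) has_derivative (\<lambda>h. exp (- U x) * - ((x \<bullet> h) / (2 * s)))) (at x)"
    using DERIV_compose_FDERIV[OF DERIV_exp has_derivative_minus[OF dU]] by (simp only: mult.commute)
  have dn: "((\<lambda>x. x $ i) has_derivative (\<lambda>h. h $ i)) (at x)" for i
    by (rule bounded_linear.has_derivative[OF bounded_linear_vec_nth has_derivative_ident])
  have dq: "((\<lambda>x. x $ i * x $ k / (2 * s)) has_derivative (\<lambda>h. (x $ i * h $ k + h $ i * x $ k) / (2 * s))) (at x)" for i
    by (rule bounded_linear.has_derivative[OF bounded_linear_divide has_derivative_mult[OF dn[of i] dn[of k]]])
  have comp: "((\<lambda>x. f i x) has_derivative f' i) (at x)" for i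
    unfolding f_def f'_def
    by (rule has_derivative_mult_right[OF has_derivative_diff[OF has_derivative_mult_right[OF dE]
          has_derivative_diff[OF has_derivative_mult_right[OF dA2] has_derivative_mult[OF dq dA4]]]])
  have "((\<lambda>x. \<chi> i. f i x) has_derivative (\<lambda>h. \<chi> i. f' i h)) (at x)"
  proof (rule has_derivative_componentwise_within[THEN iffD2], intro ballI)
    fix b :: "real^3" assume "b \<in> Basis"
    then obtain m where b: "b = axis m 1" by (auto simp: Basis_vec_def)
    show "((\<lambda>x. (\<chi> i. f i x) \<bullet> b) has_derivative (\<lambda>h. (\<chi> i. f' i h) \<bullet> b)) (at x)"
      unfolding b inner_axis vec_lambda_beta inner_real_def mult_1_right by (rule comp)
  qed
  then have "frechet_derivative (leray (\<lambda>z. heat_kernel s z *\<^sub>R axis k 1)) (at x) = (\<lambda>h. \<chi> i. f' i h)"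
    unfolding eq by (rule frechet_derivative_at[symmetric])
  then have "partial_deriv j (leray (\<lambda>z. heat_kernel s z *\<^sub>R axis k 1)) x $ i = f' i (axis j 1)"
    by (simp add: partial_deriv_def)
  also have "\<dots> = oseen s i j k x"
  proof -
    have "f' i (axis j 1) = P * (- delta i k * x $ j / (2 * s) * exp (- U x)
      + (delta i k * x $ j + delta i j * x $ k + delta j k * x $ i) / (2 * s) * A 4 x
      - x $ i * x $ j * x $ k / (4 * s\<^sup>2) * A 6 x)"
    proof -
      have ax: "axis j (1::real) $ i = delta i j" "axis j (1::real) $ k = delta j k"
        by (auto simp: axis_def)
      have ix: "x \<bullet> axis j 1 = x $ j" by (simp add: inner_axis)
      have "f' i (axis j 1) = P * (delta i k * (exp (- U x) * - (x $ j / (2 * s)))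
       - (delta i k * (x $ j / (2 * s) * - A 4 x) - (x $ i * x $ k / (2 * s) * (x $ j / (2 * s) * - A 6 x)
         + (x $ i * delta j k + delta i j * x $ k) / (2 * s) * A 4 x)))"
        by (simp only: f'_def ix ax)
      then show ?thesis by (simp only: oseen_algebra)
    qed
    then show ?thesis by (simp only: oseen_def P_def U_def A_def minus_divide_left)
  qed
  finally show ?thesis .
qed

section \<open>Complexified kernels\<close>

text \<open>The velocity \<open>h\<close> and the dilation \<open>w\<close> are complex parameters. For real \<open>h\<close> and \<open>w > 0\<close> the kernels below
  are those of the equation satisfied by \<open>V (t / w\<^sup>2, x + t *\<^sub>R h)\<close> when \<open>V\<close> is the mild solution with
  datum \<open>a\<close>. Holomorphy in \<open>h\<close> therefore gives smoothness in \<open>x\<close>, and holomorphy in \<open>w\<close> gives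
  continuity in \<open>t\<close>, both with bounds by the same majorant.\<close>

definition shifted :: "real^3 \<Rightarrow> real \<Rightarrow> complex^3 \<Rightarrow> complex^3" where
  "shifted x s h = (\<chi> i. of_real (x $ i) + of_real s * h $ i)"

lemma shifted_nth [simp]: "shifted x s h $ i = of_real (x $ i) + of_real s * h $ i"
  by (simp add: shifted_def)

text \<open>The bilinear square, without conjugation, so that it is holomorphic; its real part is
  not bounded below by 0.\<close>

definition csq :: "complex^3 \<Rightarrow> complex" where
  "csq y = (\<Sum>i\<in>UNIV. (y $ i)\<^sup>2)"

definition heatC :: "complex \<Rightarrow> real \<Rightarrow> complex^3 \<Rightarrow> complex" where
  "heatC w s y = of_real ((4 * pi * s) powr (-3/2)) * w ^ 3 * exp (- (csq y * w\<^sup>2 / of_real (4 * s)))"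

text \<open>For w > 0 this is the kernel at time \<open>s / w\<^sup>2\<close> divided by
  \<open>w\<^sup>2\<close>; the division is the Jacobian of the change of time in the Duhamel
  integral.\<close>

definition oseenC :: "complex \<Rightarrow> real \<Rightarrow> 3 \<Rightarrow> 3 \<Rightarrow> 3 \<Rightarrow> complex^3 \<Rightarrow> complex" where
  "oseenC w s i j k y = of_real ((4 * pi * s) powr (-3/2)) * w ^ 3 *
     (- delta i k * y $ j / of_real (2 * s) * exp (- (csq y * w\<^sup>2 / of_real (4 * s)))
      + (delta i k * y $ j + delta i j * y $ k + delta j k * y $ i) / of_real (2 * s) * gauss_moment 4 (csq y * w\<^sup>2 / of_real (4 * s))
      - y $ i * y $ j * y $ k * w\<^sup>2 / of_real (4 * s\<^sup>2) * gauss_moment 6 (csq y * w\<^sup>2 / of_real (4 * s)))"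

lemma csq_of_real: "csq (\<chi> i. of_real (x $ i)) = of_real (x \<bullet> x)"
  by (simp add: csq_def inner_vec_def power2_eq_square)

lemma heatC_real: "heatC (of_real w) s (\<chi> i. of_real (x $ i)) =
    of_real ((4 * pi * s) powr (-3/2) * w ^ 3 * exp (- ((x \<bullet> x) * w\<^sup>2 / (4 * s))))"
  unfolding heatC_def csq_of_real by (simp flip: exp_of_real)

lemma heatC_1: "heatC 1 s (\<chi> i. of_real (x $ i)) = of_real (heat_kernel s x)"
  using heatC_real[of 1 s x] by (simp add: heat_kernel_def dot_square_norm)

lemma oseenC_1: "oseenC 1 s i j k (\<chi> i. of_real (x $ i)) = of_real (oseen s i j k x)"
proof -
  have e: "csq (\<chi> i. of_real (x $ i)) * 1\<^sup>2 / of_real (4 * s) = of_real ((x \<bullet> x) / (4 * s))"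
    by (simp add: csq_of_real)
  have d: "(delta a b :: complex) = of_real (delta a b)" for a b :: 3 by simp
  show ?thesis
    unfolding oseenC_def oseen_def e gauss_moment_of_real d
    by (simp flip: exp_of_real del: of_real_eq_1_iff)
qed

text \<open>For w near 1 the square of w has real part at least 1/2, and the displacement s h
  contributes at worst - 4 s |x| - 2 s^2. The cross term is absorbed through (|x| / 2 - 4 s)^2 \<ge>
  0. The loss is of order s^2, because the displacement is proportional to s, and thus stays bounded
  after division by 4 s.\<close>

lemma csq_shifted_bound:
  assumes h: "norm h \<le> 1" and w: "norm (w - 1) \<le> 1/4" and s: "0 < s"
  shows "Re (csq (shifted x s h) * w\<^sup>2) \<ge> (norm x)\<^sup>2 / 4 - 18 * s\<^sup>2"
proof -
  define d where "d = (\<Sum>i\<in>UNIV. of_real (x $ i) * h $ i)"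
  define e where "e = csq h"
  have eq: "csq (shifted x s h) = of_real ((norm x)\<^sup>2) + (of_real (2 * s) * d + of_real (s\<^sup>2) * e)"
    by (simp add: csq_def shifted_def norm_vec3 d_def e_def power2_sum power_mult_distrib sum.distrib sum_distrib_left algebra_simps)
  have nd: "norm d \<le> norm x"
  proof -
    have "norm d \<le> (\<Sum>i\<in>UNIV. \<bar>x $ i\<bar> * norm (h $ i))"
      unfolding d_def by (rule order_trans[OF norm_sum]) (simp add: norm_mult)
    also have "\<dots> \<le> L2_set (\<lambda>i. \<bar>x $ i\<bar>) UNIV * L2_set (\<lambda>i. norm (h $ i)) UNIV"
      using L2_set_mult_ineq[of "\<lambda>i. \<bar>x $ i\<bar>" "\<lambda>i. norm (h $ i)" UNIV] by simp
    also have "\<dots> = norm x * norm h" by (simp add: norm_vec_def)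
    also have "\<dots> \<le> norm x * 1" using h by (intro mult_left_mono) auto
    finally show ?thesis by simp
  qed
  have ne: "norm e \<le> 1"
  proof -
    have "norm e \<le> (\<Sum>i\<in>UNIV. (norm (h $ i))\<^sup>2)"
      unfolding e_def csq_def by (rule order_trans[OF norm_sum]) (simp add: norm_power)
    also have "\<dots> = (norm h)\<^sup>2" by (simp add: norm_vec_def L2_set_def sum_nonneg)
    also have "\<dots> \<le> 1" using h by (simp add: power_le_one)
    finally show ?thesis .
  qed
  have w1: "\<bar>Re w - 1\<bar> \<le> 1/4" "\<bar>Im w\<bar> \<le> 1/4"
    using abs_Re_le_cmod[of "w - 1"] abs_Im_le_cmod[of "w - 1"] w by auto
  have "Re w \<ge> 3/4" using w1(1) by linarith
  then have "(Re w)\<^sup>2 \<ge> (3/4)\<^sup>2" by (intro power_mono) auto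
  moreover have "(Im w)\<^sup>2 \<le> (1/4)\<^sup>2" using w1 by (intro power2_le_iff_abs_le[THEN iffD2]) auto
  ultimately have Rw: "Re (w\<^sup>2) \<ge> 1/2" by (simp add: Re_power2 power2_eq_square)
  have "norm w \<le> 5/4" using norm_triangle_ineq[of "w - 1" 1] w by simp
  then have "norm (w\<^sup>2) \<le> (5/4)\<^sup>2" unfolding norm_power by (intro power_mono) auto
  then have nw: "norm (w\<^sup>2) \<le> 2" by (simp add: power2_eq_square)
  have "norm (of_real (2 * s) * d + of_real (s\<^sup>2) * e) \<le> norm (of_real (2 * s) * d) + norm (of_real (s\<^sup>2) * e)"
    by (rule norm_triangle_ineq)
  also have "\<dots> \<le> 2 * s * norm x + s\<^sup>2 * 1"
    unfolding norm_mult norm_of_real using s nd ne by (intro add_mono mult_mono) auto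
  finally have r: "norm (of_real (2 * s) * d + of_real (s\<^sup>2) * e) \<le> 2 * s * norm x + s\<^sup>2" by simp
  have "norm ((of_real (2 * s) * d + of_real (s\<^sup>2) * e) * w\<^sup>2) \<le> (2 * s * norm x + s\<^sup>2) * 2"
    unfolding norm_mult[of _ "w\<^sup>2"] using r nw s by (intro mult_mono) auto
  then have "Re ((of_real (2 * s) * d + of_real (s\<^sup>2) * e) * w\<^sup>2) \<ge> - ((2 * s * norm x + s\<^sup>2) * 2)"
    using abs_Re_le_cmod[of "(of_real (2 * s) * d + of_real (s\<^sup>2) * e) * w\<^sup>2"] by linarith
  moreover have "Re (of_real ((norm x)\<^sup>2) * w\<^sup>2) \<ge> (norm x)\<^sup>2 / 2"
    using mult_left_mono[OF Rw, of "(norm x)\<^sup>2"] by simp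
  moreover have "csq (shifted x s h) * w\<^sup>2 = of_real ((norm x)\<^sup>2) * w\<^sup>2 + (of_real (2 * s) * d + of_real (s\<^sup>2) * e) * w\<^sup>2"
    unfolding eq by (rule distrib_right)
  ultimately have "Re (csq (shifted x s h) * w\<^sup>2) \<ge> (norm x)\<^sup>2 / 2 - (2 * s * norm x + s\<^sup>2) * 2"
    by simp
  moreover have "0 \<le> (norm x / 2 - 4 * s)\<^sup>2" by simp
  ultimately show ?thesis by (simp add: power2_diff power_divide power_mult_distrib algebra_simps)
qed

lemma norm_shifted_le:
  assumes h: "norm h \<le> 1" and s: "0 < s"
  shows "norm (shifted x s h $ i) \<le> norm x + s"
proof -
  have "norm (shifted x s h $ i) \<le> \<bar>x $ i\<bar> + s * norm (h $ i)"
    unfolding shifted_nth by (rule order_trans[OF norm_triangle_ineq]) (use s in \<open>simp add: norm_mult\<close>)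
  also have "\<dots> \<le> norm x + s * 1"
    using component_le_norm_cart[of x i] Finite_Cartesian_Product.norm_nth_le[of h i] h s by (intro add_mono mult_left_mono) auto
  finally show ?thesis by simp
qed

text \<open>The factor exp (9/2) pays for 18 s^2 / (4 s) \<le> 9/2, which is where s \<le> 1 enters,
  and the 2 bounds the cube of |w|.\<close>

lemma heatC_bound:
  assumes h: "norm h \<le> 1" and w: "norm (w - 1) \<le> 1/4" and s: "0 < s" "s \<le> 1"
  shows "norm (heatC w s (shifted x s h)) \<le> 2 * exp (9/2) * s powr (-3/2) * exp (- ((norm x)\<^sup>2 / (16 * s)))"
proof -
  have "norm w \<le> 5/4" using norm_triangle_ineq[of "w - 1" 1] w by simp
  then have "norm w ^ 3 \<le> (5/4) ^ 3" by (intro power_mono) auto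
  then have w3: "norm w ^ 3 \<le> 2" by (simp add: power3_eq_cube)
  have "Re (csq (shifted x s h) * w\<^sup>2 / of_real (4 * s)) = Re (csq (shifted x s h) * w\<^sup>2) / (4 * s)"
    by (simp add: Re_divide_of_real del: of_real_mult)
  also have "\<dots> \<ge> ((norm x)\<^sup>2 / 4 - 18 * s\<^sup>2) / (4 * s)"
    using csq_shifted_bound[OF h w s(1)] s by (intro divide_right_mono) auto
  also have "((norm x)\<^sup>2 / 4 - 18 * s\<^sup>2) / (4 * s) = (norm x)\<^sup>2 / (16 * s) - 9/2 * s"
    using s by (simp add: field_simps power2_eq_square)
  finally have "- Re (csq (shifted x s h) * w\<^sup>2 / of_real (4 * s)) \<le> 9/2 + - ((norm x)\<^sup>2 / (16 * s))"
    using s by simp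
  then have ex: "norm (exp (- (csq (shifted x s h) * w\<^sup>2 / of_real (4 * s)))) \<le> exp (9/2) * exp (- ((norm x)\<^sup>2 / (16 * s)))"
    unfolding norm_exp_eq_Re exp_add[symmetric] by simp
  have p: "(4 * pi * s) powr (-3/2) \<le> s powr (-3/2)"
    using s pi_gt3 by (intro powr_mono2') auto
  have "norm (heatC w s (shifted x s h)) \<le> (s powr (-3/2) * 2) * (exp (9/2) * exp (- ((norm x)\<^sup>2 / (16 * s))))"
    unfolding heatC_def norm_mult norm_power norm_of_real
    using ex p w3 by (intro mult_mono) auto
  then show ?thesis by (simp add: mult_ac)
qed

text \<open>The three ingredients of the Oseen kernel on one power scale: 5/2 and 7/2 are the
  exponents (m + 1) / 2 for m = 4 and m = 6, and the exponential is compared with the slower of the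
  two.\<close>

lemma gauss_bounds:
  "\<exists>C>0. \<forall>R\<ge>0::real. exp (- (R / 16)) \<le> C * (1 + R) powr (-5/2) \<and>
     gauss_moment 4 (R / 16) \<le> C * (1 + R) powr (-5/2) \<and> gauss_moment 6 (R / 16) \<le> C * (1 + R) powr (-7/2)"
proof -
  have p: "(1 + R / 16) powr - k \<le> 16 powr k * (1 + R) powr - k" if "R \<ge> 0" "k \<ge> 0" for R k :: real
  proof -
    have "(1 + R / 16) powr - k \<le> ((1 + R) / 16) powr - k"
      using that by (intro powr_mono2') auto
    also have "\<dots> = 16 powr k * (1 + R) powr - k"
      using that by (simp add: powr_divide powr_minus field_simps)
    finally show ?thesis .
  qed
  define C where "C = Max {real 3 ^ 3 * 16 powr (5/2), real (4 + 4) ^ (4 + 4) * 16 powr (5/2), real (6 + 4) ^ (6 + 4) * 16 powr (7/2)}"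
  have C: "real 3 ^ 3 * 16 powr (5/2) \<le> C" "real (4 + 4) ^ (4 + 4) * 16 powr (5/2) \<le> C" "real (6 + 4) ^ (6 + 4) * 16 powr (7/2) \<le> C"
    unfolding C_def by (auto intro!: Max_ge simp del: of_nat_add)
  have st: "c * (1 + R / 16) powr - k \<le> C * (1 + R) powr - k" if "R \<ge> 0" "k \<ge> 0" "c * 16 powr k \<le> C" "c \<ge> 0" for c R k
  proof -
    have "c * (1 + R / 16) powr - k \<le> c * (16 powr k * (1 + R) powr - k)"
      using p that by (intro mult_left_mono) auto
    also have "\<dots> \<le> C * (1 + R) powr - k"
      unfolding mult.assoc[symmetric] using that by (intro mult_right_mono) auto
    finally show ?thesis .
  qed
  show ?thesis
  proof (intro exI[of _ C] conjI allI impI)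
    have "0 < real 3 ^ 3 * (16 powr (5/2) :: real)" by simp
    then show "C > 0" using C(1) by linarith
    fix R :: real assume R: "R \<ge> 0"
    have "exp (- (R / 16)) \<le> real 3 ^ 3 * (1 + R / 16) powr - (5/2)"
      using R by (intro exp_minus_le_powr) auto
    also have "\<dots> \<le> C * (1 + R) powr - (5/2)" using R C by (intro st) auto
    finally show "exp (- (R / 16)) \<le> C * (1 + R) powr (-5/2)" by simp
    have "gauss_moment 4 (R / 16) \<le> real (4 + 4) ^ (4 + 4) * (1 + R / 16) powr - ((real 4 + 1) / 2)"
      using R by (intro gauss_moment_decay) auto
    also have "\<dots> \<le> C * (1 + R) powr - (5/2)" using R C(2) st[of R "5/2" "real (4 + 4) ^ (4 + 4)"] by simp
    finally show "gauss_moment 4 (R / 16) \<le> C * (1 + R) powr (-5/2)" by simp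
    have "gauss_moment 6 (R / 16) \<le> real (6 + 4) ^ (6 + 4) * (1 + R / 16) powr - ((real 6 + 1) / 2)"
      using R by (intro gauss_moment_decay) auto
    also have "\<dots> \<le> C * (1 + R) powr - (7/2)" using R C(3) st[of R "7/2" "real (6 + 4) ^ (6 + 4)"] by simp
    finally show "gauss_moment 6 (R / 16) \<le> C * (1 + R) powr (-7/2)" by simp
  qed
qed

text \<open>The classical decay of the Oseen kernel, of order (sqrt s + |x|)^(-4), persists for
  complex parameters. With S = 1 + |x|^2 / s, each component of y is of order sqrt (s S), so the
  terms linear in y carry S to the power 1/2 - 5/2 and the cubic one 3/2 - 7/2; both are -2. The
  powers of s add up to -2 as well, and s S = s + |x|^2.\<close>

lemma oseenC_bound:
  "\<exists>C>0. \<forall>h w s x i j k. norm h \<le> 1 \<longrightarrow> norm (w - 1) \<le> 1/4 \<longrightarrow> 0 < s \<longrightarrow> s \<le> 1 \<longrightarrow>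
     norm (oseenC w s i j k (shifted x s h)) \<le> C * (s + (norm x)\<^sup>2) powr (-2)"
proof -
  obtain B :: real where B: "B > 0" "\<And>R::real. R \<ge> 0 \<Longrightarrow> exp (- (R / 16)) \<le> B * (1 + R) powr (-5/2)"
     "\<And>R::real. R \<ge> 0 \<Longrightarrow> gauss_moment 4 (R / 16) \<le> B * (1 + R) powr (-5/2)"
     "\<And>R::real. R \<ge> 0 \<Longrightarrow> gauss_moment 6 (R / 16) \<le> B * (1 + R) powr (-7/2)"
    using gauss_bounds by metis
  define E where "E = exp (9/2) * B"
  have E: "E > 0" using B by (simp add: E_def)
  have main: "norm (oseenC w s i j k (shifted x s h)) \<le> 16 * E * (s + (norm x)\<^sup>2) powr (-2)"
    if h: "norm h \<le> 1" and w: "norm (w - 1) \<le> 1/4" and s: "0 < s" "s \<le> 1" for h w s x i j k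
  proof -
    define R where "R = (norm x)\<^sup>2 / s"
    define S where "S = 1 + R"
    define y where "y = shifted x s h"
    define U where "U = csq y * w\<^sup>2 / of_real (4 * s)"
    have R: "R \<ge> 0" "S \<ge> 1" using s by (auto simp: R_def S_def)
    have "norm w \<le> 5/4" using norm_triangle_ineq[of "w - 1" 1] w by simp
    then have "norm w ^ 3 \<le> (5/4) ^ 3" "norm w ^ 2 \<le> (5/4) ^ 2" by (intro power_mono; simp)+
    then have w3: "norm w ^ 3 \<le> 2" and w2: "norm w ^ 2 \<le> 2" by (simp_all add: power3_eq_cube power2_eq_square)
    have "Re U = Re (csq y * w\<^sup>2) / (4 * s)"
      unfolding U_def by (simp add: Re_divide_of_real del: of_real_mult)
    also have "\<dots> \<ge> ((norm x)\<^sup>2 / 4 - 18 * s\<^sup>2) / (4 * s)"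
      using csq_shifted_bound[OF h w s(1)] s unfolding y_def by (intro divide_right_mono) auto
    also have "((norm x)\<^sup>2 / 4 - 18 * s\<^sup>2) / (4 * s) = R / 16 - 9/2 * s"
      using s by (simp add: field_simps power2_eq_square R_def)
    finally have U: "Re U \<ge> R / 16 - 9/2" using s by simp
    have "norm (exp (- U)) \<le> exp (9/2) * exp (- (R / 16))"
      using U unfolding norm_exp_eq_Re exp_add[symmetric] by simp
    also have "\<dots> \<le> exp (9/2) * (B * S powr (-5/2))"
      using B(2)[OF R(1)] by (intro mult_left_mono) (auto simp: S_def)
    finally have b0: "norm (exp (- U)) \<le> E * S powr (-5/2)" by (simp add: E_def mult_ac)
    have "norm (gauss_moment 4 U) \<le> exp (9/2) * gauss_moment 4 (R / 16)"
      using U by (intro norm_gauss_moment_le) auto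
    also have "\<dots> \<le> exp (9/2) * (B * S powr (-5/2))"
      using B(3)[OF R(1)] by (intro mult_left_mono) (auto simp: S_def)
    finally have b4: "norm (gauss_moment 4 U) \<le> E * S powr (-5/2)" by (simp add: E_def mult_ac)
    have "norm (gauss_moment 6 U) \<le> exp (9/2) * gauss_moment 6 (R / 16)"
      using U by (intro norm_gauss_moment_le) auto
    also have "\<dots> \<le> exp (9/2) * (B * S powr (-7/2))"
      using B(4)[OF R(1)] by (intro mult_left_mono) (auto simp: S_def)
    finally have b6: "norm (gauss_moment 6 U) \<le> E * S powr (-7/2)" by (simp add: E_def mult_ac)
    \<comment> \<open>A bound for |x| + s: the first summand is at most sqrt (s S), and s \<le> sqrt
      s because s \<le> 1.\<close>
    define L where "L = 2 * s powr (1/2) * S powr (1/2)"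
    have L: "norm (y $ i) \<le> L" for i
    proof -
      have "norm x = s powr (1/2) * R powr (1/2)"
        using s R by (simp add: R_def powr_half_sqrt real_sqrt_divide)
      also have "\<dots> \<le> s powr (1/2) * S powr (1/2)" using R by (intro mult_left_mono powr_mono2) (auto simp: S_def)
      finally have 1: "norm x \<le> s powr (1/2) * S powr (1/2)" .
      have "s = s powr 1" using s by simp
      also have "\<dots> \<le> s powr (1/2)" using s by (intro powr_mono') auto
      also have "\<dots> \<le> s powr (1/2) * S powr (1/2)" using R by (simp add: mult_le_cancel_left1 ge_one_powr_ge_zero)
      finally show ?thesis using norm_shifted_le[OF h s(1), of x i] 1 unfolding y_def L_def by simp
    qed
    have L0: "L \<ge> 0" by (simp add: L_def)
    have t0: "norm (- delta i k * y $ j / of_real (2 * s) * exp (- U)) \<le> L / (2 * s) * (E * S powr (-5/2))"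
    proof -
      have "norm (- delta i k * y $ j) \<le> L" using L[of j] L0 by (simp add: norm_mult)
      then have "norm (- delta i k * y $ j / of_real (2 * s)) \<le> L / (2 * s)"
        using s by (simp add: norm_divide norm_mult divide_right_mono del: mult_minus_left)
      then show ?thesis unfolding norm_mult[of _ "exp (- U)"] using s L0 by (intro mult_mono b0) auto
    qed
    have "norm (delta i k * y $ j + delta i j * y $ k + delta j k * y $ i) \<le> norm (y $ j) + norm (y $ k) + norm (y $ i)"
      by (intro norm_triangle_le add_mono) auto
    also have "\<dots> \<le> 3 * L" using L[of i] L[of j] L[of k] by simp
    finally have "norm ((delta i k * y $ j + delta i j * y $ k + delta j k * y $ i) / of_real (2 * s) * gauss_moment 4 U) \<le> 3 * L / (2 * s) * (E * S powr (-5/2))"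
    proof -
      assume *: "norm (delta i k * y $ j + delta i j * y $ k + delta j k * y $ i) \<le> 3 * L"
      then have "norm ((delta i k * y $ j + delta i j * y $ k + delta j k * y $ i) / of_real (2 * s)) \<le> 3 * L / (2 * s)"
        unfolding norm_divide norm_of_real using s by (simp only: abs_of_pos mult_pos_pos zero_less_numeral divide_right_mono less_imp_le)
      then show ?thesis unfolding norm_mult[of _ "gauss_moment 4 U"] using s L0 by (intro mult_mono b4) auto
    qed
    note t4 = this
    have "norm (y $ i) * norm (y $ j) * norm (y $ k) * (norm w)\<^sup>2 \<le> L * L * L * 2"
      using L w2 L0 by (intro mult_mono) auto
    then have t6: "norm (y $ i * y $ j * y $ k * w\<^sup>2 / of_real (4 * s\<^sup>2) * gauss_moment 6 U) \<le> L * L * L * 2 / (4 * s\<^sup>2) * (E * S powr (-7/2))"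
    proof -
      assume *: "norm (y $ i) * norm (y $ j) * norm (y $ k) * (norm w)\<^sup>2 \<le> L * L * L * 2"
      have a: "\<bar>4 * s\<^sup>2\<bar> = 4 * s\<^sup>2" by simp
      have "norm (y $ i * y $ j * y $ k * w\<^sup>2 / of_real (4 * s\<^sup>2)) \<le> L * L * L * 2 / (4 * s\<^sup>2)"
        unfolding norm_divide norm_of_real norm_mult norm_power a by (rule divide_right_mono[OF *]) simp
      then show ?thesis unfolding norm_mult[of _ "gauss_moment 6 U"] using s L0 by (intro mult_mono b6) auto
    qed
    have LS: "L / s * S powr (-5/2) = 2 * s powr (-1/2) * S powr (-2)"
    proof -
      have "s powr (1/2) / s = s powr (-1/2)" using s powr_diff[of s "1/2" 1] by simp
      moreover have "S powr (1/2) * S powr (-5/2) = S powr (-2)" using R by (simp flip: powr_add)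
      moreover have "L / s * S powr (-5/2) = 2 * (s powr (1/2) / s) * (S powr (1/2) * S powr (-5/2))"
        by (simp add: L_def)
      ultimately show ?thesis by simp
    qed
    have LLL: "L * L * L / s\<^sup>2 * S powr (-7/2) = 8 * s powr (-1/2) * S powr (-2)"
    proof -
      have "s powr (1/2) * s powr (1/2) * s powr (1/2) / s\<^sup>2 = s powr (-1/2)"
      proof -
        have "s powr (1/2) * s powr (1/2) * s powr (1/2) = s powr (3/2)"
          by (simp only: powr_add[symmetric]) simp
        then show ?thesis using s powr_diff[of s "3/2" 2] by simp
      qed
      moreover have "S powr (1/2) * S powr (1/2) * S powr (1/2) * S powr (-7/2) = S powr (-2)"
        by (simp only: powr_add[symmetric]) simp
      moreover have "L * L * L / s\<^sup>2 * S powr (-7/2) = 8 * (s powr (1/2) * s powr (1/2) * s powr (1/2) / s\<^sup>2) * (S powr (1/2) * S powr (1/2) * S powr (1/2) * S powr (-7/2))"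
        by (simp add: L_def)
      ultimately show ?thesis by simp
    qed
    have p: "(4 * pi * s) powr (-3/2) \<le> s powr (-3/2)"
      using s pi_gt3 by (intro powr_mono2') auto
    have "norm (- delta i k * y $ j / of_real (2 * s) * exp (- U)
      + (delta i k * y $ j + delta i j * y $ k + delta j k * y $ i) / of_real (2 * s) * gauss_moment 4 U
      - y $ i * y $ j * y $ k * w\<^sup>2 / of_real (4 * s\<^sup>2) * gauss_moment 6 U)
      \<le> L / (2 * s) * (E * S powr (-5/2)) + 3 * L / (2 * s) * (E * S powr (-5/2)) + L * L * L * 2 / (4 * s\<^sup>2) * (E * S powr (-7/2))"
      by (rule order_trans[OF norm_triangle_ineq4 add_mono[OF order_trans[OF norm_triangle_ineq add_mono[OF t0 t4]] t6]])
    also have "\<dots> = E * (2 * (L / s * S powr (-5/2)) + (L * L * L / s\<^sup>2 * S powr (-7/2)) / 2)"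
    proof -
      define a b where "a = L / s" and "b = L * L * L / s\<^sup>2"
      have eqs: "L / (2 * s) = a / 2" "3 * L / (2 * s) = 3 * a / 2" "L * L * L * 2 / (4 * s\<^sup>2) = b / 2"
        by (simp_all add: a_def b_def)
      show ?thesis unfolding eqs a_def[symmetric] b_def[symmetric] by (simp add: algebra_simps)
    qed
    also have "\<dots> = 8 * E * (s powr (-1/2) * S powr (-2))"
      unfolding LS LLL by simp
    finally have sum: "norm (- delta i k * y $ j / of_real (2 * s) * exp (- U)
      + (delta i k * y $ j + delta i j * y $ k + delta j k * y $ i) / of_real (2 * s) * gauss_moment 4 U
      - y $ i * y $ j * y $ k * w\<^sup>2 / of_real (4 * s\<^sup>2) * gauss_moment 6 U) \<le> 8 * E * (s powr (-1/2) * S powr (-2))" .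
    have "norm (oseenC w s i j k y) \<le> (s powr (-3/2) * 2) * (8 * E * (s powr (-1/2) * S powr (-2)))"
      unfolding oseenC_def norm_mult[of _ "_ + _ - _"] U_def[symmetric]
    proof (rule mult_mono[OF _ sum])
      show "norm (complex_of_real ((4 * pi * s) powr (-3/2)) * w ^ 3) \<le> s powr (-3/2) * 2"
        unfolding norm_mult norm_power norm_of_real using p w3 by (intro mult_mono) auto
    qed auto
    also have "\<dots> = 16 * E * (s powr (-3/2) * s powr (-1/2) * S powr (-2))" by simp
    also have "s powr (-3/2) * s powr (-1/2) = s powr (-2)" by (simp flip: powr_add)
    also have "s powr (-2) * S powr (-2) = (s + (norm x)\<^sup>2) powr (-2)"
    proof -
      have "s * S = s + (norm x)\<^sup>2" using s by (simp add: S_def R_def field_simps)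
      then show ?thesis using s R by (simp flip: powr_mult)
    qed
    finally show ?thesis by (simp add: y_def)
  qed
  show ?thesis
    by (intro exI[of _ "16 * E"] conjI allI impI main) (use E in auto)
qed

section \<open>Convolution estimates\<close>

lemma nn_integral_lborel_affine:
  fixes f :: "'a::euclidean_space \<Rightarrow> ennreal"
  assumes c: "c \<noteq> 0" and [measurable]: "f \<in> borel_measurable borel"
  shows "(\<integral>\<^sup>+x. f x \<partial>lborel) = ennreal (\<bar>c\<bar> ^ DIM('a)) * (\<integral>\<^sup>+x. f (t + c *\<^sub>R x) \<partial>lborel)"
  by (subst lborel_affine[OF c, of t]) (simp add: nn_integral_density nn_integral_distr nn_integral_cmult)

lemma nn_integral_lborel_reflect:
  fixes f :: "'a::euclidean_space \<Rightarrow> ennreal"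
  assumes [measurable]: "f \<in> borel_measurable borel"
  shows "(\<integral>\<^sup>+y. f (x - y) \<partial>lborel) = (\<integral>\<^sup>+y. f y \<partial>lborel)"
  using nn_integral_lborel_affine[of "-1" f x] by simp

lemma nn_integral_lborel_translate:
  fixes f :: "'a::euclidean_space \<Rightarrow> ennreal"
  assumes [measurable]: "f \<in> borel_measurable borel"
  shows "(\<integral>\<^sup>+x. f (x + y) \<partial>lborel) = (\<integral>\<^sup>+x. f x \<partial>lborel)"
  using nn_integral_lborel_affine[of "1" f y] by (simp add: add.commute)

lemma nn_integral_lborel_minus:
  fixes f :: "'a::euclidean_space \<Rightarrow> ennreal"
  assumes [measurable]: "f \<in> borel_measurable borel"
  shows "(\<integral>\<^sup>+x. f (x - y) \<partial>lborel) = (\<integral>\<^sup>+x. f x \<partial>lborel)"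
  using nn_integral_lborel_translate[of f "-y"] by simp

text \<open>No \<open>q\<close>-th root is taken: \<open>lq q f\<close> is the \<open>q\<close>-th power of the \<open>L\<^sub>q\<close> norm.\<close>

definition lq :: "real \<Rightarrow> (real^3 \<Rightarrow> ennreal) \<Rightarrow> ennreal" where
  "lq q f = (\<integral>\<^sup>+x. epow (f x) q \<partial>lborel)"

lemma lq_mono: "(\<And>x. f x \<le> g x) \<Longrightarrow> q \<ge> 0 \<Longrightarrow> lq q f \<le> lq q g"
  unfolding lq_def by (intro nn_integral_mono epow_mono) auto

lemma lq_add:
  assumes [measurable]: "f \<in> borel_measurable borel" "g \<in> borel_measurable borel" and "q > 0"
  shows "lq q (\<lambda>x. f x + g x) \<le> ennreal (2 powr q) * (lq q f + lq q g)"
proof -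
  have "lq q (\<lambda>x. f x + g x) \<le> (\<integral>\<^sup>+x. ennreal (2 powr q) * (epow (f x) q + epow (g x) q) \<partial>lborel)"
    unfolding lq_def using assms by (intro nn_integral_mono epow_add_le)
  also have "\<dots> = ennreal (2 powr q) * (lq q f + lq q g)"
    unfolding lq_def by (simp add: nn_integral_cmult nn_integral_add)
  finally show ?thesis .
qed

lemma lq_SUP:
  assumes [measurable]: "\<And>n. f n \<in> borel_measurable borel" and "\<And>n x. f n x \<le> f (Suc n) x" "q > 0"
  shows "lq q (\<lambda>x. SUP n. f n x) = (SUP n. lq q (f n))"
proof -
  have "incseq (\<lambda>n x. epow (f n x) q)"
    using assms(2,3) by (intro incseq_SucI) (auto simp: le_fun_def intro!: epow_mono)
  then show ?thesis
    unfolding lq_def using assms(3) by (simp add: epow_SUP nn_integral_monotone_convergence_SUP)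
qed

text \<open>The case of an integrable kernel: Jensen with weight K (x - y), then an exchange of the
  integrals.\<close>

lemma Young_convolution_weight:
  fixes f K :: "real^3 \<Rightarrow> ennreal"
  assumes q: "q > 1" and [measurable]: "f \<in> borel_measurable borel" "K \<in> borel_measurable borel"
  shows "lq q (\<lambda>x. \<integral>\<^sup>+y. K (x - y) * f y \<partial>lborel) \<le> epow (\<integral>\<^sup>+x. K x \<partial>lborel) q * lq q f"
proof -
  let ?m = "\<integral>\<^sup>+x. K x \<partial>lborel"
  have "lq q (\<lambda>x. \<integral>\<^sup>+y. K (x - y) * f y \<partial>lborel) \<le> (\<integral>\<^sup>+x. epow ?m (q - 1) * (\<integral>\<^sup>+y. K (x - y) * epow (f y) q \<partial>lborel) \<partial>lborel)"
    unfolding lq_def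
  proof (rule nn_integral_mono)
    fix x :: "real^3"
    have "epow (\<integral>\<^sup>+y. K (x - y) * f y \<partial>lborel) q \<le> epow (\<integral>\<^sup>+y. K (x - y) \<partial>lborel) (q - 1) * (\<integral>\<^sup>+y. K (x - y) * epow (f y) q \<partial>lborel)"
      by (rule nn_integral_weighted_power[OF q]) measurable
    then show "epow (\<integral>\<^sup>+y. K (x - y) * f y \<partial>lborel) q \<le> epow ?m (q - 1) * (\<integral>\<^sup>+y. K (x - y) * epow (f y) q \<partial>lborel)"
      by (simp add: nn_integral_lborel_reflect)
  qed
  also have "\<dots> = epow ?m (q - 1) * (\<integral>\<^sup>+x. (\<integral>\<^sup>+y. K (x - y) * epow (f y) q \<partial>lborel) \<partial>lborel)"
    by (rule nn_integral_cmult) measurable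
  also have "(\<integral>\<^sup>+x. (\<integral>\<^sup>+y. K (x - y) * epow (f y) q \<partial>lborel) \<partial>lborel) = (\<integral>\<^sup>+y. (\<integral>\<^sup>+x. K (x - y) * epow (f y) q \<partial>lborel) \<partial>lborel)"
    by (rule lborel_pair.Fubini') measurable
  also have "\<dots> = ?m * lq q f"
    by (simp add: nn_integral_multc nn_integral_cmult nn_integral_lborel_minus lq_def)
  finally show ?thesis
    using epow_add_exp[of ?m "q - 1" 1] by (simp add: mult.assoc[symmetric])
qed

text \<open>Young's inequality from L_r and L_(q/2) into L_q, applied to the square of f. In the
  pointwise estimate only the first factor depends on x, and integrating it over x produces the last
  missing \<open>lq r K\<close>.\<close>

lemma Young_convolution_square:
  fixes f K :: "real^3 \<Rightarrow> ennreal"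
  assumes q: "q > 2" and r: "r = q / (q - 1)" and [measurable]: "f \<in> borel_measurable borel" "K \<in> borel_measurable borel"
  shows "lq q (\<lambda>x. \<integral>\<^sup>+y. K (x - y) * (f y * f y) \<partial>lborel) \<le> epow (lq r K) (q - 1) * (lq q f * lq q f)"
proof -
  have "lq q (\<lambda>x. \<integral>\<^sup>+y. K (x - y) * (f y * f y) \<partial>lborel) \<le>
     (\<integral>\<^sup>+x. (\<integral>\<^sup>+y. epow (K (x - y)) r * epow (f y) q \<partial>lborel) * (lq q f * epow (lq r K) (q - 2)) \<partial>lborel)"
    unfolding lq_def[of q "\<lambda>x. \<integral>\<^sup>+y. _ x y \<partial>lborel"]
  proof (rule nn_integral_mono)
    fix x :: "real^3"
    have "epow (\<integral>\<^sup>+y. K (x - y) * (f y * f y) \<partial>lborel) q \<le> (\<integral>\<^sup>+y. epow (K (x - y)) r * epow (f y) q \<partial>lborel) * (\<integral>\<^sup>+y. epow (f y) q \<partial>lborel) * epow (\<integral>\<^sup>+y. epow (K (x - y)) r \<partial>lborel) (q - 2)"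
      by (rule nn_integral_kernel_square_power[OF q r]) measurable
    moreover have "(\<integral>\<^sup>+y. epow (K (x - y)) r \<partial>lborel) = lq r K"
      unfolding lq_def by (rule nn_integral_lborel_reflect[of "\<lambda>x. epow (K x) r"]) measurable
    ultimately show "epow (\<integral>\<^sup>+y. K (x - y) * (f y * f y) \<partial>lborel) q \<le> (\<integral>\<^sup>+y. epow (K (x - y)) r * epow (f y) q \<partial>lborel) * (lq q f * epow (lq r K) (q - 2))"
      by (simp add: mult.assoc lq_def[of q f])
  qed
  also have "\<dots> = (\<integral>\<^sup>+x. (\<integral>\<^sup>+y. epow (K (x - y)) r * epow (f y) q \<partial>lborel) \<partial>lborel) * (lq q f * epow (lq r K) (q - 2))"
    by (rule nn_integral_multc) measurable
  also have "(\<integral>\<^sup>+x. (\<integral>\<^sup>+y. epow (K (x - y)) r * epow (f y) q \<partial>lborel) \<partial>lborel) = (\<integral>\<^sup>+y. (\<integral>\<^sup>+x. epow (K (x - y)) r * epow (f y) q \<partial>lborel) \<partial>lborel)"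
    by (rule lborel_pair.Fubini') measurable
  also have "\<dots> = lq r K * lq q f"
    by (simp add: nn_integral_multc nn_integral_cmult nn_integral_lborel_minus[of "\<lambda>x. epow (K x) r"] lq_def)
  finally show ?thesis
    using epow_add_exp[of "lq r K" 1 "q - 2"] by (simp add: mult_ac)
qed

lemma nn_integral_powr_interval:
  assumes "t > 0" "\<alpha> > 0"
  shows "(\<integral>\<^sup>+s. indicator {0<..<t} s * ennreal ((t - s) powr (\<alpha> - 1)) \<partial>lborel) = ennreal (t powr \<alpha> / \<alpha>)"
proof -
  have "((\<lambda>s. s powr (\<alpha> - 1)) has_integral (t powr (\<alpha> - 1 + 1) / (\<alpha> - 1 + 1))) {0..t}"
    using assms by (intro has_integral_powr_from_0) auto
  then have I: "(\<integral>\<^sup>+s. indicator {0..t} s * ennreal (s powr (\<alpha> - 1)) \<partial>lborel) = ennreal (t powr \<alpha> / \<alpha>)"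
  proof -
    have "(\<lambda>s. indicator {0..t} s * ennreal (s powr (\<alpha> - 1))) = (\<lambda>s. ennreal (indicator {0..t} s * s powr (\<alpha> - 1)))"
      by (auto split: split_indicator)
    then show ?thesis
      using nn_integral_has_integral_lebesgue[of "{0..t}" "\<lambda>s. s powr (\<alpha> - 1)", OF _ \<open>(_ has_integral _) _\<close>] by simp
  qed
  have "(\<integral>\<^sup>+s. indicator {0<..<t} s * ennreal ((t - s) powr (\<alpha> - 1)) \<partial>lborel) =
      (\<integral>\<^sup>+s. indicator {0<..<t} (t - s) * ennreal ((t - (t - s)) powr (\<alpha> - 1)) \<partial>lborel)"
    by (rule nn_integral_lborel_reflect[symmetric]) measurable
  also have "\<dots> = (\<integral>\<^sup>+s. indicator {0..t} s * ennreal (s powr (\<alpha> - 1)) \<partial>lborel)"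
  proof (rule nn_integral_cong_AE)
    have "AE s in lborel. s \<noteq> 0" "AE s in lborel. s \<noteq> t" by (rule AE_lborel_singleton)+
    then show "AE s in lborel. indicator {0<..<t} (t - s) * ennreal ((t - (t - s)) powr (\<alpha> - 1)) = indicator {0..t} s * ennreal (s powr (\<alpha> - 1))"
      by eventually_elim (auto split: split_indicator)
  qed
  finally show ?thesis using I by simp
qed

text \<open>Plays the role of Minkowski's inequality for the integral over s. Jensen's inequality
  with the weight \<open>(t - s) powr (\<alpha> - 1)\<close> gives the same bound for a power-law
  majorant while staying with q-th powers; \<open>c\<close> is the reciprocal of that
  weight.\<close>

lemma lq_time_integral:
  fixes g :: "real \<Rightarrow> real^3 \<Rightarrow> ennreal"
  assumes q: "q > 1" and t: "t > 0" and \<alpha>: "\<alpha> > 0"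
    and [measurable]: "(\<lambda>(s, x). g s x) \<in> borel_measurable (lborel \<Otimes>\<^sub>M lborel)"
    and g: "\<And>s. 0 < s \<Longrightarrow> s < t \<Longrightarrow> lq q (g s) \<le> C * ennreal ((t - s) powr (q * (\<alpha> - 1)))"
  shows "lq q (\<lambda>x. \<integral>\<^sup>+s. indicator {0<..<t} s * g s x \<partial>lborel) \<le> C * ennreal ((t powr \<alpha> / \<alpha>) powr q)"
proof -
  define b :: "real \<Rightarrow> ennreal" where "b s = indicator {0<..<t} s * ennreal ((t - s) powr (\<alpha> - 1))" for s
  define c :: "real \<Rightarrow> ennreal" where "c s = ennreal ((t - s) powr (1 - \<alpha>))" for s
  have [measurable]: "b \<in> borel_measurable borel" "c \<in> borel_measurable borel"
    unfolding b_def c_def by measurable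
  have gm[measurable]: "(\<lambda>x. g s x) \<in> borel_measurable borel" for s
  proof -
    have "(\<lambda>x. (\<lambda>(s, x). g s x) (s, x)) \<in> borel_measurable lborel" by measurable
    then show ?thesis by simp
  qed
  have Ib: "(\<integral>\<^sup>+s. b s \<partial>lborel) = ennreal (t powr \<alpha> / \<alpha>)"
    unfolding b_def by (rule nn_integral_powr_interval[OF t \<alpha>])
  have bc: "indicator {0<..<t} s * g s x = b s * (c s * g s x)" for s x
    by (auto simp: b_def c_def mult.assoc[symmetric] simp flip: ennreal_mult powr_add split: split_indicator)
  have "lq q (\<lambda>x. \<integral>\<^sup>+s. indicator {0<..<t} s * g s x \<partial>lborel) \<le>
     (\<integral>\<^sup>+x. epow (\<integral>\<^sup>+s. b s \<partial>lborel) (q - 1) * (\<integral>\<^sup>+s. b s * epow (c s * g s x) q \<partial>lborel) \<partial>lborel)"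
    unfolding lq_def bc
  proof (intro nn_integral_mono nn_integral_weighted_power[OF q])
    fix x :: "real^3"
    have "(\<lambda>s. (\<lambda>(s, x). g s x) (s, x)) \<in> borel_measurable lborel" by measurable
    then have [measurable]: "(\<lambda>s. g s x) \<in> borel_measurable borel" by simp
    show "(\<lambda>s. c s * g s x) \<in> borel_measurable lborel" by measurable
  qed measurable
  also have "\<dots> = epow (\<integral>\<^sup>+s. b s \<partial>lborel) (q - 1) * (\<integral>\<^sup>+x. (\<integral>\<^sup>+s. b s * epow (c s * g s x) q \<partial>lborel) \<partial>lborel)"
    by (rule nn_integral_cmult) measurable
  also have "(\<integral>\<^sup>+x. (\<integral>\<^sup>+s. b s * epow (c s * g s x) q \<partial>lborel) \<partial>lborel) = (\<integral>\<^sup>+s. (\<integral>\<^sup>+x. b s * epow (c s * g s x) q \<partial>lborel) \<partial>lborel)"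
    by (rule lborel_pair.Fubini') measurable
  also have "\<dots> \<le> (\<integral>\<^sup>+s. b s * C \<partial>lborel)"
  proof (rule nn_integral_mono)
    fix s
    show "(\<integral>\<^sup>+x. b s * epow (c s * g s x) q \<partial>lborel) \<le> b s * C"
    proof (cases "0 < s \<and> s < t")
      case True
      have "(\<integral>\<^sup>+x. b s * epow (c s * g s x) q \<partial>lborel) = b s * (epow (c s) q * lq q (g s))"
        by (simp add: epow_mult nn_integral_cmult lq_def)
      also have "\<dots> \<le> b s * (epow (c s) q * (C * ennreal ((t - s) powr (q * (\<alpha> - 1)))))"
        using True by (intro mult_left_mono g) auto
      also have "epow (c s) q * (C * ennreal ((t - s) powr (q * (\<alpha> - 1)))) = C * (ennreal ((t - s) powr ((1 - \<alpha>) * q)) * ennreal ((t - s) powr (q * (\<alpha> - 1))))"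
        by (simp add: c_def epow_ennreal powr_powr mult_ac)
      also have "ennreal ((t - s) powr ((1 - \<alpha>) * q)) * ennreal ((t - s) powr (q * (\<alpha> - 1))) = 1"
      proof -
        have "(1 - \<alpha>) * q + q * (\<alpha> - 1) = 0" by (simp add: algebra_simps)
        then show ?thesis using True by (simp flip: ennreal_mult powr_add)
      qed
      finally show ?thesis by simp
    qed (simp add: b_def)
  qed
  also have "\<dots> = (\<integral>\<^sup>+s. b s \<partial>lborel) * C" by (rule nn_integral_multc) measurable
  finally have "lq q (\<lambda>x. \<integral>\<^sup>+s. indicator {0<..<t} s * g s x \<partial>lborel) \<le>
      epow (\<integral>\<^sup>+s. b s \<partial>lborel) (q - 1) * ((\<integral>\<^sup>+s. b s \<partial>lborel) * C)"
    by (simp add: mult_left_mono)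
  also have "\<dots> = C * epow (\<integral>\<^sup>+s. b s \<partial>lborel) q"
    using epow_add_exp[of "\<integral>\<^sup>+s. b s \<partial>lborel" "q - 1" 1] by (simp add: mult_ac)
  also have "epow (\<integral>\<^sup>+s. b s \<partial>lborel) q = ennreal ((t powr \<alpha> / \<alpha>) powr q)"
    unfolding Ib using \<alpha> by (intro epow_ennreal) auto
  finally show ?thesis .
qed

definition gauss_majorant :: "real \<Rightarrow> real \<Rightarrow> real^3 \<Rightarrow> ennreal" where
  "gauss_majorant c t x = ennreal (c * t powr (-3/2) * exp (- ((norm x)\<^sup>2 / (16 * t))))"

definition oseen_majorant :: "real \<Rightarrow> real \<Rightarrow> real^3 \<Rightarrow> ennreal" where
  "oseen_majorant c s x = ennreal (c * (s + (norm x)\<^sup>2) powr (-2))"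

lemma gauss_majorant_measurable [measurable (raw)]:
  assumes "f \<in> borel_measurable M" "g \<in> borel_measurable M"
  shows "(\<lambda>x. gauss_majorant c (f x) (g x)) \<in> borel_measurable M"
  unfolding gauss_majorant_def using assms by measurable

lemma oseen_majorant_measurable [measurable (raw)]:
  assumes "f \<in> borel_measurable M" "g \<in> borel_measurable M"
  shows "(\<lambda>x. oseen_majorant c (f x) (g x)) \<in> borel_measurable M"
  unfolding oseen_majorant_def using assms by measurable

lemma nn_integral_gauss_majorant:
  assumes t: "t > 0" and c: "c \<ge> 0"
  shows "(\<integral>\<^sup>+x. gauss_majorant c t x \<partial>lborel) = ennreal (c * (16 * pi) powr (3/2))"
proof -
  have l: "1 / (16 * t) > 0" using t by simp
  have i: "integrable lborel (\<lambda>x::real^3. exp (- (1 / (16 * t)) * (norm x)\<^sup>2))"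
    by (rule integrable_gauss3_real[OF l])
  have "of_real (\<integral>x. exp (- (1 / (16 * t)) * (norm (x::real^3))\<^sup>2) \<partial>lborel) = (of_real (sqrt (pi / (1 / (16 * t))) ^ 3) :: complex)"
    using integral_gauss3_0[OF l, of 0] by (simp flip: integral_of_real)
  then have e: "(\<integral>x. exp (- (1 / (16 * t)) * (norm (x::real^3))\<^sup>2) \<partial>lborel) = sqrt (pi / (1 / (16 * t))) ^ 3"
    by (simp only: of_real_eq_iff)
  have "sqrt (pi / (1 / (16 * t))) ^ 3 = (16 * pi * t) powr (3/2)"
    using t by (subst sqrt_cube_powr) (auto simp: mult_ac)
  also have "\<dots> = (16 * pi) powr (3/2) * t powr (3/2)" using t by (simp add: powr_mult)
  finally have s: "c * t powr (-3/2) * sqrt (pi / (1 / (16 * t))) ^ 3 = c * (16 * pi) powr (3/2)"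
    using t by (simp add: powr_minus field_simps)
  have "(\<integral>\<^sup>+x. gauss_majorant c t x \<partial>lborel) = (\<integral>\<^sup>+x. ennreal (c * t powr (-3/2) * exp (- (1 / (16 * t)) * (norm (x::real^3))\<^sup>2)) \<partial>lborel)"
    by (simp add: gauss_majorant_def)
  also have "\<dots> = ennreal (\<integral>x. c * t powr (-3/2) * exp (- (1 / (16 * t)) * (norm (x::real^3))\<^sup>2) \<partial>lborel)"
    using i c by (intro nn_integral_eq_integral integrable_mult_right) auto
  also have "(\<integral>x. c * t powr (-3/2) * exp (- (1 / (16 * t)) * (norm (x::real^3))\<^sup>2) \<partial>lborel) = c * (16 * pi) powr (3/2)"
    unfolding integral_mult_right_zero e s by simp
  finally show ?thesis .
qed

lemma nn_integral_decay_1d: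
  assumes p: "p > 1/2"
  shows "(\<integral>\<^sup>+t. ennreal ((1 + t\<^sup>2) powr - p) \<partial>lborel) < \<infinity>"
proof -
  let ?f = "\<lambda>t::real. ennreal ((1 + t\<^sup>2) powr - p)"
  have half: "(\<integral>\<^sup>+t. ?f t * indicator {0..} t \<partial>lborel) < \<infinity>"
  proof -
    have "(\<integral>\<^sup>+t. ?f t * indicator {0..} t \<partial>lborel) \<le> (\<integral>\<^sup>+t. ennreal (2 powr p) * (ennreal ((1 + t) powr (- (2 * p))) * indicator {0..} t) \<partial>lborel)"
    proof (rule nn_integral_mono)
      fix t :: real
      show "?f t * indicator {0..} t \<le> ennreal (2 powr p) * (ennreal ((1 + t) powr (- (2 * p))) * indicator {0..} t)"
      proof (cases "t \<ge> 0")
        case True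
        have "(1 + t)\<^sup>2 \<le> 2 * (1 + t\<^sup>2)" using sum_squares_bound[of 1 t] by (simp add: power2_sum)
        then have "(1 + t\<^sup>2) powr - p \<le> ((1 + t)\<^sup>2 / 2) powr - p" using True p by (intro powr_mono2') auto
        also have "\<dots> = 2 powr p * ((1 + t)\<^sup>2) powr - p" using True by (simp add: powr_divide powr_minus field_simps)
        also have "((1 + t)\<^sup>2) powr - p = (1 + t) powr (- (2 * p))"
          using True by (simp add: powr_powr flip: powr_numeral)
        finally show ?thesis using True by (simp add: ennreal_leI flip: ennreal_mult)
      qed simp
    qed
    also have "\<dots> = ennreal (2 powr p) * (\<integral>\<^sup>+t. ennreal ((1 + t) powr (- (2 * p))) * indicator {0..} t \<partial>lborel)"
      by (rule nn_integral_cmult) measurable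
    also have "(\<integral>\<^sup>+t. ennreal ((1 + t) powr (- (2 * p))) * indicator {0..} t \<partial>lborel) = ennreal (0 - (1 + 0) powr (1 - 2 * p) / (1 - 2 * p))"
    proof (rule nn_integral_FTC_atLeast)
      show "((\<lambda>t. (1 + t) powr (1 - 2 * p) / (1 - 2 * p)) has_real_derivative (1 + t) powr (- (2 * p))) (at t)" if "0 \<le> t" for t
      proof -
        have "((\<lambda>t. (1 + t) powr (1 - 2 * p)) has_real_derivative (1 - 2 * p) * (1 + t) powr (1 - 2 * p - 1)) (at t)"
          using that by (auto intro!: derivative_eq_intros)
        from DERIV_cdivide[OF this, of "1 - 2 * p"] show ?thesis using p by simp
      qed
      have "((\<lambda>t. (1 + t) powr (1 - 2 * p)) \<longlongrightarrow> 0) at_top"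
        using p by (intro tendsto_neg_powr filterlim_tendsto_add_at_top[OF tendsto_const filterlim_ident]) auto
      then show "((\<lambda>t. (1 + t) powr (1 - 2 * p) / (1 - 2 * p)) \<longlongrightarrow> 0) at_top"
        using tendsto_divide_zero by blast
    qed auto
    finally show ?thesis by (auto simp: ennreal_mult_less_top elim!: le_less_trans)
  qed
  have "(\<integral>\<^sup>+t. ?f t \<partial>lborel) \<le> (\<integral>\<^sup>+t. ?f t * indicator {0..} t + ?f (0 - t) * indicator {0..} (0 - t) \<partial>lborel)"
    by (intro nn_integral_mono) (auto split: split_indicator)
  also have "\<dots> = (\<integral>\<^sup>+t. ?f t * indicator {0..} t \<partial>lborel) + (\<integral>\<^sup>+t. ?f (0 - t) * indicator {0..} (0 - t) \<partial>lborel)"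
    by (rule nn_integral_add) measurable
  also have "(\<integral>\<^sup>+t. ?f (0 - t) * indicator {0..} (0 - t) \<partial>lborel) = (\<integral>\<^sup>+t. ?f t * indicator {0..} t \<partial>lborel)"
    by (rule nn_integral_lborel_reflect) measurable
  also have "(\<integral>\<^sup>+t. ?f t * indicator {0..} t \<partial>lborel) + (\<integral>\<^sup>+t. ?f t * indicator {0..} t \<partial>lborel) < \<infinity>"
    using half by simp
  finally show ?thesis .
qed

text \<open>Each coordinate is at most the norm, so a third of the power can be given to each of the
  three coordinates, and the integral is bounded by a product of one-dimensional ones. They converge
  since 2 r / 3 > 1/2.\<close>

lemma nn_integral_decay_3d:
  assumes r: "r \<ge> 1"
  shows "(\<integral>\<^sup>+x. ennreal ((1 + (norm (x::real^3))\<^sup>2) powr - (2 * r)) \<partial>lborel) < \<infinity>"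
proof -
  let ?g = "\<lambda>t::real. (1 + t\<^sup>2) powr - (2 * r / 3)"
  have "(\<integral>\<^sup>+x. ennreal ((1 + (norm (x::real^3))\<^sup>2) powr - (2 * r)) \<partial>lborel) \<le> (\<integral>\<^sup>+x. (\<Prod>b\<in>Basis. ennreal (?g ((x::real^3) \<bullet> b))) \<partial>lborel)"
  proof (rule nn_integral_mono)
    fix x :: "real^3"
    have "?g (x \<bullet> b) \<ge> (1 + (norm x)\<^sup>2) powr - (2 * r / 3)" if "b \<in> Basis" for b
    proof -
      have "\<bar>x \<bullet> b\<bar>\<^sup>2 \<le> (norm x)\<^sup>2" using Basis_le_norm[OF that, of x] by (intro power_mono) auto
      then show ?thesis using r by (intro powr_mono2') (auto intro: add_pos_nonneg)
    qed
    then have "(\<Prod>b\<in>(Basis :: (real^3) set). (1 + (norm x)\<^sup>2) powr - (2 * r / 3)) \<le> (\<Prod>b\<in>Basis. ?g (x \<bullet> b))"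
      by (intro prod_mono) auto
    moreover have "(\<Prod>b\<in>(Basis :: (real^3) set). (1 + (norm x)\<^sup>2) powr - (2 * r / 3)) = (1 + (norm x)\<^sup>2) powr - (2 * r)"
    proof -
      have pos: "1 + (norm x)\<^sup>2 > 0" by (simp add: add_pos_nonneg)
      have "((1 + (norm x)\<^sup>2) powr - (2 * r / 3)) ^ 3 = ((1 + (norm x)\<^sup>2) powr - (2 * r / 3)) powr 3"
        using pos by (subst powr_numeral) auto
      then show ?thesis using pos by (simp add: powr_powr)
    qed
    ultimately show "ennreal ((1 + (norm x)\<^sup>2) powr - (2 * r)) \<le> (\<Prod>b\<in>Basis. ennreal (?g (x \<bullet> b)))"
      by (subst prod_ennreal) (auto intro!: ennreal_leI)
  qed
  also have "\<dots> = (\<Prod>b\<in>(Basis :: (real^3) set). (\<integral>\<^sup>+t. ennreal (?g t) \<partial>lborel))"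
    by (rule nn_integral_lborel_prod) auto
  also have "\<dots> < \<infinity>"
    using nn_integral_decay_1d[of "2 * r / 3"] r by (simp add: power_less_top_ennreal)
  finally show ?thesis .
qed

text \<open>The substitution of sqrt s x for x: 3/2 is the power from the volume element, - 2 r the
  one from the kernel.\<close>

lemma lq_oseen_majorant:
  assumes r: "r \<ge> 1" and c: "c \<ge> 0"
  shows "\<exists>K\<ge>0. \<forall>s>0. lq r (oseen_majorant c s) = ennreal (K * s powr (3/2 - 2 * r))"
proof -
  define J where "J = enn2real (\<integral>\<^sup>+x. ennreal ((1 + (norm (x::real^3))\<^sup>2) powr - (2 * r)) \<partial>lborel)"
  have J: "(\<integral>\<^sup>+x. ennreal ((1 + (norm (x::real^3))\<^sup>2) powr - (2 * r)) \<partial>lborel) = ennreal J"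
    using nn_integral_decay_3d[OF r] by (simp add: J_def less_top)
  have "lq r (oseen_majorant c s) = ennreal (c powr r * J * s powr (3/2 - 2 * r))" if s: "s > 0" for s
  proof -
    have pos: "1 + (norm x)\<^sup>2 > 0" for x :: "real^3" by (simp add: add_pos_nonneg)
    have "lq r (oseen_majorant c s) = ennreal (\<bar>sqrt s\<bar> ^ DIM(real^3)) * (\<integral>\<^sup>+x. epow (oseen_majorant c s (0 + sqrt s *\<^sub>R x)) r \<partial>lborel)"
      unfolding lq_def using s by (intro nn_integral_lborel_affine) auto
    also have "(\<integral>\<^sup>+x. epow (oseen_majorant c s (0 + sqrt s *\<^sub>R x)) r \<partial>lborel) =
       (\<integral>\<^sup>+x. ennreal (c powr r * s powr - (2 * r)) * ennreal ((1 + (norm (x::real^3))\<^sup>2) powr - (2 * r)) \<partial>lborel)"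
    proof (rule nn_integral_cong)
      fix x :: "real^3"
      have "s + (norm (0 + sqrt s *\<^sub>R x))\<^sup>2 = s * (1 + (norm x)\<^sup>2)"
        using s by (simp add: power_mult_distrib algebra_simps)
      then have "(c * (s + (norm (0 + sqrt s *\<^sub>R x))\<^sup>2) powr (-2)) powr r = c powr r * s powr - (2 * r) * (1 + (norm x)\<^sup>2) powr - (2 * r)"
        using s c pos[of x] by (simp add: powr_mult powr_powr)
      then show "epow (oseen_majorant c s (0 + sqrt s *\<^sub>R x)) r = ennreal (c powr r * s powr - (2 * r)) * ennreal ((1 + (norm x)\<^sup>2) powr - (2 * r))"
        using c by (simp add: oseen_majorant_def epow_ennreal flip: ennreal_mult)
    qed
    also have "\<dots> = ennreal (c powr r * s powr - (2 * r)) * ennreal J"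
      by (subst nn_integral_cmult) (auto simp: J)
    also have "ennreal (\<bar>sqrt s\<bar> ^ DIM(real^3)) * (ennreal (c powr r * s powr - (2 * r)) * ennreal J) = ennreal (s powr (3/2) * (c powr r * s powr - (2 * r) * J))"
      using s by (simp add: sqrt_cube_powr J_def flip: ennreal_mult)
    also have "s powr (3/2) * (c powr r * s powr - (2 * r) * J) = c powr r * J * (s powr (3/2) * s powr - (2 * r))" by simp
    also have "s powr (3/2) * s powr - (2 * r) = s powr (3/2 - 2 * r)" using s by (simp flip: powr_add)
    finally show ?thesis .
  qed
  then show ?thesis by (intro exI[of _ "c powr r * J"]) (auto simp: J_def)
qed

section \<open>The complexified integral equation\<close>

lemma borel_measurable_fst_snd [measurable]:
  "fst \<in> borel_measurable (borel :: ('a::second_countable_topology \<times> 'b::second_countable_topology) measure)"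
  "snd \<in> borel_measurable (borel :: ('a::second_countable_topology \<times> 'b::second_countable_topology) measure)"
  by (auto intro!: borel_measurable_continuous_onI continuous_intros)

lemma Pair_borel_measurable [measurable]:
  "Pair t \<in> borel_measurable (borel :: 'b::second_countable_topology measure)"
  by (intro borel_measurable_continuous_onI continuous_intros)

lemma nn_integral_lborel_pair:
  fixes f :: "'a::euclidean_space \<times> 'b::euclidean_space \<Rightarrow> ennreal"
  assumes "f \<in> borel_measurable borel"
  shows "(\<integral>\<^sup>+z. f z \<partial>lborel) = (\<integral>\<^sup>+s. \<integral>\<^sup>+y. f (s, y) \<partial>lborel \<partial>lborel)"
  using lborel.nn_integral_fst[of f lborel] assms by (simp add: lborel_prod)

text \<open>The value \<open>\<infinity>\<close> outside \<open>(0, 1)\<close> removes these times from all statements about points where the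
  majorant is finite.\<close>

definition beta_majorant :: "real \<Rightarrow> (real^3 \<Rightarrow> real^3) \<Rightarrow> real \<times> (real^3) \<Rightarrow> ennreal" where
  "beta_majorant c a \<xi> = (if 0 < fst \<xi> \<and> fst \<xi> < 1
     then \<integral>\<^sup>+y. gauss_majorant c (fst \<xi>) (snd \<xi> - y) * ennreal (norm (a y)) \<partial>lborel else \<infinity>)"

definition kappa_majorant :: "real \<Rightarrow> real \<times> (real^3) \<Rightarrow> real \<times> (real^3) \<Rightarrow> ennreal" where
  "kappa_majorant c \<xi> \<eta> = (if 0 < fst \<eta> \<and> fst \<eta> < fst \<xi>
     then oseen_majorant c (fst \<xi> - fst \<eta>) (snd \<xi> - snd \<eta>) else 0)"

lemma majorant_kernel_heat:
  assumes [measurable]: "a \<in> borel_measurable borel"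
  shows "majorant_kernel lborel (beta_majorant c a) (kappa_majorant c')"
proof
  show "beta_majorant c a \<in> borel_measurable lborel"
    unfolding beta_majorant_def[abs_def] by measurable
  show "(\<lambda>(\<xi>, \<eta>). kappa_majorant c' \<xi> \<eta>) \<in> borel_measurable (lborel \<Otimes>\<^sub>M lborel)"
    unfolding kappa_majorant_def[abs_def] split_beta by measurable
qed

text \<open>The power of \<open>t\<close> gained by the Duhamel term in \<open>L\<^sub>q\<close>; it equals \<open>1 / p\<close> when \<open>2 / p + 3 / q = 1\<close>.\<close>

abbreviation "gain q \<equiv> 1 / 2 - 3 / (2 * q)"

lemma gain_pos: "q > 3 \<Longrightarrow> gain q > (0::real)"
  by (simp add: field_simps)

text \<open>The bilinear estimate in L_q. Young's inequality in space gives a singularity of order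
  \<open>(t - s) powr (gain q - 1)\<close> in time, integrable because q > 3, and the time integral
  turns it into \<open>t powr gain q\<close>. K depends on q and c alone.\<close>

lemma kappa_square_bound:
  assumes q: "q > 3" and c: "c \<ge> 0"
  shows "\<exists>K\<ge>0. \<forall>w M t. w \<in> borel_measurable borel \<longrightarrow> t > 0 \<longrightarrow> (\<forall>s. 0 < s \<longrightarrow> s < t \<longrightarrow> lq q (\<lambda>y. w (s, y)) \<le> M) \<longrightarrow>
     lq q (\<lambda>x. \<integral>\<^sup>+\<eta>. kappa_majorant c (t, x) \<eta> * (w \<eta> * w \<eta>) \<partial>lborel) \<le> ennreal (K * t powr (gain q * q)) * (M * M)"
proof -
  define r where "r = q / (q - 1)"
  define \<alpha> where "\<alpha> = gain q"
  have \<alpha>: "\<alpha> > 0" using gain_pos[OF q] by (simp add: \<alpha>_def)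
  have r: "r \<ge> 1" using q by (simp add: r_def)
  obtain K0 where K0: "K0 \<ge> 0" "\<And>s. s > 0 \<Longrightarrow> lq r (oseen_majorant c s) = ennreal (K0 * s powr (3/2 - 2 * r))"
    using lq_oseen_majorant[OF r c] by auto
  define K where "K = K0 powr (q - 1) * (1 / \<alpha>) powr q"
  have "lq q (\<lambda>x. \<integral>\<^sup>+\<eta>. kappa_majorant c (t, x) \<eta> * (w \<eta> * w \<eta>) \<partial>lborel) \<le> ennreal (K * t powr (\<alpha> * q)) * (M * M)"
    if w[measurable]: "w \<in> borel_measurable borel" and t: "t > 0" and M: "\<And>s. 0 < s \<Longrightarrow> s < t \<Longrightarrow> lq q (\<lambda>y. w (s, y)) \<le> M" for w M t
  proof -
    define g where "g s x = (\<integral>\<^sup>+y. oseen_majorant c (t - s) (x - y) * (w (s, y) * w (s, y)) \<partial>lborel)" for s x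
    have [measurable]: "(\<lambda>y. w (s, y)) \<in> borel_measurable borel" for s
      by measurable
    have [measurable]: "w \<in> borel_measurable (borel \<Otimes>\<^sub>M borel)" using w by (simp add: borel_prod)
    have eq: "(\<integral>\<^sup>+\<eta>. kappa_majorant c (t, x) \<eta> * (w \<eta> * w \<eta>) \<partial>lborel) = (\<integral>\<^sup>+s. indicator {0<..<t} s * g s x \<partial>lborel)" for x
    proof -
      have "(\<lambda>\<eta>. kappa_majorant c (t, x) \<eta> * (w \<eta> * w \<eta>)) \<in> borel_measurable borel"
        unfolding kappa_majorant_def by measurable
      then have "(\<integral>\<^sup>+\<eta>. kappa_majorant c (t, x) \<eta> * (w \<eta> * w \<eta>) \<partial>lborel) = (\<integral>\<^sup>+s. \<integral>\<^sup>+y. kappa_majorant c (t, x) (s, y) * (w (s, y) * w (s, y)) \<partial>lborel \<partial>lborel)"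
        by (rule nn_integral_lborel_pair)
      also have "\<dots> = (\<integral>\<^sup>+s. indicator {0<..<t} s * g s x \<partial>lborel)"
        by (intro nn_integral_cong) (auto simp: kappa_majorant_def g_def split: split_indicator)
      finally show ?thesis .
    qed
    \<comment> \<open>This identity is the origin of \<open>gain q\<close>: it matches the time
      power of the Oseen kernel in L_r with the form expected by
      \<open>lq_time_integral\<close>.\<close>
    have e: "(3/2 - 2 * r) * (q - 1) = q * (\<alpha> - 1)"
      using q by (simp add: r_def \<alpha>_def field_simps)
    have "lq q (g s) \<le> (ennreal (K0 powr (q - 1)) * (M * M)) * ennreal ((t - s) powr (q * (\<alpha> - 1)))" if s: "0 < s" "s < t" for s
    proof -
      have "lq q (g s) \<le> epow (lq r (oseen_majorant c (t - s))) (q - 1) * (lq q (\<lambda>y. w (s, y)) * lq q (\<lambda>y. w (s, y)))"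
        unfolding g_def using q r_def by (intro Young_convolution_square) auto
      also have "epow (lq r (oseen_majorant c (t - s))) (q - 1) = ennreal (K0 powr (q - 1)) * ennreal ((t - s) powr (q * (\<alpha> - 1)))"
        using s K0 by (simp add: epow_ennreal powr_mult powr_powr e flip: ennreal_mult)
      also have "\<dots> * (lq q (\<lambda>y. w (s, y)) * lq q (\<lambda>y. w (s, y))) \<le> \<dots> * (M * M)"
        using M[OF s] by (intro mult_left_mono mult_mono) auto
      finally show ?thesis by (simp add: mult_ac)
    qed
    moreover have "(\<lambda>(s, x). g s x) \<in> borel_measurable (lborel \<Otimes>\<^sub>M lborel)"
      unfolding g_def split_beta by measurable
    ultimately have "lq q (\<lambda>x. \<integral>\<^sup>+s. indicator {0<..<t} s * g s x \<partial>lborel) \<le> (ennreal (K0 powr (q - 1)) * (M * M)) * ennreal ((t powr \<alpha> / \<alpha>) powr q)"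
      using q t \<alpha> by (intro lq_time_integral) auto
    also have "(t powr \<alpha> / \<alpha>) powr q = (1 / \<alpha>) powr q * t powr (\<alpha> * q)"
      using t \<alpha> by (simp add: powr_divide powr_powr)
    finally show ?thesis
      unfolding eq K_def by (simp add: ennreal_mult mult_ac)
  qed
  then show ?thesis
    unfolding \<alpha>_def by (intro exI[of _ K]) (auto simp: K_def)
qed

lemma beta_majorant_bound:
  assumes q: "q > 1" and c: "c \<ge> 0" and [measurable]: "a \<in> borel_measurable borel" and t: "0 < t" "t < 1"
  shows "lq q (\<lambda>x. beta_majorant c a (t, x)) \<le> ennreal ((c * (16 * pi) powr (3/2)) powr q) * lq q (\<lambda>y. ennreal (norm (a y)))"
proof -
  have "lq q (\<lambda>x. beta_majorant c a (t, x)) \<le> epow (\<integral>\<^sup>+x. gauss_majorant c t x \<partial>lborel) q * lq q (\<lambda>y. ennreal (norm (a y)))"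
    using t unfolding beta_majorant_def by simp (intro Young_convolution_weight q; measurable)
  then show ?thesis using c t by (simp add: nn_integral_gauss_majorant epow_ennreal)
qed

text \<open>The value of M is made for an invariant: if w n is bounded by M, then w (Suc n) is
  bounded by \<open>2 powr q\<close> times B + K \<tau>^(gain q * q) M^2, and the smallness
  condition makes the second summand at most B, which gives \<open>2 powr (q + 1)\<close> times B =
  M. The iterates increase, so the bound passes to their limit by monotone convergence, and one more
  use of the bilinear estimate bounds the Duhamel part separately, with a positive power of
  t.\<close>

lemma majorant_lq_bound:
  assumes a: "a \<in> borel_measurable borel" and q: "q > 3"
    and K: "K \<ge> 0" "\<And>w M t. w \<in> borel_measurable borel \<Longrightarrow> t > 0 \<Longrightarrow> (\<And>s. 0 < s \<Longrightarrow> s < t \<Longrightarrow> lq q (\<lambda>y. w (s, y)) \<le> M) \<Longrightarrow>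
       lq q (\<lambda>x. \<integral>\<^sup>+\<eta>. kappa_majorant c' (t, x) \<eta> * (w \<eta> * w \<eta>) \<partial>lborel) \<le> ennreal (K * t powr (gain q * q)) * (M * M)"
    and B: "\<And>t. 0 < t \<Longrightarrow> t < \<tau> \<Longrightarrow> lq q (\<lambda>x. beta_majorant c a (t, x)) \<le> B"
    and M: "M = ennreal (2 powr (q + 1)) * B"
    and small: "ennreal (2 powr (q + 1) * K * \<tau> powr (gain q * q)) * M \<le> 1"
    and t: "0 < t" "t < \<tau>"
  shows "lq q (\<lambda>x. majorant_limit lborel (beta_majorant c a) (kappa_majorant c') (t, x)) \<le> M"
    and "lq q (\<lambda>x. \<integral>\<^sup>+\<eta>. kappa_majorant c' (t, x) \<eta> * (majorant_limit lborel (beta_majorant c a) (kappa_majorant c') \<eta> * majorant_limit lborel (beta_majorant c a) (kappa_majorant c') \<eta>) \<partial>lborel)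
       \<le> ennreal (K * t powr (gain q * q)) * (M * M)"
proof -
  interpret majorant_kernel lborel "beta_majorant c a" "kappa_majorant c'"
    by (rule majorant_kernel_heat[OF a])
  have wm: "w n \<in> borel_measurable borel" for n using majorant_measurable[of n] by simp
  have ws[measurable]: "(\<lambda>x. w n (t, x)) \<in> borel_measurable borel" for n t
    using measurable_compose[OF Pair_borel_measurable wm] .
  have bm: "beta_majorant c a \<in> borel_measurable borel" using beta_measurable by simp
  have bs[measurable]: "(\<lambda>x. beta_majorant c a (t, x)) \<in> borel_measurable borel" for t
    using measurable_compose[OF Pair_borel_measurable bm] .
  have wn: "lq q (\<lambda>x. w n (t, x)) \<le> M" if "0 < t" "t < \<tau>" for n t
    using that
  proof (induction n arbitrary: t)
    case 0
    then show ?case by (simp add: lq_def)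
  next
    case (Suc n)
    let ?D = "\<lambda>x. \<integral>\<^sup>+\<eta>. kappa_majorant c' (t, x) \<eta> * (w n \<eta> * w n \<eta>) \<partial>lborel"
    have [measurable]: "?D \<in> borel_measurable borel"
    proof -
      have "(\<lambda>\<xi>. \<integral>\<^sup>+\<eta>. kappa_majorant c' \<xi> \<eta> * (w n \<eta> * w n \<eta>) \<partial>lborel) \<in> borel_measurable lborel"
        by measurable
      then show ?thesis using measurable_compose[OF Pair_borel_measurable] by simp
    qed
    have "lq q ?D \<le> ennreal (K * t powr (gain q * q)) * (M * M)"
      using Suc by (intro K(2) wm) auto
    also have "\<dots> \<le> ennreal (K * \<tau> powr (gain q * q)) * (M * M)"
      using Suc.prems K(1) gain_pos[OF q] q by (intro mult_right_mono ennreal_leI mult_left_mono powr_mono2) auto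
    finally have D: "lq q ?D \<le> ennreal (K * \<tau> powr (gain q * q)) * (M * M)" .
    have p: "ennreal (2 powr (q + 1)) = ennreal (2 powr q) * 2"
      by (simp add: powr_add ennreal_mult flip: ennreal_numeral)
    have "lq q (\<lambda>x. w (Suc n) (t, x)) \<le> ennreal (2 powr q) * (lq q (\<lambda>x. beta_majorant c a (t, x)) + lq q ?D)"
      unfolding majorant.simps(2) using q by (intro lq_add) auto
    also have "\<dots> \<le> ennreal (2 powr q) * (B + ennreal (K * \<tau> powr (gain q * q)) * (M * M))"
      using Suc.prems by (intro mult_left_mono add_mono B D) auto
    also have "\<dots> = ennreal (2 powr q) * B + (ennreal (2 powr q) * 2 * ennreal (K * \<tau> powr (gain q * q)) * M) * (ennreal (2 powr q) * B)"
      unfolding distrib_left by (simp add: M p mult_ac)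
    also have "ennreal (2 powr q) * 2 * ennreal (K * \<tau> powr (gain q * q)) * M = ennreal (2 powr (q + 1) * K * \<tau> powr (gain q * q)) * M"
      using K(1) by (simp add: p[symmetric] mult.assoc flip: ennreal_mult)
    also have "ennreal (2 powr q) * B + \<dots> * (ennreal (2 powr q) * B) \<le> ennreal (2 powr q) * B + 1 * (ennreal (2 powr q) * B)"
      by (intro add_left_mono mult_right_mono small) auto
    also have "\<dots> = M" by (simp add: M p mult_ac flip: mult_2)
    finally show ?case .
  qed
  have Wt: "lq q (\<lambda>x. W (t, x)) \<le> M" if "0 < t" "t < \<tau>" for t
    unfolding majorant_limit_def
    using q by (subst lq_SUP) (auto intro!: majorant_Suc_ge SUP_least wn that)
  show "lq q (\<lambda>x. W (t, x)) \<le> M" by (rule Wt[OF t])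
  have "W \<in> borel_measurable borel" using majorant_limit_measurable by simp
  then show "lq q (\<lambda>x. \<integral>\<^sup>+\<eta>. kappa_majorant c' (t, x) \<eta> * (W \<eta> * W \<eta>) \<partial>lborel) \<le> ennreal (K * t powr (gain q * q)) * (M * M)"
    using t by (intro K(2)) (auto intro: Wt)
qed

lemma borel_measurable_vecI:
  fixes f :: "'a \<Rightarrow> 'b::euclidean_space^'n"
  assumes [measurable]: "\<And>i. (\<lambda>x. f x $ i) \<in> borel_measurable M"
  shows "f \<in> borel_measurable M"
proof -
  have ax: "axis i \<in> borel_measurable (borel :: 'b measure)" for i :: 'n
  proof (rule borel_measurable_continuous_onI)
    have "linear (axis i :: 'b \<Rightarrow> 'b^'n)"
      by (rule linearI) (auto simp: axis_def vec_eq_iff)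
    then show "continuous_on UNIV (axis i :: 'b \<Rightarrow> 'b^'n)" by (rule linear_continuous_on[OF linear_conv_bounded_linear[THEN iffD1]])
  qed
  have [measurable]: "(\<lambda>x. axis i (f x $ i) :: 'b^'n) \<in> borel_measurable M" for i
    by (rule measurable_compose[OF assms ax])
  have "(\<lambda>x. \<Sum>i\<in>UNIV. axis i (f x $ i)) \<in> borel_measurable M" by measurable
  moreover have "(\<lambda>x. \<Sum>i\<in>UNIV. axis i (f x $ i)) = f"
    by (auto simp: fun_eq_iff vec_eq_iff axis_def sum.delta')
  ultimately show ?thesis by simp
qed

definition trilinear :: "('i::finite \<Rightarrow> 'i \<Rightarrow> 'i \<Rightarrow> complex) \<Rightarrow> complex^'i \<Rightarrow> complex^'i \<Rightarrow> complex^'i" where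
  "trilinear Q u v = (\<chi> i. \<Sum>j\<in>UNIV. \<Sum>k\<in>UNIV. Q i j k * u $ j * v $ k)"

lemma trilinear_nth [simp]: "trilinear Q u v $ i = (\<Sum>j\<in>UNIV. \<Sum>k\<in>UNIV. Q i j k * u $ j * v $ k)"
  by (simp add: trilinear_def)

lemma norm_vec_le_sum: "norm (x :: 'b::real_normed_vector^'n) \<le> (\<Sum>i\<in>UNIV. norm (x $ i))"
  unfolding norm_vec_def by (rule L2_set_le_sum) simp

lemma norm_trilinear_le:
  "norm (trilinear Q u v) \<le> (\<Sum>i\<in>UNIV. \<Sum>j\<in>UNIV. \<Sum>k\<in>UNIV. norm (Q i j k)) * (norm u * norm v)"
proof -
  have "norm (trilinear Q u v) \<le> (\<Sum>i\<in>UNIV. norm (trilinear Q u v $ i))" by (rule norm_vec_le_sum)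
  also have "\<dots> \<le> (\<Sum>i\<in>UNIV. \<Sum>j\<in>UNIV. \<Sum>k\<in>UNIV. norm (Q i j k) * (norm u * norm v))"
    unfolding trilinear_nth
  proof (intro sum_mono order_trans[OF norm_sum])
    fix i j k
    show "norm (Q i j k * u $ j * v $ k) \<le> norm (Q i j k) * (norm u * norm v)"
      unfolding norm_mult mult.assoc
      by (intro mult_left_mono mult_mono Finite_Cartesian_Product.norm_nth_le) auto
  qed
  also have "\<dots> = (\<Sum>i\<in>UNIV. \<Sum>j\<in>UNIV. \<Sum>k\<in>UNIV. norm (Q i j k)) * (norm u * norm v)"
    by (simp add: sum_distrib_right)
  finally show ?thesis .
qed

lemma bounded_bilinear_trilinear: "bounded_bilinear (trilinear Q)"
proof
  show "\<exists>K. \<forall>a b. norm (trilinear Q a b) \<le> norm a * norm b * K"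
    using norm_trilinear_le[of Q] by (intro exI[of _ "\<Sum>i\<in>UNIV. \<Sum>j\<in>UNIV. \<Sum>k\<in>UNIV. norm (Q i j k)"]) (simp add: mult_ac)
qed (auto simp: vec_eq_iff algebra_simps sum.distrib scaleR_sum_right)

definition heat_term :: "(real^3 \<Rightarrow> real^3) \<Rightarrow> complex^3 \<Rightarrow> complex \<Rightarrow> real \<times> (real^3) \<Rightarrow> complex^3" where
  "heat_term a h w \<xi> = (\<chi> i. \<integral>y. heatC w (fst \<xi>) (shifted (snd \<xi> - y) (fst \<xi>) h) * of_real (a y $ i) \<partial>lborel)"

definition oseen_term :: "complex^3 \<Rightarrow> complex \<Rightarrow> real \<times> (real^3) \<Rightarrow> real \<times> (real^3) \<Rightarrow> complex^3 \<Rightarrow> complex^3 \<Rightarrow> complex^3" where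
  "oseen_term h w \<xi> \<eta> = trilinear (\<lambda>i j k. if 0 < fst \<eta> \<and> fst \<eta> < fst \<xi>
     then oseenC w (fst \<xi> - fst \<eta>) i j k (shifted (snd \<xi> - snd \<eta>) (fst \<xi> - fst \<eta>) h) else 0)"

lemma shifted_measurable [measurable (raw)]:
  assumes [measurable]: "f \<in> borel_measurable M" "g \<in> borel_measurable M"
  shows "(\<lambda>x. shifted (f x) (g x) h) \<in> borel_measurable M"
  by (rule borel_measurable_vecI) simp

lemma csq_measurable [measurable (raw)]:
  assumes [measurable]: "f \<in> borel_measurable M"
  shows "(\<lambda>x. csq (f x)) \<in> borel_measurable M"
  unfolding csq_def by measurable

lemma heatC_measurable [measurable (raw)]:
  assumes [measurable]: "f \<in> borel_measurable M" "g \<in> borel_measurable M"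
  shows "(\<lambda>x. heatC w (f x) (g x)) \<in> borel_measurable M"
  unfolding heatC_def by measurable

lemma oseenC_measurable [measurable (raw)]:
  assumes [measurable]: "f \<in> borel_measurable M" "g \<in> borel_measurable M"
  shows "(\<lambda>x. oseenC w (f x) i j k (g x)) \<in> borel_measurable M"
  unfolding oseenC_def by measurable

text \<open>Three times the constant of \<open>heatC_bound\<close>, one for each component of the
  field.\<close>

definition heat_const :: real where "heat_const = 6 * exp (9/2)"

text \<open>The 27 counts the index triples (i, j, k). \<open>oseenC_bound\<close> yields existence
  only, and the choice turns its constant into a term that can occur in
  \<open>ns_kappa\<close>.\<close>

definition oseen_const :: real where
  "oseen_const = 27 * (SOME C. C > 0 \<and> (\<forall>h w s x i j k. norm h \<le> 1 \<longrightarrow> norm (w - 1) \<le> 1/4 \<longrightarrow> 0 < s \<longrightarrow> s \<le> 1 \<longrightarrow>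
     norm (oseenC w s i j k (shifted x s h)) \<le> C * (s + (norm x)\<^sup>2) powr (-2)))"

lemma oseen_const:
  "oseen_const > 0"
  "norm h \<le> 1 \<Longrightarrow> norm (w - 1) \<le> 1/4 \<Longrightarrow> 0 < s \<Longrightarrow> s \<le> 1 \<Longrightarrow>
     norm (oseenC w s i j k (shifted x s h)) \<le> oseen_const / 27 * (s + (norm x)\<^sup>2) powr (-2)"
  using someI_ex[OF oseenC_bound] unfolding oseen_const_def by simp_all

lemma heat_const_pos: "heat_const > 0" by (simp add: heat_const_def)

abbreviation "ns_beta a \<equiv> beta_majorant heat_const a"
abbreviation "ns_kappa \<equiv> kappa_majorant oseen_const"

lemma norm_heatC_le_majorant:
  assumes "norm h \<le> 1" "norm (w - 1) \<le> 1/4" "0 < s" "s \<le> 1"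
  shows "3 * ennreal (norm (heatC w s (shifted x s h))) \<le> gauss_majorant heat_const s x"
proof -
  have "3 * norm (heatC w s (shifted x s h)) \<le> heat_const * s powr (-3/2) * exp (- ((norm x)\<^sup>2 / (16 * s)))"
    using heatC_bound[OF assms, of x] by (simp add: heat_const_def mult.assoc)
  then have "ennreal (3 * norm (heatC w s (shifted x s h))) \<le> gauss_majorant heat_const s x"
    unfolding gauss_majorant_def by (rule ennreal_leI)
  then show ?thesis by (simp add: ennreal_mult)
qed

lemma majorized_picard_heat:
  assumes a[measurable]: "a \<in> borel_measurable borel" and h: "norm h \<le> 1" and w: "norm (w - 1) \<le> 1/4"
  shows "majorized_picard lborel (ns_beta a) ns_kappa (heat_term a h w) (oseen_term h w)"
proof -
  interpret majorant_kernel lborel "ns_beta a" ns_kappa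
    by (rule majorant_kernel_heat[OF a])
  show ?thesis
  proof (rule majorized_picard.intro[OF majorant_kernel_heat[OF a] majorized_picard_axioms.intro])
    show "heat_term a h w \<in> borel_measurable lborel"
      unfolding heat_term_def[abs_def] by (rule borel_measurable_vecI) (simp, measurable)
    show "(\<lambda>(\<xi>, \<eta>). oseen_term h w \<xi> \<eta> (f \<eta>) (g \<eta>)) \<in> borel_measurable (lborel \<Otimes>\<^sub>M lborel)"
      if [measurable]: "f \<in> borel_measurable lborel" "g \<in> borel_measurable lborel" for f g
      unfolding oseen_term_def split_beta by (rule borel_measurable_vecI) (unfold trilinear_nth, measurable)
    show "bounded_bilinear (oseen_term h w \<xi> \<eta>)" for \<xi> \<eta>
      unfolding oseen_term_def by (rule bounded_bilinear_trilinear)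
    show "ennreal (norm (heat_term a h w \<xi>)) \<le> ns_beta a \<xi>" for \<xi>
    proof (cases "0 < fst \<xi> \<and> fst \<xi> < 1")
      case True
      let ?I = "\<lambda>i. \<integral>y. heatC w (fst \<xi>) (shifted (snd \<xi> - y) (fst \<xi>) h) * of_real (a y $ i) \<partial>lborel"
      have "norm (heat_term a h w \<xi>) \<le> (\<Sum>i\<in>UNIV. norm (?I i))"
        using norm_vec_le_sum[of "heat_term a h w \<xi>"] by (simp add: heat_term_def)
      then have "ennreal (norm (heat_term a h w \<xi>)) \<le> (\<Sum>i\<in>UNIV. ennreal (norm (?I i)))"
        by (subst sum_ennreal) (auto intro: ennreal_leI)
      also have "\<dots> \<le> (\<Sum>i\<in>(UNIV::3 set). \<integral>\<^sup>+y. ennreal (norm (heatC w (fst \<xi>) (shifted (snd \<xi> - y) (fst \<xi>) h))) * ennreal (norm (a y)) \<partial>lborel)"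
      proof (rule sum_mono)
        fix i
        have "ennreal (norm (?I i)) \<le> (\<integral>\<^sup>+y. ennreal (norm (heatC w (fst \<xi>) (shifted (snd \<xi> - y) (fst \<xi>) h) * of_real (a y $ i))) \<partial>lborel)"
        proof (cases "integrable lborel (\<lambda>y. heatC w (fst \<xi>) (shifted (snd \<xi> - y) (fst \<xi>) h) * of_real (a y $ i))")
          case True then show ?thesis by (rule integral_norm_bound_ennreal)
        qed (simp add: not_integrable_integral_eq)
        also have "\<dots> \<le> (\<integral>\<^sup>+y. ennreal (norm (heatC w (fst \<xi>) (shifted (snd \<xi> - y) (fst \<xi>) h))) * ennreal (norm (a y)) \<partial>lborel)"
          by (intro nn_integral_mono)
             (auto simp: norm_mult component_le_norm_cart intro!: ennreal_leI mult_left_mono simp flip: ennreal_mult)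
        finally show "ennreal (norm (?I i)) \<le> \<dots>" .
      qed
      also have "\<dots> = (\<integral>\<^sup>+y. 3 * ennreal (norm (heatC w (fst \<xi>) (shifted (snd \<xi> - y) (fst \<xi>) h))) * ennreal (norm (a y)) \<partial>lborel)"
        by (simp add: mult.assoc nn_integral_cmult)
      also have "\<dots> \<le> (\<integral>\<^sup>+y. gauss_majorant heat_const (fst \<xi>) (snd \<xi> - y) * ennreal (norm (a y)) \<partial>lborel)"
        using True by (intro nn_integral_mono mult_right_mono norm_heatC_le_majorant h w) auto
      finally show ?thesis using True by (simp add: beta_majorant_def)
    next
      case False
      then have "ns_beta a \<xi> = \<infinity>" unfolding beta_majorant_def by (rule if_not_P)
      then show ?thesis by simp
    qed
    show "ennreal (norm (oseen_term h w \<xi> \<eta> x y)) \<le> ns_kappa \<xi> \<eta> * (ennreal (norm x) * ennreal (norm y))"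
      if "ns_beta a \<xi> < \<infinity>" for \<xi> \<eta> x y
    proof (cases "0 < fst \<eta> \<and> fst \<eta> < fst \<xi>")
      case True
      have "fst \<xi> < 1" using that by (auto simp: beta_majorant_def split: if_splits)
      then have s: "0 < fst \<xi> - fst \<eta>" "fst \<xi> - fst \<eta> \<le> 1" using True by auto
      let ?q = "oseen_const * (fst \<xi> - fst \<eta> + (norm (snd \<xi> - snd \<eta>))\<^sup>2) powr (-2)"
      have "norm (oseen_term h w \<xi> \<eta> x y) \<le> (\<Sum>i\<in>(UNIV::3 set). \<Sum>j\<in>(UNIV::3 set). \<Sum>k\<in>(UNIV::3 set). norm (oseenC w (fst \<xi> - fst \<eta>) i j k (shifted (snd \<xi> - snd \<eta>) (fst \<xi> - fst \<eta>) h))) * (norm x * norm y)"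
        using True unfolding oseen_term_def by (intro order_trans[OF norm_trilinear_le]) auto
      also have "\<dots> \<le> (\<Sum>i\<in>(UNIV::3 set). \<Sum>j\<in>(UNIV::3 set). \<Sum>k\<in>(UNIV::3 set). oseen_const / 27 * (fst \<xi> - fst \<eta> + (norm (snd \<xi> - snd \<eta>))\<^sup>2) powr (-2)) * (norm x * norm y)"
        by (intro mult_right_mono sum_mono oseen_const(2) h w s) auto
      also have "\<dots> = ?q * (norm x * norm y)" by simp
      finally have "ennreal (norm (oseen_term h w \<xi> \<eta> x y)) \<le> ennreal (?q * (norm x * norm y))" by (rule ennreal_leI)
      then show ?thesis using True oseen_const(1)
        by (simp add: kappa_majorant_def oseen_majorant_def ennreal_mult)
    next
      case False
      have "oseen_term h w \<xi> \<eta> x y = 0"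
        unfolding oseen_term_def trilinear_def if_not_P[OF False] by (simp add: vec_eq_iff)
      then show ?thesis by simp
    qed
  qed
qed

definition nsV :: "(real^3 \<Rightarrow> real^3) \<Rightarrow> complex^3 \<Rightarrow> complex \<Rightarrow> real \<times> (real^3) \<Rightarrow> complex^3" where
  "nsV a h w \<xi> = picard_limit lborel (heat_term a h w) (oseen_term h w) \<xi>"

definition nsW :: "(real^3 \<Rightarrow> real^3) \<Rightarrow> real \<times> (real^3) \<Rightarrow> ennreal" where
  "nsW a \<xi> = majorant_limit lborel (ns_beta a) ns_kappa \<xi>"

lemma heatC_holomorphic:
  assumes "\<And>i. (\<lambda>z. y z $ i) holomorphic_on A" "w holomorphic_on A" "s > 0"
  shows "(\<lambda>z. heatC (w z) s (y z)) holomorphic_on A"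
  unfolding heatC_def csq_def using assms(3) by (intro holomorphic_intros assms(1,2)) auto

lemma oseenC_holomorphic:
  assumes "\<And>i. (\<lambda>z. y z $ i) holomorphic_on A" "w holomorphic_on A" "s > 0"
  shows "(\<lambda>z. oseenC (w z) s i j k (y z)) holomorphic_on A"
  unfolding oseenC_def csq_def using assms(3) by (intro holomorphic_intros assms(1,2)) auto

lemma shifted_holomorphic:
  assumes "\<And>i. (\<lambda>z. h z $ i) holomorphic_on A"
  shows "(\<lambda>z. shifted x s (h z) $ i) holomorphic_on A"
  unfolding shifted_nth by (intro holomorphic_intros assms)

lemma holomorphic_picard_heat:
  assumes a[measurable]: "a \<in> borel_measurable borel" and A: "open A"
    and h: "\<And>i. (\<lambda>z. h z $ i) holomorphic_on A" "\<And>z. z \<in> A \<Longrightarrow> norm (h z) \<le> 1"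
    and w: "w holomorphic_on A" "\<And>z. z \<in> A \<Longrightarrow> norm (w z - 1) \<le> 1/4"
  shows "holomorphic_picard lborel (ns_beta a) ns_kappa A (\<lambda>z. heat_term a (h z) (w z)) (\<lambda>z. oseen_term (h z) (w z))"
proof (rule holomorphic_picard.intro[OF majorant_kernel_heat[OF a] holomorphic_picard_axioms.intro[OF A]])
  show "majorized_picard lborel (ns_beta a) ns_kappa (heat_term a (h z) (w z)) (oseen_term (h z) (w z))" if "z \<in> A" for z
    using h(2) w(2) that by (intro majorized_picard_heat a)
  show "(\<lambda>z. heat_term a (h z) (w z) \<xi> $ i) holomorphic_on A" if "ns_beta a \<xi> < \<infinity>" for \<xi> i
  proof -
    have t: "0 < fst \<xi>" "fst \<xi> < 1" using that by (auto simp: beta_majorant_def split: if_splits)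
    define g where "g y = heat_const * fst \<xi> powr (-3/2) * exp (- ((norm (snd \<xi> - y))\<^sup>2 / (16 * fst \<xi>))) * norm (a y)" for y
    have [measurable]: "g \<in> borel_measurable borel" unfolding g_def[abs_def] by measurable
    have g0: "g y \<ge> 0" for y using heat_const_pos by (simp add: g_def)
    have "(\<integral>\<^sup>+y. ennreal (g y) \<partial>lborel) = ns_beta a \<xi>"
      using t heat_const_pos by (simp add: beta_majorant_def g_def gauss_majorant_def ennreal_mult)
    then have gint: "integrable lborel g"
      using that g0 by (intro integrableI_bounded) auto
    show ?thesis
      unfolding heat_term_def vec_lambda_beta
    proof (rule holomorphic_on_integral[OF A _ _ _ gint])
      show "AE y in lborel. (\<lambda>z. heatC (w z) (fst \<xi>) (shifted (snd \<xi> - y) (fst \<xi>) (h z)) * of_real (a y $ i)) holomorphic_on A"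
        using t by (intro always_eventually allI holomorphic_intros heatC_holomorphic shifted_holomorphic h w)
      show "AE y in lborel. \<forall>z\<in>A. norm (heatC (w z) (fst \<xi>) (shifted (snd \<xi> - y) (fst \<xi>) (h z)) * of_real (a y $ i)) \<le> g y"
      proof (intro always_eventually allI ballI)
        fix y z assume z: "z \<in> A"
        have "norm (heatC (w z) (fst \<xi>) (shifted (snd \<xi> - y) (fst \<xi>) (h z))) \<le> heat_const * fst \<xi> powr (-3/2) * exp (- ((norm (snd \<xi> - y))\<^sup>2 / (16 * fst \<xi>)))"
        proof (rule order_trans[OF heatC_bound])
          have "2 * exp (9/2) \<le> heat_const" by (simp add: heat_const_def)
          then show "2 * exp (9/2) * fst \<xi> powr (-3/2) * exp (- ((norm (snd \<xi> - y))\<^sup>2 / (16 * fst \<xi>))) \<le> heat_const * fst \<xi> powr (-3/2) * exp (- ((norm (snd \<xi> - y))\<^sup>2 / (16 * fst \<xi>)))"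
            by (intro mult_right_mono) auto
        qed (use t h(2) w(2) z in auto)
        then show "norm (heatC (w z) (fst \<xi>) (shifted (snd \<xi> - y) (fst \<xi>) (h z)) * of_real (a y $ i)) \<le> g y"
          unfolding norm_mult g_def using heat_const_pos by (intro mult_mono) (auto simp: component_le_norm_cart)
      qed
    qed measurable
  qed
  show "(\<lambda>z. oseen_term (h z) (w z) \<xi> \<eta> (f z) (g z) $ i) holomorphic_on A"
    if "\<And>j. (\<lambda>z. f z $ j) holomorphic_on A" "\<And>j. (\<lambda>z. g z $ j) holomorphic_on A" for \<xi> \<eta> f g i
  proof (cases "0 < fst \<eta> \<and> fst \<eta> < fst \<xi>")
    case True
    then show ?thesis
      unfolding oseen_term_def if_P[OF True] trilinear_nth
      by (intro holomorphic_intros oseenC_holomorphic shifted_holomorphic h w that) auto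
  next
    case False
    then show ?thesis
      unfolding oseen_term_def if_not_P[OF False] trilinear_nth by simp
  qed
qed

lemma nsV_holomorphic:
  assumes "a \<in> borel_measurable borel" "open A"
    and "\<And>i. (\<lambda>z. h z $ i) holomorphic_on A" "\<And>z. z \<in> A \<Longrightarrow> norm (h z) \<le> 1"
    and "w holomorphic_on A" "\<And>z. z \<in> A \<Longrightarrow> norm (w z - 1) \<le> 1/4" and W: "nsW a \<xi> < \<infinity>"
  shows "(\<lambda>z. nsV a (h z) (w z) \<xi> $ i) holomorphic_on A"
proof -
  interpret holomorphic_picard lborel "ns_beta a" ns_kappa A "\<lambda>z. heat_term a (h z) (w z)" "\<lambda>z. oseen_term (h z) (w z)"
    using assms by (intro holomorphic_picard_heat) auto
  show ?thesis unfolding nsV_def using W by (intro picard_limit_holomorphic) (auto simp: nsW_def)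
qed

lemma nsV_bound:
  assumes "a \<in> borel_measurable borel" "norm h \<le> 1" "norm (w - 1) \<le> 1/4" and W: "nsW a \<xi> < \<infinity>"
  shows "norm (nsV a h w \<xi>) \<le> enn2real (nsW a \<xi>)"
proof -
  interpret majorized_picard lborel "ns_beta a" ns_kappa "heat_term a h w" "oseen_term h w"
    using assms by (intro majorized_picard_heat)
  show ?thesis using picard_limit_le(1)[of \<xi>] W by (simp add: nsV_def nsW_def)
qed

lemma heat_term_measurable [measurable]:
  assumes [measurable]: "a \<in> borel_measurable borel"
  shows "heat_term a h w \<in> borel_measurable borel"
proof -
  have "heat_term a h w \<in> borel_measurable (lborel :: (real \<times> (real^3)) measure)"
    unfolding heat_term_def[abs_def] by (rule borel_measurable_vecI) (simp, measurable)
  then show ?thesis by simp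
qed

lemma oseen_term_measurable:
  assumes [measurable]: "f \<in> borel_measurable borel" "g \<in> borel_measurable borel"
  shows "(\<lambda>(\<xi>, \<eta>). oseen_term h w \<xi> \<eta> (f \<eta>) (g \<eta>)) \<in> borel_measurable (borel \<Otimes>\<^sub>M borel)"
  unfolding oseen_term_def split_beta by (rule borel_measurable_vecI) (unfold trilinear_nth, measurable)

lemma picard_heat_measurable [measurable]:
  assumes a[measurable]: "a \<in> borel_measurable borel"
  shows "picard lborel (heat_term a h w) (oseen_term h w) n \<in> borel_measurable borel"
proof (induction n)
  case (Suc n)
  have "(\<lambda>(\<xi>, \<eta>). oseen_term h w \<xi> \<eta> (picard lborel (heat_term a h w) (oseen_term h w) n \<eta>) (picard lborel (heat_term a h w) (oseen_term h w) n \<eta>)) \<in> borel_measurable (borel \<Otimes>\<^sub>M lborel)"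
    using oseen_term_measurable[OF Suc Suc] by (simp cong: measurable_cong_sets)
  then have "(\<lambda>\<xi>. \<integral>\<eta>. oseen_term h w \<xi> \<eta> (picard lborel (heat_term a h w) (oseen_term h w) n \<eta>) (picard lborel (heat_term a h w) (oseen_term h w) n \<eta>) \<partial>lborel) \<in> borel_measurable borel"
    by (intro lborel.borel_measurable_lebesgue_integral) (simp add: split_beta)
  then show ?case unfolding picard.simps(2) by measurable
qed simp

lemma nsV_measurable [measurable]:
  assumes [measurable]: "a \<in> borel_measurable borel"
  shows "nsV a h w \<in> borel_measurable borel"
  unfolding nsV_def[abs_def] picard_limit_def by (rule borel_measurable_lim_metric) measurable

lemma nsW_measurable [measurable]:
  assumes "a \<in> borel_measurable borel"
  shows "nsW a \<in> borel_measurable borel"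
proof -
  interpret majorant_kernel lborel "ns_beta a" ns_kappa by (rule majorant_kernel_heat[OF assms])
  show ?thesis using majorant_limit_measurable by (simp add: nsW_def[abs_def])
qed

section \<open>Invariance under moving frames and dilations, and reality of the iterates\<close>

lemma oseen_term_section_measurable:
  assumes [measurable]: "f \<in> borel_measurable borel"
  shows "(\<lambda>\<eta>. oseen_term h w \<xi> \<eta> (f \<eta>) (f \<eta>)) \<in> borel_measurable borel"
  unfolding oseen_term_def by (rule borel_measurable_vecI) (unfold trilinear_nth, measurable)

text \<open>The shear preserves volume at each time, and the dilation of time contributes the factor
  c. The case c = 1 serves the change of frame, the case h = 0 the dilation.\<close>

lemma lborel_shear:
  fixes c :: real and h :: "real^3"
  assumes c: "c > 0"
  shows "(lborel :: (real \<times> (real^3)) measure) = density (distr lborel borel (\<lambda>\<eta>. (c * fst \<eta>, snd \<eta> + fst \<eta> *\<^sub>R h))) (\<lambda>_. ennreal c)"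
proof (rule measure_eqI)
  fix A :: "(real \<times> (real^3)) set" assume "A \<in> sets lborel"
  then have A[measurable]: "A \<in> sets borel" by simp
  let ?T = "\<lambda>\<eta>::real \<times> (real^3). (c * fst \<eta>, snd \<eta> + fst \<eta> *\<^sub>R h)"
  have T[measurable]: "?T \<in> borel_measurable borel" 
    by (intro borel_measurable_continuous_onI continuous_intros)
  have i[measurable]: "(indicator A :: _ \<Rightarrow> ennreal) \<in> borel_measurable (borel \<Otimes>\<^sub>M borel)" using A by (simp add: borel_prod)
  have iy[measurable]: "(\<lambda>y. indicator A (s, y) :: ennreal) \<in> borel_measurable borel" for s by measurable
  have "emeasure (density (distr lborel borel ?T) (\<lambda>_. ennreal c)) A = ennreal c * (\<integral>\<^sup>+\<eta>. indicator A (?T \<eta>) \<partial>lborel)"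
    by (subst emeasure_density, simp, simp, subst nn_integral_distr, simp, simp, rule nn_integral_cmult, measurable)
  also have "(\<integral>\<^sup>+\<eta>. indicator A (?T \<eta>) \<partial>lborel) = (\<integral>\<^sup>+s. \<integral>\<^sup>+y. indicator A (c * s, y + s *\<^sub>R h) \<partial>lborel \<partial>lborel)"
    by (subst nn_integral_lborel_pair) simp_all
  also have "\<dots> = (\<integral>\<^sup>+s. \<integral>\<^sup>+y. indicator A (c * s, y) \<partial>lborel \<partial>lborel)"
    by (intro nn_integral_cong nn_integral_lborel_translate[OF iy])
  also have "ennreal c * (\<integral>\<^sup>+s. \<integral>\<^sup>+y. indicator A (c * s, y) \<partial>lborel \<partial>lborel) = (\<integral>\<^sup>+s. \<integral>\<^sup>+y. indicator A (s, y) \<partial>lborel \<partial>lborel)"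
    using nn_integral_lborel_affine[of c "\<lambda>s. \<integral>\<^sup>+y. indicator A (s, y) \<partial>lborel" 0] c by simp
  also have "\<dots> = emeasure lborel A"
    by (subst nn_integral_lborel_pair[symmetric]) simp_all
  finally show "emeasure lborel A = emeasure (density (distr lborel borel ?T) (\<lambda>_. ennreal c)) A" by simp
qed simp

lemma integral_lborel_shear:
  fixes F :: "real \<times> (real^3) \<Rightarrow> 'b::{banach, second_countable_topology}"
  assumes c: "c > 0" and [measurable]: "F \<in> borel_measurable borel"
  shows "(\<integral>\<eta>. F \<eta> \<partial>lborel) = c *\<^sub>R (\<integral>\<eta>. F (c * fst \<eta>, snd \<eta> + fst \<eta> *\<^sub>R h) \<partial>lborel)"
proof -
  have T[measurable]: "(\<lambda>\<eta>::real \<times> (real^3). (c * fst \<eta>, snd \<eta> + fst \<eta> *\<^sub>R h)) \<in> borel_measurable borel" 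
    by (intro borel_measurable_continuous_onI continuous_intros)
  show ?thesis
    using c by (subst lborel_shear[OF c, of h]) (simp add: integral_density integral_distr)
qed

abbreviation cvec :: "real^3 \<Rightarrow> complex^3" where "cvec x \<equiv> (\<chi> i. of_real (x $ i))"

text \<open>In the Duhamel integral (s, y) is replaced by (s, y + s h'). The relative position of
  (t, x + t h') and the new point changes by (t - s) h', which is exactly what
  \<open>shifted\<close> adds for the velocity h'. The induction proceeds iterate by iterate as an
  identity of Bochner integrals, integrable or not.\<close>

lemma picard_heat_shift:
  assumes [measurable]: "a \<in> borel_measurable borel"
  shows "picard lborel (heat_term a (h + cvec h') w) (oseen_term (h + cvec h') w) n (t, x) =
         picard lborel (heat_term a h w) (oseen_term h w) n (t, x + t *\<^sub>R h')"
proof (induction n arbitrary: t x)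
  case (Suc n)
  have sh: "shifted z s (h + cvec h') = shifted (z + s *\<^sub>R h') s h" for z s
    by (simp add: vec_eq_iff algebra_simps)
  have heat: "heat_term a (h + cvec h') w (t, x) = heat_term a h w (t, x + t *\<^sub>R h')"
    by (simp add: heat_term_def sh algebra_simps)
  let ?v = "picard lborel (heat_term a h w) (oseen_term h w) n"
  have "(\<integral>\<eta>. oseen_term h w (t, x + t *\<^sub>R h') \<eta> (?v \<eta>) (?v \<eta>) \<partial>lborel) =
     1 *\<^sub>R (\<integral>\<eta>. oseen_term h w (t, x + t *\<^sub>R h') (1 * fst \<eta>, snd \<eta> + fst \<eta> *\<^sub>R h') (?v (1 * fst \<eta>, snd \<eta> + fst \<eta> *\<^sub>R h')) (?v (1 * fst \<eta>, snd \<eta> + fst \<eta> *\<^sub>R h')) \<partial>lborel)"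
    by (intro integral_lborel_shear oseen_term_section_measurable) auto
  also have "\<dots> = (\<integral>\<eta>. oseen_term (h + cvec h') w (t, x) \<eta> (picard lborel (heat_term a (h + cvec h') w) (oseen_term (h + cvec h') w) n \<eta>)
       (picard lborel (heat_term a (h + cvec h') w) (oseen_term (h + cvec h') w) n \<eta>) \<partial>lborel)"
    unfolding scaleR_one
  proof (intro Bochner_Integration.integral_cong refl)
    fix \<eta> :: "real \<times> (real^3)"
    have "picard lborel (heat_term a (h + cvec h') w) (oseen_term (h + cvec h') w) n \<eta> = ?v (1 * fst \<eta>, snd \<eta> + fst \<eta> *\<^sub>R h')"
      using Suc.IH[of "fst \<eta>" "snd \<eta>"] by simp
    moreover have sh2: "shifted (x - snd \<eta>) (t - fst \<eta>) (h + cvec h') = shifted (x + t *\<^sub>R h' - (snd \<eta> + fst \<eta> *\<^sub>R h')) (t - fst \<eta>) h"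
      by (simp add: vec_eq_iff algebra_simps)
    have "oseen_term h w (t, x + t *\<^sub>R h') (1 * fst \<eta>, snd \<eta> + fst \<eta> *\<^sub>R h') = oseen_term (h + cvec h') w (t, x) \<eta>"
      unfolding oseen_term_def by (simp only: fst_conv snd_conv mult_1_left sh2)
    ultimately show "oseen_term h w (t, x + t *\<^sub>R h') (1 * fst \<eta>, snd \<eta> + fst \<eta> *\<^sub>R h') (?v (1 * fst \<eta>, snd \<eta> + fst \<eta> *\<^sub>R h')) (?v (1 * fst \<eta>, snd \<eta> + fst \<eta> *\<^sub>R h')) =
      oseen_term (h + cvec h') w (t, x) \<eta> (picard lborel (heat_term a (h + cvec h') w) (oseen_term (h + cvec h') w) n \<eta>)
       (picard lborel (heat_term a (h + cvec h') w) (oseen_term (h + cvec h') w) n \<eta>)" by simp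
  qed
  finally show ?case by (simp add: picard.simps(2) heat)
qed simp

lemma nsV_shift:
  assumes "a \<in> borel_measurable borel"
  shows "nsV a (h + cvec h') w (t, x) = nsV a h w (t, x + t *\<^sub>R h')"
  unfolding nsV_def picard_limit_def picard_heat_shift[OF assms] ..

lemma heatC_dilate:
  assumes "w > 0" "t > 0"
  shows "heatC (of_real w) t y = heatC 1 (t / w\<^sup>2) y"
proof -
  have "(4 * pi * (t / w\<^sup>2)) powr (-3/2) = (4 * pi * t) powr (-3/2) * (w\<^sup>2) powr (3/2)"
    using assms by (simp add: powr_divide powr_minus field_simps)
  also have "(w\<^sup>2) powr (3/2) = w ^ 3" using assms by (simp add: powr_powr flip: powr_numeral)
  finally show ?thesis using assms by (simp add: heatC_def power2_eq_square)
qed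

lemma oseenC_dilate:
  assumes w: "w > 0" and s: "s > 0"
  shows "oseenC (of_real w) s i j k y = of_real (1 / w\<^sup>2) * oseenC 1 (s / w\<^sup>2) i j k y"
proof -
  have p: "(4 * pi * (s / w\<^sup>2)) powr (-3/2) = (4 * pi * s) powr (-3/2) * w ^ 3"
  proof -
    have "(4 * pi * (s / w\<^sup>2)) powr (-3/2) = (4 * pi * s) powr (-3/2) * (w\<^sup>2) powr (3/2)"
      using assms by (simp add: powr_divide powr_minus field_simps)
    also have "(w\<^sup>2) powr (3/2) = w ^ 3" using assms by (simp add: powr_powr flip: powr_numeral)
    finally show ?thesis .
  qed
  have U: "csq y * (of_real w)\<^sup>2 / of_real (4 * s) = csq y * 1\<^sup>2 / of_real (4 * (s / w\<^sup>2))"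
    using w s by (simp add: field_simps)
  have alg: "of_real p * of_real w ^ 3 * (X / of_real (2 * s) * E + Y / of_real (2 * s) * A - Z * (of_real w)\<^sup>2 / of_real (4 * s\<^sup>2) * B) =
     of_real (1 / w\<^sup>2) * (of_real (p * w ^ 3) * 1 ^ 3 * (X / of_real (2 * (s / w\<^sup>2)) * E + Y / of_real (2 * (s / w\<^sup>2)) * A - Z * 1\<^sup>2 / of_real (4 * (s / w\<^sup>2)\<^sup>2) * B))"
    for p :: real and X Y Z E A B :: complex
  proof -
    have eX: "X / of_real (2 * (s / w\<^sup>2)) = (of_real w)\<^sup>2 * (X / of_real (2 * s))" for X :: complex
      using w s by (simp add: field_simps)
    have eZ: "Z / of_real (4 * (s / w\<^sup>2)\<^sup>2) = (of_real w)\<^sup>2 * (Z * (of_real w)\<^sup>2 / of_real (4 * s\<^sup>2))"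
      using w s by (simp add: field_simps power2_eq_square)
    have inv: "of_real (1 / w\<^sup>2) * (of_real w)\<^sup>2 = (1::complex)"
      using w by simp
    have pw: "of_real (p * w ^ 3) = (of_real p * of_real w ^ 3 :: complex)" by simp
    have key: "P * (a * E + b * A - c * B) = of_real (1 / w\<^sup>2) * (P * ((of_real w)\<^sup>2 * a * E + (of_real w)\<^sup>2 * b * A - (of_real w)\<^sup>2 * c * B))"
      for P a b c :: complex
    proof -
      have "of_real (1 / w\<^sup>2) * (P * ((of_real w)\<^sup>2 * a * E + (of_real w)\<^sup>2 * b * A - (of_real w)\<^sup>2 * c * B))
        = (of_real (1 / w\<^sup>2) * (of_real w)\<^sup>2) * (P * (a * E + b * A - c * B))"
        by (simp only: ring_distribs mult_ac)
      then show ?thesis unfolding inv by simp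
    qed
    show ?thesis
      unfolding pw power_one mult_1_right eX eZ by (rule key)
  qed
  show ?thesis unfolding oseenC_def U p by (rule alg)
qed

lemma trilinear_scale: "trilinear (\<lambda>i j k. of_real c * Q i j k) u v = c *\<^sub>R trilinear Q u v"
  unfolding vec_eq_iff vector_scaleR_component trilinear_nth
  by (simp add: scaleR_conv_of_real sum_distrib_left mult.assoc)

text \<open>The conditional makes the claim a triviality for t \<le> 0, where the kernels do not
  scale, so that one induction covers all (t, x); the Duhamel integral only looks at positive times.
  For n = 0 both sides vanish at every time.\<close>

lemma picard_heat_dilate:
  assumes [measurable]: "a \<in> borel_measurable borel" and w: "w > 0"
  shows "picard lborel (heat_term a 0 (of_real w)) (oseen_term 0 (of_real w)) n (t, x) =
         (if n > 0 \<and> t \<le> 0 then picard lborel (heat_term a 0 (of_real w)) (oseen_term 0 (of_real w)) n (t, x) else picard lborel (heat_term a 0 1) (oseen_term 0 1) n (t / w\<^sup>2, x))"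
proof (induction n arbitrary: t x)
  case (Suc n)
  show ?case
  proof (cases "t > 0")
    case True
    have c: "1 / w\<^sup>2 > 0" using w by simp
    have sh: "shifted z s 0 = shifted z r 0" for z s r by (simp add: shifted_def)
    have heat: "heat_term a 0 (of_real w) (t, x) = heat_term a 0 1 (t / w\<^sup>2, x)"
      using w True by (simp add: heat_term_def heatC_dilate sh[of _ t "t / w\<^sup>2"])
    let ?v = "picard lborel (heat_term a 0 1) (oseen_term 0 1) n"
    let ?vw = "picard lborel (heat_term a 0 (of_real w)) (oseen_term 0 (of_real w)) n"
    have "(\<integral>\<eta>. oseen_term 0 1 (t / w\<^sup>2, x) \<eta> (?v \<eta>) (?v \<eta>) \<partial>lborel) =
       (1 / w\<^sup>2) *\<^sub>R (\<integral>\<eta>. oseen_term 0 1 (t / w\<^sup>2, x) (1 / w\<^sup>2 * fst \<eta>, snd \<eta> + fst \<eta> *\<^sub>R 0) (?v (1 / w\<^sup>2 * fst \<eta>, snd \<eta> + fst \<eta> *\<^sub>R 0)) (?v (1 / w\<^sup>2 * fst \<eta>, snd \<eta> + fst \<eta> *\<^sub>R 0)) \<partial>lborel)"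
      by (intro integral_lborel_shear[OF c] oseen_term_section_measurable) auto
    also have "\<dots> = (\<integral>\<eta>. (1 / w\<^sup>2) *\<^sub>R oseen_term 0 1 (t / w\<^sup>2, x) (1 / w\<^sup>2 * fst \<eta>, snd \<eta> + fst \<eta> *\<^sub>R 0) (?v (1 / w\<^sup>2 * fst \<eta>, snd \<eta> + fst \<eta> *\<^sub>R 0)) (?v (1 / w\<^sup>2 * fst \<eta>, snd \<eta> + fst \<eta> *\<^sub>R 0)) \<partial>lborel)"
      by (rule integral_scaleR_right[symmetric])
    also have "\<dots> = (\<integral>\<eta>. oseen_term 0 (of_real w) (t, x) \<eta> (?vw \<eta>) (?vw \<eta>) \<partial>lborel)"
    proof (intro Bochner_Integration.integral_cong refl)
      fix \<eta> :: "real \<times> (real^3)"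
      show "(1 / w\<^sup>2) *\<^sub>R oseen_term 0 1 (t / w\<^sup>2, x) (1 / w\<^sup>2 * fst \<eta>, snd \<eta> + fst \<eta> *\<^sub>R 0) (?v (1 / w\<^sup>2 * fst \<eta>, snd \<eta> + fst \<eta> *\<^sub>R 0)) (?v (1 / w\<^sup>2 * fst \<eta>, snd \<eta> + fst \<eta> *\<^sub>R 0)) =
        oseen_term 0 (of_real w) (t, x) \<eta> (?vw \<eta>) (?vw \<eta>)"
      proof (cases "0 < fst \<eta> \<and> fst \<eta> < t")
        case True
        have v: "?vw \<eta> = ?v (1 / w\<^sup>2 * fst \<eta>, snd \<eta> + fst \<eta> *\<^sub>R 0)"
          using Suc.IH[of "fst \<eta>" "snd \<eta>"] True by simp
        have c1: "0 < fst (1 / w\<^sup>2 * fst \<eta>, snd \<eta> + fst \<eta> *\<^sub>R 0) \<and> fst (1 / w\<^sup>2 * fst \<eta>, snd \<eta> + fst \<eta> *\<^sub>R (0::real^3)) < fst (t / w\<^sup>2, x)"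
          using True w by (simp add: divide_strict_right_mono)
        have c2: "0 < fst \<eta> \<and> fst \<eta> < fst (t, x)" using True by simp
        have d: "t / w\<^sup>2 - 1 / w\<^sup>2 * fst \<eta> = (t - fst \<eta>) / w\<^sup>2" by (simp add: diff_divide_distrib)
        have o: "oseenC (of_real w) (t - fst \<eta>) i j k (shifted z (t - fst \<eta>) 0) = of_real (1 / w\<^sup>2) * oseenC 1 ((t - fst \<eta>) / w\<^sup>2) i j k (shifted z ((t - fst \<eta>) / w\<^sup>2) 0)" for i j k z
          using True w sh[of z "t - fst \<eta>" "(t - fst \<eta>) / w\<^sup>2"] oseenC_dilate[OF w, of "t - fst \<eta>"] by simp
        show ?thesis
          unfolding v[symmetric]
          unfolding oseen_term_def fst_conv snd_conv d if_P[OF c1[unfolded fst_conv]] if_P[OF c2[unfolded fst_conv]] o scaleR_zero_right add_0_right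
          by (rule trilinear_scale[symmetric])
      next
        case False
        have c2: "\<not> (0 < fst \<eta> \<and> fst \<eta> < fst (t, x))" using False by simp
        have c1: "\<not> (0 < fst (1 / w\<^sup>2 * fst \<eta>, snd \<eta> + fst \<eta> *\<^sub>R 0) \<and> fst (1 / w\<^sup>2 * fst \<eta>, snd \<eta> + fst \<eta> *\<^sub>R (0::real^3)) < fst (t / w\<^sup>2, x))"
          using False w by (simp add: divide_less_cancel zero_less_divide_iff)
        show ?thesis unfolding oseen_term_def if_not_P[OF c1] if_not_P[OF c2] by (simp add: vec_eq_iff)
      qed
    qed
    finally show ?thesis using True by (simp add: picard.simps(2) heat)
  qed simp
qed simp

lemma nsV_dilate:
  assumes "a \<in> borel_measurable borel" "w > 0" "t > 0"
  shows "nsV a 0 (of_real w) (t, x) = nsV a 0 1 (t / w\<^sup>2, x)"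
proof -
  have "picard lborel (heat_term a 0 (of_real w)) (oseen_term 0 (of_real w)) n (t, x) = picard lborel (heat_term a 0 1) (oseen_term 0 1) n (t / w\<^sup>2, x)" for n
    using picard_heat_dilate[OF assms(1,2), of n t x] assms(3) by simp
  then show ?thesis by (simp add: nsV_def picard_limit_def)
qed

lemma integral_complex_Reals:
  assumes "\<And>y. f y \<in> \<real>" shows "(\<integral>y. f y \<partial>M) \<in> (\<real> :: complex set)"
proof -
  have f: "f = (\<lambda>y. of_real (Re (f y)))" using assms by (auto simp: of_real_Re)
  show ?thesis
  proof (cases "integrable M f")
    case True
    then have "(\<integral>y. of_real (Re (f y)) \<partial>M) = (of_real (\<integral>y. Re (f y) \<partial>M) :: complex)"
      by (intro integral_of_real integrable_Re)
    then show ?thesis by (subst f) simp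
  qed (simp add: not_integrable_integral_eq)
qed

lemma picard_heat_real:
  "picard lborel (heat_term a 0 1) (oseen_term 0 1) n \<xi> $ i \<in> \<real>"
proof (induction n arbitrary: \<xi> i)
  case (Suc n)
  have sh: "shifted z s 0 = cvec z" for z s by (simp add: shifted_def)
  have hr: "heatC 1 s (cvec z) \<in> \<real>" for s z by (simp add: heatC_1)
  have orr: "oseenC 1 s i j k (cvec z) \<in> \<real>" for s z i j k by (simp add: oseenC_1)
  have oif: "(if c then oseenC 1 s i j k (cvec z) else 0) \<in> \<real>" for c s i j k z using orr by (cases c) auto
  let ?v = "picard lborel (heat_term a 0 1) (oseen_term 0 1) n"
  have "heat_term a 0 1 \<xi> $ i \<in> \<real>"
    unfolding heat_term_def vec_lambda_beta sh by (intro integral_complex_Reals Reals_mult hr) auto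
  moreover have "(\<integral>\<eta>. oseen_term 0 1 \<xi> \<eta> (?v \<eta>) (?v \<eta>) \<partial>lborel) $ i \<in> \<real>"
  proof (cases "integrable lborel (\<lambda>\<eta>. oseen_term 0 1 \<xi> \<eta> (?v \<eta>) (?v \<eta>))")
    case True
    then have "(\<integral>\<eta>. oseen_term 0 1 \<xi> \<eta> (?v \<eta>) (?v \<eta>) \<partial>lborel) $ i = (\<integral>\<eta>. oseen_term 0 1 \<xi> \<eta> (?v \<eta>) (?v \<eta>) $ i \<partial>lborel)"
      by (rule integral_bounded_linear[OF bounded_linear_vec_nth, symmetric])
    also have "\<dots> \<in> \<real>"
      unfolding oseen_term_def trilinear_nth sh
      by (intro integral_complex_Reals sum_in_Reals Reals_mult oif Suc.IH[unfolded oseen_term_def sh])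
    finally show ?thesis .
  qed (simp add: not_integrable_integral_eq)
  ultimately show ?case unfolding picard.simps(2) vector_minus_component by (rule Reals_diff)
qed simp

lemma nsV_real:
  assumes "a \<in> borel_measurable borel" "nsW a \<xi> < \<infinity>"
  shows "nsV a 0 1 \<xi> $ i \<in> \<real>"
proof -
  interpret majorized_picard lborel "ns_beta a" ns_kappa "heat_term a 0 1" "oseen_term 0 1"
    using assms by (intro majorized_picard_heat) auto
  have "(\<lambda>n. v n \<xi>) \<longlonglongrightarrow> V \<xi>" using assms(2) by (intro picard_tendsto) (auto simp: nsW_def)
  then have "(\<lambda>n. v n \<xi> $ i) \<longlonglongrightarrow> V \<xi> $ i" by (rule tendsto_vec_nth)
  then show ?thesis
    unfolding nsV_def by (rule closed_sequentially[OF closed_complex_Reals, rotated]) (rule picard_heat_real)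
qed

section \<open>Regularity from analyticity in translations\<close>

lemma norm_vector_smult: "norm (z *s e) = norm z * norm (e :: complex^'n)"
  by (simp add: norm_vec_def norm_mult L2_set_right_distrib)

lemma norm_axis_one: "norm (axis j (1::complex) :: complex^'n) = 1"
proof -
  have "(\<Sum>i\<in>UNIV. (norm ((axis j (1::complex) :: complex^'n) $ i))\<^sup>2) = (\<Sum>i\<in>UNIV. if i = j then 1 else 0)"
    by (intro sum.cong) (auto simp: axis_def)
  then show ?thesis by (simp add: norm_vec_def L2_set_def)
qed

text \<open>\<open>F h\<close> stands for the translate of \<open>F 0\<close> by the complex vector
  h; the compatibility with real h' is what links the parameter to x. The bound M is the same for
  all h. Holomorphy is required along complex lines, as derivatives are taken one direction at a
  time.\<close>

definition trans_analytic :: "real \<Rightarrow> (real^3 \<Rightarrow> ennreal) \<Rightarrow> (complex^3 \<Rightarrow> real^3 \<Rightarrow> complex) \<Rightarrow> bool" where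
  "trans_analytic r M F \<longleftrightarrow> r > 0 \<and> M \<in> borel_measurable borel \<and> (\<forall>h. F h \<in> borel_measurable borel) \<and>
     (\<forall>h h' x. F (h + cvec h') x = F h (x + h')) \<and>
     (\<forall>x h. M x < \<infinity> \<longrightarrow> norm h < r \<longrightarrow> norm (F h x) \<le> enn2real (M x)) \<and>
     (\<forall>x h e. M x < \<infinity> \<longrightarrow> (\<lambda>z. F (h + z *s e) x) holomorphic_on {z. norm (h + z *s e) < r})"

lemma trans_analyticD:
  assumes "trans_analytic r M F"
  shows "r > 0" "M \<in> borel_measurable borel" "F h \<in> borel_measurable borel"
    "F (h + cvec h') x = F h (x + h')" "M x < \<infinity> \<Longrightarrow> norm h < r \<Longrightarrow> norm (F h x) \<le> enn2real (M x)"
    "M x < \<infinity> \<Longrightarrow> (\<lambda>z. F (h + z *s e) x) holomorphic_on {z. norm (h + z *s e) < r}"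
  using assms unfolding trans_analytic_def by auto

definition step :: "nat \<Rightarrow> real" where "step n = 1 / (real n + 1)"

lemma step_pos: "step n > 0" by (simp add: step_def)

lemma step_tendsto: "step \<longlonglongrightarrow> 0"
  unfolding step_def[abs_def] by real_asymp

text \<open>A limit along a fixed sequence, hence measurable in x even though it is a derivative
  only where M is finite.\<close>

definition trans_deriv :: "3 \<Rightarrow> (complex^3 \<Rightarrow> real^3 \<Rightarrow> complex) \<Rightarrow> complex^3 \<Rightarrow> real^3 \<Rightarrow> complex" where
  "trans_deriv j F h x = lim (\<lambda>n. (F (h + of_real (step n) *s axis j 1) x - F h x) / of_real (step n))"

lemma trans_analytic_slice:
  assumes F: "trans_analytic r M F" and x: "M x < \<infinity>" and h: "norm h < r / 2"
  shows "(\<lambda>z. F (h + z *s axis j 1) x) holomorphic_on ball 0 (r / 2)"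
    and "\<And>z. z \<in> ball 0 (r / 2) \<Longrightarrow> norm (F (h + z *s axis j 1) x) \<le> enn2real (M x)"
proof -
  have n: "norm (h + z *s axis j 1) < r" if "z \<in> ball 0 (r / 2)" for z
    using norm_triangle_ineq[of h "z *s axis j 1"] that h by (simp add: norm_vector_smult norm_axis_one)
  show "(\<lambda>z. F (h + z *s axis j 1) x) holomorphic_on ball 0 (r / 2)"
    using n by (intro holomorphic_on_subset[OF trans_analyticD(6)[OF F x]]) auto
  show "norm (F (h + z *s axis j 1) x) \<le> enn2real (M x)" if "z \<in> ball 0 (r / 2)" for z
    using n[OF that] by (intro trans_analyticD(5)[OF F x])
qed

text \<open>The Cauchy estimates on a disc of radius r / 2: 2 B / (r / 2) = 4 B / r and 8 B / (r /
  2)^2 = 32 B / r^2, with B the value of M at x.\<close>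

lemma trans_deriv_limit:
  assumes F: "trans_analytic r M F" and x: "M x < \<infinity>" and h: "norm h < r / 2"
  shows "(\<lambda>n. (F (h + of_real (step n) *s axis j 1) x - F h x) / of_real (step n)) \<longlonglongrightarrow> trans_deriv j F h x" (is "?q \<longlonglongrightarrow> _")
    and "trans_deriv j F h x = deriv (\<lambda>z. F (h + z *s axis j 1) x) 0"
    and "norm (trans_deriv j F h x) \<le> 4 / r * enn2real (M x)"
    and "step n < r / 8 \<Longrightarrow> norm ((F (h + of_real (step n) *s axis j 1) x - F h x) / of_real (step n) - trans_deriv j F h x) \<le> 32 * enn2real (M x) / r\<^sup>2 * step n"
    and "step n < r / 4 \<Longrightarrow> norm ((F (h + of_real (step n) *s axis j 1) x - F h x) / of_real (step n)) \<le> 4 / r * enn2real (M x)"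
proof -
  note r = trans_analyticD(1)[OF F]
  let ?f = "\<lambda>z. F (h + z *s axis j 1) x"
  note sl = trans_analytic_slice[OF F x h, where j=j]
  have "(?f has_field_derivative deriv ?f 0) (at 0)"
    using r by (intro holomorphic_derivI[OF sl(1)]) auto
  then have d: "((\<lambda>d. (?f (0 + d) - ?f 0) / d) \<longlongrightarrow> deriv ?f 0) (at 0)"
    unfolding DERIV_def .
  have "(\<lambda>n. of_real (step n) :: complex) \<longlonglongrightarrow> of_real 0"
    by (intro tendsto_of_real step_tendsto)
  moreover have "of_real (step n) \<noteq> (0::complex)" for n using step_pos[of n] by simp
  ultimately have l: "?q \<longlonglongrightarrow> deriv ?f 0"
    using d unfolding tendsto_at_iff_sequentially by (auto simp: o_def)
  show e: "trans_deriv j F h x = deriv ?f 0"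
    unfolding trans_deriv_def by (rule limI[OF l])
  show "?q \<longlonglongrightarrow> trans_deriv j F h x" using l e by simp
  show "norm (trans_deriv j F h x) \<le> 4 / r * enn2real (M x)"
    unfolding e using holomorphic_deriv_bound[OF sl(1) sl(2), of 0] r by simp
  show "norm (?q n - trans_deriv j F h x) \<le> 32 * enn2real (M x) / r\<^sup>2 * step n" if "step n < r / 8"
    unfolding e using holomorphic_difference_quotient[OF sl(1) sl(2), of "of_real (step n)"] that step_pos[of n] r
    by (simp add: power_divide)
  show "norm (?q n) \<le> 4 / r * enn2real (M x)" if "step n < r / 4"
    using holomorphic_Lipschitz[OF sl(1) sl(2), of "of_real (step n)"] that step_pos[of n] r
    by (simp add: norm_divide divide_le_eq)
qed

text \<open>Closure under differentiation, at the price of half the radius and a factor 4 / r in the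
  bound; iterated, this yields derivatives of all orders in the same L_q. Holomorphy of the
  derivative along a second direction holds since the difference quotients converge at a rate that
  is uniform on the line.\<close>

lemma trans_analytic_deriv:
  assumes F: "trans_analytic r M F"
  shows "trans_analytic (r / 2) (\<lambda>x. ennreal (4 / r) * M x) (trans_deriv j F)"
  unfolding trans_analytic_def
proof (intro conjI allI impI)
  note r = trans_analyticD(1)[OF F]
  have [measurable]: "M \<in> borel_measurable borel" "\<And>h. F h \<in> borel_measurable borel"
    using trans_analyticD[OF F] by auto
  show "r / 2 > 0" using r by simp
  show "(\<lambda>x. ennreal (4 / r) * M x) \<in> borel_measurable borel" by measurable
  show "trans_deriv j F h \<in> borel_measurable borel" for h
    unfolding trans_deriv_def[abs_def] by (rule borel_measurable_lim_metric) measurable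
  have fin: "M x < \<infinity>" if "ennreal (4 / r) * M x < \<infinity>" for x
    using that r by (auto simp: ennreal_mult_less_top)
  show "trans_deriv j F (h + cvec h') x = trans_deriv j F h (x + h')" for h h' x
  proof -
    have "F (h + cvec h' + z *s axis j 1) x = F (h + z *s axis j 1) (x + h')" for z
      using trans_analyticD(4)[OF F, of "h + z *s axis j 1" h' x] by (simp add: add_ac)
    then show ?thesis using trans_analyticD(4)[OF F, of h h' x] by (simp add: trans_deriv_def)
  qed
  show "norm (trans_deriv j F h x) \<le> enn2real (ennreal (4 / r) * M x)" if "ennreal (4 / r) * M x < \<infinity>" "norm h < r / 2" for x h
    using trans_deriv_limit(3)[OF F fin[OF that(1)] that(2)] r by (simp add: enn2real_mult)
  show "(\<lambda>z. trans_deriv j F (h + z *s e) x) holomorphic_on {z. norm (h + z *s e) < r / 2}"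
    if x': "ennreal (4 / r) * M x < \<infinity>" for x h e
  proof -
    note x = fin[OF x']
    let ?A = "{z. norm (h + z *s e) < r / 2}"
    have cont: "continuous_on UNIV (\<lambda>z. norm (h + z *s e))"
    proof -
      have "continuous_on UNIV (\<lambda>z. z *s e)"
        unfolding vector_scalar_mult_def by (intro continuous_intros)
      then show ?thesis by (intro continuous_intros)
    qed
    have A: "open ?A"
      using cont by (intro open_Collect_less) auto
    have "eventually (\<lambda>n. step n < r / 8) sequentially"
      using r by (intro order_tendstoD[OF step_tendsto]) auto
    then obtain N where N: "\<And>n. n \<ge> N \<Longrightarrow> step n < r / 8" by (auto simp: eventually_sequentially)
    let ?q = "\<lambda>n z. (F (h + z *s e + of_real (step n) *s axis j 1) x - F (h + z *s e) x) / of_real (step n)"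
    show ?thesis
    proof (rule holomorphic_uniform_sequence[OF A, of "\<lambda>n. ?q (n + N)"])
      fix n
      have s: "step (n + N) < r / 8" by (rule N) simp
      have sub: "norm (h + of_real (step (n + N)) *s axis j 1 + z *s e) < r" if "z \<in> ?A" for z
        using norm_triangle_ineq[of "h + z *s e" "of_real (step (n + N)) *s axis j 1"] that s step_pos[of "n+N"]
        by (simp add: norm_vector_smult norm_axis_one add_ac)
      have "(\<lambda>z. F (h + of_real (step (n + N)) *s axis j 1 + z *s e) x) holomorphic_on ?A"
        using sub by (intro holomorphic_on_subset[OF trans_analyticD(6)[OF F x]]) auto
      moreover have "(\<lambda>z. F (h + z *s e) x) holomorphic_on ?A"
        using r by (intro holomorphic_on_subset[OF trans_analyticD(6)[OF F x]]) auto
      ultimately show "?q (n + N) holomorphic_on ?A"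
        using step_pos[of "n + N"] by (intro holomorphic_intros) (auto simp: add_ac)
    next
      fix z assume "z \<in> ?A"
      then obtain d where d: "d > 0" "cball z d \<subseteq> ?A" using A open_contains_cball by blast
      have "uniform_limit ?A (\<lambda>n. ?q (n + N)) (\<lambda>z. trans_deriv j F (h + z *s e) x) sequentially"
      proof (rule uniform_limitI)
        fix \<epsilon> :: real assume "\<epsilon> > 0"
        have "(\<lambda>n. 32 * enn2real (M x) / r\<^sup>2 * step (n + N)) \<longlonglongrightarrow> 32 * enn2real (M x) / r\<^sup>2 * 0"
          by (intro tendsto_intros LIMSEQ_ignore_initial_segment step_tendsto)
        then have "eventually (\<lambda>n. 32 * enn2real (M x) / r\<^sup>2 * step (n + N) < \<epsilon>) sequentially"
          using \<open>\<epsilon> > 0\<close> by (intro order_tendstoD) auto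
        then show "\<forall>\<^sub>F n in sequentially. \<forall>z\<in>?A. dist (?q (n + N) z) (trans_deriv j F (h + z *s e) x) < \<epsilon>"
        proof eventually_elim
          case (elim n)
          have s: "step (n + N) < r / 8" by (rule N) simp
          show ?case
            unfolding dist_norm by (intro ballI le_less_trans[OF trans_deriv_limit(4)[OF F x _ s] elim]) simp
        qed
      qed
      then have "uniform_limit (cball z d) (\<lambda>n. ?q (n + N)) (\<lambda>z. trans_deriv j F (h + z *s e) x) sequentially"
        using d(2) uniform_limit_on_subset by blast
      then show "\<exists>d>0. cball z d \<subseteq> ?A \<and> uniform_limit (cball z d) (\<lambda>n. ?q (n + N)) (\<lambda>z. trans_deriv j F (h + z *s e) x) sequentially"
        using d by blast
    qed
  qed
qed

section \<open>Test functions and weak derivatives\<close>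

lemma partial_derivs_append: "partial_derivs (js @ ks) f = partial_derivs js (partial_derivs ks f)"
  by (induction js) auto

lemma partial_deriv_zero_outside:
  fixes \<phi> :: "real^3 \<Rightarrow> real"
  assumes "\<And>x. norm x > R \<Longrightarrow> \<phi> x = 0" "norm x > R"
  shows "partial_deriv j \<phi> x = 0"
proof -
  have "open {x::real^3. norm x > R}" by (intro open_Collect_less continuous_intros)
  then have "(\<phi> has_derivative (\<lambda>_. 0)) (at x)"
    using assms by (intro has_derivative_transform_within_open[of "\<lambda>_. 0" _ _ _ "{x. norm x > R}" \<phi>]) auto
  then have "frechet_derivative \<phi> (at x) = (\<lambda>_. 0)" by (rule frechet_derivative_at[symmetric])
  then show ?thesis by (simp add: partial_deriv_def)
qed

lemma test_function_partial_derivs: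
  assumes "test_function \<phi>" shows "test_function (partial_derivs js \<phi>)"
proof -
  obtain R where R: "\<And>x. norm x > R \<Longrightarrow> \<phi> x = 0" using assms by (auto simp: test_function_def)
  have "partial_derivs js \<phi> x = 0" if "norm x > R" for x
    using that by (induction js arbitrary: x) (auto intro!: R partial_deriv_zero_outside[of R])
  then show ?thesis
    using assms by (auto simp: test_function_def simp flip: partial_derivs_append)
qed

lemma test_function_facts:
  assumes "test_function \<phi>"
  obtains R C where "\<And>x. norm x > R \<Longrightarrow> \<phi> x = 0" "\<And>x. \<bar>\<phi> x\<bar> \<le> C" "continuous_on UNIV \<phi>" "R > 0" "C > 0"
proof -
  obtain R where R: "\<And>x. norm x > R \<Longrightarrow> \<phi> x = 0" using assms by (auto simp: test_function_def)
  have "\<phi> differentiable (at x)" for x using assms unfolding test_function_def by (metis partial_derivs.simps(1))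
  then have c: "continuous_on UNIV \<phi>"
    by (intro continuous_at_imp_continuous_on ballI differentiable_imp_continuous_within) auto
  have "compact (\<phi> ` cball 0 \<bar>R\<bar>)"
    by (intro compact_continuous_image continuous_on_subset[OF c]) auto
  then obtain C where "\<forall>y\<in>\<phi> ` cball 0 \<bar>R\<bar>. norm y \<le> C"
    using compact_imp_bounded[of "\<phi> ` cball 0 \<bar>R\<bar>"] unfolding bounded_iff by blast
  then have C: "\<And>x. x \<in> cball 0 \<bar>R\<bar> \<Longrightarrow> \<bar>\<phi> x\<bar> \<le> C" by auto
  show thesis
  proof (rule that[of "\<bar>R\<bar> + 1" "\<bar>C\<bar> + 1"])
    show "\<bar>\<phi> x\<bar> \<le> \<bar>C\<bar> + 1" for x
      using C[of x] R[of x] by (cases "norm x \<le> \<bar>R\<bar>") auto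
  qed (use c R in auto)
qed

lemma nn_integral_ball_lq:
  fixes M :: "real^3 \<Rightarrow> ennreal"
  assumes [measurable]: "M \<in> borel_measurable borel" and q: "q \<ge> 1" and fin: "lq q M < \<infinity>"
  shows "(\<integral>\<^sup>+x. indicator (cball 0 R) x * M x \<partial>lborel) < \<infinity>"
proof -
  have le: "m \<le> 1 + epow m q" for m
  proof (cases m)
    case (real c)
    have "c \<le> 1 + c powr q"
    proof (cases "c \<le> 1")
      case False
      then have "c powr 1 \<le> c powr q" using q by (intro powr_mono) auto
      then show ?thesis using False by simp
    qed (simp add: add_increasing2)
    then show ?thesis using real by (simp add: epow_ennreal ennreal_leI flip: ennreal_1 ennreal_plus)
  qed simp
  have "(\<integral>\<^sup>+x. indicator (cball 0 R) x * M x \<partial>lborel) \<le> (\<integral>\<^sup>+x. indicator (cball 0 R) x + epow (M x) q \<partial>lborel)"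
    by (intro nn_integral_mono) (auto simp: le split: split_indicator)
  also have "\<dots> = (\<integral>\<^sup>+x. indicator (cball (0::real^3) R) x \<partial>lborel) + lq q M"
    unfolding lq_def by (rule nn_integral_add) (simp_all add: borel_measurable_indicator)
  also have "(\<integral>\<^sup>+x. indicator (cball (0::real^3) R) x \<partial>lborel) = emeasure lborel (cball (0::real^3) R)"
    by (rule nn_integral_indicator) simp
  finally have "(\<integral>\<^sup>+x. indicator (cball 0 R) x * M x \<partial>lborel) \<le> emeasure lborel (cball (0::real^3) R) + lq q M" .
  also have "\<dots> < \<infinity>" using fin emeasure_lborel_cball_finite[of 0 R] by (simp add: less_top)
  finally show ?thesis .
qed

lemma integrable_compact_majorant:
  fixes f :: "real^3 \<Rightarrow> 'b::{banach, second_countable_topology}"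
  assumes "f \<in> borel_measurable borel" and [measurable]: "M \<in> borel_measurable borel" and "q \<ge> 1" "lq q M < \<infinity>"
    and "\<And>x. M x < \<infinity> \<Longrightarrow> norm (f x) \<le> C * (indicator (cball 0 R) x * enn2real (M x))"
  shows "integrable lborel f"
    and "integrable lborel (\<lambda>x. C * (indicator (cball 0 R) x * enn2real (M x)))"
    and "AE x in lborel. M x < \<infinity>"
proof -
  have "(\<integral>\<^sup>+x. epow (M x) q \<partial>lborel) \<noteq> \<infinity>" using assms(4) by (simp add: lq_def)
  then have "AE x in lborel. epow (M x) q \<noteq> \<infinity>" by (intro nn_integral_PInf_AE) auto
  then show AE: "AE x in lborel. M x < \<infinity>" by eventually_elim (auto simp: less_top)
  have "integrable lborel (\<lambda>x. indicator (cball 0 R) x * enn2real (M x))"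
  proof (rule integrableI_bounded)
    have "(\<integral>\<^sup>+x. ennreal (norm (indicator (cball 0 R) x * enn2real (M x))) \<partial>lborel) \<le> (\<integral>\<^sup>+x. indicator (cball 0 R) x * M x \<partial>lborel)"
      using AE by (intro nn_integral_mono_AE) (auto elim!: eventually_mono split: split_indicator)
    then show "(\<integral>\<^sup>+x. ennreal (norm (indicator (cball 0 R) x * enn2real (M x))) \<partial>lborel) < \<infinity>"
      using nn_integral_ball_lq[OF assms(2-4), of R] by (rule le_less_trans)
    have [measurable]: "cball (0::real^3) R \<in> sets borel" by simp
    have "(\<lambda>x. indicator (cball 0 R) x * enn2real (M x)) \<in> borel_measurable borel" by measurable
    then show "(\<lambda>x. indicator (cball 0 R) x * enn2real (M x)) \<in> borel_measurable lborel" by simp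
  qed
  then show g: "integrable lborel (\<lambda>x. C * (indicator (cball 0 R) x * enn2real (M x)))" by (rule integrable_mult_right)
  show "integrable lborel f"
    using assms(1,5) AE by (intro Bochner_Integration.integrable_bound[OF g]) (auto elim!: eventually_mono intro!: order_trans[OF assms(5) abs_ge_self])
qed

text \<open>Discrete integration by parts. A translation of the integral moves the forward quotient
  from F to a backward one on the test function (\<open>eq\<close>), and both sides converge by
  domination with a multiple of M on a ball. The backward quotient \<open>q2\<close> tends to minus
  the partial derivative, which is the sign in the result.\<close>

lemma trans_deriv_weak:
  assumes F: "trans_analytic r M F" and q: "q \<ge> 1" "lq q M < \<infinity>" and \<phi>: "test_function \<phi>"
  shows "(\<integral>x. of_real (partial_deriv j \<phi> x) * F 0 x \<partial>lborel) = - (\<integral>x. of_real (\<phi> x) * trans_deriv j F 0 x \<partial>lborel)"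
proof -
  note r = trans_analyticD(1)[OF F]
  have Mm[measurable]: "M \<in> borel_measurable borel" and Fm[measurable]: "F h \<in> borel_measurable borel" for h
    using trans_analyticD[OF F] by auto
  have Dm[measurable]: "trans_deriv j F h \<in> borel_measurable borel" for h
    using trans_analyticD(3)[OF trans_analytic_deriv[OF F]] .
  obtain R C where RC: "\<And>x. norm x > R \<Longrightarrow> \<phi> x = 0" "\<And>x. \<bar>\<phi> x\<bar> \<le> C" "continuous_on UNIV \<phi>" "R > 0" "C > 0"
    using test_function_facts[OF \<phi>] by blast
  have \<psi>: "test_function (partial_deriv j \<phi>)" using test_function_partial_derivs[OF \<phi>, of "[j]"] by simp
  obtain R' L where RL: "\<And>x. norm x > R' \<Longrightarrow> partial_deriv j \<phi> x = 0" "\<And>x. \<bar>partial_deriv j \<phi> x\<bar> \<le> L" "continuous_on UNIV (partial_deriv j \<phi>)" "R' > 0" "L > 0"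
    using test_function_facts[OF \<psi>] by blast
  have [measurable]: "\<phi> \<in> borel_measurable borel" "partial_deriv j \<phi> \<in> borel_measurable borel"
    using RC(3) RL(3) by (auto intro: borel_measurable_continuous_onI)
  define e :: "real^3" where "e = axis j 1"
  have ne: "norm e = 1" by (simp add: e_def)
  have ce: "cvec (s *\<^sub>R e) = of_real s *s axis j 1" for s by (simp add: vec_eq_iff e_def axis_def)
  have diff: "\<phi> differentiable (at x)" for x using \<phi> unfolding test_function_def by (metis partial_derivs.simps(1))
  have line: "((\<lambda>s. \<phi> (x + s *\<^sub>R e)) has_real_derivative partial_deriv j \<phi> (x + s *\<^sub>R e)) (at s within S)" for x s S
  proof -
    have 1: "(\<phi> has_derivative frechet_derivative \<phi> (at (x + s *\<^sub>R e))) (at (x + s *\<^sub>R e))"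
      using diff frechet_derivative_works by blast
    have 2: "((\<lambda>s. x + s *\<^sub>R e) has_derivative (\<lambda>d. d *\<^sub>R e)) (at s within S)"
      by (auto intro!: derivative_eq_intros)
    have 3: "((\<lambda>s. \<phi> (x + s *\<^sub>R e)) has_derivative (\<lambda>d. frechet_derivative \<phi> (at (x + s *\<^sub>R e)) (d *\<^sub>R e))) (at s within S)"
      using has_derivative_compose[OF 2 1] .
    have "frechet_derivative \<phi> (at (x + s *\<^sub>R e)) (d *\<^sub>R e) = partial_deriv j \<phi> (x + s *\<^sub>R e) * d" for d
      using linear_scale[OF has_derivative_linear[OF 1]] by (simp add: partial_deriv_def e_def mult.commute)
    with 3 show ?thesis by (simp add: has_field_derivative_def)
  qed
  let ?s = step
  define q1 where "q1 n x = of_real (\<phi> x) * ((F (0 + of_real (?s n) *s axis j 1) x - F 0 x) / of_real (?s n))" for n x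
  define q2 where "q2 n x = of_real ((\<phi> (x + (- ?s n) *\<^sub>R e) - \<phi> x) / ?s n) * F 0 x" for n x
  have "eventually (\<lambda>n. ?s n < r / 4 \<and> ?s n < 1) sequentially"
    using r order_tendstoD(2)[OF step_tendsto, of "r / 4"] order_tendstoD(2)[OF step_tendsto, of 1] by (auto intro: eventually_conj)
  then obtain N where N: "\<And>n. n \<ge> N \<Longrightarrow> ?s n < r / 4 \<and> ?s n < 1" by (auto simp: eventually_sequentially)
  have q1m[measurable]: "q1 n \<in> borel_measurable borel" for n unfolding q1_def[abs_def] by measurable
  have q2m[measurable]: "q2 n \<in> borel_measurable borel" for n unfolding q2_def[abs_def] by measurable
  have q1b: "norm (q1 n x) \<le> (C * (4 / r)) * (indicator (cball 0 R) x * enn2real (M x))" if "n \<ge> N" "M x < \<infinity>" for n x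
  proof (cases "norm x > R")
    case False
    have "norm (q1 n x) \<le> C * (4 / r * enn2real (M x))"
      unfolding q1_def norm_mult norm_of_real using RC trans_deriv_limit(5)[OF F that(2), of 0 n j] N[OF that(1)] r
      by (intro mult_mono) auto
    then show ?thesis using False by simp
  qed (simp add: q1_def RC(1))
  have q2b: "norm (q2 n x) \<le> L * (indicator (cball 0 (R + 1)) x * enn2real (M x))" if "n \<ge> N" "M x < \<infinity>" for n x
  proof (cases "norm x > R + 1")
    case False
    have "norm (\<phi> (x + (- ?s n) *\<^sub>R e) - \<phi> (x + 0 *\<^sub>R e)) \<le> L * norm (- ?s n - 0)"
      by (rule field_differentiable_bound[where S=UNIV and f="\<lambda>s. \<phi> (x + s *\<^sub>R e)"]) (auto intro!: line RL(2) simp: real_norm_def)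
    then have "\<bar>(\<phi> (x + (- ?s n) *\<^sub>R e) - \<phi> x) / ?s n\<bar> \<le> L"
      using step_pos[of n] by (simp add: divide_le_eq)
    moreover have "norm (F 0 x) \<le> enn2real (M x)" using trans_analyticD(5)[OF F that(2), of 0] r by simp
    ultimately have "norm (q2 n x) \<le> L * enn2real (M x)"
      unfolding q2_def norm_mult norm_of_real using RL(5) by (intro mult_mono) auto
    then show ?thesis using False by simp
  next
    case True
    have "norm (x + (- ?s n) *\<^sub>R e) \<ge> norm x - ?s n"
      using norm_triangle_ineq2[of x "?s n *\<^sub>R e"] step_pos[of n] ne by simp
    then have "norm (x + (- ?s n) *\<^sub>R e) > R" using True N[OF that(1)] by linarith
    then show ?thesis using True RC(1) RC(4) by (simp add: q2_def)
  qed
  note ic1 = integrable_compact_majorant[OF q1m Mm q q1b]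
  note ic2 = integrable_compact_majorant[OF q2m Mm q q2b]
  have AE: "AE x in lborel. M x < \<infinity>" using ic1(3)[of N] by simp
  have l1: "(\<lambda>n. \<integral>x. q1 (n + N) x \<partial>lborel) \<longlonglongrightarrow> (\<integral>x. of_real (\<phi> x) * trans_deriv j F 0 x \<partial>lborel)"
  proof (rule integral_dominated_convergence[where w="\<lambda>x. (C * (4 / r)) * (indicator (cball 0 R) x * enn2real (M x))"])
    show "AE x in lborel. (\<lambda>n. q1 (n + N) x) \<longlonglongrightarrow> of_real (\<phi> x) * trans_deriv j F 0 x"
      using AE
    proof eventually_elim
      case (elim x)
      show ?case unfolding q1_def
        using r by (intro tendsto_intros LIMSEQ_ignore_initial_segment[OF trans_deriv_limit(1)[OF F elim]]) auto
    qed
    show "AE x in lborel. norm (q1 (n + N) x) \<le> (C * (4 / r)) * (indicator (cball 0 R) x * enn2real (M x))" for n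
      using AE by eventually_elim (rule q1b, auto)
    show "integrable lborel (\<lambda>x. (C * (4 / r)) * (indicator (cball 0 R) x * enn2real (M x)))"
      using ic1(2)[of N] by simp
  qed measurable
  have l2: "(\<lambda>n. \<integral>x. q2 (n + N) x \<partial>lborel) \<longlonglongrightarrow> (\<integral>x. - (of_real (partial_deriv j \<phi> x) * F 0 x) \<partial>lborel)"
  proof (rule integral_dominated_convergence[where w="\<lambda>x. L * (indicator (cball 0 (R + 1)) x * enn2real (M x))"])
    show "AE x in lborel. (\<lambda>n. q2 (n + N) x) \<longlonglongrightarrow> - (of_real (partial_deriv j \<phi> x) * F 0 x)"
    proof (intro always_eventually allI)
      fix x
      have lim0: "((\<lambda>h. (\<phi> (x + (0 + h) *\<^sub>R e) - \<phi> (x + 0 *\<^sub>R e)) / h) \<longlongrightarrow> partial_deriv j \<phi> (x + 0 *\<^sub>R e)) (at 0)"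
        using line[of x 0 UNIV] unfolding DERIV_def .
      have neg: "(\<lambda>n. - ?s n) \<longlonglongrightarrow> 0" using tendsto_minus[OF step_tendsto] by simp
      have nz: "\<forall>n. - ?s n \<in> UNIV - {0}" using step_pos by (metis Diff_iff UNIV_I less_irrefl neg_0_equal_iff_equal singletonD)
      have "((\<lambda>h. (\<phi> (x + (0 + h) *\<^sub>R e) - \<phi> (x + 0 *\<^sub>R e)) / h) \<circ> (\<lambda>n. - ?s n)) \<longlonglongrightarrow> partial_deriv j \<phi> (x + 0 *\<^sub>R e)"
        by (rule lim0[unfolded tendsto_at_iff_sequentially, THEN spec, THEN mp, THEN mp, OF nz neg])
      then have "(\<lambda>n. (\<phi> (x + (- ?s n) *\<^sub>R e) - \<phi> x) / - ?s n) \<longlonglongrightarrow> partial_deriv j \<phi> x"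
        by (simp add: o_def)
      then have "(\<lambda>n. of_real (- ((\<phi> (x + (- ?s n) *\<^sub>R e) - \<phi> x) / - ?s n)) * F 0 x) \<longlonglongrightarrow> of_real (- partial_deriv j \<phi> x) * F 0 x"
        by (intro tendsto_intros)
      then have "(\<lambda>n. q2 n x) \<longlonglongrightarrow> - (of_real (partial_deriv j \<phi> x) * F 0 x)"
        by (simp add: q2_def)
      then show "(\<lambda>n. q2 (n + N) x) \<longlonglongrightarrow> - (of_real (partial_deriv j \<phi> x) * F 0 x)"
        by (rule LIMSEQ_ignore_initial_segment)
    qed
    show "AE x in lborel. norm (q2 (n + N) x) \<le> L * (indicator (cball 0 (R + 1)) x * enn2real (M x))" for n
      using AE by eventually_elim (rule q2b, auto)
    show "integrable lborel (\<lambda>x. L * (indicator (cball 0 (R + 1)) x * enn2real (M x)))"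
      using ic2(2)[of N] by simp
  qed measurable
  have eq: "(\<integral>x. q1 n x \<partial>lborel) = (\<integral>x. q2 n x \<partial>lborel)" if n: "n \<ge> N" for n
  proof -
    have F0: "norm (F 0 x) \<le> enn2real (M x)" if "M x < \<infinity>" for x using trans_analyticD(5)[OF F that, of 0] r by simp
    have i1: "integrable lborel (\<lambda>x. of_real (\<phi> x) * F 0 x)"
    proof (rule integrable_compact_majorant(1)[OF _ Mm q])
      show "norm (of_real (\<phi> x) * F 0 x) \<le> C * (indicator (cball 0 R) x * enn2real (M x))" if "M x < \<infinity>" for x
        using F0[OF that] RC(1,2,5) by (cases "norm x > R") (auto simp: norm_mult intro!: mult_mono)
    qed measurable
    have i2: "integrable lborel (\<lambda>x. of_real (\<phi> (x + (- ?s n) *\<^sub>R e)) * F 0 x)"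
    proof -
      have "integrable lborel (\<lambda>x. of_real (?s n) * q2 n x + of_real (\<phi> x) * F 0 x)"
        using ic2(1)[of n] n i1 by (intro Bochner_Integration.integrable_add integrable_mult_right) auto
      moreover have "(\<lambda>x. of_real (?s n) * q2 n x + of_real (\<phi> x) * F 0 x) = (\<lambda>x. of_real (\<phi> (x + (- ?s n) *\<^sub>R e)) * F 0 x)"
        using step_pos[of n] by (auto simp: fun_eq_iff q2_def field_simps)
      ultimately show ?thesis by simp
    qed
    have tr: "(\<integral>x. of_real (\<phi> x) * F 0 (x + ?s n *\<^sub>R e) \<partial>lborel) = (\<integral>x. of_real (\<phi> (x + (- ?s n) *\<^sub>R e)) * F 0 x \<partial>lborel)"
      and i3: "integrable lborel (\<lambda>x. of_real (\<phi> x) * F 0 (x + ?s n *\<^sub>R e))"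
    proof -
      have d: "(lborel :: (real^3) measure) = distr lborel borel (\<lambda>x. ?s n *\<^sub>R e + x)"
        by (rule lborel_distr_plus[symmetric])
      show "(\<integral>x. of_real (\<phi> x) * F 0 (x + ?s n *\<^sub>R e) \<partial>lborel) = (\<integral>x. of_real (\<phi> (x + (- ?s n) *\<^sub>R e)) * F 0 x \<partial>lborel)"
        by (subst (2) d, subst integral_distr) (auto simp: add.commute)
      have "integrable (distr lborel borel (\<lambda>x. ?s n *\<^sub>R e + x)) (\<lambda>x. of_real (\<phi> (x + (- ?s n) *\<^sub>R e)) * F 0 x)"
        using i2 d by simp
      then show "integrable lborel (\<lambda>x. of_real (\<phi> x) * F 0 (x + ?s n *\<^sub>R e))"
        by (subst (asm) integrable_distr_eq) (auto simp: add.commute)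
    qed
    have sh: "F (0 + of_real (?s n) *s axis j 1) x = F 0 (x + ?s n *\<^sub>R e)" for x
      using trans_analyticD(4)[OF F, of 0 "?s n *\<^sub>R e" x] unfolding ce .
    have "(\<integral>x. q1 n x \<partial>lborel) = (\<integral>x. (of_real (\<phi> x) * F 0 (x + ?s n *\<^sub>R e) - of_real (\<phi> x) * F 0 x) / of_real (?s n) \<partial>lborel)"
      unfolding q1_def sh right_diff_distrib times_divide_eq_right ..
    also have "\<dots> = ((\<integral>x. of_real (\<phi> x) * F 0 (x + ?s n *\<^sub>R e) \<partial>lborel) - (\<integral>x. of_real (\<phi> x) * F 0 x \<partial>lborel)) / of_real (?s n)"
      by (simp only: integral_divide_zero Bochner_Integration.integral_diff[OF i3 i1])
    also have "\<dots> = (\<integral>x. (of_real (\<phi> (x + (- ?s n) *\<^sub>R e)) * F 0 x - of_real (\<phi> x) * F 0 x) / of_real (?s n) \<partial>lborel)"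
      by (simp only: integral_divide_zero Bochner_Integration.integral_diff[OF i2 i1] tr)
    also have "\<dots> = (\<integral>x. q2 n x \<partial>lborel)"
      by (intro Bochner_Integration.integral_cong refl) (simp add: q2_def left_diff_distrib)
    finally show ?thesis .
  qed
  have "(\<integral>x. of_real (\<phi> x) * trans_deriv j F 0 x \<partial>lborel) = (\<integral>x. - (of_real (partial_deriv j \<phi> x) * F 0 x) \<partial>lborel)"
    using LIMSEQ_unique[OF l1] l2 by (simp add: eq)
  then show ?thesis by simp
qed

text \<open>The outermost derivative of the test function is moved first; it turns F into
  \<open>trans_deriv j F\<close>, so the induction has to run over all F, M and r at once.\<close>

lemma trans_analytic_weak_derivs:
  assumes "trans_analytic r M F" "q \<ge> 1" "lq q M < \<infinity>"
  shows "\<exists>r' M' G. trans_analytic r' M' G \<and> lq q M' < \<infinity> \<and>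
    (\<forall>\<phi>. test_function \<phi> \<longrightarrow> (\<integral>x. of_real (partial_derivs js \<phi> x) * F 0 x \<partial>lborel) = (-1) ^ length js * (\<integral>x. of_real (\<phi> x) * G 0 x \<partial>lborel))"
  using assms
proof (induction js arbitrary: r M F)
  case Nil
  then show ?case by auto
next
  case (Cons j js)
  note F = Cons.prems(1)
  have "lq q (\<lambda>x. ennreal (4 / r) * M x) = epow (ennreal (4 / r)) q * lq q M"
    unfolding lq_def using trans_analyticD(2)[OF F] by (simp add: epow_mult nn_integral_cmult)
  then have fin: "lq q (\<lambda>x. ennreal (4 / r) * M x) < \<infinity>"
    using Cons.prems(3) by (auto simp: ennreal_mult_less_top epow_def)
  from Cons.IH[OF trans_analytic_deriv[OF F, of j] Cons.prems(2) fin]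
  obtain r' M' G where G: "trans_analytic r' M' G \<and> lq q M' < \<infinity> \<and>
     (\<forall>\<phi>. test_function \<phi> \<longrightarrow> (\<integral>x. of_real (partial_derivs js \<phi> x) * trans_deriv j F 0 x \<partial>lborel) = (-1) ^ length js * (\<integral>x. of_real (\<phi> x) * G 0 x \<partial>lborel))"
    by (elim exE)
  have "(\<integral>x. of_real (partial_derivs (j # js) \<phi> x) * F 0 x \<partial>lborel) = (-1) ^ length (j # js) * (\<integral>x. of_real (\<phi> x) * G 0 x \<partial>lborel)" if "test_function \<phi>" for \<phi>
    using trans_deriv_weak[OF F Cons.prems(2,3) test_function_partial_derivs[OF that], of j js] G that by simp
  then show ?case using G by (intro exI[of _ r'] exI[of _ M'] exI[of _ G]) simp
qed

section \<open>Extended integrals versus Lebesgue norms, and vector fields assembled from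
  components\<close>

lemma lq_norm_eq:
  fixes g :: "real^3 \<Rightarrow> real^3"
  shows "lq q (\<lambda>x. ennreal (norm (g x))) = (\<integral>\<^sup>+x. ennreal (norm (g x) powr q) \<partial>lborel)"
  by (simp add: lq_def epow_ennreal)

lemma in_Lq_iff_lq:
  fixes g :: "real^3 \<Rightarrow> real^3"
  assumes [measurable]: "g \<in> borel_measurable borel"
  shows "in_Lq q g \<longleftrightarrow> lq q (\<lambda>x. ennreal (norm (g x))) < \<infinity>"
proof -
  have "g \<in> borel_measurable lebesgue" by (rule measurable_completion) simp
  moreover have "integrable lebesgue (\<lambda>x. norm (g x) powr q) \<longleftrightarrow> integrable lborel (\<lambda>x. norm (g x) powr q)"
    by (rule integrable_completion) simp
  moreover have "integrable lborel (\<lambda>x. norm (g x) powr q) \<longleftrightarrow> (\<integral>\<^sup>+x. ennreal (norm (g x) powr q) \<partial>lborel) < \<infinity>"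
    unfolding integrable_iff_bounded by simp
  ultimately show ?thesis by (simp add: in_Lq_def lq_norm_eq)
qed

lemma Lq_norm_lq:
  fixes g :: "real^3 \<Rightarrow> real^3"
  assumes [measurable]: "g \<in> borel_measurable borel" and "in_Lq q g" "q > 0"
  shows "ennreal (Lq_norm q g powr q) = lq q (\<lambda>x. ennreal (norm (g x)))"
proof -
  have i: "integrable lborel (\<lambda>x. norm (g x) powr q)"
    using assms(2) integrable_completion[of "\<lambda>x. norm (g x) powr q" lborel] by (simp add: in_Lq_def)
  have "Lq_norm q g powr q = (\<integral>x. norm (g x) powr q \<partial>lborel)"
    using assms(3) by (simp add: Lq_norm_def powr_powr integral_completion)
  then show ?thesis using i by (simp add: lq_norm_eq nn_integral_eq_integral)
qed

lemma lq_mono_AE: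
  assumes "AE x in lborel. f x \<le> g x" "q \<ge> 0" shows "lq q f \<le> lq q g"
  unfolding lq_def using assms by (intro nn_integral_mono_AE) (auto elim!: eventually_mono intro: epow_mono)

lemma lq_finite_AE:
  assumes [measurable]: "M \<in> borel_measurable borel" and "lq q M < \<infinity>"
  shows "AE x in lborel. M x < \<infinity>"
proof -
  have "(\<integral>\<^sup>+x. epow (M x) q \<partial>lborel) \<noteq> \<infinity>" using assms(2) by (simp add: lq_def)
  then have "AE x in lborel. epow (M x) q \<noteq> \<infinity>" by (intro nn_integral_PInf_AE) auto
  then show ?thesis by eventually_elim (auto simp: less_top)
qed

lemma lq_add_finite:
  assumes "f \<in> borel_measurable borel" "g \<in> borel_measurable borel" "q > 0" "lq q f < \<infinity>" "lq q g < \<infinity>"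
  shows "lq q (\<lambda>x. f x + g x) < \<infinity>"
proof (rule le_less_trans[OF lq_add[OF assms(1-3)]])
  show "ennreal (2 powr q) * (lq q f + lq q g) < \<infinity>"
    using assms(4,5) by (simp add: ennreal_mult_less_top)
qed

lemma lq_sum_finite:
  assumes "finite I" "\<And>i. i \<in> I \<Longrightarrow> f i \<in> borel_measurable borel" "q > 0" "\<And>i. i \<in> I \<Longrightarrow> lq q (f i) < \<infinity>"
  shows "lq q (\<lambda>x. \<Sum>i\<in>I. f i x) < \<infinity>"
  using assms
proof (induction I rule: finite_induct)
  case empty
  then show ?case by (simp add: lq_def)
next
  case (insert i I)
  have "lq q (\<lambda>x. f i x + (\<Sum>i\<in>I. f i x)) < \<infinity>"
  proof (rule lq_add_finite)
    show "lq q (\<lambda>x. \<Sum>i\<in>I. f i x) < \<infinity>" using insert by auto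
    show "(\<lambda>x. \<Sum>i\<in>I. f i x) \<in> borel_measurable borel" using insert by (intro borel_measurable_sum) auto
  qed (use insert in auto)
  then show ?case using insert.hyps by simp
qed

text \<open>Each component may bring its own majorant, as happens when a multi-index derivative is
  taken component by component; the sum of the majorants then dominates the field.\<close>

locale majorized_components =
  fixes q :: real and M :: "3 \<Rightarrow> real^3 \<Rightarrow> ennreal" and G :: "3 \<Rightarrow> real^3 \<Rightarrow> complex"
  assumes q: "q \<ge> 1" and Gm [measurable]: "G i \<in> borel_measurable borel" and Mm [measurable]: "M i \<in> borel_measurable borel"
    and fin: "lq q (M i) < \<infinity>" and bound: "M i x < \<infinity> \<Longrightarrow> norm (G i x) \<le> enn2real (M i x)"
begin

definition total :: "real^3 \<Rightarrow> ennreal" where "total x = (\<Sum>i\<in>UNIV. M i x)"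

definition field :: "real^3 \<Rightarrow> real^3" where "field x = (\<chi> i. Re (G i x))"

lemma total_measurable [measurable]: "total \<in> borel_measurable borel"
  unfolding total_def[abs_def] by measurable

lemma field_measurable [measurable]: "field \<in> borel_measurable borel"
  unfolding field_def[abs_def] by (rule borel_measurable_vecI) simp

lemma total_finite: "lq q total < \<infinity>"
  unfolding total_def[abs_def] using q by (intro lq_sum_finite fin) auto

lemma norm_field_le: assumes "total x < \<infinity>" shows "norm (field x) \<le> enn2real (total x)"
proof -
  have f: "M i x < \<infinity>" for i using assms by (auto simp: total_def less_top)
  have "norm (field x) \<le> (\<Sum>i\<in>UNIV. norm (field x $ i))" by (rule norm_vec_le_sum)
  also have "\<dots> \<le> (\<Sum>i\<in>UNIV. enn2real (M i x))"
    using bound[OF f] by (intro sum_mono) (auto simp: field_def intro: order_trans[OF abs_Re_le_cmod])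
  also have "\<dots> = enn2real (total x)"
    unfolding total_def using f by (subst enn2real_sum) auto
  finally show ?thesis .
qed

lemma field_in_Lq: "in_Lq q field"
proof -
  have "AE x in lborel. ennreal (norm (field x)) \<le> total x"
    using lq_finite_AE[OF total_measurable total_finite]
  proof eventually_elim
    case (elim x)
    then show ?case using ennreal_leI[OF norm_field_le[OF elim]] by simp
  qed
  then have "lq q (\<lambda>x. ennreal (norm (field x))) \<le> lq q total" using q by (intro lq_mono_AE) auto
  then show ?thesis using total_finite by (simp add: in_Lq_iff_lq) 
qed

lemma integral_test_component:
  assumes "test_function \<psi>"
  shows "(\<integral>x. \<psi> x *\<^sub>R field x \<partial>lebesgue) $ i = Re (\<integral>x. of_real (\<psi> x) * G i x \<partial>lborel)"
proof -
  obtain R C where RC: "\<And>x. norm x > R \<Longrightarrow> \<psi> x = 0" "\<And>x. \<bar>\<psi> x\<bar> \<le> C" "continuous_on UNIV \<psi>" "R > 0" "C > 0"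
    using test_function_facts[OF assms] by blast
  have [measurable]: "\<psi> \<in> borel_measurable borel"
    using RC(3) by (rule borel_measurable_continuous_onI)
  have 1: "integrable lborel (\<lambda>x. \<psi> x *\<^sub>R field x)"
  proof (rule integrable_compact_majorant(1)[OF _ total_measurable q total_finite])
    show "norm (\<psi> x *\<^sub>R field x) \<le> C * (indicator (cball 0 R) x * enn2real (total x))" if "total x < \<infinity>" for x
      using norm_field_le[OF that] RC(1,2,5) by (cases "norm x > R") (auto intro!: mult_mono)
  qed measurable
  have 2: "integrable lborel (\<lambda>x. of_real (\<psi> x) * G i x)"
  proof (rule integrable_compact_majorant(1)[OF _ Mm q fin])
    show "norm (of_real (\<psi> x) * G i x) \<le> C * (indicator (cball 0 R) x * enn2real (M i x))" if "M i x < \<infinity>" for x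
      using bound[OF that] RC(1,2,5) by (cases "norm x > R") (auto simp: norm_mult intro!: mult_mono)
  qed measurable
  have "(\<integral>x. \<psi> x *\<^sub>R field x \<partial>lebesgue) $ i = (\<integral>x. \<psi> x *\<^sub>R field x \<partial>lborel) $ i"
    by (subst integral_completion) simp_all
  also have "\<dots> = (\<integral>x. (\<psi> x *\<^sub>R field x) $ i \<partial>lborel)"
    by (rule integral_bounded_linear[OF bounded_linear_vec_nth 1, symmetric])
  also have "\<dots> = (\<integral>x. Re (of_real (\<psi> x) * G i x) \<partial>lborel)"
    by (simp add: field_def)
  also have "\<dots> = Re (\<integral>x. of_real (\<psi> x) * G i x \<partial>lborel)" by (rule integral_Re[OF 2])
  finally show ?thesis .
qed

end

lemma regular_field_trans_analytic:
  assumes F: "\<And>i. trans_analytic r M (F i)" and q: "q \<ge> 2" "lq q M < \<infinity>"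
  shows "regular_field (\<lambda>x. \<chi> i. Re (F i 0 x))"
proof -
  have mc: "majorized_components q M' (\<lambda>i. G i 0)"
    if "\<And>i. trans_analytic (r' i) (M' i) (G i)" "\<And>i. lq q (M' i) < \<infinity>" for r' :: "3 \<Rightarrow> real" and M' G
  proof
    show "1 \<le> q" using q by simp
    show "G i 0 \<in> borel_measurable borel" "M' i \<in> borel_measurable borel" for i using trans_analyticD(2,3)[OF that(1)] by auto
    show "lq q (M' i) < \<infinity>" for i by (rule that)
    show "norm (G i 0 x) \<le> enn2real (M' i x)" if "M' i x < \<infinity>" for i x
      using trans_analyticD(1,5)[OF \<open>\<And>i. trans_analytic (r' i) (M' i) (G i)\<close>] that by simp
  qed
  interpret V: majorized_components q "\<lambda>_. M" "\<lambda>i. F i 0"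
    using mc[of "\<lambda>_. r" "\<lambda>_. M" F] F q by simp
  have V: "V.field = (\<lambda>x. \<chi> i. Re (F i 0 x))" by (simp add: V.field_def[abs_def])
  have "\<exists>g. in_Lq q g \<and> weak_deriv js V.field g" for js
  proof -
    have "\<exists>T. trans_analytic (fst T) (fst (snd T)) (snd (snd T)) \<and> lq q (fst (snd T)) < \<infinity> \<and>
       (\<forall>\<phi>. test_function \<phi> \<longrightarrow> (\<integral>x. of_real (partial_derivs js \<phi> x) * F i 0 x \<partial>lborel) = (-1) ^ length js * (\<integral>x. of_real (\<phi> x) * snd (snd T) 0 x \<partial>lborel))" for i
    proof -
      have "1 \<le> q" using q by simp
      from trans_analytic_weak_derivs[OF F[of i] this q(2), of js]
      obtain r' M' G where "trans_analytic r' M' G \<and> lq q M' < \<infinity> \<and>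
       (\<forall>\<phi>. test_function \<phi> \<longrightarrow> (\<integral>x. of_real (partial_derivs js \<phi> x) * F i 0 x \<partial>lborel) = (-1) ^ length js * (\<integral>x. of_real (\<phi> x) * G 0 x \<partial>lborel))"
        by (elim exE)
      then show ?thesis by (intro exI[of _ "(r', M', G)"]) simp
    qed
    then have "\<forall>i. \<exists>T. trans_analytic (fst T) (fst (snd T)) (snd (snd T)) \<and> lq q (fst (snd T)) < \<infinity> \<and>
       (\<forall>\<phi>. test_function \<phi> \<longrightarrow> (\<integral>x. of_real (partial_derivs js \<phi> x) * F i 0 x \<partial>lborel) = (-1) ^ length js * (\<integral>x. of_real (\<phi> x) * snd (snd T) 0 x \<partial>lborel))"
      by (rule allI)
    from choice[OF this] obtain T where T: "\<forall>i. trans_analytic (fst (T i)) (fst (snd (T i))) (snd (snd (T i))) \<and> lq q (fst (snd (T i))) < \<infinity> \<and>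
       (\<forall>\<phi>. test_function \<phi> \<longrightarrow> (\<integral>x. of_real (partial_derivs js \<phi> x) * F i 0 x \<partial>lborel) = (-1) ^ length js * (\<integral>x. of_real (\<phi> x) * snd (snd (T i)) 0 x \<partial>lborel))"
      by (elim exE)
    define r' M' G where "r' i = fst (T i)" and "M' i = fst (snd (T i))" and "G i = snd (snd (T i))" for i
    have G: "\<forall>i. trans_analytic (r' i) (M' i) (G i) \<and> lq q (M' i) < \<infinity> \<and>
       (\<forall>\<phi>. test_function \<phi> \<longrightarrow> (\<integral>x. of_real (partial_derivs js \<phi> x) * F i 0 x \<partial>lborel) = (-1) ^ length js * (\<integral>x. of_real (\<phi> x) * G i 0 x \<partial>lborel))"
      using T unfolding r'_def M'_def G_def .
    interpret W: majorized_components q M' "\<lambda>i. G i 0"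
      using G by (intro mc) auto
    have "weak_deriv js V.field W.field"
      unfolding weak_deriv_def
    proof (intro allI impI)
      fix \<phi> :: "real^3 \<Rightarrow> real" assume \<phi>: "test_function \<phi>"
      note \<psi> = test_function_partial_derivs[OF \<phi>, of js]
      have e: "Re ((-1) ^ n * z) = (-1) ^ n * Re z" for n z
        by (cases "even n") auto
      show "(\<integral>x. partial_derivs js \<phi> x *\<^sub>R V.field x \<partial>lebesgue) = (-1) ^ length js *\<^sub>R (\<integral>x. \<phi> x *\<^sub>R W.field x \<partial>lebesgue)"
        unfolding vec_eq_iff vector_scaleR_component V.integral_test_component[OF \<psi>] W.integral_test_component[OF \<phi>]
        using G \<phi> by (simp add: e)
    qed
    then show ?thesis using W.field_in_Lq by blast
  qed
  then have "in_Sobolev n q V.field" for n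
    using V.field_in_Lq by (auto simp: in_Sobolev_def)
  then show ?thesis unfolding V[symmetric] regular_field_def using q by blast
qed

lemma in_Lq_AE:
  assumes "AE x in lebesgue. u x = v x" "in_Lq q v"
  shows "in_Lq q u" "Lq_norm q u = Lq_norm q v"
proof -
  have sym: "AE x in lebesgue. v x = u x" using assms(1) by eventually_elim simp
  have um: "u \<in> borel_measurable lebesgue"
    using assms(2) sym by (auto simp: in_Lq_def intro: borel_measurable_AE)
  have vm: "v \<in> borel_measurable lebesgue" using assms(2) by (simp add: in_Lq_def)
  have "integrable lebesgue (\<lambda>x. norm (u x) powr q) \<longleftrightarrow> integrable lebesgue (\<lambda>x. norm (v x) powr q)"
    using um vm assms(1) by (intro integrable_cong_AE) auto
  then show "in_Lq q u" using um assms(2) by (simp add: in_Lq_def)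
  have "(\<integral>x. norm (u x) powr q \<partial>lebesgue) = (\<integral>x. norm (v x) powr q \<partial>lebesgue)"
    using um vm assms(1) by (intro integral_cong_AE) auto
  then show "Lq_norm q u = Lq_norm q v" by (simp add: Lq_norm_def)
qed

lemma regular_field_AE:
  assumes AE: "AE x in lebesgue. u x = v x" and "regular_field v"
  shows "regular_field u"
proof -
  obtain q where q: "q \<ge> 2" "\<And>n. n \<ge> 1 \<Longrightarrow> in_Sobolev n q v" using assms(2) by (auto simp: regular_field_def)
  have vm: "v \<in> borel_measurable lebesgue" using q(2)[of 1] by (simp add: in_Sobolev_def in_Lq_def)
  have um: "u \<in> borel_measurable lebesgue"
    using AE by (intro borel_measurable_AE[OF vm]) (auto elim!: eventually_mono)
  have w: "weak_deriv js u g" if "weak_deriv js v g" for js g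
    unfolding weak_deriv_def
  proof (intro allI impI)
    fix \<phi> :: "real^3 \<Rightarrow> real" assume \<phi>: "test_function \<phi>"
    have "continuous_on UNIV (partial_derivs js \<phi>)"
      using test_function_facts[OF test_function_partial_derivs[OF \<phi>, of js]] by metis
    then have "partial_derivs js \<phi> \<in> borel_measurable borel" by (rule borel_measurable_continuous_onI)
    then have pm: "partial_derivs js \<phi> \<in> borel_measurable lebesgue" by (intro measurable_completion) simp
    have "(\<integral>x. partial_derivs js \<phi> x *\<^sub>R u x \<partial>lebesgue) = (\<integral>x. partial_derivs js \<phi> x *\<^sub>R v x \<partial>lebesgue)"
      using um vm pm AE by (intro integral_cong_AE borel_measurable_scaleR) auto
    then show "(\<integral>x. partial_derivs js \<phi> x *\<^sub>R u x \<partial>lebesgue) = (-1) ^ length js *\<^sub>R (\<integral>x. \<phi> x *\<^sub>R g x \<partial>lebesgue)"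
      using that \<phi> by (simp add: weak_deriv_def)
  qed
  have "in_Sobolev n q u" if "n \<ge> 1" for n
    using q(2)[OF that] w in_Lq_AE(1)[OF AE] unfolding in_Sobolev_def by blast
  then show ?thesis using q(1) by (auto simp: regular_field_def)
qed

text \<open>At time t the velocity h / t has displaced the point by h. Velocities of norm below 1
  are admissible, so the radius of analyticity at time t is t.\<close>

lemma nsV_trans_analytic:
  assumes a[measurable]: "a \<in> borel_measurable borel" and t: "t > 0"
  shows "trans_analytic t (\<lambda>x. nsW a (t, x)) (\<lambda>h x. nsV a (of_real (1 / t) *s h) 1 (t, x) $ i)"
  unfolding trans_analytic_def
proof (intro conjI allI impI)
  have n: "norm (of_real (1 / t) *s h) < 1 \<longleftrightarrow> norm h < t" for h :: "complex^3"
    using t unfolding norm_vector_smult norm_of_real by (simp add: divide_less_eq)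
  show "(\<lambda>x. nsW a (t, x)) \<in> borel_measurable borel" by measurable
  show "(\<lambda>x. nsV a (of_real (1 / t) *s h) 1 (t, x) $ i) \<in> borel_measurable borel" for h by measurable
  show "nsV a (of_real (1 / t) *s (h + cvec h')) 1 (t, x) $ i = nsV a (of_real (1 / t) *s h) 1 (t, x + h') $ i" for h h' x
  proof -
    have "of_real (1 / t) *s (h + cvec h') = of_real (1 / t) *s h + cvec ((1 / t) *\<^sub>R h')"
      by (simp add: vec_eq_iff distrib_left)
    then show ?thesis using nsV_shift[OF a, of "of_real (1 / t) *s h" "(1 / t) *\<^sub>R h'" 1 t x] t by simp
  qed
  show "norm (nsV a (of_real (1 / t) *s h) 1 (t, x) $ i) \<le> enn2real (nsW a (t, x))" if "nsW a (t, x) < \<infinity>" "norm h < t" for x h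
    using nsV_bound[OF a _ _ that(1), of "of_real (1 / t) *s h" 1] n[of h] that(2)
    by (intro order_trans[OF Finite_Cartesian_Product.norm_nth_le]) simp
  show "(\<lambda>z. nsV a (of_real (1 / t) *s (h + z *s e)) 1 (t, x) $ i) holomorphic_on {z. norm (h + z *s e) < t}" if "nsW a (t, x) < \<infinity>" for x h e
  proof (rule nsV_holomorphic[OF a _ _ _ _ _ that])
    have "continuous_on UNIV (\<lambda>z. z *s e)"
      unfolding vector_scalar_mult_def by (intro continuous_intros)
    then show "open {z. norm (h + z *s e) < t}"
      by (intro open_Collect_less continuous_intros)
    show "(\<lambda>z. (of_real (1 / t) *s (h + z *s e)) $ i) holomorphic_on {z. norm (h + z *s e) < t}" for i
      by (simp, intro holomorphic_intros) (use t in auto)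
    show "norm (of_real (1 / t) *s (h + z *s e)) \<le> 1" if "z \<in> {z. norm (h + z *s e) < t}" for z
      using n[of "h + z *s e"] that by simp
  qed auto
qed (use t in auto)

lemma nsV_regular:
  assumes a: "a \<in> borel_measurable borel" and t: "t > 0" and q: "q \<ge> 2" "lq q (\<lambda>x. nsW a (t, x)) < \<infinity>"
  shows "regular_field (\<lambda>x. \<chi> i. Re (nsV a 0 1 (t, x) $ i))"
  using regular_field_trans_analytic[OF nsV_trans_analytic[OF a t] q] by simp

section \<open>Strong continuity of the heat semigroup\<close>

lemma tendsto_zero_ennreal_le:
  fixes g h :: "nat \<Rightarrow> ennreal"
  assumes "h \<longlonglongrightarrow> 0" "\<And>n. g n \<le> h n" shows "g \<longlonglongrightarrow> 0"
  by (rule tendsto_sandwich[of "\<lambda>_. 0" g sequentially h]) (use assms in auto)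

definition heat_op :: "real \<Rightarrow> (real^3 \<Rightarrow> real) \<Rightarrow> real^3 \<Rightarrow> real" where
  "heat_op s f x = (\<integral>y. heat_kernel s (x - y) * f y \<partial>lborel)"

abbreviation lqn :: "real \<Rightarrow> (real^3 \<Rightarrow> real) \<Rightarrow> ennreal" where
  "lqn q f \<equiv> lq q (\<lambda>x. ennreal \<bar>f x\<bar>)"

text \<open>Strong continuity at time 0, in sequential form because the convergence theorems for
  integrals are sequential.\<close>

definition heat_conv :: "real \<Rightarrow> (real^3 \<Rightarrow> real) \<Rightarrow> bool" where
  "heat_conv q f \<longleftrightarrow> (\<forall>X::nat \<Rightarrow> real. (\<forall>n. X n > 0) \<longrightarrow> X \<longlonglongrightarrow> 0 \<longrightarrow> (\<lambda>n. lqn q (\<lambda>x. heat_op (X n) f x - f x)) \<longlonglongrightarrow> 0)"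

lemma heat_kernel_nonneg: "heat_kernel s x \<ge> 0"
  by (simp add: heat_kernel_def)

lemma has_bochner_integral_heat_kernel:
  assumes s: "s > 0" shows "has_bochner_integral lborel (heat_kernel s) 1"
proof -
  have l: "1 / (4 * s) > 0" using s by simp
  have i: "integrable lborel (\<lambda>x::real^3. exp (- (1 / (4 * s)) * (norm x)\<^sup>2))"
    by (rule integrable_gauss3_real[OF l])
  have "exp (- (norm (0::real^3))\<^sup>2 / (4 * (1 / (4 * s)))) = 1" by simp
  then have e: "(\<integral>x. exp (- (1 / (4 * s)) * (norm (x::real^3))\<^sup>2) \<partial>lborel) = sqrt (pi / (1 / (4 * s))) ^ 3"
    using integral_gauss3_0[OF l, of 0]
    by (simp only: inner_zero_left cis_zero mult_1_left mult_1_right integral_complex_of_real of_real_eq_iff)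
  have "sqrt (pi / (1 / (4 * s))) ^ 3 = (4 * pi * s) powr (3 / 2)"
    using s by (subst sqrt_cube_powr) (auto simp: mult_ac)
  then have m: "(4 * pi * s) powr (-3/2) * sqrt (pi / (1 / (4 * s))) ^ 3 = 1"
    using s by (simp add: powr_minus field_simps)
  have "has_bochner_integral lborel (\<lambda>x::real^3. (4 * pi * s) powr (-3/2) * exp (- (1 / (4 * s)) * (norm x)\<^sup>2)) 1"
    using i by (simp only: has_bochner_integral_iff integrable_mult_right integral_mult_right_zero e m)
  moreover have "(\<lambda>x::real^3. (4 * pi * s) powr (-3/2) * exp (- (1 / (4 * s)) * (norm x)\<^sup>2)) = heat_kernel s"
    by (auto simp: heat_kernel_def fun_eq_iff)
  ultimately show ?thesis by simp
qed

lemma nn_integral_heat_kernel: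
  assumes "s > 0" shows "(\<integral>\<^sup>+x. ennreal (heat_kernel s x) \<partial>lborel) = 1"
  using has_bochner_integral_heat_kernel[OF assms] by (simp add: has_bochner_integral_iff nn_integral_eq_integral heat_kernel_nonneg)

lemma heat_young:
  assumes q: "q \<ge> 1" and s: "s > 0" and [measurable]: "f \<in> borel_measurable borel"
  shows "lq q (\<lambda>x. \<integral>\<^sup>+y. ennreal (heat_kernel s (x - y)) * ennreal \<bar>f y\<bar> \<partial>lborel) \<le> lqn q f"
proof (cases "q = 1")
  case True
  have "(\<integral>\<^sup>+x. \<integral>\<^sup>+y. ennreal (heat_kernel s (x - y)) * ennreal \<bar>f y\<bar> \<partial>lborel \<partial>lborel) = (\<integral>\<^sup>+y. \<integral>\<^sup>+x. ennreal (heat_kernel s (x - y)) * ennreal \<bar>f y\<bar> \<partial>lborel \<partial>lborel)"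
    by (rule lborel_pair.Fubini') measurable
  also have "\<dots> = (\<integral>\<^sup>+y. ennreal \<bar>f y\<bar> \<partial>lborel)"
    by (simp add: nn_integral_multc nn_integral_lborel_minus[of "\<lambda>x. ennreal (heat_kernel s x)"] nn_integral_heat_kernel[OF s])
  finally show ?thesis using True by (simp add: lq_def)
next
  case False
  then have "q > 1" using q by simp
  from Young_convolution_weight[OF this, of "\<lambda>y. ennreal \<bar>f y\<bar>" "\<lambda>x. ennreal (heat_kernel s x)"]
  show ?thesis by (simp add: nn_integral_heat_kernel[OF s] epow_ennreal[of 1, simplified])
qed

lemma heat_op_AE:
  assumes q: "q \<ge> 1" and s: "s > 0" and [measurable]: "f \<in> borel_measurable borel" and fin: "lqn q f < \<infinity>"
  shows "AE x in lborel. integrable lborel (\<lambda>y. heat_kernel s (x - y) * f y)"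
proof -
  have "AE x in lborel. (\<integral>\<^sup>+y. ennreal (heat_kernel s (x - y)) * ennreal \<bar>f y\<bar> \<partial>lborel) < \<infinity>"
    using le_less_trans[OF heat_young[OF q s assms(3)] fin] by (intro lq_finite_AE) auto
  then show ?thesis
  proof eventually_elim
    case (elim x)
    then show ?case
      by (intro integrableI_bounded) (auto simp: abs_mult heat_kernel_nonneg ennreal_mult)
  qed
qed

lemma heat_op_measurable [measurable]:
  assumes [measurable]: "f \<in> borel_measurable borel" shows "heat_op s f \<in> borel_measurable borel"
  unfolding heat_op_def[abs_def] by measurable

lemma lqn_heat_op:
  assumes q: "q \<ge> 1" and s: "s > 0" and [measurable]: "f \<in> borel_measurable borel"
  shows "lqn q (heat_op s f) \<le> lqn q f"
proof -
  have "ennreal \<bar>heat_op s f x\<bar> \<le> (\<integral>\<^sup>+y. ennreal (heat_kernel s (x - y)) * ennreal \<bar>f y\<bar> \<partial>lborel)" for x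
  proof (cases "integrable lborel (\<lambda>y. heat_kernel s (x - y) * f y)")
    case True
    then show ?thesis
      using integral_norm_bound_ennreal[OF True] by (simp add: heat_op_def abs_mult heat_kernel_nonneg ennreal_mult)
  qed (simp add: heat_op_def not_integrable_integral_eq)
  then have "lqn q (heat_op s f) \<le> lq q (\<lambda>x. \<integral>\<^sup>+y. ennreal (heat_kernel s (x - y)) * ennreal \<bar>f y\<bar> \<partial>lborel)"
    using q by (intro lq_mono) auto
  also have "\<dots> \<le> lqn q f" by (rule heat_young[OF q s assms(3)])
  finally show ?thesis .
qed

lemma lqn_add:
  assumes "f \<in> borel_measurable borel" "g \<in> borel_measurable borel" "q > 0"
    and "AE x in lborel. \<bar>h x\<bar> \<le> \<bar>f x\<bar> + \<bar>g x\<bar>"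
  shows "lqn q h \<le> ennreal (2 powr q) * (lqn q f + lqn q g)"
proof -
  have "lqn q h \<le> lq q (\<lambda>x. ennreal \<bar>f x\<bar> + ennreal \<bar>g x\<bar>)"
    using assms(3,4) by (intro lq_mono_AE) (auto elim!: eventually_mono intro: ennreal_leI simp flip: ennreal_plus)
  also have "\<dots> \<le> ennreal (2 powr q) * (lqn q f + lqn q g)"
    using assms by (intro lq_add) auto
  finally show ?thesis .
qed

text \<open>The heat operator is linear and contractive, so replacing f by g costs two terms of the
  size of f - g. The factor \<open>4 powr q\<close> comes from two uses of the triangle inequality
  in q-th powers, each with \<open>2 powr q\<close>.\<close>

lemma heat_diff_split:
  assumes q: "q \<ge> 1" and s: "s > 0" and f[measurable]: "f \<in> borel_measurable borel" and g[measurable]: "g \<in> borel_measurable borel"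
    and fin: "lqn q f < \<infinity>" "lqn q g < \<infinity>"
  shows "lqn q (\<lambda>x. heat_op s f x - f x) \<le> ennreal (4 powr q) * (2 * lqn q (\<lambda>x. f x - g x) + lqn q (\<lambda>x. heat_op s g x - g x))"
proof -
  have q0: "q > 0" using q by simp
  let ?d = "\<lambda>x. f x - g x"
  have dm[measurable]: "?d \<in> borel_measurable borel" by measurable
  have AE: "AE x in lborel. heat_op s ?d x = heat_op s f x - heat_op s g x"
    using heat_op_AE[OF q s f fin(1)] heat_op_AE[OF q s g fin(2)]
    by eventually_elim (simp add: heat_op_def right_diff_distrib)
  have 1: "lqn q (\<lambda>x. heat_op s f x - f x) \<le> ennreal (2 powr q) * (lqn q (heat_op s ?d) + lqn q (\<lambda>x. (heat_op s g x - g x) - ?d x))"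
    using AE by (intro lqn_add q0) (auto elim!: eventually_mono)
  have 2: "lqn q (\<lambda>x. (heat_op s g x - g x) - ?d x) \<le> ennreal (2 powr q) * (lqn q (\<lambda>x. heat_op s g x - g x) + lqn q ?d)"
    by (intro lqn_add q0) auto
  have c: "1 \<le> ennreal (2 powr q)"
    using q0 ge_one_powr_ge_zero[of 2 q] by (subst ennreal_1[symmetric], intro ennreal_leI) simp
  have "lqn q (\<lambda>x. heat_op s f x - f x) \<le> ennreal (2 powr q) * (ennreal (2 powr q) * lqn q ?d + ennreal (2 powr q) * (lqn q (\<lambda>x. heat_op s g x - g x) + lqn q ?d))"
  proof (intro order_trans[OF 1] mult_left_mono add_mono 2)
    show "lqn q (heat_op s ?d) \<le> ennreal (2 powr q) * lqn q ?d"
      using lqn_heat_op[OF q s dm] mult_right_mono[OF c, of "lqn q ?d"] by simp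
  qed auto
  also have "\<dots> = (ennreal (2 powr q) * ennreal (2 powr q)) * (2 * lqn q ?d + lqn q (\<lambda>x. heat_op s g x - g x))"
    by (simp add: distrib_left mult.assoc mult_2 add_ac)
  also have "ennreal (2 powr q) * ennreal (2 powr q) = ennreal (4 powr q)"
    by (simp add: powr_mult[symmetric] flip: ennreal_mult)
  finally show ?thesis .
qed

text \<open>Strong continuity is a closed condition. This carries it from indicators of open sets
  step by step to all of L_q.\<close>

lemma heat_conv_approx:
  assumes q: "q \<ge> 1" and f: "f \<in> borel_measurable borel" and fin: "lqn q f < \<infinity>"
    and app: "\<And>\<epsilon>::real. \<epsilon> > 0 \<Longrightarrow> \<exists>g. g \<in> borel_measurable borel \<and> lqn q g < \<infinity> \<and> lqn q (\<lambda>x. f x - g x) \<le> ennreal \<epsilon> \<and> heat_conv q g"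
  shows "heat_conv q f"
  unfolding heat_conv_def
proof (intro allI impI)
  fix X :: "nat \<Rightarrow> real" assume X: "\<forall>n. X n > 0" "X \<longlonglongrightarrow> 0"
  show "(\<lambda>n. lqn q (\<lambda>x. heat_op (X n) f x - f x)) \<longlonglongrightarrow> 0"
  proof (rule order_tendstoI)
    fix a :: ennreal assume "0 < a"
    then obtain b where b: "0 < b" "b < a" using dense by blast
    then obtain c where c: "b = ennreal c" "c > 0" by (cases b) auto
    define \<epsilon> where "\<epsilon> = c / (3 * 4 powr q)"
    have \<epsilon>: "\<epsilon> > 0" using c by (simp add: \<epsilon>_def)
    obtain g where g: "g \<in> borel_measurable borel" "lqn q g < \<infinity>" "lqn q (\<lambda>x. f x - g x) \<le> ennreal \<epsilon>" "heat_conv q g"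
      using app[OF \<epsilon>] by blast
    have "(\<lambda>n. lqn q (\<lambda>x. heat_op (X n) g x - g x)) \<longlonglongrightarrow> 0"
      using g(4) X unfolding heat_conv_def by blast
    then have "eventually (\<lambda>n. lqn q (\<lambda>x. heat_op (X n) g x - g x) < ennreal \<epsilon>) sequentially"
      using \<epsilon> by (intro order_tendstoD) auto
    then show "eventually (\<lambda>n. lqn q (\<lambda>x. heat_op (X n) f x - f x) < a) sequentially"
    proof eventually_elim
      case (elim n)
      have "lqn q (\<lambda>x. heat_op (X n) f x - f x) \<le> ennreal (4 powr q) * (2 * lqn q (\<lambda>x. f x - g x) + lqn q (\<lambda>x. heat_op (X n) g x - g x))"
        using X f g fin by (intro heat_diff_split q) auto
      also have "\<dots> \<le> ennreal (4 powr q) * (2 * ennreal \<epsilon> + ennreal \<epsilon>)"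
        using g(3) elim by (intro mult_left_mono add_mono) auto
      also have "\<dots> = ennreal (4 powr q * (3 * \<epsilon>))"
      proof -
        have "2 * ennreal \<epsilon> + ennreal \<epsilon> = ennreal (3 * \<epsilon>)"
          using \<epsilon> ennreal_plus[of "2 * \<epsilon>" \<epsilon>] ennreal_mult[of 2 \<epsilon>] by simp
        then show ?thesis using \<epsilon> by (simp only: ennreal_mult[of "4 powr q" "3 * \<epsilon>"] powr_ge_zero mult_nonneg_nonneg less_imp_le zero_le_numeral)
      qed
      also have "4 powr q * (3 * \<epsilon>) = c" by (simp add: \<epsilon>_def)
      finally show ?case using b c by simp
    qed
  qed simp
qed

text \<open>Half of the Gaussian exponent, u = |y|^2 / (8 s), is spent on exp (- u) \<le> 1 / u
  \<le> 8 s / d^2. The other half is the heat kernel at time 2 s up to a factor of at most 8, and it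
  has total mass 1.\<close>

lemma heat_tail_bound:
  assumes d: "d > 0" and s: "s > 0"
  shows "(\<integral>y. heat_kernel s y * indicator {y. norm y \<ge> d} y \<partial>lborel) \<le> 64 * s / d\<^sup>2"
proof -
  have pt: "heat_kernel s y * indicator {y. norm y \<ge> d} y \<le> 64 * s / d\<^sup>2 * heat_kernel (2 * s) y" for y :: "real^3"
  proof (cases "norm y \<ge> d")
    case True
    define u where "u = (norm y)\<^sup>2 / (8 * s)"
    have u: "u \<ge> d\<^sup>2 / (8 * s)"
      unfolding u_def using True d s by (intro divide_right_mono power_mono) auto
    have u0: "d\<^sup>2 / (8 * s) > 0" using d s by simp
    have "u * exp (- u) \<le> 1"
    proof -
      have "u \<le> exp u" using exp_ge_add_one_self[of u] by linarith
      then show ?thesis by (simp add: exp_minus divide_simps)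
    qed
    then have "exp (- u) \<le> 1 / u" using u u0 by (simp add: field_simps)
    also have "\<dots> \<le> 1 / (d\<^sup>2 / (8 * s))" using u u0 by (intro divide_left_mono mult_pos_pos) auto
    also have "\<dots> = 8 * s / d\<^sup>2" by simp
    finally have e: "exp (- u) \<le> 8 * s / d\<^sup>2" .
    have p: "(4 * pi * s) powr (-3/2) \<le> 8 * (4 * pi * (2 * s)) powr (-3/2)"
    proof -
      have "(4 * pi * (2 * s)) powr (-3/2) = 2 powr (-3/2) * (4 * pi * s) powr (-3/2)"
      proof -
        have "4 * pi * (2 * s) = 2 * (4 * pi * s)" by simp
        then show ?thesis using s by (simp only: powr_mult)
      qed
      moreover have "(2::real) powr (-3) \<le> 2 powr (-3/2)" by (intro powr_mono) auto
      then have "1 \<le> 8 * (2::real) powr (-3/2)" by (simp add: powr_minus)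
      then have "(4 * pi * s) powr (-3/2) \<le> 8 * 2 powr (-3/2) * (4 * pi * s) powr (-3/2)"
        by (simp add: mult_le_cancel_right1)
      ultimately show ?thesis by simp
    qed
    have "heat_kernel s y = (4 * pi * s) powr (-3/2) * (exp (- u) * exp (- u))"
      by (simp add: heat_kernel_def u_def flip: exp_add)
    also have "\<dots> \<le> (8 * (4 * pi * (2 * s)) powr (-3/2)) * (8 * s / d\<^sup>2 * exp (- u))"
      using e p by (intro mult_mono mult_right_mono) auto
    also have "\<dots> = 64 * s / d\<^sup>2 * heat_kernel (2 * s) y"
      by (simp add: heat_kernel_def u_def)
    finally show ?thesis using True by simp
  qed (use s d in \<open>simp add: heat_kernel_nonneg\<close>)
  have i: "integrable lborel (\<lambda>y::real^3. 64 * s / d\<^sup>2 * heat_kernel (2 * s) y)"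
    using has_bochner_integral_heat_kernel[of "2 * s"] s by (intro integrable_mult_right) (simp add: has_bochner_integral_iff)
  have "(\<integral>y. heat_kernel s y * indicator {y. norm y \<ge> d} y \<partial>lborel) \<le> (\<integral>y. 64 * s / d\<^sup>2 * heat_kernel (2 * s) (y::real^3) \<partial>lborel)"
    by (rule integral_mono'[OF i pt]) (use s d in \<open>simp add: heat_kernel_nonneg\<close>)
  also have "\<dots> = 64 * s / d\<^sup>2"
    using has_bochner_integral_heat_kernel[of "2 * s"] s by (simp add: has_bochner_integral_iff)
  finally show ?thesis .
qed

lemma lqn_1: "lqn 1 f = (\<integral>\<^sup>+x. ennreal \<bar>f x\<bar> \<partial>lborel)"
  by (simp add: lq_def)

lemma integral_lborel_reflect:
  fixes f :: "real^3 \<Rightarrow> real"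
  assumes [measurable]: "f \<in> borel_measurable borel"
  shows "(\<integral>y. f (x - y) \<partial>lborel) = (\<integral>y. f y \<partial>lborel)"
proof -
  have "lborel = distr lborel borel (\<lambda>y. x - y)"
    using lborel_affine[of "-1" x] by (simp add: density_1)
  then have "(\<integral>y. f y \<partial>lborel) = (\<integral>y. f y \<partial>distr lborel borel (\<lambda>y. x - y))" by simp
  also have "\<dots> = (\<integral>y. f (x - y) \<partial>lborel)" by (simp add: integral_distr)
  finally show ?thesis by simp
qed

lemma heat_op_indicator:
  assumes s: "s > 0" and U[measurable]: "U \<in> sets borel"
  shows "0 \<le> heat_op s (indicator U) x" "heat_op s (indicator U) x \<le> 1"
    and "ball x d \<subseteq> U \<Longrightarrow> d > 0 \<Longrightarrow> 1 - heat_op s (indicator U) x \<le> 64 * s / d\<^sup>2"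
proof -
  have K: "integrable lborel (heat_kernel s)" "(\<integral>x. heat_kernel s x \<partial>lborel) = 1"
    using has_bochner_integral_heat_kernel[OF s] by (auto simp: has_bochner_integral_iff)
  have eq: "heat_op s (indicator U) x = (\<integral>y. heat_kernel s y * indicator U (x - y) \<partial>lborel)"
    unfolding heat_op_def using integral_lborel_reflect[of "\<lambda>y. heat_kernel s y * indicator U (x - y)" x] by simp
  have i: "integrable lborel (\<lambda>y. heat_kernel s y * indicator U (x - y))"
    by (rule Bochner_Integration.integrable_bound[OF K(1)]) (auto simp: heat_kernel_nonneg split: split_indicator)
  show "0 \<le> heat_op s (indicator U) x"
    unfolding eq by (intro Bochner_Integration.integral_nonneg) (simp add: heat_kernel_nonneg)
  have "heat_op s (indicator U) x \<le> (\<integral>x. heat_kernel s x \<partial>lborel)"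
    unfolding eq by (intro integral_mono i K) (auto simp: heat_kernel_nonneg split: split_indicator)
  then show "heat_op s (indicator U) x \<le> 1" using K by simp
  show "1 - heat_op s (indicator U) x \<le> 64 * s / d\<^sup>2" if d: "ball x d \<subseteq> U" "d > 0"
  proof -
    have i2: "integrable lborel (\<lambda>y. heat_kernel s y * indicator {y. norm y \<ge> d} y)"
      by (rule Bochner_Integration.integrable_bound[OF K(1)]) (auto simp: heat_kernel_nonneg split: split_indicator)
    have "1 - heat_op s (indicator U) x = (\<integral>y. heat_kernel s y - heat_kernel s y * indicator U (x - y) \<partial>lborel)"
      unfolding eq using K i by simp
    also have "\<dots> \<le> (\<integral>y. heat_kernel s y * indicator {y. norm y \<ge> d} y \<partial>lborel)"
    proof (intro integral_mono Bochner_Integration.integrable_diff K i i2)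
      fix y
      have "x - y \<in> U" if "norm y < d" using that d by (auto simp: subset_iff dist_norm)
      then show "heat_kernel s y - heat_kernel s y * indicator U (x - y) \<le> heat_kernel s y * indicator {y. norm y \<ge> d} y"
        by (auto simp: heat_kernel_nonneg split: split_indicator)
    qed
    also have "\<dots> \<le> 64 * s / d\<^sup>2" by (rule heat_tail_bound[OF d(2) s])
    finally show ?thesis .
  qed
qed

lemma lqn_1_integrable:
  assumes "integrable lborel f" shows "lqn 1 f = ennreal (\<integral>x. \<bar>f x\<bar> \<partial>lborel)" "lqn 1 f < \<infinity>"
  using assms by (simp_all add: lqn_1 nn_integral_eq_integral)

text \<open>The heat flow keeps the total mass, so in |u - 1_U| = (u - 1_U) + 2 1_U (1 - u) the
  first term integrates to 0. What remains is the deficit inside U, which tends to 0 pointwise by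
  the tail bound, U being open, and is dominated by the indicator.\<close>

lemma heat_conv_indicator_open:
  assumes U: "open U" and fin: "emeasure lborel U < \<infinity>"
  shows "heat_conv 1 (indicator U)"
  unfolding heat_conv_def
proof (intro allI impI)
  fix X :: "nat \<Rightarrow> real" assume X: "\<forall>n. X n > 0" "X \<longlonglongrightarrow> 0"
  have Um[measurable]: "U \<in> sets borel" using U by simp
  have iU: "integrable lborel (indicator U :: _ \<Rightarrow> real)" using fin by (simp add: integrable_indicator_iff)
  let ?u = "\<lambda>n. heat_op (X n) (indicator U)"
  have fU: "lqn 1 (indicator U) < \<infinity>" by (rule lqn_1_integrable[OF iU])
  have iu: "integrable lborel (?u n)" for n
  proof (rule integrableI_bounded)
    have "lqn 1 (?u n) \<le> lqn 1 (indicator U)" using X by (intro lqn_heat_op) auto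
    then show "(\<integral>\<^sup>+x. ennreal (norm (?u n x)) \<partial>lborel) < \<infinity>" using fU by (simp add: lqn_1)
  qed simp
  have mass: "(\<integral>x. ?u n x \<partial>lborel) = (\<integral>x. indicator U x \<partial>lborel)" for n
  proof -
    have "ennreal (\<integral>x. ?u n x \<partial>lborel) = (\<integral>\<^sup>+x. ennreal (?u n x) \<partial>lborel)"
      using heat_op_indicator(1)[OF X(1)[rule_format] Um] by (intro nn_integral_eq_integral[symmetric] iu) auto
    also have "\<dots> = (\<integral>\<^sup>+x. \<integral>\<^sup>+y. ennreal (heat_kernel (X n) (x - y)) * indicator U y \<partial>lborel \<partial>lborel)"
    proof (rule nn_integral_cong_AE)
      have "AE x in lborel. integrable lborel (\<lambda>y. heat_kernel (X n) (x - y) * indicator U y)"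
        using X fU by (intro heat_op_AE[of 1]) auto
      then show "AE x in lborel. ennreal (?u n x) = (\<integral>\<^sup>+y. ennreal (heat_kernel (X n) (x - y)) * indicator U y \<partial>lborel)"
      proof eventually_elim
        case (elim x)
        have "(\<integral>\<^sup>+y. ennreal (heat_kernel (X n) (x - y)) * indicator U y \<partial>lborel) = (\<integral>\<^sup>+y. ennreal (heat_kernel (X n) (x - y) * indicator U y) \<partial>lborel)"
          by (intro nn_integral_cong) (auto split: split_indicator)
        then show ?case
          using nn_integral_eq_integral[OF elim] by (simp add: heat_op_def heat_kernel_nonneg)
      qed
    qed
    also have "\<dots> = (\<integral>\<^sup>+y. \<integral>\<^sup>+x. ennreal (heat_kernel (X n) (x - y)) * indicator U y \<partial>lborel \<partial>lborel)"
      by (rule lborel_pair.Fubini') measurable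
    also have "\<dots> = (\<integral>\<^sup>+y. indicator U y \<partial>lborel)"
      using X by (simp add: nn_integral_multc nn_integral_lborel_minus[of "\<lambda>x. ennreal (heat_kernel _ x)"] nn_integral_heat_kernel del: nn_integral_indicator)
    also have "\<dots> = (\<integral>\<^sup>+x. ennreal (indicator U x) \<partial>lborel)"
      by (intro nn_integral_cong) (auto split: split_indicator)
    also have "\<dots> = ennreal (\<integral>x. indicator U x \<partial>lborel)"
      by (intro nn_integral_eq_integral iU) auto
    finally show ?thesis
      by (subst (asm) ennreal_inj) (auto intro!: Bochner_Integration.integral_nonneg heat_op_indicator simp: X)
  qed
  have i1: "integrable lborel (\<lambda>x. indicator U x * (1 - ?u n x))" for n
  proof (rule Bochner_Integration.integrable_bound[OF iU])
    show "AE x in lborel. norm (indicator U x * (1 - ?u n x)) \<le> norm (indicator U x :: real)"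
      using heat_op_indicator[OF X(1)[rule_format, of n] Um] by (auto split: split_indicator)
  qed measurable
  have main: "lqn 1 (\<lambda>x. ?u n x - indicator U x) = ennreal (2 * (\<integral>x. indicator U x * (1 - ?u n x) \<partial>lborel))" for n
  proof -
    have "lqn 1 (\<lambda>x. ?u n x - indicator U x) = ennreal (\<integral>x. \<bar>?u n x - indicator U x\<bar> \<partial>lborel)"
      by (intro lqn_1_integrable Bochner_Integration.integrable_diff iu iU)
    also have "(\<integral>x. \<bar>?u n x - indicator U x\<bar> \<partial>lborel) = (\<integral>x. (?u n x - indicator U x) + 2 * (indicator U x * (1 - ?u n x)) \<partial>lborel)"
      using heat_op_indicator[OF X(1)[rule_format, of n] Um] by (intro Bochner_Integration.integral_cong refl) (auto split: split_indicator)
    also have "\<dots> = 2 * (\<integral>x. indicator U x * (1 - ?u n x) \<partial>lborel)"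
      using iu iU i1 mass by simp
    finally show ?thesis .
  qed
  have "(\<lambda>n. \<integral>x. indicator U x * (1 - ?u n x) \<partial>lborel) \<longlonglongrightarrow> (\<integral>x. 0 \<partial>(lborel :: (real^3) measure))"
  proof (rule integral_dominated_convergence[OF _ _ iU])
    show "AE x in lborel. (\<lambda>n. indicator U x * (1 - ?u n x)) \<longlonglongrightarrow> 0"
    proof (intro always_eventually allI)
      fix x
      show "(\<lambda>n. indicator U x * (1 - ?u n x)) \<longlonglongrightarrow> 0"
      proof (cases "x \<in> U")
        case True
        then obtain d where d: "d > 0" "ball x d \<subseteq> U" using U open_contains_ball by blast
        have "(\<lambda>n. 64 * X n / d\<^sup>2) \<longlonglongrightarrow> 64 * 0 / d\<^sup>2" by (intro tendsto_intros X) (use d in auto)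
        then have "(\<lambda>n. 1 - ?u n x) \<longlonglongrightarrow> 0"
          using heat_op_indicator[OF X(1)[rule_format] Um] d
          by (intro tendsto_sandwich[of "\<lambda>_. 0" "\<lambda>n. 1 - ?u n x" sequentially "\<lambda>n. 64 * X n / d\<^sup>2"] always_eventually allI) auto
        then show ?thesis using True by simp
      qed simp
    qed
    show "AE x in lborel. norm (indicator U x * (1 - ?u n x)) \<le> indicator U x" for n
      using heat_op_indicator[OF X(1)[rule_format, of n] Um] by (auto split: split_indicator)
  qed measurable
  then have "(\<lambda>n. ennreal (2 * (\<integral>x. indicator U x * (1 - ?u n x) \<partial>lborel))) \<longlonglongrightarrow> ennreal (2 * 0)"
    by (intro tendsto_ennrealI tendsto_intros) simp
  then show "(\<lambda>n. lqn 1 (\<lambda>x. ?u n x - indicator U x)) \<longlonglongrightarrow> 0"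
    unfolding main by simp
qed

text \<open>Outer regularity approximates A in L_1 by open sets of finite measure.\<close>

lemma heat_conv_indicator:
  assumes A[measurable]: "A \<in> sets borel" and fin: "emeasure lborel A < \<infinity>"
  shows "heat_conv 1 (indicator A)"
proof (rule heat_conv_approx)
  have i: "integrable lborel (indicator B :: real^3 \<Rightarrow> real)" if "B \<in> sets borel" "emeasure lborel B < \<infinity>" for B
    using that by (simp add: integrable_indicator_iff)
  show "lqn 1 (indicator A) < \<infinity>" by (intro lqn_1_integrable i A fin)
  fix \<epsilon> :: real assume "\<epsilon> > 0"
  then obtain U where U: "open U" "A \<subseteq> U" "emeasure lborel (U - A) < ennreal \<epsilon>"
    using outer_regular_lborel[of A] A by auto
  have Um[measurable]: "U \<in> sets borel" using U by simp
  have "emeasure lborel U \<le> emeasure lborel (A \<union> (U - A))" by (intro emeasure_mono) auto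
  also have "\<dots> \<le> emeasure lborel A + emeasure lborel (U - A)" by (intro emeasure_subadditive) auto
  also have "\<dots> < \<infinity>" using fin U(3) by (auto simp: less_top[symmetric])
  finally have Uf: "emeasure lborel U < \<infinity>" .
  have "lqn 1 (\<lambda>x. indicator A x - indicator U x) = (\<integral>\<^sup>+x. indicator (U - A) x \<partial>lborel)"
    unfolding lqn_1 using U(2) by (intro nn_integral_cong) (auto split: split_indicator)
  also have "\<dots> = emeasure lborel (U - A)" by simp
  finally have "lqn 1 (\<lambda>x. indicator A x - indicator U x) \<le> ennreal \<epsilon>" using U(3) by simp
  then show "\<exists>g. g \<in> borel_measurable borel \<and> lqn 1 g < \<infinity> \<and> lqn 1 (\<lambda>x. indicator A x - g x) \<le> ennreal \<epsilon> \<and> heat_conv 1 g"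
    using lqn_1_integrable(2)[OF i[OF Um Uf]] heat_conv_indicator_open[OF U(1) Uf] by (intro exI[of _ "indicator U"]) auto
qed auto

lemma heat_conv_integrable:
  assumes "integrable lborel f" shows "heat_conv 1 f"
  using assms
proof (induct f rule: integrable_induct)
  case (base A c)
  have h: "heat_conv 1 (indicator A)" using base by (intro heat_conv_indicator) auto
  have A[measurable]: "A \<in> sets borel" using base by simp
  have "lqn 1 (\<lambda>x. heat_op s (\<lambda>x. indicator A x *\<^sub>R c) x - indicator A x *\<^sub>R c) = ennreal \<bar>c\<bar> * lqn 1 (\<lambda>x. heat_op s (indicator A) x - indicator A x)" for s
  proof -
    have "heat_op s (\<lambda>x. indicator A x *\<^sub>R c) x = heat_op s (indicator A) x * c" for x
      unfolding heat_op_def by (simp add: mult.assoc[symmetric] del: mult.assoc)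
    then have "ennreal \<bar>heat_op s (\<lambda>x. indicator A x *\<^sub>R c) x - indicator A x *\<^sub>R c\<bar> = ennreal \<bar>c\<bar> * ennreal \<bar>heat_op s (indicator A) x - indicator A x\<bar>" for x
      using abs_mult[of c "heat_op s (indicator A) x - indicator A x"] by (simp add: right_diff_distrib mult.commute flip: ennreal_mult)
    then show ?thesis unfolding lqn_1 by (simp add: nn_integral_cmult)
  qed
  moreover have "(\<lambda>n. ennreal \<bar>c\<bar> * lqn 1 (\<lambda>x. heat_op (X n) (indicator A) x - indicator A x)) \<longlonglongrightarrow> ennreal \<bar>c\<bar> * 0"
    if "\<forall>n. X n > 0" "X \<longlonglongrightarrow> 0" for X
    using h that unfolding heat_conv_def by (intro ennreal_tendsto_cmult) auto
  ultimately show ?case by (simp add: heat_conv_def)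
next
  case (add f g)
  note fin = lqn_1_integrable(2)[OF add(1)] lqn_1_integrable(2)[OF add(3)]
  have fg[measurable]: "f \<in> borel_measurable borel" "g \<in> borel_measurable borel"
    using add by (auto dest: borel_measurable_integrable)
  have le: "lqn 1 (\<lambda>x. heat_op s (\<lambda>x. f x + g x) x - (f x + g x)) \<le> ennreal (2 powr 1) * (lqn 1 (\<lambda>x. heat_op s f x - f x) + lqn 1 (\<lambda>x. heat_op s g x - g x))" if s: "s > 0" for s
  proof (rule lqn_add)
    have "AE x in lborel. heat_op s (\<lambda>x. f x + g x) x = heat_op s f x + heat_op s g x"
      using heat_op_AE[OF order_refl s fg(1) fin(1)] heat_op_AE[OF order_refl s fg(2) fin(2)]
      by eventually_elim (simp_all add: heat_op_def distrib_left)
    then show "AE x in lborel. \<bar>heat_op s (\<lambda>x. f x + g x) x - (f x + g x)\<bar> \<le> \<bar>heat_op s f x - f x\<bar> + \<bar>heat_op s g x - g x\<bar>"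
      by eventually_elim linarith
  qed auto
  show ?case
    unfolding heat_conv_def
  proof (intro allI impI)
    fix X :: "nat \<Rightarrow> real" assume X: "\<forall>n. X n > 0" "X \<longlonglongrightarrow> 0"
    have "(\<lambda>n. ennreal (2 powr 1) * (lqn 1 (\<lambda>x. heat_op (X n) f x - f x) + lqn 1 (\<lambda>x. heat_op (X n) g x - g x))) \<longlonglongrightarrow> ennreal (2 powr 1) * (0 + 0)"
      using add(2,4) X unfolding heat_conv_def by (intro ennreal_tendsto_cmult tendsto_add) auto
    then have h: "(\<lambda>n. ennreal (2 powr 1) * (lqn 1 (\<lambda>x. heat_op (X n) f x - f x) + lqn 1 (\<lambda>x. heat_op (X n) g x - g x))) \<longlonglongrightarrow> 0" by simp
    show "(\<lambda>n. lqn 1 (\<lambda>x. heat_op (X n) (\<lambda>x. f x + g x) x - (f x + g x))) \<longlonglongrightarrow> 0"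
      by (rule tendsto_zero_ennreal_le[OF h]) (use X(1) le in auto)
  qed
next
  case (lim f s)
  have fm: "f \<in> borel_measurable borel" using lim(5) by (auto dest: borel_measurable_integrable)
  show ?case
  proof (rule heat_conv_approx)
    show "lqn 1 f < \<infinity>" by (rule lqn_1_integrable(2)[OF lim(5)])
    fix \<epsilon> :: real assume "\<epsilon> > 0"
    have [measurable]: "s i \<in> borel_measurable borel" "f \<in> borel_measurable borel" for i
      using lim(1) fm by (auto dest: borel_measurable_integrable)
    have "(\<lambda>i. \<integral>x. \<bar>f x - s i x\<bar> \<partial>lborel) \<longlonglongrightarrow> (\<integral>x. 0 \<partial>(lborel :: (real^3) measure))"
    proof (rule integral_dominated_convergence[where w="\<lambda>x. 3 * \<bar>f x\<bar>"])
      show "AE x in lborel. (\<lambda>i. \<bar>f x - s i x\<bar>) \<longlonglongrightarrow> 0"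
      proof (intro always_eventually allI)
        fix x
        have "(\<lambda>i. \<bar>f x - s i x\<bar>) \<longlonglongrightarrow> \<bar>f x - f x\<bar>" using lim(3)[of x] by (intro tendsto_intros) auto
        then show "(\<lambda>i. \<bar>f x - s i x\<bar>) \<longlonglongrightarrow> 0" by simp
      qed
      show "AE x in lborel. norm \<bar>f x - s i x\<bar> \<le> 3 * \<bar>f x\<bar>" for i
      proof (intro always_eventually allI)
        fix x show "norm \<bar>f x - s i x\<bar> \<le> 3 * \<bar>f x\<bar>" using lim(4)[of x i] by simp
      qed
    qed (use lim(5) in auto)
    then have "eventually (\<lambda>i. (\<integral>x. \<bar>f x - s i x\<bar> \<partial>lborel) < \<epsilon>) sequentially"
      using \<open>\<epsilon> > 0\<close> by (intro order_tendstoD) auto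
    then obtain i where i: "(\<integral>x. \<bar>f x - s i x\<bar> \<partial>lborel) < \<epsilon>" by (auto simp: eventually_sequentially)
    have "lqn 1 (\<lambda>x. f x - s i x) = ennreal (\<integral>x. \<bar>f x - s i x\<bar> \<partial>lborel)"
      using lim(1,5) by (intro lqn_1_integrable Bochner_Integration.integrable_diff)
    also have "\<dots> \<le> ennreal \<epsilon>" using i by (intro ennreal_leI) simp
    finally show "\<exists>g. g \<in> borel_measurable borel \<and> lqn 1 g < \<infinity> \<and> lqn 1 (\<lambda>x. f x - g x) \<le> ennreal \<epsilon> \<and> heat_conv 1 g"
      using lim(2) lqn_1_integrable(2)[OF lim(1)] by (intro exI[of _ "s i"]) auto
  qed (use fm in auto)
qed

text \<open>The differences are bounded by 2 B, and |d|^q \<le> (2 B)^(q - 1) |d| for such d, so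
  convergence in L_1 implies convergence in L_q.\<close>

lemma heat_conv_bounded:
  assumes f: "integrable lborel f" and B: "\<And>x. \<bar>f x\<bar> \<le> B" and q: "q \<ge> 1"
  shows "heat_conv q f"
proof -
  have [measurable]: "f \<in> borel_measurable borel" using f by (auto dest: borel_measurable_integrable)
  have B0: "B \<ge> 0" using B[of 0] by simp
  have op: "\<bar>heat_op s f x\<bar> \<le> B" if s: "s > 0" for s x
  proof (cases "integrable lborel (\<lambda>y. heat_kernel s (x - y) * f y)")
    case True
    have K: "integrable lborel (heat_kernel s)" "(\<integral>x. heat_kernel s x \<partial>lborel) = 1"
      using has_bochner_integral_heat_kernel[OF s] by (auto simp: has_bochner_integral_iff)
    have K2: "(\<integral>y. heat_kernel s (x - y) \<partial>lborel) = 1"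
      using integral_lborel_reflect[of "heat_kernel s" x] K by simp
    then have iK: "integrable lborel (\<lambda>y. heat_kernel s (x - y))" using not_integrable_integral_eq by fastforce
    have "\<bar>heat_op s f x\<bar> \<le> (\<integral>y. \<bar>heat_kernel s (x - y) * f y\<bar> \<partial>lborel)"
      unfolding heat_op_def by (rule integral_abs_bound)
    also have "\<dots> \<le> (\<integral>y. heat_kernel s (x - y) * B \<partial>lborel)"
    proof (intro integral_mono)
      show "integrable lborel (\<lambda>y. \<bar>heat_kernel s (x - y) * f y\<bar>)" using True by (rule integrable_abs)
      show "integrable lborel (\<lambda>y. heat_kernel s (x - y) * B)" using iK by simp
      show "\<bar>heat_kernel s (x - y) * f y\<bar> \<le> heat_kernel s (x - y) * B" for y
        using B[of y] by (auto simp: abs_mult heat_kernel_nonneg intro!: mult_left_mono)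
    qed
    also have "\<dots> = B" using K2 by simp
    finally show ?thesis .
  qed (use B0 in \<open>simp add: heat_op_def not_integrable_integral_eq\<close>)
  have le: "lqn q (\<lambda>x. heat_op s f x - f x) \<le> ennreal ((2 * B) powr (q - 1)) * lqn 1 (\<lambda>x. heat_op s f x - f x)" if s: "s > 0" for s
  proof -
    have "epow (ennreal \<bar>d\<bar>) q \<le> ennreal ((2 * B) powr (q - 1)) * ennreal \<bar>d\<bar>" if "\<bar>d\<bar> \<le> 2 * B" for d :: real
    proof (cases "d = 0")
      case False
      have "\<bar>d\<bar> powr q = \<bar>d\<bar> powr (q - 1) * \<bar>d\<bar>" using False powr_mult_base[of "\<bar>d\<bar>" "q - 1"] by (simp add: mult.commute)
      also have "\<dots> \<le> (2 * B) powr (q - 1) * \<bar>d\<bar>" using that q by (intro mult_right_mono powr_mono2) auto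
      finally show ?thesis by (simp add: epow_ennreal ennreal_leI flip: ennreal_mult)
    qed simp
    moreover have "\<bar>heat_op s f x - f x\<bar> \<le> 2 * B" for x using op[OF s, of x] B[of x] by linarith
    ultimately have "lqn q (\<lambda>x. heat_op s f x - f x) \<le> (\<integral>\<^sup>+x. ennreal ((2 * B) powr (q - 1)) * ennreal \<bar>heat_op s f x - f x\<bar> \<partial>lborel)"
      unfolding lq_def by (intro nn_integral_mono) auto
    also have "\<dots> = ennreal ((2 * B) powr (q - 1)) * lqn 1 (\<lambda>x. heat_op s f x - f x)"
      by (simp add: lqn_1 nn_integral_cmult)
    finally show ?thesis .
  qed
  show ?thesis
    unfolding heat_conv_def
  proof (intro allI impI)
    fix X :: "nat \<Rightarrow> real" assume X: "\<forall>n. X n > 0" "X \<longlonglongrightarrow> 0"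
    have "(\<lambda>n. ennreal ((2 * B) powr (q - 1)) * lqn 1 (\<lambda>x. heat_op (X n) f x - f x)) \<longlonglongrightarrow> ennreal ((2 * B) powr (q - 1)) * 0"
      using heat_conv_integrable[OF f] X unfolding heat_conv_def by (intro ennreal_tendsto_cmult) auto
    then have h: "(\<lambda>n. ennreal ((2 * B) powr (q - 1)) * lqn 1 (\<lambda>x. heat_op (X n) f x - f x)) \<longlonglongrightarrow> 0" by simp
    show "(\<lambda>n. lqn q (\<lambda>x. heat_op (X n) f x - f x)) \<longlonglongrightarrow> 0"
      by (rule tendsto_zero_ennreal_le[OF h]) (use X(1) le in auto)
  qed
qed

text \<open>Truncation in size and in space approximates f in L_q by bounded integrable
  functions.\<close>

theorem heat_conv_lq:
  assumes f[measurable]: "f \<in> borel_measurable borel" and q: "q \<ge> 1" and fin: "lqn q f < \<infinity>"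
  shows "heat_conv q f"
proof (rule heat_conv_approx[OF q f fin])
  fix \<epsilon> :: real assume "\<epsilon> > 0"
  define g where "g n x = (if norm x \<le> real n \<and> \<bar>f x\<bar> \<le> real n then f x else 0)" for n x
  have gm[measurable]: "g n \<in> borel_measurable borel" for n unfolding g_def[abs_def] by measurable
  have "(\<lambda>n. lqn q (\<lambda>x. f x - g n x)) \<longlonglongrightarrow> (\<integral>\<^sup>+x. 0 \<partial>(lborel :: (real^3) measure))"
    unfolding lq_def
  proof (rule nn_integral_dominated_convergence[where w="\<lambda>x. epow (ennreal \<bar>f x\<bar>) q"])
    show "AE x in lborel. (\<lambda>n. epow (ennreal \<bar>f x - g n x\<bar>) q) \<longlonglongrightarrow> 0"
    proof (intro always_eventually allI)
      fix x
      obtain N where N: "max (norm x) \<bar>f x\<bar> \<le> real N" using real_arch_simple by blast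
      have "eventually (\<lambda>n. epow (ennreal \<bar>f x - g n x\<bar>) q = 0) sequentially"
        using eventually_ge_at_top[of N]
      proof eventually_elim
        case (elim n)
        then have "real N \<le> real n" by simp
        then have "g n x = f x" using N by (auto simp: g_def)
        then show ?case by simp
      qed
      then show "(\<lambda>n. epow (ennreal \<bar>f x - g n x\<bar>) q) \<longlonglongrightarrow> 0" by (rule tendsto_eventually)
    qed
    show "AE x in lborel. epow (ennreal \<bar>f x - g n x\<bar>) q \<le> epow (ennreal \<bar>f x\<bar>) q" for n
      using q by (intro always_eventually allI epow_mono ennreal_leI) (auto simp: g_def)
    show "(\<integral>\<^sup>+x. epow (ennreal \<bar>f x\<bar>) q \<partial>lborel) < \<infinity>" using fin by (simp add: lq_def)
  qed measurable
  then have "eventually (\<lambda>n. lqn q (\<lambda>x. f x - g n x) < ennreal \<epsilon>) sequentially"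
    using \<open>\<epsilon> > 0\<close> by (intro order_tendstoD) auto
  then obtain n where n: "lqn q (\<lambda>x. f x - g n x) < ennreal \<epsilon>" by (auto simp: eventually_sequentially)
  have "lqn q (g n) \<le> lqn q f" using q by (intro lq_mono) (auto simp: g_def intro!: ennreal_leI)
  then have gf: "lqn q (g n) < \<infinity>" using fin by (rule le_less_trans)
  have ci: "integrable lborel (indicator (cball (0::real^3) (real n)) :: _ \<Rightarrow> real)"
    using emeasure_lborel_cball_finite[of "0::real^3" "real n"] by (simp add: integrable_indicator_iff less_top)
  have "integrable lborel (g n)"
    by (rule Bochner_Integration.integrable_bound[OF integrable_mult_right[OF ci, of "real n"]])
       (auto simp: g_def split: split_indicator)
  then have "heat_conv q (g n)"
    by (rule heat_conv_bounded[OF _ _ q, of _ "real n"]) (auto simp: g_def)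
  then show "\<exists>g. g \<in> borel_measurable borel \<and> lqn q g < \<infinity> \<and> lqn q (\<lambda>x. f x - g x) \<le> ennreal \<epsilon> \<and> heat_conv q g"
    using n gf by (intro exI[of _ "g n"]) auto
qed

section \<open>Local existence of mild solutions\<close>

definition re_vec :: "complex^3 \<Rightarrow> real^3" where
  "re_vec z = (\<chi> i. Re (z $ i))"

lemma norm_re_vec_le: "norm (re_vec z) \<le> norm z"
  unfolding re_vec_def norm_vec_def by (intro L2_set_mono) (auto simp: abs_Re_le_cmod)

lemma bounded_linear_re_vec: "bounded_linear re_vec"
  by (rule bounded_linear_intro[where K=1]) (auto simp: re_vec_def vec_eq_iff norm_re_vec_le[unfolded re_vec_def])

definition nsR :: "(real^3 \<Rightarrow> real^3) \<Rightarrow> real \<times> (real^3) \<Rightarrow> real^3" where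
  "nsR a \<xi> = re_vec (nsV a 0 1 \<xi>)"

lemma nsR_measurable [measurable]:
  assumes [measurable]: "a \<in> borel_measurable borel" shows "nsR a \<in> borel_measurable borel"
  unfolding nsR_def[abs_def] re_vec_def by (rule borel_measurable_vecI) (simp, measurable)

lemma nsR_bound:
  assumes "a \<in> borel_measurable borel" "nsW a \<xi> < \<infinity>"
  shows "norm (nsR a \<xi>) \<le> enn2real (nsW a \<xi>)" "ennreal (norm (nsR a \<xi>)) \<le> nsW a \<xi>"
proof -
  show "norm (nsR a \<xi>) \<le> enn2real (nsW a \<xi>)"
    unfolding nsR_def using assms by (intro order_trans[OF norm_re_vec_le nsV_bound]) auto
  then have "ennreal (norm (nsR a \<xi>)) \<le> ennreal (enn2real (nsW a \<xi>))" by (rule ennreal_leI)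
  then show "ennreal (norm (nsR a \<xi>)) \<le> nsW a \<xi>" 
    using ennreal_enn2real[of "nsW a \<xi>"] assms(2) by (simp only: infinity_ennreal_def)
qed

lemma nsV_eq_nsR:
  assumes "a \<in> borel_measurable borel" "nsW a \<xi> < \<infinity>"
  shows "nsV a 0 1 \<xi> $ i = of_real (nsR a \<xi> $ i)"
  using nsV_real[OF assms, of i] by (simp add: nsR_def re_vec_def)

text \<open>The real form of \<open>oseen_term 0 1\<close> applied to the solution, as a function on
  space-time and set to 0 for times outside (0, t).\<close>

definition duhamel :: "(real^3 \<Rightarrow> real^3) \<Rightarrow> real \<Rightarrow> real^3 \<Rightarrow> real \<times> (real^3) \<Rightarrow> real^3" where
  "duhamel a t x \<eta> = (\<chi> i. \<Sum>j\<in>UNIV. \<Sum>k\<in>UNIV.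
     (if 0 < fst \<eta> \<and> fst \<eta> < t then oseen (t - fst \<eta>) i j k (x - snd \<eta>) else 0) * nsR a \<eta> $ j * nsR a \<eta> $ k)"

lemma oseen_measurable [measurable (raw)]:
  assumes [measurable]: "f \<in> borel_measurable M" "g \<in> borel_measurable M"
  shows "(\<lambda>x. oseen (f x) i j k (g x)) \<in> borel_measurable M"
  unfolding oseen_def by measurable

lemma duhamel_measurable [measurable]:
  assumes [measurable]: "a \<in> borel_measurable borel" shows "duhamel a t x \<in> borel_measurable borel"
  unfolding duhamel_def[abs_def] by (rule borel_measurable_vecI) (unfold vec_lambda_beta, measurable)

text \<open>Real parts of the complex fixed-point equation. The complex solution is known to be real
  only where the majorant is finite, so the two Duhamel integrands are compared almost
  everywhere.\<close>

lemma nsR_fixed_point: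
  assumes a[measurable]: "a \<in> borel_measurable borel" and W: "nsW a (t, x) < \<infinity>"
  shows "0 < t" "integrable lborel (duhamel a t x)"
    and "nsR a (t, x) = (\<chi> i. heat_op t (\<lambda>y. a y $ i) x) - (\<integral>\<eta>. duhamel a t x \<eta> \<partial>lborel)"
    and "ennreal (norm (\<integral>\<eta>. duhamel a t x \<eta> \<partial>lborel)) \<le> (\<integral>\<^sup>+\<eta>. ns_kappa (t, x) \<eta> * (nsW a \<eta> * nsW a \<eta>) \<partial>lborel)"
proof -
  interpret majorized_picard lborel "ns_beta a" ns_kappa "heat_term a 0 1" "oseen_term 0 1"
    by (intro majorized_picard_heat) auto
  note VW = nsV_def[of a 0 1, symmetric] nsW_def[of a, symmetric]
  let ?G = "\<lambda>\<eta>. oseen_term 0 1 (t, x) \<eta> (nsV a 0 1 \<eta>) (nsV a 0 1 \<eta>)"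
  have sp: "(t, x) \<in> space lborel" by simp
  note fp = picard_limit_fixed_point[of "(t, x)", unfolded VW, OF sp W]
  have Wfp: "nsW a (t, x) = ns_beta a (t, x) + (\<integral>\<^sup>+\<eta>. ns_kappa (t, x) \<eta> * (nsW a \<eta> * nsW a \<eta>) \<partial>lborel)"
    using majorant_limit_fixed_point[of "(t, x)"] unfolding VW by simp
  have "ns_beta a (t, x) < \<infinity>" using W unfolding Wfp by simp
  then show t: "0 < t" by (auto simp: beta_majorant_def split: if_splits)
  have sh: "shifted z s 0 = cvec z" for z s by (simp add: vec_eq_iff)
  have km[measurable]: "ns_kappa (t, x) \<in> borel_measurable borel"
    using kappa_section_measurable[OF sp] by simp
  have kfin: "(\<integral>\<^sup>+\<eta>. ns_kappa (t, x) \<eta> * (nsW a \<eta> * nsW a \<eta>) \<partial>lborel) \<noteq> \<infinity>"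
    using W unfolding Wfp by auto
  have "AE \<eta> in lborel. ns_kappa (t, x) \<eta> * (nsW a \<eta> * nsW a \<eta>) \<noteq> \<infinity>"
    by (rule nn_integral_PInf_AE[OF _ kfin]) measurable
  then have AE: "AE \<eta> in lborel. duhamel a t x \<eta> = re_vec (?G \<eta>)"
  proof eventually_elim
    case (elim \<eta>)
    show ?case
    proof (cases "0 < fst \<eta> \<and> fst \<eta> < t")
      case True
      \<comment> \<open>The Oseen majorant is strictly positive at positive time differences, so a
        finite product with the squared majorant forces \<open>nsW a \<eta>\<close> to be
        finite.\<close>
      have "t - fst \<eta> + (norm (x - snd \<eta>))\<^sup>2 > 0" using True by (intro add_pos_nonneg) auto
      then have "ns_kappa (t, x) \<eta> \<noteq> 0"
        using True oseen_const(1) by (simp add: kappa_majorant_def oseen_majorant_def)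
      then have "nsW a \<eta> < \<infinity>" using elim by (auto simp: ennreal_mult_eq_top_iff less_top)
      then have "?G \<eta> $ i = of_real (duhamel a t x \<eta> $ i)" for i
        using True oseenC_1[of "t - fst \<eta>" i _ _ "x - snd \<eta>"] by (simp add: oseen_term_def duhamel_def sh nsV_eq_nsR[OF a])
      then show ?thesis by (simp add: re_vec_def vec_eq_iff)
    next
      case False
      then have "\<not> (0 < fst \<eta> \<and> fst \<eta> < fst (t, x))" by simp
      then show ?thesis using False unfolding oseen_term_def duhamel_def by (simp only: if_False) (simp add: re_vec_def vec_eq_iff)
    qed
  qed
  have Gm: "?G \<in> borel_measurable borel" by (intro oseen_term_section_measurable nsV_measurable a)
  have iG: "integrable lborel (\<lambda>\<eta>. re_vec (?G \<eta>))" by (intro integrable_bounded_linear[OF bounded_linear_re_vec] fp(1))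
  then show "integrable lborel (duhamel a t x)"
    using AE by (subst integrable_cong_AE) (auto dest: borel_measurable_integrable)
  have "(\<integral>\<eta>. duhamel a t x \<eta> \<partial>lborel) = (\<integral>\<eta>. re_vec (?G \<eta>) \<partial>lborel)"
    using AE iG by (intro integral_cong_AE) (auto dest: borel_measurable_integrable)
  also have "\<dots> = re_vec (\<integral>\<eta>. ?G \<eta> \<partial>lborel)"
    by (rule integral_bounded_linear[OF bounded_linear_re_vec fp(1)])
  finally have D: "(\<integral>\<eta>. duhamel a t x \<eta> \<partial>lborel) = re_vec (\<integral>\<eta>. ?G \<eta> \<partial>lborel)" .
  show "ennreal (norm (\<integral>\<eta>. duhamel a t x \<eta> \<partial>lborel)) \<le> (\<integral>\<^sup>+\<eta>. ns_kappa (t, x) \<eta> * (nsW a \<eta> * nsW a \<eta>) \<partial>lborel)"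
    unfolding D by (rule order_trans[OF ennreal_leI[OF norm_re_vec_le] fp(3)])
  have "heat_term a 0 1 (t, x) $ i = of_real (heat_op t (\<lambda>y. a y $ i) x)" for i
    unfolding heat_term_def heat_op_def vec_lambda_beta sh fst_conv snd_conv heatC_1
    by (simp only: of_real_mult[symmetric] integral_complex_of_real)
  then have "re_vec (heat_term a 0 1 (t, x)) = (\<chi> i. heat_op t (\<lambda>y. a y $ i) x)"
    by (simp add: re_vec_def vec_eq_iff)
  then show "nsR a (t, x) = (\<chi> i. heat_op t (\<lambda>y. a y $ i) x) - (\<integral>\<eta>. duhamel a t x \<eta> \<partial>lborel)"
    unfolding nsR_def fp(2) D linear_diff[OF bounded_linear.linear[OF bounded_linear_re_vec]] by simp
qed

lemma heat_leray_div_nsR: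
  assumes [measurable]: "a \<in> borel_measurable borel" and s: "0 < s" "s < t"
  shows "heat_leray_div (t - s) (tensor_square (\<lambda>y. nsR a (s, y))) x = (\<integral>y. duhamel a t x (s, y) \<partial>lborel)"
proof -
  have "(\<Sum>j\<in>UNIV. \<Sum>k\<in>UNIV. tensor_square (\<lambda>y. nsR a (s, y)) y $ j $ k *\<^sub>R
      partial_deriv j (leray (\<lambda>z. heat_kernel (t - s) z *\<^sub>R axis k 1)) (x - y)) = duhamel a t x (s, y)" for y
  proof -
    have "t - s > 0" using s by simp
    from partial_deriv_leray_heat_kernel[OF this] s show ?thesis
      by (simp add: vec_eq_iff duhamel_def tensor_square_def mult_ac)
  qed
  then have "heat_leray_div (t - s) (tensor_square (\<lambda>y. nsR a (s, y))) x = (\<integral>y. duhamel a t x (s, y) \<partial>lebesgue)"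
    unfolding heat_leray_div_def by simp
  also have "\<dots> = (\<integral>y. duhamel a t x (s, y) \<partial>lborel)"
    by (rule integral_completion) measurable
  finally show ?thesis .
qed

text \<open>Fubini splits the space-time integral into time slices. The definition of mild solutions
  integrates over the closed interval, and at its two endpoints the slices may differ: at t0 the
  field is the datum, at t the kernel has age 0. These two points form a null set.\<close>

lemma duhamel_time_integral:
  assumes a[measurable]: "a \<in> borel_measurable borel" and W: "nsW a (t - t0, x) < \<infinity>"
    and v: "\<And>s. t0 < s \<Longrightarrow> s < t \<Longrightarrow> v s = (\<lambda>y. nsR a (s - t0, y))"
  shows "set_integrable lebesgue {t0..t} (\<lambda>s. heat_leray_div (t - s) (tensor_square (v s)) x)"
    and "(LINT s:{t0..t}|lebesgue. heat_leray_div (t - s) (tensor_square (v s)) x) = (\<integral>\<eta>. duhamel a (t - t0) x \<eta> \<partial>lborel)"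
proof -
  let ?r = "t - t0"
  let ?F = "\<lambda>s. indicator {t0..t} s *\<^sub>R heat_leray_div (t - s) (tensor_square (v s)) x"
  define g where "g s = (\<integral>y. duhamel a ?r x (s, y) \<partial>lborel)" for s
  define G where "G s = g (- t0 + 1 * s)" for s
  have r: "?r > 0" by (rule nsR_fixed_point(1)[OF a W])
  have int: "integrable (lborel \<Otimes>\<^sub>M lborel) (duhamel a ?r x)"
    using nsR_fixed_point(2)[OF a W] by (simp add: lborel_prod)
  have ig: "integrable lborel g" and eg: "(\<integral>s. g s \<partial>lborel) = (\<integral>\<eta>. duhamel a ?r x \<eta> \<partial>lborel)"
    using lborel_pair.integrable_fst'[OF int] lborel_pair.integral_fst'[OF int] by (simp_all add: g_def[abs_def] lborel_prod)
  have iG: "integrable lborel G" unfolding G_def by (rule lborel_integrable_real_affine[OF ig]) simp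
  have eG: "(\<integral>s. G s \<partial>lborel) = (\<integral>s. g s \<partial>lborel)"
    using lborel_integral_real_affine[of 1 g "- t0"] by (simp add: G_def)
  have Gm: "G \<in> borel_measurable lborel" using iG by (rule borel_measurable_integrable)
  have iG': "integrable lebesgue G" using iG integrable_completion[OF Gm] by simp
  have eG': "(\<integral>s. G s \<partial>lebesgue) = (\<integral>\<eta>. duhamel a ?r x \<eta> \<partial>lborel)"
    using integral_completion[OF Gm] eG eg by simp
  have null: "emeasure lebesgue {s} = 0" for s :: real by simp
  have eq: "?F s = G s" if "s \<notin> {t0, t}" for s
  proof (cases "t0 < s \<and> s < t")
    case True
    then have "t - s = ?r - (s - t0)" "0 < s - t0" "s - t0 < ?r" by auto
    then show ?thesis
      using True heat_leray_div_nsR[OF a, of "s - t0" ?r x] v[of s] by (simp add: G_def g_def)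
  next
    case False
    then have "s \<notin> {t0..t}" using that by auto
    moreover have "g (s - t0) = 0"
      using False by (auto simp: g_def duhamel_def zero_vec_def[symmetric] intro!: integral_eq_zero_AE)
    ultimately show ?thesis by (simp add: G_def)
  qed
  have "integrable lebesgue ?F"
    using iG' by (subst integrable_discrete_difference[where X="{t0, t}" and g=G]) (use eq in auto)
  then show "set_integrable lebesgue {t0..t} (\<lambda>s. heat_leray_div (t - s) (tensor_square (v s)) x)"
    unfolding set_integrable_def .
  have "(\<integral>s. ?F s \<partial>lebesgue) = (\<integral>s. G s \<partial>lebesgue)"
    by (rule integral_discrete_difference[where X="{t0, t}"]) (use eq in auto)
  then show "(LINT s:{t0..t}|lebesgue. heat_leray_div (t - s) (tensor_square (v s)) x) = (\<integral>\<eta>. duhamel a ?r x \<eta> \<partial>lborel)"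
    unfolding set_lebesgue_integral_def eG' .
qed

section \<open>Continuity in time, and the mild formulation\<close>

lemma lq_cmult:
  assumes [measurable]: "f \<in> borel_measurable borel" and "c \<ge> 0" "q > 0"
  shows "lq q (\<lambda>x. ennreal c * f x) = ennreal (c powr q) * lq q f"
  unfolding lq_def using assms by (simp add: epow_mult epow_ennreal nn_integral_cmult)

lemma Lq_norm_eq_lq:
  fixes g :: "real^3 \<Rightarrow> real^3"
  assumes [measurable]: "g \<in> borel_measurable borel"
  shows "Lq_norm q g = enn2real (lq q (\<lambda>x. ennreal (norm (g x)))) powr (1 / q)"
proof -
  have "(\<integral>x. norm (g x) powr q \<partial>lebesgue) = (\<integral>x. norm (g x) powr q \<partial>lborel)"
    by (rule integral_completion) measurable
  also have "\<dots> = enn2real (\<integral>\<^sup>+x. ennreal (norm (g x) powr q) \<partial>lborel)"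
    by (rule integral_eq_nn_integral) auto
  finally show ?thesis by (simp add: Lq_norm_def lq_norm_eq)
qed

lemma Lq_norm_tendsto_zero:
  fixes g :: "nat \<Rightarrow> real^3 \<Rightarrow> real^3"
  assumes "\<And>n. g n \<in> borel_measurable borel" and "(\<lambda>n. lq q (\<lambda>x. ennreal (norm (g n x)))) \<longlonglongrightarrow> 0" and "q > 0"
  shows "(\<lambda>n. Lq_norm q (g n)) \<longlonglongrightarrow> 0"
proof -
  have "(\<lambda>n. enn2real (lq q (\<lambda>x. ennreal (norm (g n x))))) \<longlonglongrightarrow> 0"
    using assms(2) by (intro tendsto_enn2real) auto
  then have "(\<lambda>n. enn2real (lq q (\<lambda>x. ennreal (norm (g n x)))) powr (1 / q)) \<longlonglongrightarrow> 0 powr (1 / q)"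
    using assms(3) by (intro tendsto_powr') auto
  then show ?thesis using assms(1) by (simp add: Lq_norm_eq_lq)
qed

lemma lq_add_tendsto_zero:
  fixes f g :: "nat \<Rightarrow> real^3 \<Rightarrow> ennreal"
  assumes "\<And>n. f n \<in> borel_measurable borel" "\<And>n. g n \<in> borel_measurable borel" "q > 0"
    and "(\<lambda>n. lq q (f n)) \<longlonglongrightarrow> 0" "(\<lambda>n. lq q (g n)) \<longlonglongrightarrow> 0"
  shows "(\<lambda>n. lq q (\<lambda>x. f n x + g n x)) \<longlonglongrightarrow> 0"
proof (rule tendsto_zero_ennreal_le)
  have "(\<lambda>n. ennreal (2 powr q) * (lq q (f n) + lq q (g n))) \<longlonglongrightarrow> ennreal (2 powr q) * (0 + 0)"
    using assms(4,5) by (intro ennreal_tendsto_cmult tendsto_add) auto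
  then show "(\<lambda>n. ennreal (2 powr q) * (lq q (f n) + lq q (g n))) \<longlonglongrightarrow> 0" by simp
qed (rule lq_add[OF assms(1-3)])

lemma lq_sum_tendsto_zero:
  fixes f :: "'i \<Rightarrow> nat \<Rightarrow> real^3 \<Rightarrow> ennreal"
  assumes "finite I" and [measurable]: "\<And>i n. f i n \<in> borel_measurable borel" and "q > 0"
    and "\<And>i. i \<in> I \<Longrightarrow> (\<lambda>n. lq q (f i n)) \<longlonglongrightarrow> 0"
  shows "(\<lambda>n. lq q (\<lambda>x. \<Sum>i\<in>I. f i n x)) \<longlonglongrightarrow> 0"
  using assms(1,4)
proof (induction I rule: finite_induct)
  case empty
  then show ?case by (simp add: lq_def)
next
  case (insert i I)
  then show ?case using assms(3) by (simp, intro lq_add_tendsto_zero) auto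
qed

text \<open>By dilation invariance, \<open>t / w\<^sup>2\<close> is reached from \<open>t\<close> by varying the holomorphic parameter \<open>w\<close>.\<close>

lemma nsR_dilate_Lipschitz:
  assumes a: "a \<in> borel_measurable borel" and W: "nsW a (t, x) < \<infinity>" and t: "t > 0" and w: "\<bar>w - 1\<bar> < 1/8"
  shows "norm (nsR a (t / w\<^sup>2, x) - nsR a (t, x)) \<le> 24 * \<bar>w - 1\<bar> * enn2real (nsW a (t, x))"
proof -
  let ?f = "\<lambda>z. nsV a 0 z (t, x)"
  have w0: "w > 0" using w by linarith
  have sub: "norm (z - 1) \<le> 1/4" if "z \<in> ball 1 (1/4)" for z :: complex
    using that by (simp add: dist_norm norm_minus_commute)
  have comp: "norm (?f (of_real w) $ i - ?f 1 $ i) \<le> 8 * \<bar>w - 1\<bar> * enn2real (nsW a (t, x))" for i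
  proof -
    have "norm (?f (of_real w) $ i - ?f 1 $ i) \<le> 2 * enn2real (nsW a (t, x)) / (1/4) * norm (of_real w - 1 :: complex)"
    proof (rule holomorphic_Lipschitz)
      show "(\<lambda>z. ?f z $ i) holomorphic_on ball 1 (1/4)"
        by (rule nsV_holomorphic[OF a _ _ _ _ _ W]) (use sub in auto)
      show "norm (?f z $ i) \<le> enn2real (nsW a (t, x))" if "z \<in> ball 1 (1/4)" for z
        using that by (intro order_trans[OF Finite_Cartesian_Product.norm_nth_le nsV_bound] a W sub) auto
      show "dist 1 (complex_of_real w) < 1 / 4 / 2"
        using w by (metis abs_minus_commute dist_norm norm_of_real of_real_1 of_real_diff divide_divide_eq_left numeral_times_numeral semiring_norm(12) semiring_norm(13) mult.commute)
    qed
    also have "norm (of_real w - 1 :: complex) = \<bar>w - 1\<bar>"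
      by (metis norm_of_real of_real_1 of_real_diff)
    finally show ?thesis by (simp add: mult_ac)
  qed
  have "nsR a (t / w\<^sup>2, x) - nsR a (t, x) = re_vec (?f (of_real w) - ?f 1)"
    unfolding nsR_def nsV_dilate[OF a w0 t] linear_diff[OF bounded_linear.linear[OF bounded_linear_re_vec]] ..
  then have "norm (nsR a (t / w\<^sup>2, x) - nsR a (t, x)) \<le> norm (?f (of_real w) - ?f 1)"
    by (simp add: norm_re_vec_le)
  also have "\<dots> \<le> (\<Sum>i\<in>UNIV. norm ((?f (of_real w) - ?f 1) $ i))" by (rule norm_vec_le_sum)
  also have "\<dots> \<le> (\<Sum>i\<in>(UNIV::3 set). 8 * \<bar>w - 1\<bar> * enn2real (nsW a (t, x)))"
    by (intro sum_mono) (simp add: comp)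
  finally show ?thesis by simp
qed

locale ns_majorized =
  fixes a :: "real^3 \<Rightarrow> real^3" and q \<tau> K :: real and M :: ennreal
  assumes a [measurable]: "a \<in> borel_measurable borel" and q: "q > 3" and a_fin: "lq q (\<lambda>x. ennreal (norm (a x))) < \<infinity>"
    and M: "M < \<infinity>" and K: "K \<ge> 0"
    and W_le: "0 < t \<Longrightarrow> t < \<tau> \<Longrightarrow> lq q (\<lambda>x. nsW a (t, x)) \<le> M"
    and D_le: "0 < t \<Longrightarrow> t < \<tau> \<Longrightarrow> lq q (\<lambda>x. \<integral>\<^sup>+\<eta>. ns_kappa (t, x) \<eta> * (nsW a \<eta> * nsW a \<eta>) \<partial>lborel) \<le> ennreal (K * t powr (gain q * q)) * (M * M)"
begin

text \<open>The datum is put in by hand at time 0, where the majorant is infinite and the Picard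
  limit carries no information.\<close>

definition U :: "real \<Rightarrow> real^3 \<Rightarrow> real^3" where
  "U t = (if t = 0 then a else (\<lambda>x. nsR a (t, x)))"

lemma nsR_slice_measurable [measurable]: "(\<lambda>x. nsR a (t, x)) \<in> borel_measurable borel"
  by (rule measurable_compose[OF Pair_borel_measurable nsR_measurable[OF a]])

lemma nsW_slice_measurable [measurable]: "(\<lambda>x. nsW a (t, x)) \<in> borel_measurable borel"
  by (rule measurable_compose[OF Pair_borel_measurable nsW_measurable[OF a]])

lemma U_measurable [measurable]: "U t \<in> borel_measurable borel"
  unfolding U_def by simp

lemma W_AE: "0 < t \<Longrightarrow> t < \<tau> \<Longrightarrow> AE x in lborel. nsW a (t, x) < \<infinity>"
  using le_less_trans[OF W_le M] by (intro lq_finite_AE) auto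

lemma nsR_lq: 
  assumes "0 < t" "t < \<tau>" shows "lq q (\<lambda>x. ennreal (norm (nsR a (t, x)))) \<le> M"
proof -
  have "lq q (\<lambda>x. ennreal (norm (nsR a (t, x)))) \<le> lq q (\<lambda>x. nsW a (t, x))"
    using W_AE[OF assms] q by (intro lq_mono_AE) (auto elim!: eventually_mono intro: nsR_bound)
  also have "\<dots> \<le> M" by (rule W_le[OF assms])
  finally show ?thesis .
qed

lemma U_in_Lq: "t \<in> {0..<\<tau>} \<Longrightarrow> in_Lq q (U t)"
  using a_fin le_less_trans[OF nsR_lq M, of t] by (subst in_Lq_iff_lq) (auto simp: U_def)

text \<open>The difference from the datum is the error of the heat flow plus the Duhamel term; the
  latter is bounded in L_q by a positive power of t, which is why \<open>D_le\<close> is kept apart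
  from \<open>W_le\<close>.\<close>

lemma U_tendsto_initial:
  assumes Y: "\<And>n::nat. 0 < Y n" "\<And>n. Y n < \<tau>" "Y \<longlonglongrightarrow> 0"
  shows "(\<lambda>n. lq q (\<lambda>x. ennreal (norm (nsR a (Y n, x) - a x)))) \<longlonglongrightarrow> 0"
proof (rule tendsto_zero_ennreal_le)
  interpret majorant_kernel lborel "ns_beta a" ns_kappa by (rule majorant_kernel_heat[OF a])
  let ?h = "\<lambda>i n x. ennreal \<bar>heat_op (Y n) (\<lambda>y. a y $ i) x - a x $ i\<bar>"
  let ?D = "\<lambda>n x. \<integral>\<^sup>+\<eta>. ns_kappa (Y n, x) \<eta> * (nsW a \<eta> * nsW a \<eta>) \<partial>lborel"
  have Wm[measurable]: "nsW a \<in> borel_measurable lborel" using nsW_measurable[OF a] by simp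
  have Dm[measurable]: "?D n \<in> borel_measurable borel" for n
  proof -
    have "(\<lambda>\<xi>. \<integral>\<^sup>+\<eta>. ns_kappa \<xi> \<eta> * (nsW a \<eta> * nsW a \<eta>) \<partial>lborel) \<in> borel_measurable lborel" by measurable
    then show ?thesis using measurable_compose[OF Pair_borel_measurable] by simp
  qed
  show "lq q (\<lambda>x. ennreal (norm (nsR a (Y n, x) - a x))) \<le> lq q (\<lambda>x. (\<Sum>i\<in>UNIV. ?h i n x) + ?D n x)" for n
  proof (rule lq_mono_AE)
    show "AE x in lborel. ennreal (norm (nsR a (Y n, x) - a x)) \<le> (\<Sum>i\<in>UNIV. ?h i n x) + ?D n x"
      using W_AE[OF Y(1,2), of n]
    proof eventually_elim
      case (elim x)
      note fp = nsR_fixed_point[OF a elim]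
      let ?v = "(\<chi> i. heat_op (Y n) (\<lambda>y. a y $ i) x) - a x"
      have "nsR a (Y n, x) - a x = ?v - (\<integral>\<eta>. duhamel a (Y n) x \<eta> \<partial>lborel)" unfolding fp(3) by simp
      then have "norm (nsR a (Y n, x) - a x) \<le> norm ?v + norm (\<integral>\<eta>. duhamel a (Y n) x \<eta> \<partial>lborel)"
        by (simp only: norm_triangle_ineq4)
      also have "norm ?v \<le> (\<Sum>i\<in>UNIV. \<bar>heat_op (Y n) (\<lambda>y. a y $ i) x - a x $ i\<bar>)"
        using norm_vec_le_sum[of ?v] by simp
      finally have "ennreal (norm (nsR a (Y n, x) - a x)) \<le> ennreal ((\<Sum>i\<in>UNIV. \<bar>heat_op (Y n) (\<lambda>y. a y $ i) x - a x $ i\<bar>) + norm (\<integral>\<eta>. duhamel a (Y n) x \<eta> \<partial>lborel))"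
        by (intro ennreal_leI) simp
      also have "\<dots> = (\<Sum>i\<in>UNIV. ?h i n x) + ennreal (norm (\<integral>\<eta>. duhamel a (Y n) x \<eta> \<partial>lborel))"
        by (subst ennreal_plus) (auto intro: sum_nonneg)
      also have "\<dots> \<le> (\<Sum>i\<in>UNIV. ?h i n x) + ?D n x" by (intro add_left_mono fp(4))
      finally show ?case .
    qed
  qed (use q in simp)
  show "(\<lambda>n. lq q (\<lambda>x. (\<Sum>i\<in>UNIV. ?h i n x) + ?D n x)) \<longlonglongrightarrow> 0"
  proof (intro lq_add_tendsto_zero lq_sum_tendsto_zero)
    fix i :: 3
    have "lqn q (\<lambda>y. a y $ i) \<le> lq q (\<lambda>x. ennreal (norm (a x)))"
      using q by (intro lq_mono ennreal_leI) (auto simp: component_le_norm_cart)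
    then have "heat_conv q (\<lambda>y. a y $ i)"
      using q a_fin by (intro heat_conv_lq) auto
    then show "(\<lambda>n. lq q (?h i n)) \<longlonglongrightarrow> 0"
      using Y unfolding heat_conv_def by blast
  next
    show "(\<lambda>n. lq q (?D n)) \<longlonglongrightarrow> 0"
    proof (rule tendsto_zero_ennreal_le)
      show "lq q (?D n) \<le> ennreal (K * Y n powr (gain q * q)) * (M * M)" for n
        by (rule D_le[OF Y(1,2)])
      have g: "gain q * q > 0" using gain_pos[OF q] q by simp
      have "(\<lambda>n. Y n powr (gain q * q)) \<longlonglongrightarrow> 0 powr (gain q * q)"
        using Y g by (intro tendsto_powr' Y(3) tendsto_const) (auto intro!: always_eventually less_imp_le)
      then have "(\<lambda>n. ennreal (K * Y n powr (gain q * q))) \<longlonglongrightarrow> ennreal (K * 0)"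
        by (intro tendsto_ennrealI tendsto_mult tendsto_const) simp
      then have "(\<lambda>n. (M * M) * ennreal (K * Y n powr (gain q * q))) \<longlonglongrightarrow> (M * M) * ennreal (K * 0)"
        using M by (intro ennreal_tendsto_cmult) (auto simp: ennreal_mult_less_top)
      then show "(\<lambda>n. ennreal (K * Y n powr (gain q * q)) * (M * M)) \<longlonglongrightarrow> 0" by (simp add: mult.commute)
    qed
  qed (use q in auto)
qed

lemma U_tendsto_positive:
  assumes T: "0 < T" "T < \<tau>" and Y: "\<And>n::nat. 0 < Y n" "Y \<longlonglongrightarrow> T"
  shows "(\<lambda>n. lq q (\<lambda>x. ennreal (norm (nsR a (Y n, x) - nsR a (T, x))))) \<longlonglongrightarrow> 0"
proof -
  \<comment> \<open>The dilation that carries time T to time Y n; it tends to 1 as Y n tends to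
    T.\<close>
  define w where "w n = sqrt (T / Y n)" for n
  have wY: "T / (w n)\<^sup>2 = Y n" for n using T Y(1)[of n] by (simp add: w_def)
  have "w \<longlonglongrightarrow> sqrt (T / T)" unfolding w_def[abs_def] using T by (intro tendsto_intros Y(2)) auto
  then have w: "w \<longlonglongrightarrow> 1" using T by simp
  have "eventually (\<lambda>n. dist (w n) 1 < 1/8) sequentially" using w by (rule tendstoD) simp
  then have ev: "eventually (\<lambda>n. lq q (\<lambda>x. ennreal (norm (nsR a (Y n, x) - nsR a (T, x)))) \<le> ennreal ((24 * \<bar>w n - 1\<bar>) powr q) * M) sequentially"
  proof eventually_elim
    case (elim n)
    then have wn: "\<bar>w n - 1\<bar> < 1/8" by (simp add: dist_real_def)
    have "lq q (\<lambda>x. ennreal (norm (nsR a (Y n, x) - nsR a (T, x)))) \<le> lq q (\<lambda>x. ennreal (24 * \<bar>w n - 1\<bar>) * nsW a (T, x))"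
    proof (rule lq_mono_AE)
      show "AE x in lborel. ennreal (norm (nsR a (Y n, x) - nsR a (T, x))) \<le> ennreal (24 * \<bar>w n - 1\<bar>) * nsW a (T, x)"
        using W_AE[OF T]
      proof eventually_elim
        case (elim x)
        have "ennreal (norm (nsR a (Y n, x) - nsR a (T, x))) \<le> ennreal (24 * \<bar>w n - 1\<bar> * enn2real (nsW a (T, x)))"
          using nsR_dilate_Lipschitz[OF a elim T(1) wn] unfolding wY by (rule ennreal_leI)
        also have "\<dots> = ennreal (24 * \<bar>w n - 1\<bar>) * ennreal (enn2real (nsW a (T, x)))"
          by (rule ennreal_mult) auto
        also have "ennreal (enn2real (nsW a (T, x))) = nsW a (T, x)"
          using elim by (intro ennreal_enn2real) simp
        finally show ?case .
      qed
    qed (use q in simp)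
    also have "\<dots> = ennreal ((24 * \<bar>w n - 1\<bar>) powr q) * lq q (\<lambda>x. nsW a (T, x))"
      using q by (intro lq_cmult) auto
    also have "\<dots> \<le> ennreal ((24 * \<bar>w n - 1\<bar>) powr q) * M" by (intro mult_left_mono W_le T) simp
    finally show ?case .
  qed
  have "(\<lambda>n. (24 * \<bar>w n - 1\<bar>) powr q) \<longlonglongrightarrow> (24 * \<bar>1 - 1\<bar>) powr q"
    using q by (intro tendsto_powr' tendsto_intros w) auto
  then have "(\<lambda>n. M * ennreal ((24 * \<bar>w n - 1\<bar>) powr q)) \<longlonglongrightarrow> M * ennreal ((24 * \<bar>1 - 1\<bar>) powr q)"
    using M by (intro ennreal_tendsto_cmult tendsto_ennrealI) auto
  then have lim: "(\<lambda>n. ennreal ((24 * \<bar>w n - 1\<bar>) powr q) * M) \<longlonglongrightarrow> 0" using q by (simp add: mult.commute)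
  show ?thesis by (rule tendsto_sandwich[OF _ ev tendsto_const lim]) simp
qed

lemma U_continuous: "Lq_continuous_on {t0..<t0 + \<tau>} q (\<lambda>t. U (t - t0))"
  unfolding Lq_continuous_on_def
proof (intro ballI conjI)
  fix t assume t: "t \<in> {t0..<t0 + \<tau>}"
  then show "in_Lq q (U (t - t0))" by (intro U_in_Lq) auto
  show "((\<lambda>s. Lq_norm q (\<lambda>x. U (s - t0) x - U (t - t0) x)) \<longlongrightarrow> 0) (at t within {t0..<t0 + \<tau>})"
    unfolding tendsto_at_iff_sequentially comp_def
  proof (intro allI impI)
    fix X assume X: "\<forall>n. X n \<in> {t0..<t0 + \<tau>} - {t}" "X \<longlonglongrightarrow> t"
    define T where "T = t - t0"
    have TT: "0 \<le> T" "T < \<tau>" using t by (auto simp: T_def)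
    have lim: "(\<lambda>n. X n - t0) \<longlonglongrightarrow> T" unfolding T_def by (intro tendsto_intros X)
    have "(\<lambda>n. lq q (\<lambda>x. ennreal (norm (U (X n - t0) x - U T x)))) \<longlonglongrightarrow> 0"
    proof (cases "T = 0")
      case True
      then have "0 < X n - t0 \<and> X n - t0 < \<tau>" for n using X(1)[rule_format, of n] by (auto simp: T_def)
      then show ?thesis
        using U_tendsto_initial[of "\<lambda>n. X n - t0"] lim True by (simp add: U_def less_imp_neq[symmetric])
    next
      case False
      then have T0: "T > 0" using TT by simp
      obtain N where N: "\<And>n. n \<ge> N \<Longrightarrow> X n - t0 > 0"
        using order_tendstoD(1)[OF lim T0] by (auto simp: eventually_sequentially)
      have "(\<lambda>n. lq q (\<lambda>x. ennreal (norm (nsR a (X (n + N) - t0, x) - nsR a (T, x))))) \<longlonglongrightarrow> 0"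
        using LIMSEQ_ignore_initial_segment[OF lim, of N] T0 TT N by (intro U_tendsto_positive) auto
      moreover have "U (X (n + N) - t0) = (\<lambda>x. nsR a (X (n + N) - t0, x))" for n
        using N[of "n + N"] by (auto simp: U_def)
      ultimately have "(\<lambda>n. lq q (\<lambda>x. ennreal (norm (U (X (n + N) - t0) x - U T x)))) \<longlonglongrightarrow> 0"
        using T0 by (simp add: U_def)
      then show ?thesis by (rule LIMSEQ_offset)
    qed
    then show "(\<lambda>n. Lq_norm q (\<lambda>x. U (X n - t0) x - U (t - t0) x)) \<longlonglongrightarrow> 0"
      unfolding T_def using q by (intro Lq_norm_tendsto_zero) auto
  qed
qed

lemma heat_semigroup_eq_heat_op:
  assumes "s > 0"
  shows "AE x in lborel. heat_semigroup s a x = (\<chi> i. heat_op s (\<lambda>y. a y $ i) x)"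
proof -
  have "AE x in lborel. integrable lborel (\<lambda>y. heat_kernel s (x - y) * norm (a y))"
    using q a_fin by (intro heat_op_AE[OF _ assms, of q]) auto
  then show ?thesis
  proof eventually_elim
    case (elim x)
    have i: "integrable lborel (\<lambda>y. heat_kernel s (x - y) *\<^sub>R a y)"
      by (rule Bochner_Integration.integrable_bound[OF elim]) (auto simp: abs_mult)
    have "heat_semigroup s a x = (\<integral>y. heat_kernel s (x - y) *\<^sub>R a y \<partial>lborel)"
      unfolding heat_semigroup_def using assms by (simp, intro integral_completion) measurable
    moreover have "(\<integral>y. heat_kernel s (x - y) *\<^sub>R a y \<partial>lborel) $ j = heat_op s (\<lambda>y. a y $ j) x" for j
      using integral_bounded_linear[OF bounded_linear_vec_nth i, of j] by (simp add: heat_op_def)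
    ultimately show ?case by (simp add: vec_eq_iff)
  qed
qed

lemma U_mild_solution: "mild_solution t0 \<tau> a (\<lambda>t. U (t - t0))"
  unfolding mild_solution_def
proof (intro conjI ballI)
  show "\<exists>r\<ge>3. Lq_continuous_on {t0..<t0 + \<tau>} r (\<lambda>t. U (t - t0))"
    using q U_continuous by (intro exI[of _ q]) auto
  fix t assume t: "t \<in> {t0..<t0 + \<tau>}"
  show "AE x in lebesgue. set_integrable lebesgue {t0..t} (\<lambda>s. heat_leray_div (t - s) (tensor_square (U (s - t0))) x) \<and>
      U (t - t0) x = heat_semigroup (t - t0) a x - (LINT s:{t0..t}|lebesgue. heat_leray_div (t - s) (tensor_square (U (s - t0))) x)"
  proof (cases "t = t0")
    case True
    let ?F = "\<lambda>x s. indicator {t0..t} s *\<^sub>R heat_leray_div (t - s) (tensor_square (U (s - t0))) x"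
    have "integrable lebesgue (?F x)" for x
      by (subst integrable_discrete_difference[where X="{t0}" and g="\<lambda>_. 0"]) (use True in auto)
    moreover have "(\<integral>s. ?F x s \<partial>lebesgue) = (\<integral>s. 0 \<partial>(lebesgue :: real measure))" for x
      by (rule integral_discrete_difference[where X="{t0}"]) (use True in auto)
    ultimately show ?thesis
      using True by (simp add: set_integrable_def set_lebesgue_integral_def heat_semigroup_def U_def)
  next
    case False
    then have r: "0 < t - t0" "t - t0 < \<tau>" using t by auto
    have "AE x in lborel. set_integrable lebesgue {t0..t} (\<lambda>s. heat_leray_div (t - s) (tensor_square (U (s - t0))) x) \<and>
      U (t - t0) x = heat_semigroup (t - t0) a x - (LINT s:{t0..t}|lebesgue. heat_leray_div (t - s) (tensor_square (U (s - t0))) x)"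
      using W_AE[OF r] heat_semigroup_eq_heat_op[OF r(1)]
    proof eventually_elim
      case (elim x)
      have v: "U (s - t0) = (\<lambda>y. nsR a (s - t0, y))" if "t0 < s" "s < t" for s using that by (simp add: U_def)
      note D = duhamel_time_integral[OF a elim(1), of "\<lambda>s. U (s - t0)", OF v]
      show ?case
        using D nsR_fixed_point(3)[OF a elim(1)] elim(2) r(1) by (simp add: U_def)
    qed
    then show ?thesis by (rule AE_completion)
  qed
qed

end

section \<open>From Borel to Lebesgue measurable data, and local existence\<close>

lemma ex_borel_representative:
  fixes f :: "real^3 \<Rightarrow> real^3"
  assumes f: "f \<in> borel_measurable lebesgue"
  obtains g where "g \<in> borel_measurable borel" "AE x in lebesgue. f x = g x"
proof -
  have "\<exists>h. h \<in> borel_measurable lborel \<and> (AE x in lborel. f x $ i = h x)" for i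
    using completion_ex_borel_measurable_real[of "\<lambda>x. f x $ i" lborel] f by auto
  then obtain h where h: "\<And>i. h i \<in> borel_measurable lborel" "\<And>i. AE x in lborel. f x $ i = h i x"
    by metis
  have "AE x in lborel. \<forall>i. f x $ i = h i x" by (intro eventually_all_finite h)
  then have "AE x in lborel. f x = (\<chi> i. h i x)" by eventually_elim (simp add: vec_eq_iff)
  then have "AE x in lebesgue. f x = (\<chi> i. h i x)" by (rule AE_completion)
  moreover have "(\<lambda>x. \<chi> i. h i x) \<in> borel_measurable borel"
    using h(1) by (intro borel_measurable_vecI) simp
  ultimately show ?thesis using that by blast
qed

lemma mild_solution_cong_AE:
  assumes a[measurable]: "a \<in> borel_measurable lebesgue" and b[measurable]: "b \<in> borel_measurable lebesgue"
    and AE: "AE x in lebesgue. a x = b x" and mild: "mild_solution t0 \<tau> b v"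
  shows "mild_solution t0 \<tau> a v"
proof -
  have "AE x in lebesgue. heat_semigroup \<sigma> a x = heat_semigroup \<sigma> b x" for \<sigma>
  proof (cases "\<sigma> = 0")
    case True
    then show ?thesis using AE by (simp add: heat_semigroup_def)
  next
    case False
    have k[measurable]: "(\<lambda>y. heat_kernel \<sigma> (x - y)) \<in> borel_measurable lebesgue" for x
      by (rule measurable_completion) measurable
    have "heat_semigroup \<sigma> a x = heat_semigroup \<sigma> b x" for x
      using False AE unfolding heat_semigroup_def
      by (simp, intro integral_cong_AE) (auto elim: eventually_mono)
    then show ?thesis by simp
  qed
  then have AE2: "AE x in lebesgue. heat_semigroup (t - t0) a x = heat_semigroup (t - t0) b x" for t .
  show ?thesis
    using mild unfolding mild_solution_def
  proof (elim conjE, intro conjI ballI)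
    fix t assume "t \<in> {t0..<t0 + \<tau>}"
      and *: "\<forall>t\<in>{t0..<t0 + \<tau>}. AE x in lebesgue. set_integrable lebesgue {t0..t} (\<lambda>s. heat_leray_div (t - s) (tensor_square (v s)) x) \<and>
        v t x = heat_semigroup (t - t0) b x - (LINT s:{t0..t}|lebesgue. heat_leray_div (t - s) (tensor_square (v s)) x)"
    from *[rule_format, OF this(1)] AE2[of t]
    show "AE x in lebesgue. set_integrable lebesgue {t0..t} (\<lambda>s. heat_leray_div (t - s) (tensor_square (v s)) x) \<and>
        v t x = heat_semigroup (t - t0) a x - (LINT s:{t0..t}|lebesgue. heat_leray_div (t - s) (tensor_square (v s)) x)"
      by eventually_elim simp
  qed
qed

text \<open>The smallness condition amounts to a lifetime of order
  \<open>Lq_norm q a powr (- 1 / gain q)\<close>. It suffices to exhibit one v with the bound and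
  the regularity, since a solution of the equation is compared with every mild solution.\<close>

theorem local_existence:
  assumes q: "q > 3"
  shows "\<exists>c>0. \<exists>\<Lambda>\<ge>1. \<forall>t0 a \<tau>. in_Lq q a \<longrightarrow> 0 < \<tau> \<longrightarrow> \<tau> \<le> 1 \<longrightarrow> \<tau> powr gain q * Lq_norm q a \<le> c \<longrightarrow>
    (\<exists>v. mild_solution t0 \<tau> a v \<and> (\<forall>t\<in>{t0..<t0 + \<tau>}. in_Lq q (v t) \<and> Lq_norm q (v t) \<le> \<Lambda> * Lq_norm q a) \<and>
      (\<forall>t\<in>{t0<..<t0 + \<tau>}. regular_field (v t)))"
proof -
  obtain K where K: "K \<ge> 0" "\<And>w M t. w \<in> borel_measurable borel \<Longrightarrow> t > 0 \<Longrightarrow> (\<And>s. 0 < s \<Longrightarrow> s < t \<Longrightarrow> lq q (\<lambda>y. w (s, y)) \<le> M) \<Longrightarrow>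
       lq q (\<lambda>x. \<integral>\<^sup>+\<eta>. ns_kappa (t, x) \<eta> * (w \<eta> * w \<eta>) \<partial>lborel) \<le> ennreal (K * t powr (gain q * q)) * (M * M)"
    using kappa_square_bound[OF q less_imp_le[OF oseen_const(1)]] by (elim exE conjE) blast
  \<comment> \<open>C is the bound for the linear part in q-th powers. E is the coefficient with
    which \<open>\<tau> powr (gain q * q) * N powr q\<close> enters the smallness condition of
    \<open>majorant_lq_bound\<close>, so that c makes the left side of that condition at most E / (E
    + 1), also if E = 0. In \<Lambda>, the maximum with 1 covers the initial time, where the field
    is the datum.\<close>
  define C where "C = (heat_const * (16 * pi) powr (3/2)) powr q"
  define E where "E = 2 powr (q + 1) * K * (2 powr (q + 1) * C)"
  define c where "c = (1 / (E + 1)) powr (1 / q)"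
  define \<Lambda> where "\<Lambda> = max 1 ((2 powr (q + 1) * C) powr (1 / q))"
  have q0: "q > 0" using q by simp
  have C0: "C \<ge> 0" by (simp add: C_def)
  have E0: "E \<ge> 0" using K C0 by (simp add: E_def)
  have c0: "c > 0" using E0 by (simp add: c_def add_nonneg_pos)
  have main: "\<exists>v. mild_solution t0 \<tau> a0 v \<and> (\<forall>t\<in>{t0..<t0 + \<tau>}. in_Lq q (v t) \<and> Lq_norm q (v t) \<le> \<Lambda> * Lq_norm q a0) \<and>
      (\<forall>t\<in>{t0<..<t0 + \<tau>}. regular_field (v t))"
    if a0: "in_Lq q a0" and \<tau>: "0 < \<tau>" "\<tau> \<le> 1" and small: "\<tau> powr gain q * Lq_norm q a0 \<le> c" for t0 a0 \<tau>
  proof -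
    have am0: "a0 \<in> borel_measurable lebesgue" using a0 by (simp add: in_Lq_def)
    obtain a where a[measurable]: "a \<in> borel_measurable borel" and AE: "AE x in lebesgue. a0 x = a x"
      using ex_borel_representative[OF am0] .
    have aq: "in_Lq q a" "Lq_norm q a = Lq_norm q a0"
    proof -
      have "AE x in lebesgue. a x = a0 x" using AE by eventually_elim simp
      from in_Lq_AE[OF this a0] show "in_Lq q a" "Lq_norm q a = Lq_norm q a0" .
    qed
    define N where "N = Lq_norm q a0"
    have N0: "N \<ge> 0" by (simp add: N_def Lq_norm_def)
    have lqa: "lq q (\<lambda>x. ennreal (norm (a x))) = ennreal (N powr q)"
      using Lq_norm_lq[OF a aq(1) q0] by (simp add: aq(2) N_def)
    define B where "B = ennreal C * ennreal (N powr q)"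
    define M where "M = ennreal (2 powr (q + 1)) * B"
    have Mr: "M = ennreal (2 powr (q + 1) * C * N powr q)"
      using C0 by (simp add: M_def B_def ennreal_mult mult.assoc)
    have "(\<tau> powr gain q * N) powr q \<le> c powr q"
      using small N0 q0 by (intro powr_mono2) (auto simp: N_def)
    moreover have "(\<tau> powr gain q * N) powr q = \<tau> powr (gain q * q) * N powr q"
      using N0 by (simp add: powr_mult powr_powr)
    moreover have "c powr q = 1 / (E + 1)" using E0 q0 by (simp add: c_def powr_powr)
    ultimately have sm: "\<tau> powr (gain q * q) * N powr q \<le> 1 / (E + 1)" by simp
    have "2 powr (q + 1) * K * \<tau> powr (gain q * q) * (2 powr (q + 1) * C * N powr q) = E * (\<tau> powr (gain q * q) * N powr q)"
      by (simp add: E_def mult_ac)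
    also have "\<dots> \<le> E * (1 / (E + 1))" using E0 sm by (intro mult_left_mono)
    also have "\<dots> \<le> 1" using E0 by simp
    finally have "ennreal (2 powr (q + 1) * K * \<tau> powr (gain q * q) * (2 powr (q + 1) * C * N powr q)) \<le> ennreal 1"
      by (rule ennreal_leI)
    then have small': "ennreal (2 powr (q + 1) * K * \<tau> powr (gain q * q)) * M \<le> 1"
      unfolding Mr using K C0 by (subst ennreal_mult[symmetric]) auto
    have Bb: "lq q (\<lambda>x. ns_beta a (t, x)) \<le> B" if "0 < t" "t < \<tau>" for t
      unfolding B_def C_def lqa[symmetric] using q that \<tau> heat_const_pos by (intro beta_majorant_bound) auto
    have mb: "lq q (\<lambda>x. nsW a (t, x)) \<le> M"
      "lq q (\<lambda>x. \<integral>\<^sup>+\<eta>. ns_kappa (t, x) \<eta> * (nsW a \<eta> * nsW a \<eta>) \<partial>lborel) \<le> ennreal (K * t powr (gain q * q)) * (M * M)"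
      if "0 < t" "t < \<tau>" for t
      unfolding nsW_def
      by (rule majorant_lq_bound[OF a q K(1) _ _ M_def small' that]; fact K(2) Bb)+
    interpret ns_majorized a q \<tau> K M
    proof
      show "lq q (\<lambda>x. ennreal (norm (a x))) < \<infinity>" by (simp add: lqa)
      show "M < \<infinity>" by (simp add: Mr)
    qed (fact a q K(1) mb)+
    have bound: "Lq_norm q (U s) \<le> \<Lambda> * N" if s: "0 \<le> s" "s < \<tau>" for s
    proof (cases "s = 0")
      case True
      have "1 * N \<le> \<Lambda> * N" using N0 by (intro mult_right_mono) (auto simp: \<Lambda>_def)
      then show ?thesis using True aq by (simp add: U_def N_def)
    next
      case False
      then have "lq q (\<lambda>x. ennreal (norm (nsR a (s, x)))) \<le> M" using s by (intro nsR_lq) auto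
      then have "enn2real (lq q (\<lambda>x. ennreal (norm (nsR a (s, x))))) \<le> enn2real M"
        by (rule enn2real_mono) (simp add: Mr)
      also have "\<dots> = 2 powr (q + 1) * C * N powr q" using C0 by (simp add: Mr)
      finally have "Lq_norm q (U s) \<le> (2 powr (q + 1) * C * N powr q) powr (1 / q)"
        unfolding Lq_norm_eq_lq[OF U_measurable] using False q0 by (intro powr_mono2) (auto simp: U_def)
      also have "\<dots> = (2 powr (q + 1) * C) powr (1 / q) * N"
        using C0 N0 q0 by (simp add: powr_mult powr_powr)
      also have "\<dots> \<le> \<Lambda> * N" using N0 by (intro mult_right_mono) (auto simp: \<Lambda>_def)
      finally show ?thesis .
    qed
    show ?thesis
    proof (intro exI[of _ "\<lambda>t. U (t - t0)"] conjI ballI)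
      show "mild_solution t0 \<tau> a0 (\<lambda>t. U (t - t0))"
        by (rule mild_solution_cong_AE[OF am0 _ AE U_mild_solution]) (rule measurable_completion, simp)
      show "in_Lq q (U (t - t0))" if "t \<in> {t0..<t0 + \<tau>}" for t using that by (intro U_in_Lq) auto
      show "Lq_norm q (U (t - t0)) \<le> \<Lambda> * Lq_norm q a0" if "t \<in> {t0..<t0 + \<tau>}" for t
        using that bound[of "t - t0"] by (simp add: N_def)
      show "regular_field (U (t - t0))" if t: "t \<in> {t0<..<t0 + \<tau>}" for t
      proof -
        have "regular_field (\<lambda>x. \<chi> i. Re (nsV a 0 1 (t - t0, x) $ i))"
          using t q le_less_trans[OF W_le M, of "t - t0"] by (intro nsV_regular[OF a]) auto
        then show ?thesis using t by (simp add: U_def nsR_def re_vec_def)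
      qed
    qed
  qed
  show ?thesis
    using c0 main by (intro exI[of _ c] exI[of _ \<Lambda>] conjI allI impI) (auto simp: \<Lambda>_def)
qed

lemma not_summable_affine_inverse:
  fixes \<alpha> \<beta> b :: real
  assumes "\<alpha> > 0" "\<beta> \<ge> 0" "b > 0"
  shows "\<not> summable (\<lambda>k. b / (\<alpha> + \<beta> * real k))"
proof
  assume s: "summable (\<lambda>k. b / (\<alpha> + \<beta> * real k))"
  have "summable (\<lambda>k. inverse (real (Suc k)))"
  proof (rule summable_comparison_test'[OF summable_mult[OF s, of "max \<alpha> \<beta> / b"]])
    fix k :: nat
    have "\<alpha> + \<beta> * real k \<le> max \<alpha> \<beta> * 1 + max \<alpha> \<beta> * real k"
      by (intro add_mono mult_right_mono) auto
    then have "\<alpha> + \<beta> * real k \<le> max \<alpha> \<beta> * real (Suc k)" by (simp add: algebra_simps)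
    moreover have "\<alpha> + \<beta> * real k > 0" using assms by (intro add_pos_nonneg) auto
    ultimately have "inverse (real (Suc k)) \<le> max \<alpha> \<beta> / (\<alpha> + \<beta> * real k)" by (simp add: divide_simps mult.commute)
    then show "norm (inverse (real (Suc k))) \<le> max \<alpha> \<beta> / b * (b / (\<alpha> + \<beta> * real k))" using assms by simp
  qed
  then show False using not_summable_harmonic[where 'a=real] by (subst (asm) summable_Suc_iff) auto
qed

section \<open>The logarithmic bound\<close>

text \<open>Let \<open>s\<^sub>k\<close> be the first time at which \<open>N\<close> exceeds the level \<open>L\<^sub>k\<close>, with \<open>L\<^sub>k\<close> growing geometrically. Before
  \<open>s\<^sub>k\<^sub>+\<^sub>1\<close> there is a time interval of length \<open>(c / L\<^sub>k) powr p\<close> on which \<open>N\<close> stays above \<open>L\<^sub>k\<close>. These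
  intervals are disjoint and contribute at least \<open>c powr p / (1 + ln L\<^sub>k\<^sub>+\<^sub>1)\<close> each, and
  \<open>ln L\<^sub>k\<close> is affine in \<open>k\<close>.\<close>

lemma log_gronwall:
  fixes N :: "real \<Rightarrow> real" and A :: "real set" and p T c \<Lambda> t0 :: real
  assumes p: "p > 0" and c: "c > 0" and \<Lambda>: "\<Lambda> \<ge> 1" and t0: "t0 \<in> A" "0 \<le> t0"
    and step: "\<And>t \<tau> s. t \<in> A \<Longrightarrow> 0 \<le> t \<Longrightarrow> 0 < \<tau> \<Longrightarrow> \<tau> \<le> 1 \<Longrightarrow> \<tau> powr (1 / p) * N t \<le> c \<Longrightarrow> t \<le> s \<Longrightarrow> s < t + \<tau> \<Longrightarrow> s \<le> T
       \<Longrightarrow> s \<in> A \<and> N s \<le> \<Lambda> * N t"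
    and N0: "\<And>t. N t \<ge> 0"
    and int: "(\<integral>\<^sup>+t\<in>{0..T}. (if t \<in> A then ennreal (N t powr p / (1 + log_plus (N t))) else \<infinity>) \<partial>lebesgue) < \<infinity>"
  shows "\<exists>B. \<forall>t\<in>{t0..T}. t \<in> A \<and> N t \<le> B"
proof (rule ccontr)
  assume neg: "\<not> ?thesis"
  \<comment> \<open>The ratio is \<Lambda> + 1 since \<Lambda> itself may be 1 and the levels must
    tend to infinity. The base is at least 1 so that \<open>log_plus\<close> is \<open>ln\<close>
    above it, at least c so that lifetimes are at most 1, and at least N t0 so that the first step
    can start at t0.\<close>
  define L where "L k = (\<Lambda> + 1) ^ k * max 1 (max c (N t0))" for k :: nat
  have L_ge: "L k \<ge> max 1 (max c (N t0))" for k
    using \<Lambda> mult_right_mono[of 1 "(\<Lambda> + 1) ^ k" "max 1 (max c (N t0))"] by (simp add: L_def)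
  then have L1: "L k \<ge> 1" "L k \<ge> c" "L k \<ge> N t0" for k by (auto intro: order_trans[rotated])
  have L_Suc: "L (Suc k) = (\<Lambda> + 1) * L k" for k by (simp add: L_def)
  have L_mono: "L k \<le> L (Suc k)" for k
    unfolding L_Suc using L1(1)[of k] \<Lambda> by (simp add: mult_le_cancel_right1)
  \<comment> \<open>The time for which \<open>step\<close> controls N after a moment at which N is
    at most L k.\<close>
  define \<delta> where "\<delta> k = (c / L k) powr p" for k
  have \<delta>: "\<delta> k > 0" "\<delta> k \<le> 1" "\<delta> k powr (1 / p) = c / L k" for k
    using L1[of k] c p by (auto simp: \<delta>_def powr_powr powr_le_one_le intro!: powr_le1)
  \<comment> \<open>Times outside A count as infinite norm, so leaving A exceeds every level at
    once.\<close>
  define Bad where "Bad k = {t \<in> {t0..T}. t \<notin> A \<or> N t > L k}" for k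
  define s where "s k = Inf (Bad k)" for k
  have ne: "Bad k \<noteq> {}" for k
  proof -
    obtain t where "t \<in> {t0..T}" "\<not> (t \<in> A \<and> N t \<le> L k)" using neg by blast
    then have "t \<in> Bad k" by (auto simp: Bad_def not_le)
    then show ?thesis by blast
  qed
  have bdd: "bdd_below (Bad k)" for k by (intro bdd_belowI[of _ t0]) (auto simp: Bad_def)
  have s_le: "s k \<le> t" if "t \<in> Bad k" for k t unfolding s_def by (rule cInf_lower[OF that bdd])
  have s_ge: "s k \<ge> t" if "\<And>x. x \<in> Bad k \<Longrightarrow> t \<le> x" for k t unfolding s_def by (rule cInf_greatest[OF ne that])
  have sT: "t0 \<le> s k" "s k \<le> T" for k
    using s_ge[of k t0] s_le ne[of k] by (auto simp: Bad_def intro: order_trans)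
  have good: "t \<in> A \<and> N t \<le> L k" if "t0 \<le> t" "t < s k" for t k
    using s_le[of t k] that sT(2)[of k] by (force simp: Bad_def)
  \<comment> \<open>From a time with N \<le> L k the local theory keeps N below \<Lambda> * L k,
    hence below the next level, for as long as \<delta> k.\<close>
  have jump: "s (Suc k) \<ge> t + \<delta> k" if t: "t \<in> A" "t0 \<le> t" "N t \<le> L k" "\<And>x. x \<in> Bad (Suc k) \<Longrightarrow> t \<le> x" for t k
  proof (rule s_ge, rule ccontr)
    fix x assume x: "x \<in> Bad (Suc k)" "\<not> t + \<delta> k \<le> x"
    have Lp: "L k > 0" using L1(1)[of k] by linarith
    have "\<delta> k powr (1 / p) * N t \<le> c / L k * L k"
      unfolding \<delta>(3) using t(3) c Lp by (intro mult_left_mono) auto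
    also have "\<dots> = c" using Lp by simp
    finally have "x \<in> A \<and> N x \<le> \<Lambda> * N t"
      using x t t0 \<delta>[of k] by (intro step[of t "\<delta> k" x]) (auto simp: Bad_def)
    moreover have "\<Lambda> * N t \<le> (\<Lambda> + 1) * L k" using t(3) \<Lambda> N0[of t] by (intro mult_mono) auto
    ultimately show False using x(1) by (auto simp: Bad_def L_Suc)
  qed
  have s0: "s (Suc k) - \<delta> k \<ge> t0" for k
    using jump[of t0 k] t0 L1(3)[of k] by (auto simp: Bad_def)
  \<comment> \<open>If N were at most L k at some time of this interval, \<open>jump\<close> would
    place s (Suc k) at least \<delta> k later, beyond itself. So N exceeds L k throughout, and it is
    still at most L (Suc k).\<close>
  define I where "I k = {s (Suc k) - \<delta> k <..< s (Suc k)}" for k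
  have large: "N t > L k \<and> t \<in> A \<and> N t \<le> L (Suc k) \<and> t0 \<le> t \<and> t \<le> T" if "t \<in> I k" for t k
  proof -
    have t: "t0 \<le> t" "t < s (Suc k)" "s (Suc k) < t + \<delta> k" using that s0[of k] by (auto simp: I_def)
    note g = good[OF t(1,2)]
    have "N t > L k"
    proof (rule ccontr)
      assume "\<not> N t > L k"
      then have "s (Suc k) \<ge> t + \<delta> k"
        using g t s_le[of _ "Suc k"] by (intro jump) (auto intro: order_trans less_imp_le)
      then show False using t by simp
    qed
    then show ?thesis using g t sT(2)[of "Suc k"] by auto
  qed
  have s_I: "s k \<le> t" if "t \<in> I k" for t k
    using large[OF that] by (intro s_le) (auto simp: Bad_def)
  have s_mono: "s j \<le> s k" if "j \<le> k" for j k
  proof (rule lift_Suc_mono_le[of s, OF _ that])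
    fix n
    show "s n \<le> s (Suc n)" by (rule s_ge, rule s_le) (use L_mono[of n] in \<open>auto simp: Bad_def\<close>)
  qed
  \<comment> \<open>Points of I k exceed level k and so lie at or after s k, whereas I j ends before
    s (Suc j), which is at most s k if j < k.\<close>
  have disj: "j = k" if "t \<in> I j" "t \<in> I k" for t j k
  proof (rule ccontr)
    have *: False if "t \<in> I j" "t \<in> I k" "Suc j \<le> k" for j k
      using s_I[OF that(2)] s_mono[OF that(3)] that(1) by (auto simp: I_def)
    assume "j \<noteq> k"
    then show False using *[of j k] *[of k j] that by (cases "j < k") auto
  qed
  let ?F = "\<lambda>t. (if t \<in> A then ennreal (N t powr p / (1 + log_plus (N t))) else \<infinity>) * indicator {0..T} t"
  define b where "b k = L k powr p / (1 + ln (L (Suc k)))" for k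
  have b0: "b k \<ge> 0" for k using L1(1)[of "Suc k"] by (simp add: b_def)
  have F_ge: "ennreal (b k) \<le> ?F t" if "t \<in> I k" for t k
  proof -
    note l = large[OF that]
    have N1: "N t > 1" using l L1(1)[of k] by linarith
    have ln: "0 < 1 + ln (N t)" using ln_gt_zero[OF N1] by linarith
    have "b k \<le> N t powr p / (1 + ln (N t))"
      unfolding b_def using l N1 p L1(1)[of k] by (intro frac_le powr_mono2 ln) auto
    also have "ln (N t) = log_plus (N t)" using N1 by (simp add: log_plus_def)
    finally show ?thesis using l t0 by (auto intro: ennreal_leI)
  qed
  obtain R where R: "(\<integral>\<^sup>+t. ?F t \<partial>lebesgue) = ennreal R" "R \<ge> 0"
    using int by (cases "\<integral>\<^sup>+t. ?F t \<partial>lebesgue") auto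
  have part: "(\<Sum>k<n. b k * \<delta> k) \<le> R" for n
  proof -
    have "ennreal (\<Sum>k<n. b k * \<delta> k) = (\<Sum>k<n. ennreal (b k) * emeasure lebesgue (I k))"
      using b0 \<delta>(1) by (subst sum_ennreal[symmetric]) (auto simp: I_def ennreal_mult less_imp_le)
    also have "\<dots> = (\<integral>\<^sup>+t. (\<Sum>k<n. ennreal (b k) * indicator (I k) t) \<partial>lebesgue)"
    proof (subst nn_integral_sum)
      have I[measurable]: "I k \<in> sets lebesgue" for k by (simp add: I_def)
      show "(\<lambda>t. ennreal (b k) * indicator (I k) t) \<in> borel_measurable lebesgue" for k by measurable
      show "(\<Sum>k<n. ennreal (b k) * emeasure lebesgue (I k)) = (\<Sum>k<n. \<integral>\<^sup>+t. ennreal (b k) * indicator (I k) t \<partial>lebesgue)"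
        using I by (simp add: nn_integral_cmult_indicator)
    qed
    also have "\<dots> \<le> (\<integral>\<^sup>+t. ?F t \<partial>lebesgue)"
    proof (rule nn_integral_mono)
      fix t
      show "(\<Sum>k<n. ennreal (b k) * indicator (I k) t) \<le> ?F t"
      proof (cases "\<exists>k<n. t \<in> I k")
        case True
        then obtain k where k: "k < n" "t \<in> I k" by blast
        have one: "ennreal (b j) * indicator (I j) t = (if j = k then ennreal (b k) else 0)" for j
        proof (cases "t \<in> I j")
          case True
          then have "k = j" by (rule disj[OF k(2)])
          then show ?thesis using k(2) by simp
        next
          case False
          then have "j \<noteq> k" using k(2) by blast
          then show ?thesis using False by simp
        qed
        have "(\<Sum>j<n. ennreal (b j) * indicator (I j) t) = (\<Sum>j<n. if j = k then ennreal (b k) else 0)"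
          unfolding one ..
        also have "\<dots> = ennreal (b k)" using k by simp
        finally show ?thesis using F_ge[OF k(2)] by simp
      next
        case False
        then have "(\<Sum>j<n. ennreal (b j) * indicator (I j) t) = 0"
          by (intro sum.neutral) (auto split: split_indicator)
        then show ?thesis by simp
      qed
    qed
    finally show ?thesis using R by simp
  qed
  have "summable (\<lambda>k. b k * \<delta> k)"
  proof (rule bounded_imp_summable)
    show "b k * \<delta> k \<ge> 0" for k using b0[of k] \<delta>(1)[of k] by simp
    show "(\<Sum>k\<le>n. b k * \<delta> k) \<le> R" for n using part[of "Suc n"] by (simp only: lessThan_Suc_atMost)
  qed
  \<comment> \<open>The height \<open>L k powr p\<close> and the length
    \<open>(c / L k) powr p\<close> cancel up to a constant. Here the lifetime exponent meets the
    exponent of the integral, and only the logarithm of the level remains.\<close>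
  moreover have "b k * \<delta> k = c powr p / ((1 + ln (L 1)) + ln (\<Lambda> + 1) * real k)" for k
  proof -
    have Lp: "L k > 0" using L1(1)[of k] by linarith
    have "L (Suc k) = (\<Lambda> + 1) ^ k * L 1" by (simp add: L_def mult_ac)
    then have "ln (L (Suc k)) = ln (L 1) + real k * ln (\<Lambda> + 1)"
      using \<Lambda> L1(1)[of 1] by (simp add: ln_mult ln_realpow)
    moreover have "L k powr p * \<delta> k = c powr p"
      using Lp c by (simp add: \<delta>_def powr_divide)
    ultimately show ?thesis by (simp add: b_def mult_ac add_ac)
  qed
  moreover have "\<not> summable (\<lambda>k. c powr p / ((1 + ln (L 1)) + ln (\<Lambda> + 1) * real k))"
    using L1(1)[of 1] c \<Lambda> by (intro not_summable_affine_inverse) (auto simp: add_pos_nonneg)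
  ultimately show False by simp
qed

theorem theorem1p1:
  fixes p q T :: real and u :: "real \<Rightarrow> real^3 \<Rightarrow> real^3"
  assumes "2 < p" and "3 < q" and "2 / p + 3 / q = 1"
    and "T > 0"
    and "navier_stokes_solution T u"
    and "(\<integral>\<^sup>+t\<in>{0..T}.
            (if in_Lq q (u t)
             then ennreal (Lq_norm q (u t) powr p / (1 + log_plus (Lq_norm q (u t))))
             else \<infinity>) \<partial>lebesgue) < \<infinity>"
  shows "\<forall>t. 0 < t \<and> t \<le> T \<longrightarrow> regular_field (u t)"
proof (intro allI impI, elim conjE)
  fix t assume t: "0 < t" "t \<le> T"
  \<comment> \<open>The scaling relation between p and q enters here: it identifies the lifetime
    exponent of the local theory with the integrability exponent in time.\<close>
  have g: "gain q = 1 / p" using assms(1-3) by (simp add: field_simps)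
  define N where "N r = Lq_norm q (u r)" for r
  define A where "A = {r. in_Lq q (u r)}"
  have N0: "N r \<ge> 0" for r by (simp add: N_def Lq_norm_def)
  obtain c \<Lambda> where c: "c > 0" and \<Lambda>: "\<Lambda> \<ge> 1" and ex: "\<And>t0 a \<tau>. in_Lq q a \<Longrightarrow> 0 < \<tau> \<Longrightarrow> \<tau> \<le> 1 \<Longrightarrow> \<tau> powr (1 / p) * Lq_norm q a \<le> c \<Longrightarrow>
    (\<exists>v. mild_solution t0 \<tau> a v \<and> (\<forall>t\<in>{t0..<t0 + \<tau>}. in_Lq q (v t) \<and> Lq_norm q (v t) \<le> \<Lambda> * Lq_norm q a) \<and>
      (\<forall>t\<in>{t0<..<t0 + \<tau>}. regular_field (v t)))"
    using local_existence[OF assms(2)] unfolding g by (elim exE conjE) blast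
  have step: "s \<in> A \<and> N s \<le> \<Lambda> * N r \<and> (r < s \<longrightarrow> regular_field (u s))"
    if r: "r \<in> A" "0 \<le> r" and \<tau>: "0 < \<tau>" "\<tau> \<le> 1" "\<tau> powr (1 / p) * N r \<le> c" and s: "r \<le> s" "s < r + \<tau>" "s \<le> T" for r \<tau> s
  proof -
    obtain v where v: "mild_solution r \<tau> (u r) v" "in_Lq q (v s)" "Lq_norm q (v s) \<le> \<Lambda> * N r" "r < s \<Longrightarrow> regular_field (v s)"
      using ex[of "u r" \<tau> r] r \<tau> s by (auto simp: A_def N_def)
    have AE: "AE x in lebesgue. u s x = v s x"
      using assms(5)[unfolded navier_stokes_solution_def, rule_format, OF _ \<tau>(1) v(1), of s] r s by auto
    show ?thesis
      using in_Lq_AE[OF AE v(2)] regular_field_AE[OF AE] v by (auto simp: A_def N_def)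
  qed
  let ?F = "\<lambda>t. (if t \<in> A then ennreal (N t powr p / (1 + log_plus (N t))) else \<infinity>) * indicator {0..T} t"
  have int: "(\<integral>\<^sup>+t. ?F t \<partial>lebesgue) < \<infinity>" using assms(6) unfolding A_def N_def mem_Collect_eq .
  \<comment> \<open>The integrand is infinite at times when u is not in L_q, and a finite integral
    cannot be infinite on the whole interval (0, t).\<close>
  have "\<exists>t0\<in>A. 0 \<le> t0 \<and> t0 < t"
  proof (rule ccontr)
    assume "\<not> ?thesis"
    then have "(\<integral>\<^sup>+r. \<infinity> * indicator {0<..<t} r \<partial>lebesgue) \<le> (\<integral>\<^sup>+r. ?F r \<partial>lebesgue)"
      using t by (intro nn_integral_mono) (auto split: split_indicator)
    moreover have "(\<integral>\<^sup>+r. \<infinity> * indicator {0<..<t} r \<partial>lebesgue) = \<infinity>"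
      using t by (subst nn_integral_cmult_indicator) (auto simp: ennreal_top_mult)
    ultimately show False using int by auto
  qed
  then obtain t0 where t0: "t0 \<in> A" "0 \<le> t0" "t0 < t" by blast
  have p0: "p > 0" using assms(1) by simp
  obtain B where B: "\<And>r. r \<in> {t0..T} \<Longrightarrow> r \<in> A \<and> N r \<le> B"
    using log_gronwall[OF p0 c \<Lambda> t0(1,2) _ N0 int] step by blast
  \<comment> \<open>A lifetime valid from every time in [t0, T], by the uniform bound B. Restarting
    at r, at most \<tau> / 2 before t, puts t strictly inside the interval of existence and strictly
    after its start, where the mild solution is regular; this includes t = T.\<close>
  define \<tau> where "\<tau> = min 1 ((c / (\<bar>B\<bar> + 1)) powr p)"
  define r where "r = max t0 (t - \<tau> / 2)"
  have \<tau>: "0 < \<tau>" "\<tau> \<le> 1" using c by (auto simp: \<tau>_def)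
  have r: "r \<in> {t0..T}" "r < t" "t < r + \<tau>" using t0 t \<tau> by (auto simp: r_def)
  have "\<tau> powr (1 / p) \<le> ((c / (\<bar>B\<bar> + 1)) powr p) powr (1 / p)"
    using \<tau> p0 by (intro powr_mono2) (auto simp: \<tau>_def)
  also have "\<dots> = c / (\<bar>B\<bar> + 1)" using c p0 by (simp add: powr_powr)
  finally have "\<tau> powr (1 / p) * N r \<le> c / (\<bar>B\<bar> + 1) * (\<bar>B\<bar> + 1)"
    using B[OF r(1)] N0[of r] c by (intro mult_mono) auto
  then have "\<tau> powr (1 / p) * N r \<le> c" by simp
  then show "regular_field (u t)"
    using step[of r \<tau> t] B[OF r(1)] r t0 t \<tau> by auto
qed

end
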